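(* Suppose that $\mu$ satisfies the logarithmic Sobolev inequality, that $\sum_{n\in\mathbb Z}|a_n|^2<+\infty$, and that $g$ is continuous on $\mathbb T$. Let $F:(\mathbb R^p)^{l+1}\to\mathbb R^m$, $(x_0,\dots,x_l)\mapsto F(x_0,\dots,x_l)$, be differentiable and such that $\partial_{x_i}F$ is Lipschitz for each $i=0,\dots,l$. Then the limit $$\Sigma_F^2:=\lim_{n\to+\infty}\frac1n\,\Gamma\left(\sum_{k=1}^nF(X_k,\dots,X_{k+l})\right)$$ exists, and $$S_n(F)=\frac1{\sqrt n\,b_n}\sum_{k=1}^n\Big(F(X_k,\dots,X_{k+l})-\mathbb E\big(F(X_k,\dots,X_{k+l})\big)\Big)$$ satisfies the moderate deviation principle on $\mathbb R^m$ with speed $b_n^2$ and good rate function $$I_F(z)=\sup_{\lambda\in\mathbb R^m}\left\{\langle\lambda,z\rangle-\frac12\lambda^*\Sigma_F^2\lambda\right\}=\frac12z^*\Sigma_F^{-2}z,$$ where $\Sigma_F^{-2}$ is the generalized inverse of the covariance matrix $\Sigma_F^2$.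
   Context: Setting: $(\xi_n)_{n\in\mathbb Z}$ is a sequence of $\mathbb R^d$-valued, centered, square integrable i.i.d. random variables with common law $\mu$; $(a_n)_{n\in\mathbb Z}$ is a sequence of real $p\times d$ matrices with $\sum_n|a_n|^2<\infty$; and $X_n:=\sum_{j\in\mathbb Z}a_j\xi_{n+j}\in\mathbb R^p$, $n\in\mathbb Z$ (moving average process). The torus $\mathbb T$ is identified with $[-\pi,\pi[$, and $g(\theta):=\sum_{n\in\mathbb Z}a_ne^{in\theta}$. For a random vector $Y$, $\Gamma(Y)$ denotes its covariance matrix. Logarithmic Sobolev inequality for $\mu$: there exists $C>0$ such that $\mathrm{Ent}_\mu(h^2)\le 2C\,\mathbb E_\mu(|\nabla h|^2)$ for every smooth $h$ with $\mathbb E_\mu(h^2\log^+h^2)<\infty$, where $\mathrm{Ent}_\mu(h^2)=\mathbb E_\mu(h^2\log h^2)-\mathbb E_\mu(h^2)\log\mathbb E_\mu(h^2)$. $(b_n)$ is a sequence of positive real numbers with $1\ll b_n\ll\sqrt n$, i.e. $b_n\to\infty$ and $b_n/\sqrt n\to0$. The expression $z^*\Sigma_F^{-2}z$ is understood as $+\infty$ when $z$ is not in the range of $\Sigma_F^2$. Moderate deviation principle (MDP) with speed $b_n^2$ and good rate function $I$: the sequence $(Z_n)$ of random elements of a topological space $E$ satisfies the large deviation principle with speed $b_n^2$, i.e. $I:E\to[0,\infty]$ has compact level sets $\{I\le c\}$, $c<\infty$, and for every measurable $A\subset E$, $-\inf_{\mathrm{int}A}I\le\liminf_n b_n^{-2}\log\mathbb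 P(Z_n\in A)\le\limsup_n b_n^{-2}\log\mathbb P(Z_n\in A)\le-\inf_{\overline A}I$. *)

theory Defs
  imports "HOL-Probability.Probability"
begin

text \<open>\<open>S = \<Sum>\<^sub>j f j\<close> with unconditional convergence in \<open>L\<^sup>2(M)\<close>; \<open>S\<close> is determined up to
  almost-everywhere equality.\<close>

definition L2_sum :: "'x measure \<Rightarrow> ('i \<Rightarrow> 'x \<Rightarrow> 'b::real_normed_vector) \<Rightarrow> ('x \<Rightarrow> 'b) \<Rightarrow> bool" where
  "L2_sum M f S \<longleftrightarrow>
     (\<forall>j. f j \<in> borel_measurable M) \<and> S \<in> borel_measurable M \<and>
     ((\<lambda>J. \<integral>\<^sup>+x. ennreal ((norm (S x - (\<Sum>j\<in>J. f j x)))\<^sup>2) \<partial>M) \<longlongrightarrow> 0) (finite_subsets_at_top UNIV)"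

definition moving_average ::
  "'w measure \<Rightarrow> (int \<Rightarrow> real^'d^'p) \<Rightarrow> (int \<Rightarrow> 'w \<Rightarrow> real^'d) \<Rightarrow> (int \<Rightarrow> 'w \<Rightarrow> real^'p) \<Rightarrow> bool" where
  "moving_average M a \<xi> X \<longleftrightarrow> (\<forall>n. L2_sum M (\<lambda>j \<omega>. a j *v \<xi> (n + j) \<omega>) (X n))"

definition fourier_term :: "(int \<Rightarrow> real^'d^'p) \<Rightarrow> int \<Rightarrow> real \<Rightarrow> complex^'d^'p" where
  "fourier_term a n \<theta> = (\<chi> r c. complex_of_real (a n $ r $ c) * exp (\<i> * of_int n * of_real \<theta>))"

text \<open>\<open>g(\<theta>) = \<Sum>\<^sub>n a\<^sub>n e\<^sup>i\<^sup>n\<^sup>\<theta>\<close> in \<open>L\<^sup>2\<close> of the torus. Functions on the torus are represented by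
  \<open>2\<pi>\<close>-periodic functions on the line, so that continuity on the torus is continuity of \<open>g\<close>
  on the whole line (it includes the matching at the endpoints of \<open>[-\<pi>, \<pi>[\<close>).\<close>

definition fourier_series :: "(int \<Rightarrow> real^'d^'p) \<Rightarrow> (real \<Rightarrow> complex^'d^'p) \<Rightarrow> bool" where
  "fourier_series a g \<longleftrightarrow>
     (\<forall>\<theta>. g (\<theta> + 2 * pi) = g \<theta>) \<and>
     L2_sum (restrict_space lborel {-pi..<pi}) (fourier_term a) g"

primrec C_k :: "nat \<Rightarrow> ('a::real_normed_vector \<Rightarrow> 'b::real_normed_vector) \<Rightarrow> bool" where
  "C_k 0 h \<longleftrightarrow> continuous_on UNIV h"
| "C_k (Suc k) h \<longleftrightarrow>
     (\<forall>x. h differentiable (at x)) \<and> (\<forall>v. C_k k (\<lambda>x. frechet_derivative h (at x) v))"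

definition smooth :: "('a::real_normed_vector \<Rightarrow> 'b::real_normed_vector) \<Rightarrow> bool" where
  "smooth h \<longleftrightarrow> (\<forall>k. C_k k h)"

text \<open>Since \<open>ln 0 = 0\<close>, the convention \<open>0 log 0 = 0\<close> is built in.\<close>

definition Ent :: "'a measure \<Rightarrow> ('a \<Rightarrow> real) \<Rightarrow> real" where
  "Ent \<mu> f = (\<integral>x. f x * ln (f x) \<partial>\<mu>) - (\<integral>x. f x \<partial>\<mu>) * ln (\<integral>x. f x \<partial>\<mu>)"

text \<open>The right-hand side may be infinite. The left-hand side is nonnegative by Jensen's
  inequality, so the truncation by \<open>ennreal\<close> is harmless.\<close>

definition log_sobolev :: "'a::euclidean_space measure \<Rightarrow> bool" where
  "log_sobolev \<mu> \<longleftrightarrow>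
     (\<exists>C>0. \<forall>h Dh. smooth h \<longrightarrow> (\<forall>x. GDERIV h x :> Dh x) \<longrightarrow>
        integrable \<mu> (\<lambda>x. (h x)\<^sup>2 * max 0 (ln ((h x)\<^sup>2))) \<longrightarrow>
        ennreal (Ent \<mu> (\<lambda>x. (h x)\<^sup>2)) \<le> ennreal (2 * C) * (\<integral>\<^sup>+x. ennreal ((norm (Dh x))\<^sup>2) \<partial>\<mu>))"

text \<open>\<open>\<partial>\<^sub>i F\<close> for the \<open>i\<close>-th block variable \<open>x\<^sub>i \<in> \<real>\<^sup>p\<close>, as an \<open>m \<times> p\<close> Jacobian matrix.\<close>

definition block_partial :: "'k \<Rightarrow> ((real^'p)^'k \<Rightarrow> real^'m) \<Rightarrow> (real^'p)^'k \<Rightarrow> real^'p^'m" where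
  "block_partial i F x = jacobian (\<lambda>u. F (\<chi> j. if j = i then u else x $ j)) (at (x $ i))"

text \<open>The vector \<open>(X\<^sub>k, \<dots>, X\<^sub>k\<^sub>+\<^sub>l)\<close>; \<open>idx\<close> numbers the coordinates by \<open>0, \<dots>, l\<close>.\<close>

definition window :: "('k \<Rightarrow> nat) \<Rightarrow> (int \<Rightarrow> 'w \<Rightarrow> real^'p) \<Rightarrow> int \<Rightarrow> 'w \<Rightarrow> (real^'p)^'k" where
  "window idx X k \<omega> = (\<chi> i. X (k + int (idx i)) \<omega>)"

definition covariance_matrix :: "'w measure \<Rightarrow> ('w \<Rightarrow> real^'m) \<Rightarrow> real^'m^'m" where
  "covariance_matrix M Y =
     (\<chi> i j. \<integral>\<omega>. (Y \<omega> $ i - (\<integral>\<omega>'. Y \<omega>' $ i \<partial>M)) * (Y \<omega> $ j - (\<integral>\<omega>'. Y \<omega>' $ j \<partial>M)) \<partial>M)"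

definition pseudo_inverse :: "real^'n^'m \<Rightarrow> real^'m^'n" where
  "pseudo_inverse A =
     (THE B. A ** B ** A = A \<and> B ** A ** B = B \<and>
             transpose (A ** B) = A ** B \<and> transpose (B ** A) = B ** A)"

definition log_prob :: "real \<Rightarrow> ereal" where
  "log_prob p = (if p \<le> 0 then -\<infinity> else ereal (ln p))"

definition good_rate_function :: "('e::topological_space \<Rightarrow> ereal) \<Rightarrow> bool" where
  "good_rate_function I \<longleftrightarrow> (\<forall>z. 0 \<le> I z) \<and> (\<forall>c::real. compact {z. I z \<le> ereal c})"

definition LDP ::
  "'w measure \<Rightarrow> (nat \<Rightarrow> 'w \<Rightarrow> 'e::topological_space) \<Rightarrow> (nat \<Rightarrow> real) \<Rightarrow> ('e \<Rightarrow> ereal) \<Rightarrow> bool" where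
  "LDP M Z s I \<longleftrightarrow>
     (\<forall>n. Z n \<in> borel_measurable M) \<and> good_rate_function I \<and>
     (\<forall>A\<in>sets borel.
        - (INF z\<in>interior A. I z)
          \<le> liminf (\<lambda>n. ereal (1 / s n) * log_prob (measure M {\<omega>\<in>space M. Z n \<omega> \<in> A})) \<and>
        limsup (\<lambda>n. ereal (1 / s n) * log_prob (measure M {\<omega>\<in>space M. Z n \<omega> \<in> A}))
          \<le> - (INF z\<in>closure A. I z))"

end

theory Submission
  imports Defs
begin

text \<open>
  By polarization and a quadratic form of the Gaertner--Ellis theorem it suffices to show, for scalar
  functionals \<open>S\<^sub>n = \<Sum>\<^sub>k f(X\<^sub>k, \<dots>, X\<^sub>k\<^sub>+\<^sub>l)\<close> with \<open>f = \<langle>v, F\<rangle>\<close>, that \<open>log E exp(t(S\<^sub>n - E S\<^sub>n)) / (n t\<^sup>2)\<close> and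
  half the normalized variance have a common limit as \<open>t = b\<^sub>n / \<surd>n \<rightarrow> 0\<close>. For finitely many nonzero
  coefficients \<open>a\<^sub>j\<close>, \<open>S\<^sub>n\<close> splits into i.i.d. large blocks and a small remainder. In general, \<open>a\<close> is
  approximated by finitely supported coefficients; since \<open>g\<close> is continuous, a trigonometric polynomial
  uniformly close to \<open>g\<close> makes the convolution operator \<open>a - a'\<close> small on \<open>\<ell>\<^sup>2\<close>. The logarithmic
  Sobolev inequality tensorizes, and Herbst's argument turns a small operator norm into a small
  subgaussian constant per step for the difference of the functionals. The gradient grows linearly, so
  Herbst's argument is combined with an exponential moment bound for quadratic forms. Hoelder's
  inequality then transfers the asymptotics.
\<close>

section \<open>Quadratic forms and their Legendre transforms\<close>

text \<open>The functional grows quadratically, so in general it has exponential moments only near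
  0. Every exponential estimate is therefore restricted to \<open>\<bar>t\<bar> \<le> \<tau>\<close>
  with \<open>\<tau>\<close> independent of \<open>n\<close>; this is enough because
  \<open>b\<^sub>n / \<surd>n\<close> tends to 0. The coefficients are only square summable, so l1
  bounds on them are out of reach: \<open>a - a'\<close> is measured by its convolution operator,
  whose norm is controlled by the supremum of the symbol. For two linear images
  \<open>X = L w\<close> and \<open>X' = L' w\<close> of the noise, the gradient of the difference
  of the sums is \<open>(L - L')\<^sup>T Df(X) + L'\<^sup>T (Df(X) - Df(X'))\<close>. Both terms
  carry the factor \<open>\<delta> = \<parallel>L - L'\<parallel>\<close>, the first directly, the
  second through \<open>X - X'\<close>. The square of this gradient is dominated by a constant plus
  two quadratic forms, whose exponential moments follow from a self-bounding version of Herbst's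
  argument; so the subgaussian constant is of order \<open>\<delta>\<^sup>2 n\<close>. A subgaussian
  constant also bounds the variance, hence one comparison serves both limits.\<close>

lemma symmetric_matrix_inner:
  fixes S :: "real^'n^'n"
  assumes "transpose S = S"
  shows "x \<bullet> (S *v y) = (S *v x) \<bullet> y"
  by (metis assms dot_lmul_matrix vector_transpose_matrix)

lemma matrix_symmetricI:
  fixes S :: "real^'n^'n"
  assumes "\<And>x y. x \<bullet> (S *v y) = (S *v x) \<bullet> y"
  shows "transpose S = S"
proof -
  have "transpose S *v x = S *v x" for x
  proof (rule vector_eq_ldot[THEN iffD1, rule_format])
    fix y
    have "y \<bullet> (transpose S *v x) = (S *v y) \<bullet> x"
      by (metis dot_lmul_matrix transpose_transpose vector_transpose_matrix)
    then show "y \<bullet> (transpose S *v x) = y \<bullet> (S *v x)"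
      by (simp add: assms)
  qed
  then show ?thesis
    by (simp add: matrix_eq)
qed

text \<open>\<open>pseudo_inverse\<close> is a definite description, so existence and uniqueness of
  a solution of the four Penrose equations must both be shown. A symmetric map is injective on its
  range \<open>V\<close>, because its kernel is orthogonal to \<open>V\<close>; so it permutes
  \<open>V\<close> and has an inverse there.\<close>

lemma pseudo_inverse_symmetric:
  fixes S :: "real^'n^'n"
  assumes sym: "transpose S = S"
  shows "S ** pseudo_inverse S ** S = S"
proof -
  let ?P = "\<lambda>B. S ** B ** S = S \<and> B ** S ** B = B \<and>
             transpose (S ** B) = S ** B \<and> transpose (B ** S) = B ** S"
  define f where "f = (*v) S"
  have lf: "linear f"
    by (simp add: f_def)
  have adj: "x \<bullet> f y = f x \<bullet> y" for x y
    unfolding f_def by (rule symmetric_matrix_inner[OF sym])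
  define V where "V = range f"
  have V: "subspace V"
    unfolding V_def using lf by (simp add: linear_subspace_image)
  have inj: "inj_on f V"
  proof (rule inj_onI)
    fix u v assume "u \<in> V" "v \<in> V" and eq: "f u = f v"
    then have "u - v \<in> V"
      using V by (simp add: subspace_diff)
    then obtain w where w: "u - v = f w"
      by (auto simp: V_def)
    have "f (u - v) = 0"
      using eq lf by (simp add: linear_diff)
    then have "(u - v) \<bullet> (u - v) = 0"
      using adj[of "u - v" w] w by simp
    then show "u = v" by simp
  qed
  obtain g where g: "range g \<subseteq> V" "linear g" and gf: "\<And>v. v \<in> V \<Longrightarrow> g (f v) = v"
    using linear_exists_left_inverse_on[OF lf V inj] by blast
  have "f ` V = V"
  proof (rule subspace_dim_equal)
    show "subspace (f ` V)" using lf V by (simp add: linear_subspace_image)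
    show "dim V \<le> dim (f ` V)"
      using dim_image_eq[OF lf, of V] inj V by (simp add: span_eq_iff[THEN iffD2])
  qed (use V in \<open>auto simp: V_def\<close>)
  then have fg: "f (g v) = v" if "v \<in> V" for v
    using that gf by (metis imageE)
  define G where "G = matrix g"
  have G: "G *v x = g x" for x
    by (simp add: G_def g(2) matrix_works)
  have S: "S *v x = f x" for x
    by (simp add: f_def)
  have Vs: "f x \<in> V" "g x \<in> V" for x
    using g by (auto simp: V_def)
  have Pproj: "f (x - g (f x)) = 0" for x
    by (simp add: fg Vs linear_diff[OF lf])
  have orth: "v \<bullet> (x - g (f x)) = 0" if "v \<in> V" for v x
    using that adj[of _ "x - g (f x)"] Pproj[of x] by (auto simp: V_def)
  have Psym: "x \<bullet> g (f y) = g (f x) \<bullet> y" for x y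
    using orth[OF Vs(2), of "f y" x] orth[OF Vs(2), of "f x" y]
    by (simp add: inner_diff inner_commute)
  \<comment> \<open>On \<open>V\<close> the map \<open>g\<close> inverts \<open>f\<close>, but off
    \<open>V\<close> it is arbitrary. The composition \<open>g \<circ> f\<close> is the orthogonal
    projection onto \<open>V\<close>; applying \<open>g\<close> once more gives the inverse on
    \<open>V\<close> that vanishes on the orthogonal complement.\<close>
  have ex: "?P (G ** G ** S)"
  proof (intro conjI)
    show "S ** (G ** G ** S) ** S = S" "G ** G ** S ** S ** (G ** G ** S) = G ** G ** S"
      by (simp_all add: matrix_eq G S fg gf Vs flip: matrix_vector_mul_assoc)
    show "transpose (S ** (G ** G ** S)) = S ** (G ** G ** S)"
      "transpose (G ** G ** S ** S) = G ** G ** S ** S"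
      by (rule matrix_symmetricI,
          simp add: G S fg gf Vs Psym flip: matrix_vector_mul_assoc)+
  qed
  \<comment> \<open>For two solutions, \<open>S ** B\<close> and \<open>S ** C\<close> are symmetric
    and each absorbs the other, so transposition shows that they agree; likewise for the products in
    the other order.\<close>
  have uniq: "B = C" if B: "?P B" and C: "?P C" for B C
  proof -
    have "S ** B = (S ** C) ** (S ** B)"
      using C by (simp add: matrix_mul_assoc)
    then have "transpose (S ** B) = transpose (S ** B) ** transpose (S ** C)"
      by (metis matrix_transpose_mul)
    then have 1: "S ** B = S ** C"
      using B C by (simp add: matrix_mul_assoc)
    have "B ** S = (B ** S) ** (C ** S)"
      using C by (metis matrix_mul_assoc)
    then have "transpose (B ** S) = transpose (C ** S) ** transpose (B ** S)"
      by (metis matrix_transpose_mul)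
    then have "B ** S = (C ** S) ** (B ** S)"
      using B C by simp
    then have 2: "B ** S = C ** S"
      using B by (metis matrix_mul_assoc)
    have "B = B ** S ** B" using B by simp
    also have "\<dots> = C ** S ** C" using 1 2 by (metis matrix_mul_assoc)
    finally show ?thesis using C by simp
  qed
  have "?P (pseudo_inverse S)"
    unfolding pseudo_inverse_def by (rule theI'[of ?P], rule ex1I[of _ "G ** G ** S"]) (use ex uniq in blast)+
  then show ?thesis by blast
qed

text \<open>Completing the square: the form is nonnegative at \<open>v - y\<close>, and the supremum
  is attained at \<open>v = y\<close>.\<close>

lemma Legendre_quadratic:
  fixes S :: "real^'n^'n"
  assumes sym: "transpose S = S" and psd: "\<And>v. 0 \<le> v \<bullet> (S *v v)"
  shows "(SUP v. ereal (v \<bullet> (S *v y) - (v \<bullet> (S *v v)) / 2)) = ereal (y \<bullet> (S *v y) / 2)"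
proof (rule antisym)
  show "(SUP v. ereal (v \<bullet> (S *v y) - (v \<bullet> (S *v v)) / 2)) \<le> ereal (y \<bullet> (S *v y) / 2)"
  proof (rule SUP_least)
    fix v
    have "0 \<le> (v - y) \<bullet> (S *v (v - y))" by (rule psd)
    also have "\<dots> = v \<bullet> (S *v v) - 2 * (v \<bullet> (S *v y)) + y \<bullet> (S *v y)"
      using symmetric_matrix_inner[OF sym, of y v]
      by (simp add: matrix_vector_mult_diff_distrib inner_diff inner_commute)
    finally show "ereal (v \<bullet> (S *v y) - (v \<bullet> (S *v v)) / 2) \<le> ereal (y \<bullet> (S *v y) / 2)"
      by simp
  qed
  show "ereal (y \<bullet> (S *v y) / 2) \<le> (SUP v. ereal (v \<bullet> (S *v y) - (v \<bullet> (S *v v)) / 2))"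
    by (rule SUP_upper2[of y]) auto
qed

text \<open>The component of \<open>z\<close> orthogonal to the range lies in the kernel of
  \<open>S\<close>. Along it the quadratic term vanishes while the linear term grows without
  bound.\<close>

lemma Legendre_quadratic_infinite:
  fixes S :: "real^'n^'n"
  assumes sym: "transpose S = S" and z: "z \<notin> range (\<lambda>y. S *v y)"
  shows "(SUP v. ereal (v \<bullet> z - (v \<bullet> (S *v v)) / 2)) = \<infinity>"
proof -
  have "\<exists>v. S *v v = 0 \<and> v \<bullet> z > 0"
  proof -
    let ?V = "range (\<lambda>y. S *v y)"
    have "subspace ?V" by (simp add: linear_subspace_image)
    obtain y w where yw: "y \<in> span ?V" "\<And>u. u \<in> span ?V \<Longrightarrow> orthogonal w u" "z = y + w"
      using orthogonal_subspace_decomp_exists[of ?V z] by blast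
    have "S *v w = 0"
    proof -
      have "orthogonal w (S *v (S *v w))" using yw(2) by (blast intro: span_base)
      then show ?thesis
        using symmetric_matrix_inner[OF sym, of w "S *v w"] by (simp add: orthogonal_def)
    qed
    moreover have "w \<noteq> 0" using z yw(1,3) \<open>subspace ?V\<close> by (auto simp: span_eq_iff[THEN iffD2])
    moreover have "w \<bullet> z = w \<bullet> w" using yw by (simp add: inner_add orthogonal_def)
    ultimately show ?thesis by auto
  qed
  then obtain v where v: "S *v v = 0" "v \<bullet> z > 0" by blast
  show ?thesis
  proof (rule SUP_PInfty)
    fix n :: nat
    show "\<exists>u\<in>UNIV. ereal (real n) \<le> ereal (u \<bullet> z - (u \<bullet> (S *v u)) / 2)"
      by (rule bexI[of _ "(real n / (v \<bullet> z)) *\<^sub>R v"]) (use v in \<open>auto simp: matrix_vector_mult_scaleR\<close>)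
  qed
qed

lemma Legendre_quadratic_pseudo_inverse:
  fixes S :: "real^'n^'n"
  assumes sym: "transpose S = S" and psd: "\<And>v. 0 \<le> v \<bullet> (S *v v)"
  shows "(SUP v. ereal (v \<bullet> z - (v \<bullet> (S *v v)) / 2)) =
    (if z \<in> range (\<lambda>y. S *v y) then ereal ((z \<bullet> (pseudo_inverse S *v z)) / 2) else \<infinity>)"
proof (cases "z \<in> range (\<lambda>y. S *v y)")
  case True
  then obtain y where y: "z = S *v y" by auto
  have "z \<bullet> (pseudo_inverse S *v z) = y \<bullet> (S *v (pseudo_inverse S *v (S *v y)))"
    unfolding y by (rule symmetric_matrix_inner[OF sym, symmetric])
  also have "\<dots> = y \<bullet> (S *v y)"
    by (metis pseudo_inverse_symmetric[OF sym] matrix_vector_mul_assoc)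
  finally show ?thesis
    using True Legendre_quadratic[OF sym psd, of y] y by simp
qed (simp add: Legendre_quadratic_infinite[OF sym])

section \<open>Large deviations from a quadratic log-Laplace limit\<close>

lemma (in prob_space) expectation_pos:
  fixes f :: "'a \<Rightarrow> real"
  assumes "integrable M f" "\<And>x. 0 < f x"
  shows "0 < expectation f"
proof -
  have "expectation f \<noteq> 0"
  proof
    assume "expectation f = 0"
    then have "AE x in M. f x = 0"
      using assms by (subst (asm) integral_nonneg_eq_0_iff_AE) (auto intro: less_imp_le)
    then have "AE x in M. False"
      by eventually_elim (use assms(2) in \<open>auto simp: less_le\<close>)
    then show False by simp
  qed
  moreover have "0 \<le> expectation f"
    by (intro integral_nonneg_AE AE_I2 less_imp_le assms(2))
  ultimately show ?thesis by simp
qed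

text \<open>The prefactor \<open>c\<close> only costs \<open>ln c / s\<close>, which vanishes as the
  speed tends to infinity; here it absorbs the size of a finite cover, in the companion lower
  estimate a factor \<open>1/2\<close>.\<close>

lemma log_prob_le:
  assumes "p \<le> c * exp (- s * \<alpha>)" "0 < c" "0 < s"
  shows "ereal (1 / s) * log_prob p \<le> ereal (ln c / s - \<alpha>)"
proof (cases "p \<le> 0")
  case False
  then have "ln p \<le> ln (c * exp (- s * \<alpha>))"
    using assms by (subst ln_le_cancel_iff) auto
  also have "\<dots> = ln c - s * \<alpha>"
    using assms by (simp add: ln_mult)
  finally show ?thesis
    using False assms by (simp add: log_prob_def field_simps)
qed (use assms in \<open>simp add: log_prob_def\<close>)

lemma log_prob_ge:
  assumes "c * exp (- s * \<alpha>) \<le> p" "0 < c" "0 < s"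
  shows "ereal (ln c / s - \<alpha>) \<le> ereal (1 / s) * log_prob p"
proof -
  have pos: "0 < c * exp (- s * \<alpha>)" using assms by simp
  then have "0 < p" using assms(1) by linarith
  have "ln (c * exp (- s * \<alpha>)) \<le> ln p"
    using pos \<open>0 < p\<close> assms(1) by (subst ln_le_cancel_iff)
  moreover have "ln (c * exp (- s * \<alpha>)) = ln c - s * \<alpha>"
    using assms by (simp add: ln_mult)
  ultimately have "(ln c - s * \<alpha>) / s \<le> ln p / s"
    using assms by (intro divide_right_mono) auto
  moreover have "(ln c - s * \<alpha>) / s = ln c / s - \<alpha>"
    using assms by (simp add: diff_divide_distrib)
  ultimately show ?thesis
    using \<open>0 < p\<close> assms by (simp add: log_prob_def)
qed

text \<open>A sublevel set is an intersection of closed half-spaces; those with \<open>v\<close> a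
  signed unit vector already confine it to a box.\<close>

lemma good_rate_function_Legendre_quadratic:
  fixes S :: "real^'n^'n"
  shows "good_rate_function (\<lambda>z. SUP v. ereal (v \<bullet> z - (v \<bullet> (S *v v)) / 2))"
proof -
  let ?I = "\<lambda>z. SUP v. ereal (v \<bullet> z - (v \<bullet> (S *v v)) / 2)"
  have "0 \<le> ?I z" for z
    by (rule SUP_upper2[of 0]) auto
  moreover have "compact {z. ?I z \<le> ereal c}" for c
  proof -
    have eq: "{z. ?I z \<le> ereal c} = (\<Inter>v. {z. v \<bullet> z - (v \<bullet> (S *v v)) / 2 \<le> c})"
      by (auto simp: SUP_le_iff)
    have "closed {z. ?I z \<le> ereal c}"
      unfolding eq by (intro closed_INT ballI closed_Collect_le continuous_intros)
    moreover have "bounded {z. ?I z \<le> ereal c}"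
    proof (rule bounded_subset)
      define B where "B i = c + (axis i 1 \<bullet> (S *v axis i 1)) / 2" for i :: 'n
      show "bounded (cbox (\<chi> i. - B i) (\<chi> i. B i))" by simp
      show "{z. ?I z \<le> ereal c} \<subseteq> cbox (\<chi> i. - B i) (\<chi> i. B i)"
      proof
        fix z assume "z \<in> {z. ?I z \<le> ereal c}"
        then have h: "v \<bullet> z - (v \<bullet> (S *v v)) / 2 \<le> c" for v
          by (auto simp: SUP_le_iff)
        have "- B i \<le> z $ i \<and> z $ i \<le> B i" for i
          using h[of "axis i 1"] h[of "- axis i 1"]
            matrix_vector_mult_scaleR[of S "-1" "axis i 1"]
          by (simp add: B_def inner_axis inner_commute)
        then show "z \<in> cbox (\<chi> i. - B i) (\<chi> i. B i)"
          by (simp add: mem_box_cart)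
      qed
    qed
    ultimately show ?thesis by (simp add: compact_eq_bounded_closed)
  qed
  ultimately show ?thesis by (simp add: good_rate_function_def)
qed

text \<open>Integrability is asked for only eventually, with a threshold that may depend on
  \<open>v\<close>: in the application exponential moments are available only for small
  arguments.\<close>

locale quadratic_log_Laplace = prob_space M for M :: "'w measure" +
  fixes Z :: "nat \<Rightarrow> 'w \<Rightarrow> real^'n" and s :: "nat \<Rightarrow> real" and S :: "real^'n^'n"
  assumes meas [measurable]: "\<And>n. Z n \<in> borel_measurable M"
    and speed: "filterlim s at_top sequentially"
    and sym: "transpose S = S" and psd: "\<And>v. 0 \<le> v \<bullet> (S *v v)"
    and mgf_integrable: "\<And>v. \<forall>\<^sub>F n in sequentially. integrable M (\<lambda>\<omega>. exp (s n * (v \<bullet> Z n \<omega>)))"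
    and mgf_limit: "\<And>v. (\<lambda>n. ln (\<integral>\<omega>. exp (s n * (v \<bullet> Z n \<omega>)) \<partial>M) / s n) \<longlonglongrightarrow> (v \<bullet> (S *v v)) / 2"
begin

abbreviation I where "I z \<equiv> (SUP v. ereal (v \<bullet> z - (v \<bullet> (S *v v)) / 2))"

lemma speed_gt: "\<forall>\<^sub>F n in sequentially. c < s n"
  using speed by (simp add: filterlim_at_top_dense)

lemma mgf_bounds:
  assumes "0 < e"
  shows "\<forall>\<^sub>F n in sequentially. integrable M (\<lambda>\<omega>. exp (s n * (v \<bullet> Z n \<omega>))) \<and>
    (\<integral>\<omega>. exp (s n * (v \<bullet> Z n \<omega>)) \<partial>M) \<le> exp (s n * ((v \<bullet> (S *v v)) / 2 + e)) \<and>
    exp (s n * ((v \<bullet> (S *v v)) / 2 - e)) \<le> (\<integral>\<omega>. exp (s n * (v \<bullet> Z n \<omega>)) \<partial>M)"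
proof -
  have "\<forall>\<^sub>F n in sequentially.
      dist (ln (\<integral>\<omega>. exp (s n * (v \<bullet> Z n \<omega>)) \<partial>M) / s n) ((v \<bullet> (S *v v)) / 2) < e"
    using mgf_limit assms by (rule tendstoD)
  with mgf_integrable[of v] speed_gt[of 0] show ?thesis
  proof eventually_elim
    case (elim n)
    let ?m = "\<integral>\<omega>. exp (s n * (v \<bullet> Z n \<omega>)) \<partial>M"
    have m: "?m = exp (ln ?m)"
      using expectation_pos[OF elim(1)] by simp
    have "ln ?m \<le> s n * ((v \<bullet> (S *v v)) / 2 + e)" "s n * ((v \<bullet> (S *v v)) / 2 - e) \<le> ln ?m"
      using elim(2,3) by (auto simp: dist_real_def abs_less_iff field_simps)
    then show ?case using elim(1) m by (metis exp_le_cancel_iff)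
  qed
qed

text \<open>Chernoff's bound with the exponent \<open>v\<close> itself, without optimization: the
  half-space is the set where the affine minorant of \<open>I\<close> given by \<open>v\<close>
  exceeds \<open>\<alpha>\<close>.\<close>

lemma halfspace_bound:
  assumes "0 < e"
  shows "\<forall>\<^sub>F n in sequentially.
    prob {\<omega>\<in>space M. \<alpha> < v \<bullet> Z n \<omega> - (v \<bullet> (S *v v)) / 2} \<le> exp (- s n * (\<alpha> - e))"
  using mgf_bounds[OF assms, of v] speed_gt[of 0]
proof eventually_elim
  case (elim n)
  let ?q = "(v \<bullet> (S *v v)) / 2"
  let ?u = "\<lambda>\<omega>. exp (s n * (v \<bullet> Z n \<omega>))"
  have "prob {\<omega>\<in>space M. \<alpha> < v \<bullet> Z n \<omega> - ?q}
      \<le> prob {\<omega>\<in>space M. exp (s n * (\<alpha> + ?q)) \<le> ?u \<omega>}"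
    by (rule finite_measure_mono) (use elim in \<open>auto\<close>)
  also have "\<dots> \<le> (\<integral>\<omega>. ?u \<omega> \<partial>M) / exp (s n * (\<alpha> + ?q))"
    by (rule integral_Markov_inequality_measure[where A="{}"]) (use elim in auto)
  also have "\<dots> \<le> exp (s n * (?q + e)) / exp (s n * (\<alpha> + ?q))"
    using elim by (intro divide_right_mono) auto
  also have "\<dots> = exp (- s n * (\<alpha> - e))"
    by (simp add: exp_diff[symmetric] algebra_simps)
  finally show ?case .
qed

text \<open>Exponential tightness is hidden here: the half-spaces in the signed coordinate
  directions cover everything outside a box, and the part of \<open>C\<close> inside the box is
  compact.\<close>

lemma finite_halfspace_cover:
  assumes "closed C" and C: "\<And>z. z \<in> C \<Longrightarrow> ereal \<alpha> < I z"
  obtains V where "finite V" "V \<noteq> {}"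
    "C \<subseteq> (\<Union>v\<in>V. {z. \<alpha> < v \<bullet> z - (v \<bullet> (S *v v)) / 2})"
proof -
  let ?H = "\<lambda>v. {z. \<alpha> < v \<bullet> z - (v \<bullet> (S *v v)) / 2}"
  let ?a = "\<lambda>i::'n. axis i (1::real)"
  define A where "A = range ?a \<union> range (\<lambda>i. - ?a i)"
  have "compact ({z. I z \<le> ereal \<alpha>} \<union> {z. z \<notin> (\<Union>v\<in>A. ?H v)})"
  proof -
    define B where "B i = \<alpha> + (?a i \<bullet> (S *v ?a i)) / 2" for i :: 'n
    have "- B i \<le> z $ i \<and> z $ i \<le> B i \<longleftrightarrow> z \<notin> ?H (?a i) \<and> z \<notin> ?H (- ?a i)" for z i
      using matrix_vector_mult_scaleR[of S "-1" "?a i"]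
      by (auto simp: B_def inner_axis inner_commute not_less)
    then have "{z. z \<notin> (\<Union>v\<in>A. ?H v)} = cbox (\<chi> i. - B i) (\<chi> i. B i)"
      by (simp add: set_eq_iff mem_box_cart A_def ball_Un del: mem_Collect_eq) blast
    moreover have "compact {z. I z \<le> ereal \<alpha>}"
      using good_rate_function_Legendre_quadratic[of S] by (auto simp: good_rate_function_def)
    ultimately show ?thesis by (simp add: compact_Un)
  qed
  then have c: "compact (C \<inter> ({z. I z \<le> ereal \<alpha>} \<union> {z. z \<notin> (\<Union>v\<in>A. ?H v)}))"
    using \<open>closed C\<close> by (rule closed_Int_compact[rotated])
  have sub: "C \<inter> ({z. I z \<le> ereal \<alpha>} \<union> {z. z \<notin> (\<Union>v\<in>A. ?H v)}) \<subseteq> (\<Union>v\<in>UNIV. ?H v)"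
    using C by (auto simp: less_SUP_iff)
  have op: "open (?H v)" for v
    by (intro open_Collect_less continuous_intros)
  obtain W where W: "finite W"
    "C \<inter> ({z. I z \<le> ereal \<alpha>} \<union> {z. z \<notin> (\<Union>v\<in>A. ?H v)}) \<subseteq> (\<Union>v\<in>W. ?H v)"
    by (rule compactE_image[OF c op sub]) auto
  show ?thesis
  proof (rule that)
    show "finite (W \<union> A)" using W by (simp add: A_def)
    show "W \<union> A \<noteq> {}" by (simp add: A_def)
    show "C \<subseteq> (\<Union>v\<in>W \<union> A. ?H v)"
      using W(2) by blast
  qed
qed

lemma upper_bound:
  assumes A: "A \<in> sets borel"
  shows "limsup (\<lambda>n. ereal (1 / s n) * log_prob (prob {\<omega>\<in>space M. Z n \<omega> \<in> A}))
    \<le> - (INF z\<in>closure A. I z)" (is "?L \<le> - ?J")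
proof (rule ccontr)
  assume "\<not> ?L \<le> - ?J"
  then have "- ?L < ?J" by (simp add: not_le ereal_uminus_less_reorder)
  then obtain \<beta> where "- ?L < ereal \<beta>" "ereal \<beta> < ?J" using ereal_dense2 by blast
  obtain \<alpha> where "ereal \<beta> < ereal \<alpha>" and \<alpha>: "ereal \<alpha> < ?J"
    using ereal_dense2[OF \<open>ereal \<beta> < ?J\<close>] by blast
  then have "\<beta> < \<alpha>" by simp
  have "ereal \<alpha> < I z" if "z \<in> closure A" for z
    using less_INF_D[OF \<alpha>] that by blast
  then obtain V where V: "finite V" "V \<noteq> {}"
    "closure A \<subseteq> (\<Union>v\<in>V. {z. \<alpha> < v \<bullet> z - (v \<bullet> (S *v v)) / 2})"
    using finite_halfspace_cover[OF closed_closure, of A \<alpha>] by blast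
  \<comment> \<open>Half of the gap pays for the error in Chernoff's bound, the other half for
    \<open>ln (card V) / s n\<close>.\<close>
  define e where "e = (\<alpha> - \<beta>) / 2"
  have "0 < e" using \<open>\<beta> < \<alpha>\<close> by (simp add: e_def)
  have "0 < real (card V)" using V by (simp add: card_gt_0_iff)
  have "\<forall>\<^sub>F n in sequentially. \<forall>v\<in>V.
      prob {\<omega>\<in>space M. \<alpha> < v \<bullet> Z n \<omega> - (v \<bullet> (S *v v)) / 2} \<le> exp (- s n * (\<alpha> - e))"
    using V halfspace_bound[OF \<open>0 < e\<close>] by (simp add: eventually_ball_finite)
  moreover have "\<forall>\<^sub>F n in sequentially. \<bar>ln (card V)\<bar> / e < s n"
    by (rule speed_gt)
  ultimately have "\<forall>\<^sub>F n in sequentially.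
      ereal (1 / s n) * log_prob (prob {\<omega>\<in>space M. Z n \<omega> \<in> A}) \<le> ereal (- \<beta>)"
    using speed_gt[of 0]
  proof eventually_elim
    case (elim n)
    let ?E = "\<lambda>v. {\<omega>\<in>space M. \<alpha> < v \<bullet> Z n \<omega> - (v \<bullet> (S *v v)) / 2}"
    have "prob {\<omega>\<in>space M. Z n \<omega> \<in> A} \<le> prob (\<Union>v\<in>V. ?E v)"
      using V closure_subset[of A] by (intro finite_measure_mono) (auto intro!: sets.finite_UN)
    also have "\<dots> \<le> (\<Sum>v\<in>V. prob (?E v))"
      using V by (intro finite_measure_subadditive_finite) auto
    also have "\<dots> \<le> (\<Sum>v\<in>V. exp (- s n * (\<alpha> - e)))"
      using elim by (intro sum_mono) auto
    finally have "prob {\<omega>\<in>space M. Z n \<omega> \<in> A} \<le> card V * exp (- s n * (\<alpha> - e))"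
      by simp
    then have "ereal (1 / s n) * log_prob (prob {\<omega>\<in>space M. Z n \<omega> \<in> A})
        \<le> ereal (ln (card V) / s n - (\<alpha> - e))"
      using \<open>0 < real (card V)\<close> elim(3) by (rule log_prob_le)
    also have "ln (card V) / s n - (\<alpha> - e) \<le> - \<beta>"
    proof -
      have "ln (card V) \<le> e * s n"
        using elim(2) \<open>0 < e\<close> by (simp add: field_simps)
      then have "ln (card V) / s n \<le> e" using elim(3) by (simp add: field_simps)
      then show ?thesis by (simp add: e_def field_simps)
    qed
    finally show ?case by simp
  qed
  then have "?L \<le> ereal (- \<beta>)" by (rule Limsup_bounded)
  with \<open>- ?L < ereal \<beta>\<close> show False
    
    by (simp add: ereal_uminus_less_reorder)
qed

text \<open>Exponential tilting by \<open>h\<close> with \<open>z = S \<lambda>\<close>: the tilted laws concentrate near \<open>z\<close>, because the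
  tilted log-Laplace transform is again quadratic and Chernoff's bound applies coordinatewise.\<close>

lemma tilted_lower_bound:
  assumes "open G" and z: "S *v h \<in> G" and "0 < e"
  shows "\<forall>\<^sub>F n in sequentially.
    (1/2) * exp (- s n * ((h \<bullet> (S *v h)) / 2 + e)) \<le> prob {\<omega>\<in>space M. Z n \<omega> \<in> G}"
proof -
  define z where "z = S *v h"
  define q where "q = (h \<bullet> (S *v h)) / 2"
  have "open (G \<inter> {y. \<bar>h \<bullet> (y - z)\<bar> < e / 2})"
    by (intro open_Int \<open>open G\<close> open_Collect_less continuous_intros)
  moreover have "z \<in> G \<inter> {y. \<bar>h \<bullet> (y - z)\<bar> < e / 2}"
    using z \<open>0 < e\<close> by (simp add: z_def)
  ultimately obtain r where r: "0 < r" "ball z r \<subseteq> G \<inter> {y. \<bar>h \<bullet> (y - z)\<bar> < e / 2}"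
    by (meson openE)
  \<comment> \<open>The l1 norm bounds the Euclidean norm, so a cube of half side
    \<open>\<delta>\<close> around \<open>z\<close> fits into the ball of radius
    \<open>r\<close>.\<close>
  define \<delta> where "\<delta> = r / (2 * real CARD('n))"
  have "0 < \<delta>" using r by (simp add: \<delta>_def)
  have box: "y \<in> G \<and> \<bar>h \<bullet> (y - z)\<bar> < e / 2" if "\<And>i. \<bar>y $ i - z $ i\<bar> \<le> \<delta>" for y
  proof -
    have "norm (y - z) \<le> (\<Sum>i\<in>UNIV. \<bar>(y - z) $ i\<bar>)" by (rule norm_le_l1_cart)
    also have "\<dots> \<le> (\<Sum>i\<in>(UNIV::'n set). \<delta>)" using that by (intro sum_mono) auto
    also have "\<dots> < r" using r by (simp add: \<delta>_def)
    finally have "y \<in> ball z r" by (simp add: dist_norm norm_minus_commute)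
    then show ?thesis using r by blast
  qed
  let ?a = "\<lambda>i::'n. axis i (1::real)"
  define \<sigma> where "\<sigma> = (\<Sum>i\<in>UNIV. ?a i \<bullet> (S *v ?a i)) + 1"
  have \<sigma>i: "?a i \<bullet> (S *v ?a i) \<le> \<sigma>" for i
    unfolding \<sigma>_def using member_le_sum[of i UNIV "\<lambda>i. ?a i \<bullet> (S *v ?a i)"] psd by force
  have "0 < \<sigma>" unfolding \<sigma>_def by (rule add_nonneg_pos) (auto intro: sum_nonneg psd)
  \<comment> \<open>An extra tilt \<open>\<eta>\<close> in direction \<open>w\<close> gains
    \<open>\<eta> * \<delta>\<close> and costs at most \<open>\<eta>\<^sup>2 * \<sigma> / 2\<close>;
    this choice is the optimal one and leaves \<open>\<eta> * \<delta> / 2\<close>.\<close>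
  define \<eta> where "\<eta> = \<delta> / \<sigma>"
  have "0 < \<eta>" using \<open>0 < \<delta>\<close> \<open>0 < \<sigma>\<close> by (simp add: \<eta>_def)
  \<comment> \<open>Two log-Laplace errors \<open>\<kappa>\<close> use up at most half of the gain
    \<open>\<eta> * \<delta> / 2\<close>; the bound \<open>e / 2\<close> keeps the loss in the final
    exponent within \<open>e\<close>.\<close>
  define \<kappa> where "\<kappa> = min (\<eta> * \<delta> / 8) (e / 2)"
  have "0 < \<kappa>" using \<open>0 < \<delta>\<close> \<open>0 < \<eta>\<close> \<open>0 < e\<close> by (simp add: \<kappa>_def)
  define V where "V = range ?a \<union> range (\<lambda>i. - ?a i)"
  have "finite V" by (simp add: V_def)
  have V1: "(w \<bullet> (S *v w)) \<le> \<sigma>" if "w \<in> V" for w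
    using that \<sigma>i matrix_vector_mult_scaleR[of S "-1" "?a _"] by (auto simp: V_def)
  have tilt: "((h + \<eta> *\<^sub>R w) \<bullet> (S *v (h + \<eta> *\<^sub>R w))) / 2 \<le> q + \<eta> * (w \<bullet> z) + \<eta> * \<delta> / 2"
    if "w \<in> V" for w
  proof -
    have "((h + \<eta> *\<^sub>R w) \<bullet> (S *v (h + \<eta> *\<^sub>R w))) / 2 = q + \<eta> * (w \<bullet> z) + \<eta>^2 / 2 * (w \<bullet> (S *v w))"
      using symmetric_matrix_inner[OF sym, of h w]
      by (simp add: q_def z_def matrix_vector_right_distrib matrix_vector_mult_scaleR
          inner_add inner_commute power2_eq_square field_simps)
    also have "\<eta>^2 / 2 * (w \<bullet> (S *v w)) \<le> \<eta>^2 / 2 * \<sigma>"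
      using V1[OF that] by (intro mult_left_mono) auto
    also have "\<eta>^2 / 2 * \<sigma> = \<eta> * \<delta> / 2"
      using \<open>0 < \<sigma>\<close> by (simp add: \<eta>_def power2_eq_square)
    finally show ?thesis by simp
  qed
  have "\<forall>\<^sub>F n in sequentially. \<forall>w\<in>V. integrable M (\<lambda>\<omega>. exp (s n * ((h + \<eta> *\<^sub>R w) \<bullet> Z n \<omega>))) \<and>
      (\<integral>\<omega>. exp (s n * ((h + \<eta> *\<^sub>R w) \<bullet> Z n \<omega>)) \<partial>M)
        \<le> exp (s n * (((h + \<eta> *\<^sub>R w) \<bullet> (S *v (h + \<eta> *\<^sub>R w))) / 2 + \<kappa>))"
  proof (intro eventually_ball_finite ballI)
    fix w
    show "\<forall>\<^sub>F n in sequentially. integrable M (\<lambda>\<omega>. exp (s n * ((h + \<eta> *\<^sub>R w) \<bullet> Z n \<omega>))) \<and>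
      (\<integral>\<omega>. exp (s n * ((h + \<eta> *\<^sub>R w) \<bullet> Z n \<omega>)) \<partial>M)
        \<le> exp (s n * (((h + \<eta> *\<^sub>R w) \<bullet> (S *v (h + \<eta> *\<^sub>R w))) / 2 + \<kappa>))"
      using mgf_bounds[OF \<open>0 < \<kappa>\<close>, of "h + \<eta> *\<^sub>R w"] by eventually_elim blast
  qed (rule \<open>finite V\<close>)
  moreover note mgf_bounds[OF \<open>0 < \<kappa>\<close>, of h]
  moreover have "\<forall>\<^sub>F n in sequentially. ln (2 * real (card V) + 1) / (\<eta> * \<delta> / 4) < s n"
    by (rule speed_gt)
  ultimately show ?thesis
    using speed_gt[of 0]
  proof eventually_elim
    case (elim n)
    let ?G = "{\<omega>\<in>space M. Z n \<omega> \<in> G}"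
    let ?u = "\<lambda>v \<omega>. exp (s n * (v \<bullet> Z n \<omega>))"
    let ?c = "\<lambda>w. exp (- s n * \<eta> * (w \<bullet> z + \<delta>))"
    have int: "integrable M (?u (h + \<eta> *\<^sub>R w))" if "w \<in> V" for w using elim that by auto
    have [measurable]: "G \<in> sets borel" using \<open>open G\<close> by simp
    have Gm: "?G \<in> sets M" by measurable
    \<comment> \<open>Splitting the tilting density pointwise avoids introducing the tilted measure:
      inside the cube it is at most about its value at \<open>z\<close>; outside, some coordinate
      deviates by at least \<open>\<delta>\<close>, and the exponential with the extra tilt
      dominates.\<close>
    have pt: "?u h \<omega> \<le> exp (s n * (2 * q + e / 2)) * indicator ?G \<omega>
          + (\<Sum>w\<in>V. ?c w * ?u (h + \<eta> *\<^sub>R w) \<omega>)" if "\<omega> \<in> space M" for \<omega>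
    proof (cases "\<forall>i. \<bar>Z n \<omega> $ i - z $ i\<bar> \<le> \<delta>")
      case True
      then have "Z n \<omega> \<in> G" "\<bar>h \<bullet> (Z n \<omega> - z)\<bar> < e / 2" using box by blast+
      moreover have "h \<bullet> z = 2 * q" by (simp add: q_def z_def)
      ultimately have "h \<bullet> Z n \<omega> - 2 * q < e / 2" by (simp only: inner_diff abs_less_iff)
      then have "h \<bullet> Z n \<omega> \<le> 2 * q + e / 2" by simp
      then have "?u h \<omega> \<le> exp (s n * (2 * q + e / 2)) * indicator ?G \<omega>"
        using \<open>Z n \<omega> \<in> G\<close> that elim(4) by simp
      moreover have "0 \<le> (\<Sum>w\<in>V. ?c w * ?u (h + \<eta> *\<^sub>R w) \<omega>)" by (intro sum_nonneg) auto
      ultimately show ?thesis by linarith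
    next
      case False
      then obtain i where "\<not> \<bar>Z n \<omega> $ i - z $ i\<bar> \<le> \<delta>" by blast
      then consider (up) "z $ i + \<delta> \<le> Z n \<omega> $ i" | (down) "- (z $ i) + \<delta> \<le> - (Z n \<omega> $ i)"
        by linarith
      then have "\<exists>w\<in>V. w \<bullet> z + \<delta> \<le> w \<bullet> Z n \<omega>"
      proof cases
        case up
        then show ?thesis
          by (intro bexI[of _ "?a i"]) (auto simp: V_def inner_axis inner_commute[of "?a i"])
      next
        case down
        then show ?thesis
          by (intro bexI[of _ "- ?a i"]) (auto simp: V_def inner_axis inner_commute[of "?a i"])
      qed
      then obtain w where w: "w \<in> V" "w \<bullet> z + \<delta> \<le> w \<bullet> Z n \<omega>" by blast
      have "?u h \<omega> \<le> ?c w * ?u (h + \<eta> *\<^sub>R w) \<omega>"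
      proof -
        have "s n * \<eta> * (w \<bullet> z + \<delta>) \<le> s n * \<eta> * (w \<bullet> Z n \<omega>)"
          using w elim(4) \<open>0 < \<eta>\<close> by (intro mult_left_mono) auto
        then show ?thesis
          by (simp add: exp_add[symmetric] inner_add algebra_simps)
      qed
      also have "\<dots> \<le> (\<Sum>w\<in>V. ?c w * ?u (h + \<eta> *\<^sub>R w) \<omega>)"
        using w \<open>finite V\<close> by (intro member_le_sum) auto
      finally show ?thesis
        by (simp add: add_increasing)
    qed
    have "exp (s n * (q - \<kappa>)) \<le> (\<integral>\<omega>. ?u h \<omega> \<partial>M)"
      using elim by (simp add: q_def)
    also have "\<dots> \<le> (\<integral>\<omega>. exp (s n * (2 * q + e / 2)) * indicator ?G \<omega>
          + (\<Sum>w\<in>V. ?c w * ?u (h + \<eta> *\<^sub>R w) \<omega>) \<partial>M)"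
      using elim int Gm pt by (intro integral_mono) (auto simp: emeasure_eq_measure)
    also have "\<dots> = exp (s n * (2 * q + e / 2)) * prob ?G
          + (\<Sum>w\<in>V. ?c w * (\<integral>\<omega>. ?u (h + \<eta> *\<^sub>R w) \<omega> \<partial>M))"
      using int Gm by (subst Bochner_Integration.integral_add)
        (auto simp: emeasure_eq_measure Bochner_Integration.integral_sum)
    also have "(\<Sum>w\<in>V. ?c w * (\<integral>\<omega>. ?u (h + \<eta> *\<^sub>R w) \<omega> \<partial>M))
        \<le> (\<Sum>w\<in>V. exp (s n * (q - \<eta> * \<delta> / 2 + \<kappa>)))"
    proof (rule sum_mono)
      fix w assume w: "w \<in> V"
      have "?c w * (\<integral>\<omega>. ?u (h + \<eta> *\<^sub>R w) \<omega> \<partial>M)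
          \<le> ?c w * exp (s n * (q + \<eta> * (w \<bullet> z) + \<eta> * \<delta> / 2 + \<kappa>))"
      proof (rule mult_left_mono)
        have "(\<integral>\<omega>. ?u (h + \<eta> *\<^sub>R w) \<omega> \<partial>M)
          \<le> exp (s n * (((h + \<eta> *\<^sub>R w) \<bullet> (S *v (h + \<eta> *\<^sub>R w))) / 2 + \<kappa>))"
          using elim w by blast
        also have "\<dots> \<le> exp (s n * (q + \<eta> * (w \<bullet> z) + \<eta> * \<delta> / 2 + \<kappa>))"
          using tilt[OF w] elim(4) by simp
        finally show "(\<integral>\<omega>. ?u (h + \<eta> *\<^sub>R w) \<omega> \<partial>M) \<le> \<dots>" .
      qed simp
      also have "\<dots> = exp (s n * (q - \<eta> * \<delta> / 2 + \<kappa>))"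
        by (simp add: exp_add[symmetric] algebra_simps)
      finally show "?c w * (\<integral>\<omega>. ?u (h + \<eta> *\<^sub>R w) \<omega> \<partial>M) \<le> exp (s n * (q - \<eta> * \<delta> / 2 + \<kappa>))" .
    qed
    \<comment> \<open>For large \<open>s n\<close> the remaining exponent beats the cardinality of
      \<open>V\<close>, so the deviations take at most half of the lower bound for the total
      mass.\<close>
    also have "(\<Sum>w\<in>V. exp (s n * (q - \<eta> * \<delta> / 2 + \<kappa>))) \<le> (1/2) * exp (s n * (q - \<kappa>))"
    proof -
      have "ln (2 * real (card V) + 1) \<le> s n * (\<eta> * \<delta> / 4)"
        using elim(3) \<open>0 < \<eta>\<close> \<open>0 < \<delta>\<close> by (simp add: field_simps)
      then have "exp (ln (2 * real (card V) + 1)) \<le> exp (s n * (\<eta> * \<delta> / 4))"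
        by (simp only: exp_le_cancel_iff)
      moreover have "exp (ln (2 * real (card V) + 1)) = 2 * real (card V) + 1"
        by (rule exp_ln) simp
      ultimately have "2 * real (card V) + 1 \<le> exp (s n * (\<eta> * \<delta> / 4))"
        by simp
      also have "\<dots> \<le> exp (s n * (\<eta> * \<delta> / 2 - 2 * \<kappa>))"
      proof -
        have "\<kappa> \<le> \<eta> * \<delta> / 8" by (simp add: \<kappa>_def)
        then have "\<eta> * \<delta> / 4 \<le> \<eta> * \<delta> / 2 - 2 * \<kappa>" by linarith
        then have "s n * (\<eta> * \<delta> / 4) \<le> s n * (\<eta> * \<delta> / 2 - 2 * \<kappa>)"
          using elim(4) by (intro mult_left_mono) auto
        then show ?thesis by (simp only: exp_le_cancel_iff)
      qed
      finally have "2 * real (card V) \<le> exp (s n * (\<eta> * \<delta> / 2 - 2 * \<kappa>))" by simp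
      then have "2 * real (card V) * exp (s n * (q - \<eta> * \<delta> / 2 + \<kappa>))
          \<le> exp (s n * (\<eta> * \<delta> / 2 - 2 * \<kappa>)) * exp (s n * (q - \<eta> * \<delta> / 2 + \<kappa>))"
        by (rule mult_right_mono) simp
      also have "\<dots> = exp (s n * (q - \<kappa>))"
        by (simp add: exp_add[symmetric] algebra_simps)
      finally show ?thesis by simp
    qed
    finally have "(1/2) * exp (s n * (q - \<kappa>)) \<le> exp (s n * (2 * q + e / 2)) * prob ?G"
      by simp
    then have "(1/2) * exp (s n * (q - \<kappa>)) * exp (- s n * (2 * q + e / 2))
        \<le> exp (s n * (2 * q + e / 2)) * prob ?G * exp (- s n * (2 * q + e / 2))"
      by (rule mult_right_mono) simp
    also have "\<dots> = prob ?G"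
      using exp_minus_inverse[of "s n * (2 * q + e / 2)"] by (simp only: mult_ac minus_mult_left mult_1_right)
    finally have "(1/2) * exp (s n * (q - \<kappa>)) * exp (- s n * (2 * q + e / 2)) \<le> prob ?G" .
    moreover have "exp (- s n * (q + e)) \<le> exp (s n * (q - \<kappa>)) * exp (- s n * (2 * q + e / 2))"
    proof -
      have "s n * \<kappa> \<le> s n * (e / 2)"
        using elim(4) by (intro mult_left_mono) (auto simp: \<kappa>_def)
      then show ?thesis by (simp add: exp_add[symmetric] algebra_simps)
    qed
    ultimately show ?case by (simp add: q_def)
  qed
qed

text \<open>Only points of the range of \<open>S\<close> call for an estimate, since
  \<open>I\<close> is infinite elsewhere; at \<open>S *v y\<close> the tilt is by \<open>y\<close>,
  and its cost is exactly the value of \<open>I\<close> there.\<close>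

lemma lower_bound:
  "- (INF z\<in>interior A. I z)
    \<le> liminf (\<lambda>n. ereal (1 / s n) * log_prob (prob {\<omega>\<in>space M. Z n \<omega> \<in> A}))" (is "_ \<le> ?L")
  if A: "A \<in> sets borel"
proof -
  have "- ?L \<le> I z" if z: "z \<in> interior A" for z
  proof (cases "z \<in> range (\<lambda>y. S *v y)")
    case True
    then obtain y where y: "z = S *v y" by blast
    define q where "q = y \<bullet> (S *v y) / 2"
    have "ereal (- q - e) \<le> ?L" if "0 < e" for e
    proof (rule Liminf_bounded)
      have "0 < e / 2" using that by simp
      have "\<forall>\<^sub>F n in sequentially. (1/2) * exp (- s n * (q + e / 2)) \<le> prob {\<omega>\<in>space M. Z n \<omega> \<in> interior A}"
        unfolding q_def using z y \<open>0 < e / 2\<close> by (intro tilted_lower_bound) auto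
      moreover have "\<forall>\<^sub>F n in sequentially. 2 * ln 2 / e < s n" by (rule speed_gt)
      ultimately show "\<forall>\<^sub>F n in sequentially.
          ereal (- q - e) \<le> ereal (1 / s n) * log_prob (prob {\<omega>\<in>space M. Z n \<omega> \<in> A})"
        using speed_gt[of 0]
      proof eventually_elim
        case (elim n)
        have "prob {\<omega>\<in>space M. Z n \<omega> \<in> interior A} \<le> prob {\<omega>\<in>space M. Z n \<omega> \<in> A}"
          using interior_subset[of A] A by (intro finite_measure_mono) auto
        then have "(1/2) * exp (- s n * (q + e / 2)) \<le> prob {\<omega>\<in>space M. Z n \<omega> \<in> A}"
          using elim by linarith
        then have "ereal (ln (1/2) / s n - (q + e / 2))
            \<le> ereal (1 / s n) * log_prob (prob {\<omega>\<in>space M. Z n \<omega> \<in> A})"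
          by (rule log_prob_ge) (use elim in auto)
        moreover have "- q - e \<le> ln (1/2) / s n - (q + e / 2)"
          using elim that by (simp add: ln_div field_simps)
        ultimately show ?case by (meson ereal_less_eq(3) order_trans)
      qed
    qed
    note L = this
    have "- ?L \<le> ereal q + ereal e" if "0 < e" for e :: real
    proof -
      have "- (ereal (q + e)) \<le> ?L" using L[OF that] by simp
      then have "- ?L \<le> ereal (q + e)" by (simp only: ereal_uminus_le_reorder)
      then show ?thesis by simp
    qed
    then have "- ?L \<le> ereal q"
      using ereal_le_epsilon2 by blast
    moreover have "I z = ereal q"
      unfolding y q_def by (rule Legendre_quadratic[OF sym psd])
    ultimately show ?thesis by simp
  next
    case False
    then show ?thesis using Legendre_quadratic_infinite[OF sym] by simp
  qed
  then have "- ?L \<le> (INF z\<in>interior A. I z)" by (rule INF_greatest)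
  then show ?thesis by (simp add: ereal_uminus_le_reorder)
qed

theorem LDP_quadratic: "LDP M Z s I"
  unfolding LDP_def
  using meas good_rate_function_Legendre_quadratic upper_bound lower_bound by blast

end

section \<open>Convolution operators with continuous symbol\<close>

lemma integral_cis:
  "((\<lambda>\<theta>. cis (of_int n * \<theta>)) has_integral (if n = 0 then 2 * complex_of_real pi else 0)) {-pi..pi}"
proof (cases "n = 0")
  case True
  then show ?thesis
    using has_integral_const_real[of "1::complex" "-pi" pi] by (simp add: scaleR_conv_of_real)
next
  case False
  have "((\<lambda>\<theta>. cis (of_int n * \<theta>)) has_integral
      (cis (of_int n * pi) / (\<i> * of_int n) - cis (of_int n * (-pi)) / (\<i> * of_int n))) {-pi..pi}"
  proof (rule fundamental_theorem_of_calculus)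
    fix x :: real
    have "((\<lambda>z. exp (\<i> * of_int n * z) / (\<i> * of_int n)) has_field_derivative exp (\<i> * of_int n * of_real x)) (at (of_real x))"
      using False by (auto intro!: derivative_eq_intros)
    from has_vector_derivative_real_field[OF this]
    show "((\<lambda>\<theta>. cis (of_int n * \<theta>) / (\<i> * of_int n)) has_vector_derivative cis (of_int n * x)) (at x within {-pi..pi})"
      by (simp add: cis_conv_exp mult_ac)
  qed simp
  moreover have "cis (of_int n * pi) = cis (of_int n * (-pi))"
    by (simp add: cis.ctr complex_eq_iff sin_int_times_real[of n] sin_times_pi_eq_0[THEN iffD2])
  ultimately show ?thesis using False by simp
qed

definition fcoeff :: "(real \<Rightarrow> complex) \<Rightarrow> int \<Rightarrow> complex" where
  "fcoeff \<gamma> n = integral {-pi..pi} (\<lambda>\<theta>. \<gamma> \<theta> * cis (- of_int n * \<theta>)) / (2 * pi)"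

lemma continuous_on_cis_mult [continuous_intros]:
  "continuous_on A (\<lambda>\<theta>. cis (c * \<theta>))"
  unfolding cis_conv_exp by (intro continuous_intros)

lemma fcoeff_integrable:
  assumes "continuous_on {-pi..pi} \<gamma>"
  shows "(\<lambda>\<theta>. \<gamma> \<theta> * cis (c * \<theta>)) integrable_on {-pi..pi}"
  by (intro integrable_continuous_real continuous_intros assms)

lemma fcoeff_add:
  assumes "continuous_on {-pi..pi} \<gamma>" "continuous_on {-pi..pi} \<beta>"
  shows "fcoeff (\<lambda>\<theta>. \<gamma> \<theta> + \<beta> \<theta>) n = fcoeff \<gamma> n + fcoeff \<beta> n"
  unfolding fcoeff_def
  using fcoeff_integrable[OF assms(1), of "- of_int n"] fcoeff_integrable[OF assms(2), of "- of_int n"]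
  by (simp add: distrib_right Henstock_Kurzweil_Integration.integral_add add_divide_distrib)

lemma fcoeff_diff:
  assumes "continuous_on {-pi..pi} \<gamma>" "continuous_on {-pi..pi} \<beta>"
  shows "fcoeff (\<lambda>\<theta>. \<gamma> \<theta> - \<beta> \<theta>) n = fcoeff \<gamma> n - fcoeff \<beta> n"
  unfolding fcoeff_def
  using fcoeff_integrable[OF assms(1), of "- of_int n"] fcoeff_integrable[OF assms(2), of "- of_int n"]
  by (simp add: left_diff_distrib Henstock_Kurzweil_Integration.integral_diff diff_divide_distrib)

lemma fcoeff_monomial:
  "fcoeff (\<lambda>\<theta>. c * cis (of_int m * \<theta>)) n = (if m = n then c else 0)"
proof -
  have "(\<lambda>\<theta>. c * cis (of_int m * \<theta>) * cis (- of_int n * \<theta>)) = (\<lambda>\<theta>. c * cis (of_int (m - n) * \<theta>))"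
    by (simp add: fun_eq_iff cis_mult algebra_simps)
  then have "integral {-pi..pi} (\<lambda>\<theta>. c * cis (of_int m * \<theta>) * cis (- of_int n * \<theta>))
      = c * (if m - n = 0 then 2 * complex_of_real pi else 0)"
    using integral_unique[OF has_integral_mult_right[OF integral_cis[of "m - n"], of c]] by simp
  then show ?thesis
    by (simp add: fcoeff_def)
qed

lemma cis_product: "(x * cis s) * (y * cis t) = (x * y) * cis (s + t)"
  by (simp add: cis_mult[symmetric])

lemma Parseval_finite:
  fixes w :: "int \<Rightarrow> real"
  assumes "finite K"
  shows "((\<lambda>\<theta>. (cmod (\<Sum>k\<in>K. w k * cis (of_int k * \<theta>)))\<^sup>2) has_integral (2 * pi * (\<Sum>k\<in>K. (w k)\<^sup>2))) {-pi..pi}"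
proof -
  have eq: "complex_of_real ((cmod (\<Sum>k\<in>K. w k * cis (of_int k * \<theta>)))\<^sup>2) =
      (\<Sum>k\<in>K. \<Sum>m\<in>K. of_real (w k * w m) * cis (of_int (k - m) * \<theta>))" for \<theta> :: real
    unfolding complex_norm_square cnj_sum complex_cnj_mult cis_cnj sum_product cis_product
    by (intro sum.cong refl) (simp add: algebra_simps)
  have "((\<lambda>\<theta>. \<Sum>k\<in>K. \<Sum>m\<in>K. of_real (w k * w m) * cis (of_int (k - m) * \<theta>)) has_integral
      (\<Sum>k\<in>K. \<Sum>m\<in>K. of_real (w k * w m) * (if k - m = 0 then 2 * complex_of_real pi else 0))) {-pi..pi}"
    by (intro has_integral_sum assms has_integral_mult_right integral_cis)
  moreover have "(\<Sum>k\<in>K. \<Sum>m\<in>K. complex_of_real (w k * w m) * (if k - m = 0 then 2 * complex_of_real pi else 0))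
      = of_real (2 * pi * (\<Sum>k\<in>K. (w k)\<^sup>2))"
    using assms by (simp add: if_distrib sum.delta sum_distrib_left power2_eq_square mult_ac cong: if_cong)
  ultimately have "((\<lambda>\<theta>. complex_of_real ((cmod (\<Sum>k\<in>K. w k * cis (of_int k * \<theta>)))\<^sup>2)) has_integral
      of_real (2 * pi * (\<Sum>k\<in>K. (w k)\<^sup>2))) {-pi..pi}"
    by (simp only: eq)
  from has_integral_Re[OF this] show ?thesis by simp
qed

text \<open>The multiplication operator with symbol \<open>\<gamma>\<close> has norm at most \<open>sup \<bar>\<gamma>\<bar>\<close>; test it against its own
  output \<open>w\<close> and use Parseval for the two trigonometric polynomials.\<close>

lemma symbol_l2_bound:
  fixes u :: "int \<Rightarrow> real"
  assumes cont: "continuous_on {-pi..pi} \<gamma>" and bound: "\<And>\<theta>. \<theta> \<in> {-pi..pi} \<Longrightarrow> cmod (\<gamma> \<theta>) \<le> B"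
    and fin: "finite K" "finite J"
  shows "(\<Sum>k\<in>K. (\<Sum>j\<in>J. Re (fcoeff \<gamma> (j - k)) * u j)\<^sup>2) \<le> B\<^sup>2 * (\<Sum>j\<in>J. (u j)\<^sup>2)"
proof -
  define w where "w k = (\<Sum>j\<in>J. Re (fcoeff \<gamma> (j - k)) * u j)" for k
  define W where "W \<theta> = (\<Sum>k\<in>K. w k * cis (of_int k * \<theta>))" for \<theta> :: real
  define U where "U \<theta> = (\<Sum>j\<in>J. u j * cis (of_int j * \<theta>))" for \<theta> :: real
  let ?T = "\<Sum>k\<in>K. (w k)\<^sup>2"
  have "(\<lambda>\<theta>. \<gamma> \<theta> * cis (- of_int (j - k) * \<theta>)) integrable_on {-pi..pi}" for j k
    by (intro fcoeff_integrable cont)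
  then have "((\<lambda>\<theta>. \<gamma> \<theta> * cis (- of_int (j - k) * \<theta>)) has_integral (2 * pi * fcoeff \<gamma> (j - k))) {-pi..pi}" for j k
    by (simp add: fcoeff_def has_integral_integral[symmetric])
  then have h1: "((\<lambda>\<theta>. \<Sum>k\<in>K. \<Sum>j\<in>J. of_real (w k * u j) * (\<gamma> \<theta> * cis (- of_int (j - k) * \<theta>))) has_integral
      (\<Sum>k\<in>K. \<Sum>j\<in>J. of_real (w k * u j) * (2 * pi * fcoeff \<gamma> (j - k)))) {-pi..pi}"
    by (intro has_integral_sum fin has_integral_mult_right)
  have eq: "(\<lambda>\<theta>. \<Sum>k\<in>K. \<Sum>j\<in>J. of_real (w k * u j) * (\<gamma> \<theta> * cis (- of_int (j - k) * \<theta>)))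
      = (\<lambda>\<theta>. \<gamma> \<theta> * W \<theta> * cnj (U \<theta>))"
    unfolding W_def U_def cnj_sum complex_cnj_mult cis_cnj mult.assoc[of "\<gamma> _"] sum_product cis_product
    by (intro ext, subst sum_distrib_left, intro sum.cong refl, subst sum_distrib_left, intro sum.cong refl)
      (simp add: algebra_simps)
  have "((\<lambda>\<theta>. Re (\<gamma> \<theta> * W \<theta> * cnj (U \<theta>))) has_integral
      Re (\<Sum>k\<in>K. \<Sum>j\<in>J. of_real (w k * u j) * (2 * pi * fcoeff \<gamma> (j - k)))) {-pi..pi}"
    by (rule has_integral_Re[OF h1[unfolded eq]])
  moreover have "Re (\<Sum>k\<in>K. \<Sum>j\<in>J. of_real (w k * u j) * (2 * pi * fcoeff \<gamma> (j - k))) = 2 * pi * ?T"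
    by (simp add: Re_sum w_def power2_eq_square sum_distrib_left sum_distrib_right mult_ac)
  ultimately have 1: "((\<lambda>\<theta>. Re (\<gamma> \<theta> * W \<theta> * cnj (U \<theta>))) has_integral (2 * pi * ?T)) {-pi..pi}"
    by simp
  \<comment> \<open>Young's inequality puts only half of \<open>2 * pi * ?T\<close> on the right,
    where it can be absorbed by the left-hand side.\<close>
  have 2: "((\<lambda>\<theta>. ((cmod (W \<theta>))\<^sup>2 + B\<^sup>2 * (cmod (U \<theta>))\<^sup>2) / 2) has_integral
      ((2 * pi * ?T + B\<^sup>2 * (2 * pi * (\<Sum>j\<in>J. (u j)\<^sup>2))) / 2)) {-pi..pi}"
    unfolding W_def U_def
    by (intro has_integral_divide has_integral_add has_integral_mult_right Parseval_finite fin)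
  have "2 * pi * ?T \<le> (2 * pi * ?T + B\<^sup>2 * (2 * pi * (\<Sum>j\<in>J. (u j)\<^sup>2))) / 2"
  proof (rule has_integral_le[OF 1 2])
    fix \<theta> assume \<theta>: "\<theta> \<in> {-pi..pi}"
    have "Re (\<gamma> \<theta> * W \<theta> * cnj (U \<theta>)) \<le> cmod (W \<theta>) * (cmod (\<gamma> \<theta>) * cmod (U \<theta>))"
      using complex_Re_le_cmod[of "\<gamma> \<theta> * W \<theta> * cnj (U \<theta>)"] by (simp add: norm_mult mult_ac)
    also have "\<dots> \<le> cmod (W \<theta>) * (B * cmod (U \<theta>))"
      using bound[OF \<theta>] by (intro mult_left_mono mult_right_mono) auto
    also have "\<dots> \<le> ((cmod (W \<theta>))\<^sup>2 + B\<^sup>2 * (cmod (U \<theta>))\<^sup>2) / 2"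
      using sum_squares_bound[of "cmod (W \<theta>)" "B * cmod (U \<theta>)"] by (simp add: power_mult_distrib)
    finally show "Re (\<gamma> \<theta> * W \<theta> * cnj (U \<theta>)) \<le> ((cmod (W \<theta>))\<^sup>2 + B\<^sup>2 * (cmod (U \<theta>))\<^sup>2) / 2" .
  qed
  then have "pi * ?T \<le> pi * (B\<^sup>2 * (\<Sum>j\<in>J. (u j)\<^sup>2))" by (simp add: algebra_simps)
  then show ?thesis by (simp add: w_def)
qed

section \<open>Uniform approximation of continuous periodic functions by trigonometric
  polynomials\<close>

inductive trig_poly :: "(real \<Rightarrow> complex) \<Rightarrow> bool" where
  monomial: "trig_poly (\<lambda>\<theta>. c * cis (of_int n * \<theta>))"
| add: "trig_poly p \<Longrightarrow> trig_poly q \<Longrightarrow> trig_poly (\<lambda>\<theta>. p \<theta> + q \<theta>)"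

lemma trig_poly_mult:
  assumes "trig_poly p" "trig_poly q"
  shows "trig_poly (\<lambda>\<theta>. p \<theta> * q \<theta>)"
  using assms(1)
proof induction
  case (monomial c n)
  show ?case using assms(2)
  proof induction
    case (monomial d m)
    have "(\<lambda>\<theta>. c * cis (of_int n * \<theta>) * (d * cis (of_int m * \<theta>))) = (\<lambda>\<theta>. c * d * cis (of_int (n + m) * \<theta>))"
      by (simp add: fun_eq_iff algebra_simps flip: cis_mult)
    then show ?case by (simp only: trig_poly.monomial)
  qed (auto simp: distrib_left intro: trig_poly.add)
qed (auto simp: distrib_right intro: trig_poly.add)

lemma trig_poly_const: "trig_poly (\<lambda>\<theta>. c)"
  using trig_poly.monomial[of c 0] by simp

lemma trig_poly_continuous: "trig_poly p \<Longrightarrow> continuous_on A p"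
  by (induction rule: trig_poly.induct) (intro continuous_intros | assumption)+

lemma trig_poly_finite_spectrum:
  "trig_poly p \<Longrightarrow> \<exists>r. \<forall>n. r < \<bar>n\<bar> \<longrightarrow> fcoeff p n = 0"
proof (induction rule: trig_poly.induct)
  case (monomial c n)
  then show ?case by (intro exI[of _ "\<bar>n\<bar>"]) (auto simp: fcoeff_monomial)
next
  case (add p q)
  then obtain r s where "\<forall>n. r < \<bar>n\<bar> \<longrightarrow> fcoeff p n = 0" "\<forall>n. s < \<bar>n\<bar> \<longrightarrow> fcoeff q n = 0" by blast
  then show ?case
    using add.hyps by (intro exI[of _ "max r s"]) (auto simp: fcoeff_add trig_poly_continuous)
qed

text \<open>A real linear function of \<open>cis \<theta>\<close> only has the frequencies 1 and -1,
  and trigonometric polynomials are closed under sums and products. This connects Stone-Weierstrass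
  on the circle with \<open>trig_poly\<close>.\<close>

lemma trig_poly_real_polynomial:
  assumes "real_polynomial_function (p :: complex \<Rightarrow> real)"
  shows "trig_poly (\<lambda>\<theta>. of_real (p (cis \<theta>)))"
  using assms
proof (induction rule: real_polynomial_function.induct)
  case (linear f)
  interpret bounded_linear f by fact
  have "f (cis \<theta>) = cos \<theta> * f 1 + sin \<theta> * f \<i>" for \<theta>
  proof -
    have "cis \<theta> = cos \<theta> *\<^sub>R 1 + sin \<theta> *\<^sub>R \<i>" by (simp add: complex_eq_iff)
    then show ?thesis by (simp add: add scale)
  qed
  then have "(\<lambda>\<theta>. complex_of_real (f (cis \<theta>))) =
      (\<lambda>\<theta>. (f 1 / 2 - \<i> * f \<i> / 2) * cis (of_int 1 * \<theta>) + (f 1 / 2 + \<i> * f \<i> / 2) * cis (of_int (-1) * \<theta>))"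
    by (simp add: fun_eq_iff complex_eq_iff algebra_simps)
  then show ?case by (simp only: trig_poly.intros)
qed (auto intro: trig_poly.add trig_poly_const trig_poly_mult)

text \<open>The periodic function is carried to the unit circle, a compact set on which
  Stone-Weierstrass for polynomial functions applies.\<close>

lemma trig_poly_approximation:
  fixes \<gamma> :: "real \<Rightarrow> complex"
  assumes cont: "continuous_on UNIV \<gamma>" and per: "\<gamma> pi = \<gamma> (-pi)" and "0 < e"
  obtains q where "trig_poly q" "\<And>\<theta>. \<theta> \<in> {-pi..pi} \<Longrightarrow> cmod (\<gamma> \<theta> - q \<theta>) \<le> e"
proof -
  define G where "G z = \<gamma> (Arg z)" for z
  have G: "G (cis \<theta>) = \<gamma> \<theta>" if "\<theta> \<in> {-pi..pi}" for \<theta>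
  proof (cases "\<theta> = -pi")
    case True
    have "cis \<theta> = cis pi" using True by (simp add: complex_eq_iff del: cis_pi)
    then show ?thesis using per True Arg_cis[of pi] by (simp only: G_def) simp
  next
    case False
    then show ?thesis using that by (simp add: G_def Arg_cis)
  qed
  have img: "cis ` {-pi..pi} = sphere 0 1"
  proof (intro equalityI subsetI)
    fix z :: complex assume "z \<in> sphere 0 1"
    then have "z = cis (Arg z)" by (metis cis_Arg mem_sphere_0 norm_zero sgn_div_norm div_by_1 scaleR_one zero_neq_one inverse_1)
    moreover have "Arg z \<in> {-pi..pi}" using Arg_bounded[of z] by simp
    ultimately show "z \<in> cis ` {-pi..pi}" by blast
  qed auto
  \<comment> \<open>\<open>Arg\<close> jumps at -1, so continuity is not inherited by composition.
    Instead, \<open>cis\<close> maps the compact interval onto the circle, and preimages of closed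
    sets under \<open>G\<close> are images of compact sets.\<close>
  have "continuous_on (sphere 0 1) G"
  proof (subst continuous_on_closed_vimage)
    show "\<forall>B. closed B \<longrightarrow> closed (G -` B \<inter> sphere 0 1)"
    proof (intro allI impI)
      fix B :: "complex set" assume "closed B"
      have eq: "G -` B \<inter> sphere 0 1 = cis ` (\<gamma> -` B \<inter> {-pi..pi})"
        unfolding img[symmetric] using G by auto
      have "closed (\<gamma> -` B \<inter> {-pi..pi})"
        using \<open>closed B\<close> continuous_on_subset[OF cont, of "{-pi..pi}"]
        by (simp add: continuous_on_closed_vimage)
      then have "compact (\<gamma> -` B \<inter> {-pi..pi})"
        by (metis compact_Icc closed_Int_compact inf.idem inf_assoc)
      then have "compact (cis ` (\<gamma> -` B \<inter> {-pi..pi}))"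
        by (intro compact_continuous_image) (use continuous_on_cis_mult[of _ 1] in auto)
      then show "closed (G -` B \<inter> sphere 0 1)" by (simp add: eq compact_imp_closed)
    qed
  qed simp
  from Stone_Weierstrass_polynomial_function[OF compact_sphere this \<open>0 < e\<close>]
  obtain p where p: "polynomial_function p" "\<And>z. z \<in> sphere 0 1 \<Longrightarrow> cmod (G z - p z) < e"
    by auto
  define q where "q \<theta> = complex_of_real (Re (p (cis \<theta>))) + \<i> * of_real (Im (p (cis \<theta>)))" for \<theta>
  have qp: "q \<theta> = p (cis \<theta>)" for \<theta> by (simp add: q_def complex_eq_iff)
  show ?thesis
  proof
    have "real_polynomial_function (\<lambda>z. Re (p z))" "real_polynomial_function (\<lambda>z. Im (p z))"
      using p(1) bounded_linear_Re bounded_linear_Im by (auto simp: polynomial_function_def o_def)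
    then show "trig_poly q" unfolding q_def
      by (intro trig_poly.add trig_poly_mult trig_poly_const trig_poly_real_polynomial)
    show "cmod (\<gamma> \<theta> - q \<theta>) \<le> e" if "\<theta> \<in> {-pi..pi}" for \<theta>
      using p(2)[of "cis \<theta>"] G[OF that] qp[of \<theta>] by (simp add: less_imp_le)
  qed
qed

section \<open>Identification of the given coefficients as the Fourier coefficients of
  \<open>g\<close>\<close>

lemma nn_integral_torus:
  fixes f :: "real \<Rightarrow> real"
  assumes "continuous_on UNIV f" "\<And>x. 0 \<le> f x"
  shows "(\<integral>\<^sup>+x. ennreal (f x) \<partial>restrict_space lborel {-pi..<pi}) = ennreal (integral {-pi..pi} f)"
proof -
  have [measurable]: "f \<in> borel_measurable borel"
    using assms(1) by (rule borel_measurable_continuous_onI)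
  have si: "set_integrable lborel {-pi..pi} f"
    by (rule borel_integrable_atLeastAtMost') (use assms(1) continuous_on_subset in blast)
  have "(\<integral>\<^sup>+x. ennreal (f x) \<partial>restrict_space lborel {-pi..<pi})
      = (\<integral>\<^sup>+x. ennreal (f x) * indicator {-pi..<pi} x \<partial>lborel)"
    by (subst nn_integral_restrict_space) auto
  also have "\<dots> = (\<integral>\<^sup>+x. ennreal (indicator {-pi..pi} x *\<^sub>R f x) \<partial>lborel)"
    by (rule nn_integral_cong_AE, rule AE_mp[OF AE_lborel_singleton[of pi]])
      (auto simp: indicator_def)
  also have "\<dots> = ennreal (LINT x:{-pi..pi}|lborel. f x)"
    unfolding set_lebesgue_integral_def
    by (rule nn_integral_eq_integral) (use si assms(2) in \<open>auto simp: set_integrable_def\<close>)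
  also have "(LINT x:{-pi..pi}|lborel. f x) = integral {-pi..pi} f"
    by (rule set_borel_integral_eq_integral(2)[OF si])
  finally show ?thesis .
qed

text \<open>A Fourier coefficient is continuous in the L2 norm. As soon as the partial sum over
  \<open>J\<close> contains the index \<open>n\<close>, the \<open>n\<close>-th coefficient of its
  error \<open>h\<close> is exactly \<open>?D\<close>, which is therefore as small as the
  error.\<close>

lemma fourier_series_coeff:
  fixes a :: "int \<Rightarrow> real^'d^'p"
  assumes L2: "L2_sum (restrict_space lborel {-pi..<pi}) (fourier_term a) g" and cont: "continuous_on UNIV g"
  shows "fcoeff (\<lambda>\<theta>. g \<theta> $ r $ c) n = of_real (a n $ r $ c)"
proof -
  let ?D = "fcoeff (\<lambda>\<theta>. g \<theta> $ r $ c) n - of_real (a n $ r $ c)"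
  have gc: "continuous_on A (\<lambda>\<theta>. g \<theta> $ r $ c)" for A
    using continuous_on_subset[OF cont] by (intro continuous_intros) auto
  have "cmod ?D \<le> e" if "0 < e" for e
  proof -
    have "0 < ennreal (2 * pi * e\<^sup>2)" using that by simp
    then have "\<forall>\<^sub>F J in finite_subsets_at_top UNIV.
        (\<integral>\<^sup>+x. ennreal ((norm (g x - (\<Sum>j\<in>J. fourier_term a j x)))\<^sup>2) \<partial>restrict_space lborel {-pi..<pi}) < ennreal (2 * pi * e\<^sup>2)"
      using L2 unfolding L2_sum_def by (auto dest!: order_tendstoD(2))
    moreover have "\<forall>\<^sub>F J in finite_subsets_at_top UNIV. finite J \<and> n \<in> J"
      using eventually_finite_subsets_at_top_finite[of UNIV]
      by (auto simp: eventually_finite_subsets_at_top intro!: exI[of _ "{n}"])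
    ultimately have "\<forall>\<^sub>F J in finite_subsets_at_top UNIV. finite J \<and> n \<in> J \<and>
        (\<integral>\<^sup>+x. ennreal ((norm (g x - (\<Sum>j\<in>J. fourier_term a j x)))\<^sup>2) \<partial>restrict_space lborel {-pi..<pi}) < ennreal (2 * pi * e\<^sup>2)"
      by eventually_elim blast
    then obtain J where J: "finite J" "n \<in> J" and
      small: "(\<integral>\<^sup>+x. ennreal ((norm (g x - (\<Sum>j\<in>J. fourier_term a j x)))\<^sup>2) \<partial>restrict_space lborel {-pi..<pi}) < ennreal (2 * pi * e\<^sup>2)"
      using eventually_happens'[OF finite_subsets_at_top_neq_bot] by blast
    define h where "h \<theta> = g \<theta> $ r $ c - (\<Sum>j\<in>J. of_real (a j $ r $ c) * cis (of_int j * \<theta>))" for \<theta>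
    have hc: "continuous_on A h" for A
      unfolding h_def by (intro continuous_intros gc)
    have h_le: "(cmod (h \<theta>))\<^sup>2 \<le> (norm (g \<theta> - (\<Sum>j\<in>J. fourier_term a j \<theta>)))\<^sup>2" for \<theta>
    proof -
      have "h \<theta> = (g \<theta> - (\<Sum>j\<in>J. fourier_term a j \<theta>)) $ r $ c"
        by (simp add: h_def fourier_term_def cis_conv_exp mult_ac)
      then have "cmod (h \<theta>) \<le> norm (g \<theta> - (\<Sum>j\<in>J. fourier_term a j \<theta>))"
        by (simp only: order_trans[OF Finite_Cartesian_Product.norm_nth_le Finite_Cartesian_Product.norm_nth_le])
      then show ?thesis by (intro power_mono) auto
    qed
    have "ennreal (integral {-pi..pi} (\<lambda>\<theta>. (cmod (h \<theta>))\<^sup>2)) = (\<integral>\<^sup>+x. ennreal ((cmod (h x))\<^sup>2) \<partial>restrict_space lborel {-pi..<pi})"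
      by (intro nn_integral_torus[symmetric] continuous_intros hc) auto
    also have "\<dots> \<le> (\<integral>\<^sup>+x. ennreal ((norm (g x - (\<Sum>j\<in>J. fourier_term a j x)))\<^sup>2) \<partial>restrict_space lborel {-pi..<pi})"
      by (intro nn_integral_mono ennreal_leI h_le)
    finally have "ennreal (integral {-pi..pi} (\<lambda>\<theta>. (cmod (h \<theta>))\<^sup>2)) < ennreal (2 * pi * e\<^sup>2)"
      using small by simp
    then have int: "integral {-pi..pi} (\<lambda>\<theta>. (cmod (h \<theta>))\<^sup>2) \<le> 2 * pi * e\<^sup>2"
      by (simp add: ennreal_less_iff integral_nonneg integrable_continuous_real hc continuous_intros less_imp_le)
    have "fcoeff h n = ?D"
    proof -
      have "fcoeff (\<lambda>\<theta>. \<Sum>j\<in>J. of_real (a j $ r $ c) * cis (of_int j * \<theta>)) n = (if n \<in> J then of_real (a n $ r $ c) else 0)"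
        using \<open>finite J\<close>
      proof induction
        case (insert x F)
        then show ?case
          by (subst sum.insert, simp, simp)
            (subst fcoeff_add, auto intro!: continuous_intros simp: fcoeff_monomial)
      qed (simp add: fcoeff_def)
      then show ?thesis
        unfolding h_def using J
        by (subst fcoeff_diff) (auto intro!: continuous_intros gc)
    qed
    \<comment> \<open>The inequality
      \<open>\<bar>h\<bar> \<le> e/2 + \<bar>h\<bar>\<^sup>2/(2e)\<close> takes the place of
      Cauchy-Schwarz; integrated over an interval of length \<open>2 * pi\<close>, each term
      contributes at most \<open>pi * e\<close>.\<close>
    have "cmod (integral {-pi..pi} (\<lambda>\<theta>. h \<theta> * cis (- of_int n * \<theta>)))
        \<le> integral {-pi..pi} (\<lambda>\<theta>. e / 2 + (cmod (h \<theta>))\<^sup>2 / (2 * e))"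
    proof (rule integral_norm_bound_integral)
      show "(\<lambda>\<theta>. h \<theta> * cis (- of_int n * \<theta>)) integrable_on {-pi..pi}"
        by (intro fcoeff_integrable hc)
      show "(\<lambda>\<theta>. e / 2 + (cmod (h \<theta>))\<^sup>2 / (2 * e)) integrable_on {-pi..pi}"
        using that by (intro integrable_continuous_real continuous_intros hc) auto
      fix \<theta>
      have "0 \<le> (cmod (h \<theta>) - e)\<^sup>2 / (2 * e)" using that by simp
      also have "\<dots> = e / 2 + (cmod (h \<theta>))\<^sup>2 / (2 * e) - cmod (h \<theta>)"
        using that by (simp add: power2_eq_square field_simps)
      finally show "cmod (h \<theta> * cis (- of_int n * \<theta>)) \<le> e / 2 + (cmod (h \<theta>))\<^sup>2 / (2 * e)"
        by (simp add: norm_mult)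
    qed
    also have "\<dots> = pi * e + integral {-pi..pi} (\<lambda>\<theta>. (cmod (h \<theta>))\<^sup>2) / (2 * e)"
      using that by (subst Henstock_Kurzweil_Integration.integral_add) (auto intro!: integrable_continuous_real continuous_intros hc)
    also have "\<dots> \<le> pi * e + (2 * pi * e\<^sup>2) / (2 * e)"
      using int that by (intro add_left_mono divide_right_mono) auto
    also have "\<dots> = 2 * pi * e"
      using that by (simp add: power2_eq_square)
    finally have "cmod (fcoeff h n) \<le> e"
      by (simp add: fcoeff_def norm_divide norm_mult field_simps)
    then show ?thesis using \<open>fcoeff h n = ?D\<close> by simp
  qed
  then have "cmod ?D \<le> 0" by (rule field_le_epsilon) simp
  then show ?thesis by simp
qed

text \<open>\<open>N\<close> bounds the norm on l2 of the convolution operator with coefficients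
  \<open>a\<close>. Finite sections in both indices keep all sums finite, and the bound is applied
  to finite sections only.\<close>

definition l2_bound :: "(int \<Rightarrow> real^'d^'p) \<Rightarrow> real \<Rightarrow> bool" where
  "l2_bound a N \<longleftrightarrow> (\<forall>K J u. finite K \<longrightarrow> finite J \<longrightarrow>
     (\<Sum>k\<in>K. (norm (\<Sum>j\<in>J. a (j - k) *v u j))\<^sup>2) \<le> N\<^sup>2 * (\<Sum>j\<in>J. (norm (u j))\<^sup>2))"

lemma norm_vec_power2: "(norm (x :: real^'n))\<^sup>2 = (\<Sum>i\<in>UNIV. (x $ i)\<^sup>2)"
  unfolding power2_norm_eq_inner by (simp add: inner_vec_def power2_eq_square)

lemma sum_power2_le_card:
  fixes f :: "'i \<Rightarrow> real"
  shows "(\<Sum>i\<in>A. f i)\<^sup>2 \<le> card A * (\<Sum>i\<in>A. (f i)\<^sup>2)"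
  using sum_squared_le_sum_of_squares[of f A] by (cases "finite A") (auto simp: mult.commute)

text \<open>The entries are treated as scalar symbols. Cauchy-Schwarz over the columns costs a
  factor \<open>CARD('d)\<close>, summation over the rows a factor \<open>CARD('p)\<close>; squaring
  their product only serves to write the bound in the form \<open>N\<^sup>2\<close>.\<close>

lemma l2_bound_symbol:
  fixes a :: "int \<Rightarrow> real^'d^'p" and \<gamma> :: "'p \<Rightarrow> 'd \<Rightarrow> real \<Rightarrow> complex"
  assumes cont: "\<And>r c. continuous_on {-pi..pi} (\<gamma> r c)"
    and bound: "\<And>r c \<theta>. \<theta> \<in> {-pi..pi} \<Longrightarrow> cmod (\<gamma> r c \<theta>) \<le> B"
    and a: "\<And>n r c. a n $ r $ c = Re (fcoeff (\<gamma> r c) n)"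
  shows "l2_bound a (real CARD('d) * real CARD('p) * B)"
  unfolding l2_bound_def
proof (intro allI impI)
  fix K J :: "int set" and u :: "int \<Rightarrow> real^'d"
  assume fin: "finite K" "finite J"
  let ?s = "\<lambda>k r c. \<Sum>j\<in>J. Re (fcoeff (\<gamma> r c) (j - k)) * u j $ c"
  have "(\<Sum>k\<in>K. (norm (\<Sum>j\<in>J. a (j - k) *v u j))\<^sup>2) = (\<Sum>k\<in>K. \<Sum>r\<in>UNIV. (\<Sum>c\<in>UNIV. ?s k r c)\<^sup>2)"
    by (simp add: norm_vec_power2 matrix_vector_mult_def a) (subst sum.swap, rule refl)
  also have "\<dots> \<le> (\<Sum>k\<in>K. \<Sum>r\<in>UNIV. real CARD('d) * (\<Sum>c\<in>UNIV. (?s k r c)\<^sup>2))"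
    by (intro sum_mono sum_power2_le_card)
  also have "\<dots> = real CARD('d) * (\<Sum>r\<in>UNIV. \<Sum>c\<in>UNIV. \<Sum>k\<in>K. (?s k r c)\<^sup>2)"
    by (simp add: sum_distrib_left sum.swap[of _ K] )
  also have "\<dots> \<le> real CARD('d) * (\<Sum>r\<in>(UNIV::'p set). \<Sum>c\<in>UNIV. B\<^sup>2 * (\<Sum>j\<in>J. (u j $ c)\<^sup>2))"
    by (intro mult_left_mono sum_mono symbol_l2_bound cont bound fin) auto
  also have "(\<Sum>r\<in>(UNIV::'p set). \<Sum>c\<in>UNIV. B\<^sup>2 * (\<Sum>j\<in>J. (u j $ c)\<^sup>2)) = real CARD('p) * B\<^sup>2 * (\<Sum>j\<in>J. (norm (u j))\<^sup>2)"
    by (simp add: norm_vec_power2 sum_distrib_left mult_ac) (subst sum.swap, rule refl)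
  also have "real CARD('d) * (real CARD('p) * B\<^sup>2 * (\<Sum>j\<in>J. (norm (u j))\<^sup>2))
      \<le> (real CARD('d) * real CARD('p))\<^sup>2 * (B\<^sup>2 * (\<Sum>j\<in>J. (norm (u j))\<^sup>2))"
  proof -
    have "1 \<le> real CARD('d) * real CARD('p)"
      by (metis One_nat_def Suc_leI mult_pos_pos of_nat_1 of_nat_le_iff of_nat_mult zero_less_card_finite)
    then have "real CARD('d) * real CARD('p) \<le> (real CARD('d) * real CARD('p))\<^sup>2"
      by (simp add: self_le_power)
    then show ?thesis
      by (metis (no_types, lifting) mult.assoc mult_nonneg_nonneg mult_right_mono sum_nonneg zero_le_power2)
  qed
  finally show "(\<Sum>k\<in>K. (norm (\<Sum>j\<in>J. a (j - k) *v u j))\<^sup>2)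
      \<le> (real CARD('d) * real CARD('p) * B)\<^sup>2 * (\<Sum>j\<in>J. (norm (u j))\<^sup>2)"
    by (simp add: power_mult_distrib mult_ac)
qed

lemma fourier_series_l2_bound:
  fixes a :: "int \<Rightarrow> real^'d^'p"
  assumes fs: "fourier_series a g" and cont: "continuous_on UNIV g"
  shows "\<exists>N>0. l2_bound a N"
    and "0 < \<delta> \<Longrightarrow> \<exists>a' r. (\<forall>n. r < \<bar>n\<bar> \<longrightarrow> a' n = 0) \<and> l2_bound (\<lambda>n. a n - a' n) \<delta>"
proof -
  let ?\<gamma> = "\<lambda>r c \<theta>. g \<theta> $ r $ c"
  let ?m = "real CARD('d) * real CARD('p)"
  have "0 < ?m" by simp
  have gc: "continuous_on A (?\<gamma> r c)" for A r c
    using continuous_on_subset[OF cont] by (intro continuous_intros) auto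
  have coeff: "fcoeff (?\<gamma> r c) n = of_real (a n $ r $ c)" for r c n
    using fs cont by (auto simp: fourier_series_def intro: fourier_series_coeff)
  have "bounded (g ` {-pi..pi})"
    by (intro compact_imp_bounded compact_continuous_image continuous_on_subset[OF cont]) auto
  then obtain B where B: "0 < B" "\<And>\<theta>. \<theta> \<in> {-pi..pi} \<Longrightarrow> norm (g \<theta>) \<le> B"
    by (auto simp: bounded_pos)
  have "l2_bound a (?m * B)"
  proof (rule l2_bound_symbol[of ?\<gamma>])
    show "cmod (?\<gamma> r c \<theta>) \<le> B" if "\<theta> \<in> {-pi..pi}" for \<theta> r c
      using B(2)[OF that] order_trans[OF Finite_Cartesian_Product.norm_nth_le Finite_Cartesian_Product.norm_nth_le] by (rule order_trans[rotated])
  qed (auto simp: gc coeff)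
  then show "\<exists>N>0. l2_bound a N" using \<open>0 < ?m\<close> B by (metis mult_pos_pos)
  assume "0 < \<delta>"
  \<comment> \<open>The entrywise tolerance \<open>\<delta> / ?m\<close> compensates for the
    dimensional factor \<open>?m\<close> in the norm bound for matrix symbols.\<close>
  then have "0 < \<delta> / ?m" using \<open>0 < ?m\<close> by simp
  have "\<exists>q. trig_poly q \<and> (\<forall>\<theta>\<in>{-pi..pi}. cmod (?\<gamma> r c \<theta> - q \<theta>) \<le> \<delta> / ?m)" for r c
  proof -
    have "g (-pi + 2 * pi) = g (-pi)" using fs unfolding fourier_series_def by blast
    then have "?\<gamma> r c pi = ?\<gamma> r c (-pi)" by simp
    show ?thesis
      by (rule trig_poly_approximation[OF gc[of UNIV r c] \<open>?\<gamma> r c pi = _\<close> \<open>0 < \<delta> / ?m\<close>]) auto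
  qed
  then obtain q where q: "\<And>r c. trig_poly (q r c)"
    "\<And>r c \<theta>. \<theta> \<in> {-pi..pi} \<Longrightarrow> cmod (?\<gamma> r c \<theta> - q r c \<theta>) \<le> \<delta> / ?m" by metis
  obtain R where R: "\<And>r c n. R r c < \<bar>n\<bar> \<Longrightarrow> fcoeff (q r c) n = 0"
    using trig_poly_finite_spectrum[OF q(1)] by metis
  \<comment> \<open>The entries of \<open>a\<close> are real, but the coefficients of
    \<open>q\<close> may be complex. The bound for a symbol involves only the real parts of its
    coefficients, so these define \<open>a'\<close>.\<close>
  define a' where "a' n = (\<chi> r c. Re (fcoeff (q r c) n))" for n
  have "l2_bound (\<lambda>n. a n - a' n) (?m * (\<delta> / ?m))"
    by (rule l2_bound_symbol[of "\<lambda>r c \<theta>. ?\<gamma> r c \<theta> - q r c \<theta>"])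
      (auto simp: q(2) gc trig_poly_continuous q(1) fcoeff_diff coeff a'_def intro!: continuous_on_diff gc)
  moreover have "\<forall>n. (MAX r\<in>UNIV. MAX c\<in>UNIV. R r c) < \<bar>n\<bar> \<longrightarrow> a' n = 0"
    by (simp add: a'_def vec_eq_iff R)
  ultimately have "l2_bound (\<lambda>n. a n - a' n) \<delta>" "\<exists>r. \<forall>n. r < \<bar>n\<bar> \<longrightarrow> a' n = 0"
    using \<open>0 < ?m\<close> by (auto simp del: Max_less_iff)
  then show "\<exists>a' r. (\<forall>n. r < \<bar>n\<bar> \<longrightarrow> a' n = 0) \<and> l2_bound (\<lambda>n. a n - a' n) \<delta>"
    by blast
qed

section \<open>The logarithmic Sobolev inequality for continuously differentiable functions\<close>

lemma C_k_SucI: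
  assumes "\<And>x. (h has_derivative D x) (at x)" "\<And>v. C_k k (\<lambda>x. D x v)"
  shows "C_k (Suc k) h"
proof -
  have "frechet_derivative h (at x) = D x" for x
    using assms(1)[of x] by (metis frechet_derivative_at)
  then show ?thesis
    using assms by (auto simp: differentiable_def)
qed

lemma C_k_Suc_has_derivative:
  assumes "C_k (Suc k) h"
  shows "(h has_derivative frechet_derivative h (at x)) (at x)"
  using assms by (simp add: frechet_derivative_works)

lemma C_k_Suc_imp: "C_k (Suc k) h \<Longrightarrow> C_k k h"
proof (induction k arbitrary: h)
  case 0
  then show ?case
    by (auto intro!: differentiable_imp_continuous_on simp: differentiable_on_def differentiable_at_withinI)
next
  case (Suc k)
  then show ?case by simp
qed

lemma C_k_const: "C_k k (\<lambda>x. c)"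
proof (induction k arbitrary: c)
  case (Suc k)
  show ?case by (rule C_k_SucI[where D="\<lambda>x v. 0"]) (use Suc in auto)
qed simp

lemma C_k_bounded_linear: "bounded_linear f \<Longrightarrow> C_k k f"
proof (induction k)
  case 0
  then show ?case by (simp add: linear_continuous_on)
next
  case (Suc k)
  show ?case
    by (rule C_k_SucI[where D="\<lambda>x v. f v"])
      (use Suc.prems C_k_const in \<open>auto intro: bounded_linear_imp_has_derivative\<close>)
qed

lemma C_k_add: "C_k k f \<Longrightarrow> C_k k g \<Longrightarrow> C_k k (\<lambda>x. f x + g x)"
proof (induction k arbitrary: f g)
  case 0
  then show ?case by (auto intro: continuous_intros)
next
  case (Suc k)
  show ?case
    by (rule C_k_SucI[OF has_derivative_add[OF C_k_Suc_has_derivative[OF Suc.prems(1)]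
          C_k_Suc_has_derivative[OF Suc.prems(2)]]]) (use Suc in auto)
qed

lemma C_k_mult:
  fixes f g :: "'a::real_normed_vector \<Rightarrow> real"
  shows "C_k k f \<Longrightarrow> C_k k g \<Longrightarrow> C_k k (\<lambda>x. f x * g x)"
proof (induction k arbitrary: f g)
  case 0
  then show ?case by (auto intro: continuous_intros)
next
  case (Suc k)
  show ?case
    by (rule C_k_SucI[OF has_derivative_mult[OF C_k_Suc_has_derivative[OF Suc.prems(1)]
          C_k_Suc_has_derivative[OF Suc.prems(2)]]])
      (intro C_k_add Suc.IH C_k_Suc_imp[OF Suc.prems(1)] C_k_Suc_imp[OF Suc.prems(2)],
       use Suc.prems in auto)
qed

lemma C_k_exp:
  fixes f :: "'a::real_normed_vector \<Rightarrow> real"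
  shows "C_k k f \<Longrightarrow> C_k k (\<lambda>x. exp (f x))"
proof (induction k)
  case 0
  then show ?case by (auto intro: continuous_intros)
next
  case (Suc k)
  have "((\<lambda>x. exp (f x)) has_derivative (\<lambda>v. exp (f x) * frechet_derivative f (at x) v)) (at x)" for x
    by (auto intro!: derivative_eq_intros C_k_Suc_has_derivative[OF Suc.prems])
  then show ?case
    by (rule C_k_SucI) (use Suc C_k_Suc_imp[OF Suc.prems] in \<open>auto intro!: C_k_mult\<close>)
qed

lemma C_k_sum:
  fixes f :: "'i \<Rightarrow> 'a::real_normed_vector \<Rightarrow> 'b::real_normed_vector"
  shows "finite A \<Longrightarrow> (\<And>i. i \<in> A \<Longrightarrow> C_k k (f i)) \<Longrightarrow> C_k k (\<lambda>x. \<Sum>i\<in>A. f i x)"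
proof (induction A rule: finite_induct)
  case empty
  then show ?case using C_k_const by simp
qed (simp add: C_k_add)

lemma smooth_inner_self: "smooth (\<lambda>x::'a::euclidean_space. c * (x \<bullet> x))"
  unfolding smooth_def
proof
  fix k
  have "C_k k (\<lambda>x::'a. \<Sum>b\<in>Basis. (x \<bullet> b) * (x \<bullet> b))"
    by (intro C_k_sum C_k_mult C_k_bounded_linear bounded_linear_inner_left) auto
  then have "C_k k (\<lambda>x::'a. x \<bullet> x)"
    by (simp only: euclidean_inner[symmetric])
  then show "C_k k (\<lambda>x::'a. c * (x \<bullet> x))"
    by (intro C_k_mult C_k_const)
qed

lemma smooth_directional_derivative:
  "smooth K \<Longrightarrow> smooth (\<lambda>x. frechet_derivative K (at x) v)"
  unfolding smooth_def by (metis C_k.simps(2))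

section \<open>Mollification by a Gaussian kernel\<close>

lemma has_derivative_cbox_convolution:
  fixes K :: "'a::euclidean_space \<Rightarrow> real"
  assumes K: "smooth K" and \<phi>: "continuous_on UNIV \<phi>"
  shows "((\<lambda>x. integral (cbox a b) (\<lambda>y. \<phi> y * K (x - y))) has_derivative
    (\<lambda>v. integral (cbox a b) (\<lambda>y. \<phi> y * frechet_derivative K (at (x - y)) v))) (at x)"
proof -
  have K1: "C_k (Suc 0) K" using K unfolding smooth_def by blast
  have Kd: "(K has_derivative frechet_derivative K (at z)) (at z)" for z
    by (rule C_k_Suc_has_derivative[OF K1])
  have bl: "bounded_linear (frechet_derivative K (at z))" for z
    using Kd has_derivative_bounded_linear by blast
  have Kc: "continuous_on UNIV K"
    using K unfolding smooth_def by (metis C_k.simps(1))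
  define DK where "DK z = Blinfun (frechet_derivative K (at z))" for z
  have DK: "blinfun_apply (DK z) = frechet_derivative K (at z)" for z
    by (simp add: DK_def bounded_linear_Blinfun_apply bl)
  have "continuous_on UNIV DK"
    by (rule continuous_on_blinfun_componentwise) (use K1 in \<open>simp add: DK\<close>)
  then have DKc: "continuous_on A (\<lambda>p. DK (fst p - snd p))" for A
    by (rule continuous_on_compose2) (auto intro!: continuous_intros)
  have \<phi>c: "continuous_on A (\<lambda>p. \<phi> (snd p))" for A :: "('a \<times> 'a) set"
    using \<phi> by (rule continuous_on_compose2) (auto intro!: continuous_intros)
  have "((\<lambda>x. integral (cbox a b) (\<lambda>y. \<phi> y * K (x - y))) has_derivative
      blinfun_apply (integral (cbox a b) (\<lambda>y. \<phi> y *\<^sub>R DK (x - y)))) (at x within UNIV)"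
  proof (rule leibniz_rule[where fx="\<lambda>x y. \<phi> y *\<^sub>R DK (x - y)" and U=UNIV])
    fix x y :: 'a
    have "((\<lambda>x. x - y) has_derivative (\<lambda>v. v)) (at x)"
      by (auto intro!: derivative_eq_intros)
    from has_derivative_compose[OF this Kd[of "x - y"]]
    have "((\<lambda>x. K (x - y)) has_derivative (\<lambda>v. frechet_derivative K (at (x - y)) v)) (at x)" .
    then have "((\<lambda>x. \<phi> y * K (x - y)) has_derivative (\<lambda>v. \<phi> y * frechet_derivative K (at (x - y)) v)) (at x)"
      by (rule has_derivative_mult_right)
    moreover have "blinfun_apply (\<phi> y *\<^sub>R DK (x - y)) = (\<lambda>v. \<phi> y * frechet_derivative K (at (x - y)) v)"
      by (simp add: fun_eq_iff blinfun.scaleR_left DK)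
    ultimately show "((\<lambda>x. \<phi> y * K (x - y)) has_derivative blinfun_apply (\<phi> y *\<^sub>R DK (x - y))) (at x within UNIV)"
      by simp
  next
    fix x
    show "(\<lambda>y. \<phi> y * K (x - y)) integrable_on cbox a b"
      by (intro integrable_continuous continuous_intros continuous_on_subset[OF \<phi>]
          continuous_on_compose2[OF Kc]) auto
  next
    show "continuous_on (UNIV \<times> cbox a b) (\<lambda>(x, y). \<phi> y *\<^sub>R DK (x - y))"
      unfolding case_prod_unfold by (intro continuous_intros DKc \<phi>c)
  qed auto
  moreover have "blinfun_apply (integral (cbox a b) (\<lambda>y. \<phi> y *\<^sub>R DK (x - y))) v =
      integral (cbox a b) (\<lambda>y. \<phi> y * frechet_derivative K (at (x - y)) v)" for v
  proof -
    have "continuous_on A (\<lambda>y. DK (x - y))" for A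
      using \<open>continuous_on UNIV DK\<close> by (rule continuous_on_compose2) (auto intro!: continuous_intros)
    then have "(\<lambda>y. \<phi> y *\<^sub>R DK (x - y)) integrable_on cbox a b"
      by (intro integrable_continuous continuous_intros continuous_on_subset[OF \<phi>]) auto
    then show ?thesis
      by (subst blinfun_apply_integral) (simp_all add: DK blinfun.scaleR_left)
  qed
  ultimately show ?thesis
    by (metis (no_types, lifting) ext)
qed

text \<open>Each directional derivative is again such a convolution, with a directional derivative
  of \<open>K\<close> as the kernel; so the induction on the order must leave \<open>K\<close>
  arbitrary.\<close>

lemma smooth_cbox_convolution:
  fixes K :: "'a::euclidean_space \<Rightarrow> real"
  assumes "smooth K" "continuous_on UNIV \<phi>"
  shows "smooth (\<lambda>x. integral (cbox a b) (\<lambda>y. \<phi> y * K (x - y)))"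
  unfolding smooth_def
proof
  fix k
  show "C_k k (\<lambda>x. integral (cbox a b) (\<lambda>y. \<phi> y * K (x - y)))"
    using assms(1)
  proof (induction k arbitrary: K)
    case 0
    show ?case
      unfolding C_k.simps
      by (rule has_derivative_continuous_on, rule has_derivative_cbox_convolution[OF 0 assms(2)])
  next
    case (Suc k)
    show ?case
      by (rule C_k_SucI[OF has_derivative_cbox_convolution[OF Suc.prems assms(2)]])
        (rule Suc.IH[OF smooth_directional_derivative[OF Suc.prems]])
  qed
qed

lemma integrable_gaussian:
  "integrable lborel (\<lambda>x::'a::euclidean_space. exp (- (x \<bullet> x)))"
proof -
  have eq: "exp (- (x \<bullet> x)) = (\<Prod>b\<in>Basis. exp (- (x \<bullet> b)\<^sup>2))" for x :: 'a
    by (subst euclidean_inner) (simp add: exp_sum[symmetric] sum_negf power2_eq_square)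
  have "(\<integral>\<^sup>+x. ennreal (exp (- (x\<^sup>2))) \<partial>lborel) < \<infinity>"
  proof -
    have "integrable lborel (\<lambda>x::real. exp (- (x\<^sup>2)))"
    proof -
      have "integrable lborel (normal_density 0 (1 / sqrt 2))" by simp
      then have "integrable lborel (\<lambda>x. sqrt pi * normal_density 0 (1 / sqrt 2) x)" by simp
      moreover have "sqrt pi * normal_density 0 (1 / sqrt 2) x = exp (- (x\<^sup>2))" for x
        by (simp add: normal_density_def real_sqrt_mult power_divide)
      ultimately show ?thesis by simp
    qed
    then show ?thesis by (auto simp: integrable_iff_bounded)
  qed
  then have "(\<integral>\<^sup>+x. (\<Prod>b\<in>Basis. ennreal (exp (- (x \<bullet> b)\<^sup>2))) \<partial>(lborel :: 'a measure)) < \<infinity>"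
    by (subst nn_integral_lborel_prod)
      (auto simp: power_less_top_ennreal)
  then show ?thesis
    by (intro integrableI_bounded) (auto simp: eq prod_ennreal abs_prod)
qed

text \<open>A Gaussian instead of a bump function: its smoothness comes from the closure rules for
  \<open>C_k\<close>. The kernel has no compact support, but the functions to be mollified
  do.\<close>

definition gauss :: "'a::euclidean_space \<Rightarrow> real" where
  "gauss z = exp (- (z \<bullet> z)) / (\<integral>z. exp (- (z \<bullet> z)) \<partial>(lborel :: 'a measure))"

lemma gauss_mass_pos: "0 < (\<integral>z. exp (- (z \<bullet> z)) \<partial>(lborel :: 'a::euclidean_space measure))"
proof -
  have "(\<integral>z. exp (- (z \<bullet> z)) \<partial>(lborel :: 'a measure)) \<noteq> 0"
  proof
    assume "(\<integral>z. exp (- (z \<bullet> z)) \<partial>(lborel :: 'a measure)) = 0"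
    then have "AE z in (lborel :: 'a measure). exp (- (z \<bullet> z)) = 0"
      using integrable_gaussian[where 'a='a] by (subst (asm) integral_nonneg_eq_0_iff_AE) auto
    then have "AE z in (lborel :: 'a measure). False" by simp
    then show False
      using AE_iff_measurable[of UNIV "lborel :: 'a measure" "\<lambda>_. False"] by simp
  qed
  then show ?thesis
    using integral_nonneg_AE[of "\<lambda>z. exp (- (z \<bullet> z))" "lborel :: 'a measure"] by (simp add: less_le)
qed

lemma gauss_pos: "0 < gauss z"
  by (simp add: gauss_def gauss_mass_pos)

lemma smooth_gauss_scaled: "smooth (\<lambda>z::'a::euclidean_space. d * gauss (c *\<^sub>R z))"
proof -
  have "(\<lambda>z::'a. d * gauss (c *\<^sub>R z)) =
     (\<lambda>z. d / (\<integral>z. exp (- (z \<bullet> z)) \<partial>(lborel :: 'a measure)) * exp (- (c * c) * (z \<bullet> z)))"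
    by (simp add: gauss_def fun_eq_iff algebra_simps)
  moreover have "smooth \<dots>"
    using smooth_inner_self[of "- (c * c)"] unfolding smooth_def
    by (intro allI C_k_mult[OF C_k_const C_k_exp]) blast
  ultimately show ?thesis by simp
qed

definition gauss_measure :: "'a::euclidean_space measure" where
  "gauss_measure = density lborel (\<lambda>z. ennreal (gauss z))"

lemma gauss_measurable [measurable]: "gauss \<in> borel_measurable borel"
  unfolding gauss_def by measurable

lemma integrable_gauss: "integrable lborel gauss"
  unfolding gauss_def divide_inverse by (intro integrable_mult_left integrable_gaussian)

lemma prob_space_gauss_measure: "prob_space gauss_measure"
proof
  have "(\<integral>\<^sup>+z. ennreal (gauss z) \<partial>(lborel :: 'a measure)) = ennreal (\<integral>z. gauss z \<partial>(lborel :: 'a measure))"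
    by (intro nn_integral_eq_integral integrable_gauss AE_I2 less_imp_le gauss_pos)
  also have "\<dots> = 1" using gauss_mass_pos[where 'a='a] by (simp add: gauss_def)
  finally show "emeasure (gauss_measure :: 'a measure) (space gauss_measure) = 1"
    by (simp add: gauss_measure_def emeasure_density)
qed

lemma sets_gauss_measure [measurable_cong, simp]: "sets gauss_measure = sets borel"
  by (simp add: gauss_measure_def)

text \<open>Substituting \<open>y = x - e *\<^sub>R z\<close>. The average over a probability law
  yields bounds and limits, the convolution over a fixed box yields smoothness in
  \<open>x\<close>.\<close>

lemma gauss_mollification_eq:
  fixes \<phi> :: "'a::euclidean_space \<Rightarrow> real"
  assumes cont: "continuous_on UNIV \<phi>" and supp: "\<And>y. y \<notin> cbox a b \<Longrightarrow> \<phi> y = 0" and "0 < e"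
  shows "(\<integral>z. \<phi> (x - e *\<^sub>R z) \<partial>gauss_measure) =
    integral (cbox a b) (\<lambda>y. \<phi> y * ((1/e)^DIM('a) * gauss ((1/e) *\<^sub>R (x - y))))"
proof -
  have [measurable]: "\<phi> \<in> borel_measurable borel"
    using cont by (rule borel_measurable_continuous_onI)
  let ?h = "\<lambda>y. \<phi> y * ((1/e)^DIM('a) * gauss ((1/e) *\<^sub>R (x - y)))"
  have gc: "continuous_on A (\<lambda>y. gauss ((1/e) *\<^sub>R (x - y)))" for A
    unfolding gauss_def using gauss_mass_pos[where 'a='a] by (intro continuous_intros) auto
  have hc: "continuous_on A ?h" for A
    by (intro continuous_intros continuous_on_subset[OF cont] gc) auto
  have "(\<integral>z. \<phi> (x - e *\<^sub>R z) \<partial>gauss_measure) = (\<integral>z. gauss z * \<phi> (x - e *\<^sub>R z) \<partial>lborel)"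
    unfolding gauss_measure_def
    by (subst integral_density) (auto intro!: AE_I2 less_imp_le gauss_pos)
  also have "\<dots> = (\<integral>y. ?h y \<partial>lborel)"
  proof -
    have "(\<integral>y. ?h y \<partial>lborel) = (\<integral>y. ?h y \<partial>density (distr lborel borel (\<lambda>z. x + (-e) *\<^sub>R z)) (\<lambda>_. ennreal (\<bar>-e\<bar>^DIM('a))))"
      using \<open>0 < e\<close> by (subst lborel_affine[of "-e" x]) auto
    also have "\<dots> = (\<integral>z. e^DIM('a) * ?h (x + (-e) *\<^sub>R z) \<partial>lborel)"
      using \<open>0 < e\<close> by (subst integral_density) (auto simp: integral_distr)
    also have "\<dots> = (\<integral>z. gauss z * \<phi> (x - e *\<^sub>R z) \<partial>lborel)"
      using \<open>0 < e\<close> by (intro Bochner_Integration.integral_cong) (auto simp: power_divide field_simps)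
    finally show ?thesis by simp
  qed
  also have "\<dots> = (LINT y:cbox a b|lborel. ?h y)"
    unfolding set_lebesgue_integral_def
    by (intro Bochner_Integration.integral_cong) (auto simp: indicator_def supp)
  also have "\<dots> = integral (cbox a b) ?h"
    
    by (intro set_borel_integral_eq_integral(2), unfold set_integrable_def)
      (rule borel_integrable_compact[OF compact_cbox hc])
  finally show ?thesis .
qed


section \<open>From smooth to bounded continuously differentiable test functions\<close>

definition log_sobolev_const :: "'a::euclidean_space measure \<Rightarrow> real \<Rightarrow> bool" where
  "log_sobolev_const \<mu> C \<longleftrightarrow> (\<forall>h Dh. smooth h \<longrightarrow> (\<forall>x. GDERIV h x :> Dh x) \<longrightarrow>
     integrable \<mu> (\<lambda>x. (h x)\<^sup>2 * max 0 (ln ((h x)\<^sup>2))) \<longrightarrow>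
     ennreal (Ent \<mu> (\<lambda>x. (h x)\<^sup>2)) \<le> ennreal (2 * C) * (\<integral>\<^sup>+x. ennreal ((norm (Dh x))\<^sup>2) \<partial>\<mu>))"

text \<open>The inequality is applied to \<open>h = exp (\<psi> / 2)\<close>, whose squared gradient
  is \<open>\<bar>G\<bar>\<^sup>2 exp \<psi> / 4\<close>; this turns the constant
  \<open>2 * C\<close> into \<open>C / 2\<close>.\<close>

lemma log_sobolev_smooth:
  fixes \<mu> :: "'a::euclidean_space measure"
  assumes "prob_space \<mu>" and sets [measurable_cong]: "sets \<mu> = sets borel" and lsi: "log_sobolev_const \<mu> C" and "0 < C"
    and smooth: "smooth \<psi>" and grad: "\<And>x. GDERIV \<psi> x :> G x" and bound: "\<And>x. \<bar>\<psi> x\<bar> \<le> B"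
    and G: "\<And>x. norm (G x) \<le> B'" and [measurable]: "G \<in> borel_measurable borel"
  shows "Ent \<mu> (\<lambda>x. exp (\<psi> x)) \<le> C / 2 * (\<integral>x. (norm (G x))\<^sup>2 * exp (\<psi> x) \<partial>\<mu>)"
proof -
  interpret prob_space \<mu> by fact
  have [measurable]: "\<psi> \<in> borel_measurable borel"
    using smooth unfolding smooth_def by (metis C_k.simps(1) borel_measurable_continuous_onI)
  have "0 \<le> B" using bound[of 0] by linarith
  define h where "h x = exp (1/2 * \<psi> x)" for x
  have h2: "(h x)\<^sup>2 = exp (\<psi> x)" for x
    by (simp add: h_def power2_eq_square exp_add[symmetric])
  have "smooth h"
    using smooth unfolding smooth_def h_def by (intro allI C_k_exp C_k_mult C_k_const) auto
  moreover have "GDERIV h x :> (h x / 2) *\<^sub>R G x" for x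
    using grad[of x] unfolding gderiv_def h_def by (auto intro!: derivative_eq_intros)
  moreover have "integrable \<mu> (\<lambda>x. (h x)\<^sup>2 * max 0 (ln ((h x)\<^sup>2)))"
  proof (rule integrable_const_bound[where B="exp B * B"])
    show "AE x in \<mu>. norm ((h x)\<^sup>2 * max 0 (ln ((h x)\<^sup>2))) \<le> exp B * B"
      unfolding h2 using bound by (intro AE_I2) (auto simp: abs_mult abs_le_iff \<open>0 \<le> B\<close> intro!: mult_mono)
  qed (simp add: h2)
  ultimately have "ennreal (Ent \<mu> (\<lambda>x. (h x)\<^sup>2)) \<le>
      ennreal (2 * C) * (\<integral>\<^sup>+x. ennreal ((norm ((h x / 2) *\<^sub>R G x))\<^sup>2) \<partial>\<mu>)"
    using lsi[unfolded log_sobolev_const_def, rule_format, of h "\<lambda>x. (h x / 2) *\<^sub>R G x"] by blast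
  also have "(\<integral>\<^sup>+x. ennreal ((norm ((h x / 2) *\<^sub>R G x))\<^sup>2) \<partial>\<mu>) = (\<integral>\<^sup>+x. ennreal (1/4 * ((norm (G x))\<^sup>2 * exp (\<psi> x))) \<partial>\<mu>)"
    by (intro nn_integral_cong) (simp add: power_mult_distrib h2 power_divide mult_ac)
  also have "\<dots> = ennreal (\<integral>x. 1/4 * ((norm (G x))\<^sup>2 * exp (\<psi> x)) \<partial>\<mu>)"
  proof (rule nn_integral_eq_integral)
    show "integrable \<mu> (\<lambda>x. 1/4 * ((norm (G x))\<^sup>2 * exp (\<psi> x)))"
    proof (rule integrable_const_bound[where B="1/4 * (B'\<^sup>2 * exp B)"])
      show "AE x in \<mu>. norm (1/4 * ((norm (G x))\<^sup>2 * exp (\<psi> x))) \<le> 1/4 * (B'\<^sup>2 * exp B)"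
        using bound G by (intro AE_I2) (auto simp: abs_mult abs_le_iff intro!: mult_mono power_mono)
    qed simp
  qed auto
  also have "ennreal (2 * C) * \<dots> = ennreal (C / 2 * (\<integral>x. (norm (G x))\<^sup>2 * exp (\<psi> x) \<partial>\<mu>))"
    using \<open>0 < C\<close> by (subst ennreal_mult[symmetric]) auto
  finally show ?thesis
    using \<open>0 < C\<close> by (simp add: h2 ennreal_le_iff integral_nonneg_AE)
qed

text \<open>Smoothness already provides a derivative; to identify it, difference quotients along the
  steps \<open>1 / (m + 1)\<close> suffice. They pass under the integral because the gradient bound
  makes \<open>\<phi>\<close> Lipschitz.\<close>

lemma gauss_mollification_gradient:
  fixes \<phi> :: "'a::euclidean_space \<Rightarrow> real"
  assumes smooth: "smooth (\<lambda>x. \<integral>z. \<phi> (x - e *\<^sub>R z) \<partial>gauss_measure)"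
    and grad: "\<And>x. GDERIV \<phi> x :> G x" and bound: "\<And>x. \<bar>\<phi> x\<bar> \<le> B"
    and G: "\<And>x. norm (G x) \<le> B'" and Gm [measurable]: "G \<in> borel_measurable borel"
  shows "GDERIV (\<lambda>x. \<integral>z. \<phi> (x - e *\<^sub>R z) \<partial>gauss_measure) x :> (\<integral>z. G (x - e *\<^sub>R z) \<partial>gauss_measure)"
proof -
  interpret prob_space "gauss_measure :: 'a measure" by (rule prob_space_gauss_measure)
  let ?\<psi> = "\<lambda>x. \<integral>z. \<phi> (x - e *\<^sub>R z) \<partial>gauss_measure"
  let ?D = "frechet_derivative ?\<psi> (at x)"
  have deriv: "(\<phi> has_derivative (\<lambda>h. h \<bullet> G y)) (at y)" for y
    using grad[of y] by (simp add: gderiv_def)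
  have "continuous_on UNIV \<phi>"
    by (rule has_derivative_continuous_on) (rule deriv)
  then have [measurable]: "\<phi> \<in> borel_measurable borel"
    by (rule borel_measurable_continuous_onI)
  have "C_k (Suc 0) ?\<psi>" using smooth unfolding smooth_def by blast
  then have D: "(?\<psi> has_derivative ?D) (at x)" by (rule C_k_Suc_has_derivative)
  have Gint: "integrable gauss_measure (\<lambda>z. G (x - e *\<^sub>R z))"
    using G by (intro integrable_const_bound[where B=B']) auto
  have lip: "\<bar>\<phi> u - \<phi> v\<bar> \<le> B' * norm (u - v)" for u v
  proof -
    have "norm (\<phi> u - \<phi> v) \<le> B' * norm (u - v)"
    proof (rule differentiable_bound[of UNIV \<phi> "\<lambda>y h. h \<bullet> G y"])
      show "onorm (\<lambda>h. h \<bullet> G y) \<le> B'" for y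
        using G[of y] Cauchy_Schwarz_ineq2[of _ "G y"]
        by (intro onorm_le) (metis mult.commute mult_left_mono norm_ge_zero order_trans real_norm_def)
    qed (auto intro: deriv)
    then show ?thesis by simp
  qed
  have "?D v = v \<bullet> (\<integral>z. G (x - e *\<^sub>R z) \<partial>gauss_measure)" for v
  proof -
    have quot: "(\<lambda>m. (f (y + inverse (real (Suc m)) *\<^sub>R v) - f y) / inverse (real (Suc m))) \<longlonglongrightarrow> f' v"
      if "(f has_derivative f') (at y)" for f :: "'a \<Rightarrow> real" and f' y
    proof -
      have "((\<lambda>s. f (y + s *\<^sub>R v)) has_vector_derivative f' v) (at 0)"
      proof -
        have "((\<lambda>s. y + s *\<^sub>R v) has_derivative (\<lambda>s. s *\<^sub>R v)) (at 0)"
          by (auto intro!: derivative_eq_intros)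
        from has_derivative_compose[OF this, of f f'] that
        have "((\<lambda>s. f (y + s *\<^sub>R v)) has_derivative (\<lambda>s. f' (s *\<^sub>R v))) (at 0)" by simp
        then show ?thesis
          using linear_scale[OF has_derivative_linear[OF that]] by (simp add: has_vector_derivative_def)
      qed
      then have "((\<lambda>s. f (y + s *\<^sub>R v)) has_real_derivative f' v) (at 0)"
        by (simp add: has_real_derivative_iff_has_vector_derivative)
      then have "((\<lambda>s. (f (y + s *\<^sub>R v) - f y) / s) \<longlongrightarrow> f' v) (at 0)"
        by (simp add: DERIV_def)
      moreover have "filterlim (\<lambda>m. inverse (real (Suc m))) (at 0) sequentially"
        unfolding filterlim_at using LIMSEQ_inverse_real_of_nat by auto
      ultimately show ?thesis by (rule filterlim_compose)
    qed
    have "(\<lambda>m. \<integral>z. (\<phi> ((x - e *\<^sub>R z) + inverse (real (Suc m)) *\<^sub>R v) - \<phi> (x - e *\<^sub>R z)) / inverse (real (Suc m)) \<partial>gauss_measure)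
        \<longlonglongrightarrow> (\<integral>z. v \<bullet> G (x - e *\<^sub>R z) \<partial>gauss_measure)"
    proof (rule integral_dominated_convergence[where w="\<lambda>_. B' * norm v"])
      show "AE z in gauss_measure. norm ((\<phi> ((x - e *\<^sub>R z) + inverse (real (Suc m)) *\<^sub>R v) - \<phi> (x - e *\<^sub>R z)) / inverse (real (Suc m))) \<le> B' * norm v" for m
      proof (rule AE_I2)
        fix z
        define i where "i = inverse (real (Suc m))"
        have "0 < i" by (simp add: i_def)
        have "\<bar>\<phi> ((x - e *\<^sub>R z) + i *\<^sub>R v) - \<phi> (x - e *\<^sub>R z)\<bar> \<le> B' * (i * norm v)"
          using lip[of "(x - e *\<^sub>R z) + i *\<^sub>R v" "x - e *\<^sub>R z"] \<open>0 < i\<close> by simp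
        then have "norm ((\<phi> ((x - e *\<^sub>R z) + i *\<^sub>R v) - \<phi> (x - e *\<^sub>R z)) / i) \<le> B' * norm v"
          using \<open>0 < i\<close> unfolding norm_divide real_norm_def by (simp add: pos_divide_le_eq mult_ac)
        then show "norm ((\<phi> ((x - e *\<^sub>R z) + inverse (real (Suc m)) *\<^sub>R v) - \<phi> (x - e *\<^sub>R z)) / inverse (real (Suc m))) \<le> B' * norm v"
          by (simp only: i_def)
      qed
    next
      show "AE z in gauss_measure. (\<lambda>m. (\<phi> ((x - e *\<^sub>R z) + inverse (real (Suc m)) *\<^sub>R v) - \<phi> (x - e *\<^sub>R z)) / inverse (real (Suc m)))
          \<longlonglongrightarrow> v \<bullet> G (x - e *\<^sub>R z)"
        by (intro AE_I2 quot[OF deriv])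
    qed auto
    moreover have "(\<integral>z. (\<phi> ((x - e *\<^sub>R z) + s *\<^sub>R v) - \<phi> (x - e *\<^sub>R z)) / s \<partial>gauss_measure)
        = (?\<psi> (x + s *\<^sub>R v) - ?\<psi> x) / s" for s
    proof -
      have "integrable gauss_measure (\<lambda>z. \<phi> ((y - e *\<^sub>R z) + w))" for y w
        using bound by (intro integrable_const_bound[where B=B]) auto
      from this[of x "s *\<^sub>R v"] this[of x 0] show ?thesis
        by (simp add: algebra_simps)
    qed
    ultimately have "(\<lambda>m. (?\<psi> (x + inverse (real (Suc m)) *\<^sub>R v) - ?\<psi> x) / inverse (real (Suc m)))
        \<longlonglongrightarrow> (\<integral>z. v \<bullet> G (x - e *\<^sub>R z) \<partial>gauss_measure)" by (simp only:)
    from LIMSEQ_unique[OF quot[OF D] this]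
    show ?thesis using Gint by simp
  qed
  then show ?thesis
    using D unfolding gderiv_def by (metis (no_types, lifting) ext)
qed

text \<open>Dominated convergence for both integrals in the entropy. The uniform bound also keeps
  the limiting expectation positive, so that the logarithm is continuous there.\<close>

lemma Ent_exp_tendsto:
  fixes \<psi> :: "nat \<Rightarrow> 'a \<Rightarrow> real"
  assumes "prob_space M" and [measurable]: "\<And>n. \<psi> n \<in> borel_measurable M" "\<phi> \<in> borel_measurable M"
    and bound: "\<And>n x. \<bar>\<psi> n x\<bar> \<le> B" and lim: "\<And>x. (\<lambda>n. \<psi> n x) \<longlonglongrightarrow> \<phi> x"
  shows "(\<lambda>n. Ent M (\<lambda>x. exp (\<psi> n x))) \<longlonglongrightarrow> Ent M (\<lambda>x. exp (\<phi> x))"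
proof -
  interpret prob_space M by fact
  have "0 \<le> B" using bound[of 0 undefined] by linarith
  have 1: "(\<lambda>n. \<integral>x. exp (\<psi> n x) * ln (exp (\<psi> n x)) \<partial>M) \<longlonglongrightarrow> (\<integral>x. exp (\<phi> x) * ln (exp (\<phi> x)) \<partial>M)"
  proof (rule integral_dominated_convergence[where w="\<lambda>_. exp B * B"])
    show "AE x in M. norm (exp (\<psi> n x) * ln (exp (\<psi> n x))) \<le> exp B * B" for n
      using bound by (intro AE_I2) (auto simp: abs_mult abs_le_iff \<open>0 \<le> B\<close> intro!: mult_mono)
    show "AE x in M. (\<lambda>n. exp (\<psi> n x) * ln (exp (\<psi> n x))) \<longlonglongrightarrow> exp (\<phi> x) * ln (exp (\<phi> x))"
      unfolding ln_exp by (intro AE_I2 tendsto_intros lim)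
  qed auto
  have 2: "(\<lambda>n. \<integral>x. exp (\<psi> n x) \<partial>M) \<longlonglongrightarrow> (\<integral>x. exp (\<phi> x) \<partial>M)"
  proof (rule integral_dominated_convergence[where w="\<lambda>_. exp B"])
    show "AE x in M. norm (exp (\<psi> n x)) \<le> exp B" for n
      using bound by (intro AE_I2) (auto simp: abs_le_iff)
    show "AE x in M. (\<lambda>n. exp (\<psi> n x)) \<longlonglongrightarrow> exp (\<phi> x)"
      by (intro AE_I2 tendsto_intros lim)
  qed auto
  have "(\<integral>x. exp (\<phi> x) \<partial>M) \<noteq> 0"
  proof -
    have "exp (- B) \<le> (\<integral>x. exp (\<phi> x) \<partial>M)"
    proof (rule integral_ge_const)
      have "\<bar>\<phi> x\<bar> \<le> B" for x
        by (rule LIMSEQ_le_const2[OF tendsto_rabs[OF lim[of x]]]) (use bound in auto)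
      then have b: "- B \<le> \<phi> x" "\<phi> x \<le> B" for x
        by (auto simp: abs_le_iff minus_le_iff)
      show "AE x in M. exp (- B) \<le> exp (\<phi> x)" using b by simp
      show "integrable M (\<lambda>x. exp (\<phi> x))"
        using b by (intro integrable_const_bound[where B="exp B"]) auto
    qed
    moreover have "0 < exp (- B)" by simp
    ultimately show ?thesis by linarith
  qed
  then show ?thesis
    unfolding Ent_def by (intro tendsto_intros 1 2)
qed

text \<open>Compact support bounds \<open>\<phi>\<close> and \<open>G\<close>. Their mollifications
  obey the same bounds and converge pointwise, so both sides of the inequality pass to the
  limit.\<close>

lemma log_sobolev_C1_compact:
  fixes \<mu> :: "'a::euclidean_space measure"
  assumes prob: "prob_space \<mu>" and sets [measurable_cong]: "sets \<mu> = sets borel" and lsi: "log_sobolev_const \<mu> C" and "0 < C"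
    and grad: "\<And>x. GDERIV \<phi> x :> G x" and cont: "continuous_on UNIV G"
    and supp: "\<And>x. x \<notin> cbox a b \<Longrightarrow> \<phi> x = 0" "\<And>x. x \<notin> cbox a b \<Longrightarrow> G x = 0"
  shows "Ent \<mu> (\<lambda>x. exp (\<phi> x)) \<le> C / 2 * (\<integral>x. (norm (G x))\<^sup>2 * exp (\<phi> x) \<partial>\<mu>)"
proof -
  interpret prob_space \<mu> by fact
  interpret g: prob_space "gauss_measure :: 'a measure" by (rule prob_space_gauss_measure)
  have \<phi>c: "continuous_on UNIV \<phi>"
    by (rule has_derivative_continuous_on) (use grad in \<open>simp add: gderiv_def\<close>)
  have [measurable]: "\<phi> \<in> borel_measurable borel" "G \<in> borel_measurable borel"
    using \<phi>c cont by (auto intro: borel_measurable_continuous_onI)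
  have bdd: "\<exists>B\<ge>0. \<forall>x. norm (f x) \<le> B"
    if "continuous_on UNIV f" "\<And>x. x \<notin> cbox a b \<Longrightarrow> f x = 0" for f :: "'a \<Rightarrow> 'b::real_normed_vector"
  proof -
    have "bounded (f ` cbox a b)"
      by (intro compact_imp_bounded compact_continuous_image continuous_on_subset[OF that(1)]) auto
    then obtain B where "0 < B" "\<And>x. x \<in> cbox a b \<Longrightarrow> norm (f x) \<le> B" by (auto simp: bounded_pos)
    then show ?thesis using that(2) by (intro exI[of _ B]) (metis less_imp_le norm_zero)
  qed
  obtain B where B: "0 \<le> B" "\<And>x. \<bar>\<phi> x\<bar> \<le> B" using bdd[OF \<phi>c supp(1)] by auto
  obtain B' where B': "0 \<le> B'" "\<And>x. norm (G x) \<le> B'" using bdd[OF cont supp(2)] by auto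
  define e where "e n = inverse (real (Suc n))" for n
  have e: "0 < e n" for n by (simp add: e_def)
  have e_lim: "(\<lambda>n. x - e n *\<^sub>R z) \<longlonglongrightarrow> x" for x z :: 'a
    using tendsto_diff[OF tendsto_const tendsto_scaleR[OF LIMSEQ_inverse_real_of_nat tendsto_const], of x z]
    by (simp add: e_def)
  define \<psi> where "\<psi> n x = (\<integral>z. \<phi> (x - e n *\<^sub>R z) \<partial>gauss_measure)" for n x
  define \<Gamma> where "\<Gamma> n x = (\<integral>z. G (x - e n *\<^sub>R z) \<partial>gauss_measure)" for n x
  have [measurable]: "\<psi> n \<in> borel_measurable borel" "\<Gamma> n \<in> borel_measurable borel" for n
    unfolding \<psi>_def \<Gamma>_def by measurable
  have \<psi>_smooth: "smooth (\<psi> n)" for n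
  proof -
    have eq: "\<psi> n = (\<lambda>x. integral (cbox a b) (\<lambda>y. \<phi> y * ((1/e n)^DIM('a) * gauss ((1/e n) *\<^sub>R (x - y)))))"
      unfolding \<psi>_def by (intro ext gauss_mollification_eq \<phi>c supp e)
    show ?thesis
      unfolding eq by (rule smooth_cbox_convolution[OF smooth_gauss_scaled \<phi>c])
  qed
  have \<psi>_grad: "GDERIV (\<psi> n) x :> \<Gamma> n x" for n x
    using \<psi>_smooth[of n] unfolding \<psi>_def \<Gamma>_def
    by (intro gauss_mollification_gradient[OF _ grad B(2) B'(2)]) auto
  have \<psi>_bound: "\<bar>\<psi> n x\<bar> \<le> B" for n x
  proof -
    have "norm (\<psi> n x) \<le> (\<integral>z. norm (\<phi> (x - e n *\<^sub>R z)) \<partial>gauss_measure)"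
      unfolding \<psi>_def by (rule integral_norm_bound)
    also have "\<dots> \<le> (\<integral>z. B \<partial>(gauss_measure :: 'a measure))"
      using B by (intro integral_mono g.integrable_const_bound[where B=B]) auto
    finally show ?thesis by (simp add: g.prob_space)
  qed
  have \<Gamma>_bound: "norm (\<Gamma> n x) \<le> B'" for n x
  proof -
    have "norm (\<Gamma> n x) \<le> (\<integral>z. norm (G (x - e n *\<^sub>R z)) \<partial>gauss_measure)"
      unfolding \<Gamma>_def by (rule integral_norm_bound)
    also have "\<dots> \<le> (\<integral>z. B' \<partial>(gauss_measure :: 'a measure))"
      using B' by (intro integral_mono g.integrable_const_bound[where B=B']) auto
    finally show ?thesis by (simp add: g.prob_space)
  qed
  have \<psi>_lim: "(\<lambda>n. \<psi> n x) \<longlonglongrightarrow> \<phi> x" for x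
  proof -
    have "(\<lambda>n. \<psi> n x) \<longlonglongrightarrow> (\<integral>z. \<phi> x \<partial>(gauss_measure :: 'a measure))"
      unfolding \<psi>_def
    proof (rule integral_dominated_convergence[where w="\<lambda>_. B"])
      show "AE z in gauss_measure. (\<lambda>n. \<phi> (x - e n *\<^sub>R z)) \<longlonglongrightarrow> \<phi> x"
        by (intro AE_I2 continuous_on_tendsto_compose[OF \<phi>c] e_lim) auto
    qed (use B in auto)
    then show ?thesis by (simp add: g.prob_space)
  qed
  have \<Gamma>_lim: "(\<lambda>n. \<Gamma> n x) \<longlonglongrightarrow> G x" for x
  proof -
    have "(\<lambda>n. \<Gamma> n x) \<longlonglongrightarrow> (\<integral>z. G x \<partial>(gauss_measure :: 'a measure))"
      unfolding \<Gamma>_def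
    proof (rule integral_dominated_convergence[where w="\<lambda>_. B'"])
      show "AE z in gauss_measure. (\<lambda>n. G (x - e n *\<^sub>R z)) \<longlonglongrightarrow> G x"
        by (intro AE_I2 continuous_on_tendsto_compose[OF cont] e_lim) auto
    qed (use B' in auto)
    then show ?thesis by (simp add: g.prob_space)
  qed
  have rhs: "(\<lambda>n. C / 2 * (\<integral>x. (norm (\<Gamma> n x))\<^sup>2 * exp (\<psi> n x) \<partial>\<mu>)) \<longlonglongrightarrow>
      C / 2 * (\<integral>x. (norm (G x))\<^sup>2 * exp (\<phi> x) \<partial>\<mu>)"
  proof (intro tendsto_mult tendsto_const integral_dominated_convergence[where w="\<lambda>_. B'\<^sup>2 * exp B"])
    show "AE x in \<mu>. norm ((norm (\<Gamma> n x))\<^sup>2 * exp (\<psi> n x)) \<le> B'\<^sup>2 * exp B" for n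
      using \<psi>_bound \<Gamma>_bound by (intro AE_I2) (auto simp: abs_mult abs_le_iff intro!: mult_mono power_mono)
    show "AE x in \<mu>. (\<lambda>n. (norm (\<Gamma> n x))\<^sup>2 * exp (\<psi> n x)) \<longlonglongrightarrow> (norm (G x))\<^sup>2 * exp (\<phi> x)"
      by (intro AE_I2 tendsto_intros \<psi>_lim \<Gamma>_lim)
  qed auto
  have lhs: "(\<lambda>n. Ent \<mu> (\<lambda>x. exp (\<psi> n x))) \<longlonglongrightarrow> Ent \<mu> (\<lambda>x. exp (\<phi> x))"
    by (rule Ent_exp_tendsto[OF prob _ _ \<psi>_bound \<psi>_lim]) auto
  show ?thesis
    by (rule LIMSEQ_le[OF lhs rhs])
      (use log_sobolev_smooth[OF prob sets lsi \<open>0 < C\<close> \<psi>_smooth \<psi>_grad \<psi>_bound \<Gamma>_bound] in auto)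
qed

text \<open>The square removes the kink of the positive part at 0; this makes the squared cutoff
  function continuously differentiable.\<close>

lemma has_real_derivative_max0_square:
  "((\<lambda>s::real. (max 0 s)\<^sup>2) has_real_derivative 2 * max 0 s) (at s)"
proof -
  consider "s < 0" | "s = 0" | "0 < s" by linarith
  then show ?thesis
  proof cases
    case 1
    have "((\<lambda>s::real. 0) has_real_derivative 0) (at s)" by simp
    then have "((\<lambda>s::real. (max 0 s)\<^sup>2) has_real_derivative 0) (at s)"
      by (rule has_field_derivative_transform_within_open[where S="{..<0}"]) (use 1 in auto)
    then show ?thesis using 1 by simp
  next
    case 3
    have "((\<lambda>s::real. s\<^sup>2) has_real_derivative 2 * s) (at s)" by (auto intro!: derivative_eq_intros)
    then have "((\<lambda>s::real. (max 0 s)\<^sup>2) has_real_derivative 2 * s) (at s)"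
      by (rule has_field_derivative_transform_within_open[where S="{0<..}"]) (use 3 in auto)
    then show ?thesis using 3 by simp
  next
    case 2
    have "((\<lambda>h::real. (max 0 h)\<^sup>2 / h) \<longlongrightarrow> 0) (at 0)"
    proof (rule Lim_null_comparison)
      show "\<forall>\<^sub>F h in at 0. norm ((max 0 h)\<^sup>2 / h) \<le> \<bar>h::real\<bar>"
        by (intro always_eventually) (auto simp: max_def power2_eq_square)
      show "((\<lambda>h::real. \<bar>h\<bar>) \<longlongrightarrow> 0) (at 0)" by (rule tendsto_rabs_zero) (rule tendsto_ident_at)
    qed
    then show ?thesis using 2 by (simp add: DERIV_def)
  qed
qed

text \<open>A cutoff reduces the claim to compact support. If the right-hand side is infinite there
  is nothing to show; otherwise \<open>\<bar>G\<bar>\<^sup>2 exp \<phi>\<close> is integrable and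
  supplies the dominating function.\<close>

lemma log_sobolev_C1:
  fixes \<mu> :: "'a::euclidean_space measure"
  assumes prob: "prob_space \<mu>" and sets [measurable_cong]: "sets \<mu> = sets borel" and lsi: "log_sobolev_const \<mu> C" and "0 < C"
    and grad: "\<And>x. GDERIV \<phi> x :> G x" and cont: "continuous_on UNIV G" and B: "\<And>x. \<bar>\<phi> x\<bar> \<le> B"
  shows "ennreal (Ent \<mu> (\<lambda>x. exp (\<phi> x))) \<le> ennreal (C / 2) * (\<integral>\<^sup>+x. ennreal ((norm (G x))\<^sup>2 * exp (\<phi> x)) \<partial>\<mu>)"
proof (cases "(\<integral>\<^sup>+x. ennreal ((norm (G x))\<^sup>2 * exp (\<phi> x)) \<partial>\<mu>) = \<infinity>")
  case True
  then show ?thesis using \<open>0 < C\<close> by (simp add: ennreal_mult_top)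
next
  case False
  interpret prob_space \<mu> by fact
  have \<phi>d: "(\<phi> has_derivative (\<lambda>h. h \<bullet> G x)) (at x)" for x
    using grad by (simp add: gderiv_def)
  have \<phi>c: "continuous_on UNIV \<phi>"
    by (rule has_derivative_continuous_on) (rule \<phi>d)
  have [measurable]: "\<phi> \<in> borel_measurable borel" "G \<in> borel_measurable borel"
    using \<phi>c cont by (auto intro: borel_measurable_continuous_onI)
  have "0 \<le> B" using B[of 0] by linarith
  have int: "integrable \<mu> (\<lambda>x. (norm (G x))\<^sup>2 * exp (\<phi> x))"
    using False by (intro integrableI_bounded) (auto simp: less_top)
  \<comment> \<open>A bump supported in the ball of radius \<open>n + 1\<close>. Multiplying by its
    square adds to the damped gradient a term of norm at most \<open>4 * B / (n + 1)\<close>, which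
    tends to 0.\<close>
  define w where "w n x = max 0 (1 - (x \<bullet> x) / (real (Suc n))\<^sup>2)" for n and x :: 'a
  define \<psi> where "\<psi> n x = (w n x)\<^sup>2 * \<phi> x" for n x
  define \<Gamma> where "\<Gamma> n x = (w n x)\<^sup>2 *\<^sub>R G x - (4 * w n x * \<phi> x / (real (Suc n))\<^sup>2) *\<^sub>R x" for n x
  have w01: "0 \<le> w n x" "w n x \<le> 1" for n x
    by (auto simp: w_def)
  have w2: "(w n x)\<^sup>2 \<le> 1" "0 \<le> (w n x)\<^sup>2" for n x
    using w01[of n x] by (auto simp: power_le_one)
  have wc: "continuous_on A (w n)" for A n
    unfolding w_def by (intro continuous_intros) auto
  have w0: "w n x = 0" if "real (Suc n) \<le> norm x" for n x
  proof -
    have "(real (Suc n))\<^sup>2 \<le> x \<bullet> x"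
      using that by (simp add: power2_norm_eq_inner[symmetric] power_mono)
    then have "1 \<le> (x \<bullet> x) / (real (Suc n))\<^sup>2" by (simp add: le_divide_eq)
    then show ?thesis by (simp add: w_def)
  qed
  have w_lim: "(\<lambda>n. w n x) \<longlonglongrightarrow> 1" for x
  proof -
    have "(\<lambda>n. max 0 (1 - (x \<bullet> x) * (inverse (real (Suc n)))\<^sup>2)) \<longlonglongrightarrow> max 0 (1 - (x \<bullet> x) * 0\<^sup>2)"
      by (intro tendsto_intros LIMSEQ_inverse_real_of_nat)
    then show ?thesis by (simp add: w_def divide_inverse power_inverse)
  qed
  have \<psi>_bound: "\<bar>\<psi> n x\<bar> \<le> B" for n x
    using mult_mono[OF w2(1) B[of x] zero_le_one abs_ge_zero] by (simp add: \<psi>_def abs_mult)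
  have \<Gamma>_diff: "norm (\<Gamma> n x - (w n x)\<^sup>2 *\<^sub>R G x) \<le> 4 * B / real (Suc n)" for n x
  proof (cases "real (Suc n) \<le> norm x")
    case False
    have "norm (\<Gamma> n x - (w n x)\<^sup>2 *\<^sub>R G x) = 4 * w n x * \<bar>\<phi> x\<bar> * norm x / (real (Suc n))\<^sup>2"
      using w01 by (simp add: \<Gamma>_def abs_mult)
    also have "\<dots> \<le> 4 * 1 * B * real (Suc n) / (real (Suc n))\<^sup>2"
      using False w01 B \<open>0 \<le> B\<close> by (intro divide_right_mono mult_mono) auto
    also have "\<dots> = 4 * B / real (Suc n)" by (simp add: power2_eq_square)
    finally show ?thesis .
  qed (use \<open>0 \<le> B\<close> in \<open>simp add: w0 \<Gamma>_def\<close>)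
  have ineq: "Ent \<mu> (\<lambda>x. exp (\<psi> n x)) \<le> C / 2 * (\<integral>x. (norm (\<Gamma> n x))\<^sup>2 * exp (\<psi> n x) \<partial>\<mu>)" for n
  proof (rule log_sobolev_C1_compact[OF prob sets lsi \<open>0 < C\<close>])
    let ?R = "(\<Sum>b\<in>Basis. real (Suc n) *\<^sub>R b) :: 'a"
    have out: "real (Suc n) \<le> norm x" if "x \<notin> cbox (- ?R) ?R" for x
    proof -
      have "\<exists>b\<in>Basis. \<not> (- real (Suc n) \<le> x \<bullet> b \<and> x \<bullet> b \<le> real (Suc n))"
        using that by (auto simp: mem_box inner_sum_left inner_Basis if_distrib sum.delta cong: if_cong)
      then obtain b where b: "b \<in> Basis" "\<not> (- real (Suc n) \<le> x \<bullet> b \<and> x \<bullet> b \<le> real (Suc n))" by blast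
      then have "real (Suc n) \<le> \<bar>x \<bullet> b\<bar>" by linarith
      also have "\<dots> \<le> norm x" using b by (simp add: Basis_le_norm)
      finally show ?thesis .
    qed
    show "\<psi> n x = 0" "\<Gamma> n x = 0" if "x \<notin> cbox (- ?R) ?R" for x
      using w0[OF out[OF that]] by (auto simp: \<psi>_def \<Gamma>_def)
    show "continuous_on UNIV (\<Gamma> n)"
      unfolding \<Gamma>_def by (intro continuous_intros wc cont \<phi>c) auto
    show "GDERIV (\<psi> n) x :> \<Gamma> n x" for x
    proof -
      let ?s = "1 - (x \<bullet> x) / (real (Suc n))\<^sup>2"
      have "((\<lambda>s. (max 0 s)\<^sup>2) has_derivative (\<lambda>h. 2 * max 0 ?s * h)) (at ?s)"
        using has_real_derivative_max0_square[of ?s] by (simp add: has_field_derivative_def)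
      moreover have "((\<lambda>x. 1 - c * (x \<bullet> x)) has_derivative (\<lambda>h. - (c * (2 * (h \<bullet> x))))) (at x)" for c
        by (auto intro!: derivative_eq_intros simp: inner_commute)
      from this[of "1 / (real (Suc n))\<^sup>2"]
      have "((\<lambda>x. 1 - (x \<bullet> x) / (real (Suc n))\<^sup>2) has_derivative (\<lambda>h. - (2 * (h \<bullet> x)) / (real (Suc n))\<^sup>2)) (at x)"
        by simp
      ultimately have "((\<lambda>x. (w n x)\<^sup>2) has_derivative (\<lambda>h. 2 * w n x * (- (2 * (h \<bullet> x)) / (real (Suc n))\<^sup>2))) (at x)"
        unfolding w_def by (rule has_derivative_compose[rotated])
      from has_derivative_mult[OF this \<phi>d]
      show ?thesis
        unfolding \<psi>_def gderiv_def \<Gamma>_def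
        by (rule has_derivative_eq_rhs) (auto simp: inner_diff_right inner_commute)
    qed
  qed
  have [measurable]: "\<psi> n \<in> borel_measurable borel" "\<Gamma> n \<in> borel_measurable borel" for n
    unfolding \<psi>_def \<Gamma>_def w_def by measurable
  have \<psi>_lim: "(\<lambda>n. \<psi> n x) \<longlonglongrightarrow> \<phi> x" for x
    using tendsto_mult[OF tendsto_power[OF w_lim[of x], of 2] tendsto_const[of "\<phi> x"]] by (simp add: \<psi>_def)
  have \<Gamma>_lim: "(\<lambda>n. \<Gamma> n x) \<longlonglongrightarrow> G x" for x
  proof -
    have "(\<lambda>n. \<Gamma> n x - (w n x)\<^sup>2 *\<^sub>R G x) \<longlonglongrightarrow> 0"
    proof (rule Lim_null_comparison)
      show "\<forall>\<^sub>F n in sequentially. norm (\<Gamma> n x - (w n x)\<^sup>2 *\<^sub>R G x) \<le> 4 * B * inverse (real (Suc n))"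
        using \<Gamma>_diff by (simp add: divide_inverse)
      show "(\<lambda>n. 4 * B * inverse (real (Suc n))) \<longlonglongrightarrow> 0"
        using tendsto_mult[OF tendsto_const LIMSEQ_inverse_real_of_nat, of "4 * B"] by simp
    qed
    from tendsto_add[OF this tendsto_scaleR[OF tendsto_power[OF w_lim[of x], of 2] tendsto_const[of "G x"]]]
    show ?thesis by simp
  qed
  have rhs: "(\<lambda>n. C / 2 * (\<integral>x. (norm (\<Gamma> n x))\<^sup>2 * exp (\<psi> n x) \<partial>\<mu>)) \<longlonglongrightarrow>
      C / 2 * (\<integral>x. (norm (G x))\<^sup>2 * exp (\<phi> x) \<partial>\<mu>)"
  proof (intro tendsto_mult tendsto_const
      integral_dominated_convergence[where w="\<lambda>x. (2 * exp (2 * B)) * ((norm (G x))\<^sup>2 * exp (\<phi> x)) + 2 * (4 * B)\<^sup>2 * exp B"])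
    show "AE x in \<mu>. (\<lambda>n. (norm (\<Gamma> n x))\<^sup>2 * exp (\<psi> n x)) \<longlonglongrightarrow> (norm (G x))\<^sup>2 * exp (\<phi> x)"
      by (intro AE_I2 tendsto_intros \<psi>_lim \<Gamma>_lim)
    show "AE x in \<mu>. norm ((norm (\<Gamma> n x))\<^sup>2 * exp (\<psi> n x))
        \<le> (2 * exp (2 * B)) * ((norm (G x))\<^sup>2 * exp (\<phi> x)) + 2 * (4 * B)\<^sup>2 * exp B" for n
    proof (rule AE_I2)
      fix x
      have "norm (\<Gamma> n x) \<le> norm ((w n x)\<^sup>2 *\<^sub>R G x) + norm (\<Gamma> n x - (w n x)\<^sup>2 *\<^sub>R G x)"
        by (metis add_diff_cancel_left' diff_add_cancel norm_triangle_ineq add.commute)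
      also have "\<dots> \<le> norm (G x) + 4 * B"
      proof (intro add_mono)
        show "norm ((w n x)\<^sup>2 *\<^sub>R G x) \<le> norm (G x)"
          using w2[of n x] by (simp add: mult_left_le_one_le)
        have "4 * B / real (Suc n) \<le> 4 * B / 1"
          using \<open>0 \<le> B\<close> by (intro divide_left_mono) auto
        then show "norm (\<Gamma> n x - (w n x)\<^sup>2 *\<^sub>R G x) \<le> 4 * B"
          using \<Gamma>_diff[of n x] by linarith
      qed
      finally have "(norm (\<Gamma> n x))\<^sup>2 \<le> (norm (G x) + 4 * B)\<^sup>2" by (intro power_mono) auto
      also have "\<dots> \<le> 2 * (norm (G x))\<^sup>2 + 2 * (4 * B)\<^sup>2"
        using sum_squares_bound[of "norm (G x)" "4 * B"] by (simp add: power2_sum)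
      finally have "(norm (\<Gamma> n x))\<^sup>2 * exp (\<psi> n x) \<le> (2 * (norm (G x))\<^sup>2 + 2 * (4 * B)\<^sup>2) * exp B"
        using \<psi>_bound[of n x] by (intro mult_mono) (auto simp: abs_le_iff)
      also have "\<dots> = 2 * (norm (G x))\<^sup>2 * exp B + 2 * (4 * B)\<^sup>2 * exp B"
        by (simp add: algebra_simps)
      \<comment> \<open>Since \<open>\<phi> x \<ge> - B\<close>, the factor \<open>exp B\<close> is
        at most \<open>exp (2 * B) * exp (\<phi> x)\<close>; this brings in the weight for which
        integrability is known.\<close>
      also have "2 * (norm (G x))\<^sup>2 * exp B \<le> 2 * (norm (G x))\<^sup>2 * (exp (2 * B) * exp (\<phi> x))"
        using B[of x] by (intro mult_left_mono) (auto simp: exp_add[symmetric] abs_le_iff)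
      finally show "norm ((norm (\<Gamma> n x))\<^sup>2 * exp (\<psi> n x))
        \<le> (2 * exp (2 * B)) * ((norm (G x))\<^sup>2 * exp (\<phi> x)) + 2 * (4 * B)\<^sup>2 * exp B"
        by (simp add: mult_ac)
    qed
  qed (use int in auto)
  have lhs: "(\<lambda>n. Ent \<mu> (\<lambda>x. exp (\<psi> n x))) \<longlonglongrightarrow> Ent \<mu> (\<lambda>x. exp (\<phi> x))"
    by (rule Ent_exp_tendsto[OF prob _ _ \<psi>_bound \<psi>_lim]) auto
  have "Ent \<mu> (\<lambda>x. exp (\<phi> x)) \<le> C / 2 * (\<integral>x. (norm (G x))\<^sup>2 * exp (\<phi> x) \<partial>\<mu>)"
    by (rule LIMSEQ_le[OF lhs rhs]) (use ineq in auto)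
  then have "ennreal (Ent \<mu> (\<lambda>x. exp (\<phi> x))) \<le> ennreal (C / 2) * ennreal (\<integral>x. (norm (G x))\<^sup>2 * exp (\<phi> x) \<partial>\<mu>)"
    using \<open>0 < C\<close> by (subst ennreal_mult[symmetric]) (auto intro!: ennreal_leI)
  also have "ennreal (\<integral>x. (norm (G x))\<^sup>2 * exp (\<phi> x) \<partial>\<mu>) = (\<integral>\<^sup>+x. ennreal ((norm (G x))\<^sup>2 * exp (\<phi> x)) \<partial>\<mu>)"
    by (rule nn_integral_eq_integral[symmetric, OF int]) auto
  finally show ?thesis .
qed

section \<open>Tensorization of entropy\<close>

text \<open>This is \<open>a ln (a / b) \<ge> a - b\<close>, the pointwise form of the nonnegativity
  of relative entropy. Nonnegativity, subadditivity and the variational inequality for entropy all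
  come from integrating it.\<close>

lemma mult_ln_le: "0 < a \<Longrightarrow> 0 < b \<Longrightarrow> a - b \<le> a * ln a - a * ln (b::real)"
  using ln_diff_le[of b a] mult_left_mono[of "ln b - ln a" "(b - a) / a" a]
  by (simp add: field_simps)

lemma (in prob_space) integrable_between:
  fixes f :: "'a \<Rightarrow> real"
  assumes "f \<in> borel_measurable M" "\<And>x. lo \<le> f x" "\<And>x. f x \<le> hi"
  shows "integrable M f"
proof (rule integrable_const_bound[where B="max \<bar>lo\<bar> \<bar>hi\<bar>"])
  show "AE x in M. norm (f x) \<le> max \<bar>lo\<bar> \<bar>hi\<bar>"
    using assms(2,3) by (intro AE_I2) (auto simp: abs_le_iff le_max_iff_disj; smt (verit))
qed (rule assms(1))

lemma (in prob_space) expectation_between: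
  fixes f :: "'a \<Rightarrow> real"
  assumes "f \<in> borel_measurable M" "\<And>x. lo \<le> f x" "\<And>x. f x \<le> hi"
  shows "lo \<le> expectation f" "expectation f \<le> hi"
  using integrable_between[OF assms] assms(2,3)
  by (auto intro!: integral_ge_const integral_le_const)

lemma mult_ln_bounds:
  assumes "0 < lo" "lo \<le> x" "x \<le> (hi::real)"
  shows "- (hi * max \<bar>ln lo\<bar> \<bar>ln hi\<bar>) \<le> x * ln x" "x * ln x \<le> hi * max \<bar>ln lo\<bar> \<bar>ln hi\<bar>"
proof -
  have "ln lo \<le> ln x" "ln x \<le> ln hi"
    using assms by (subst ln_le_cancel_iff; linarith)+
  then have "\<bar>ln x\<bar> \<le> max \<bar>ln lo\<bar> \<bar>ln hi\<bar>" by linarith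
  then have "\<bar>x * ln x\<bar> \<le> hi * max \<bar>ln lo\<bar> \<bar>ln hi\<bar>"
    using assms by (auto simp: abs_mult intro!: mult_mono)
  then show "- (hi * max \<bar>ln lo\<bar> \<bar>ln hi\<bar>) \<le> x * ln x" "x * ln x \<le> hi * max \<bar>ln lo\<bar> \<bar>ln hi\<bar>"
    by linarith+
qed

lemma (in prob_space) Ent_nonneg:
  assumes [measurable]: "f \<in> borel_measurable M" and f: "0 < lo" "\<And>x. lo \<le> f x" "\<And>x. f x \<le> hi"
  shows "0 \<le> Ent M f"
proof -
  let ?m = "expectation f"
  have m: "0 < ?m" using expectation_between(1)[of f lo hi] f by auto
  have i1: "integrable M f" by (rule integrable_between[OF _ f(2,3)]) simp
  have i2: "integrable M (\<lambda>x. f x * ln (f x))"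
    by (rule integrable_between[OF _ mult_ln_bounds[OF f]]) simp
  have "0 = (\<integral>x. f x - ?m \<partial>M)" using i1 by (simp add: prob_space)
  also have "\<dots> \<le> (\<integral>x. f x * ln (f x) - f x * ln ?m \<partial>M)"
  proof (rule integral_mono)
    show "f x - ?m \<le> f x * ln (f x) - f x * ln ?m" for x
      using f(1) f(2)[of x] m by (intro mult_ln_le) auto
  qed (use i1 i2 in auto)
  also have "\<dots> = Ent M f" using i1 i2 by (simp add: Ent_def)
  finally show ?thesis .
qed

text \<open>Subadditivity of entropy: \<open>f\<close> is compared with \<open>F m / t\<close>,
  built from its two marginals \<open>F\<close> and \<open>m\<close> and its total mass
  \<open>t\<close>. Both have the same mass, so integrating the pointwise inequality shows that the
  difference of the two sides is nonnegative.\<close>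

lemma Ent_pair_measure_le:
  assumes M1: "prob_space M1" and M2: "prob_space M2"
    and meas [measurable]: "f \<in> borel_measurable (M1 \<Otimes>\<^sub>M M2)"
    and f: "0 < lo" "\<And>p. lo \<le> f p" "\<And>p. f p \<le> hi"
  shows "ennreal (Ent (M1 \<Otimes>\<^sub>M M2) f) \<le>
    (\<integral>\<^sup>+y. ennreal (Ent M1 (\<lambda>x. f (x, y))) \<partial>M2) + (\<integral>\<^sup>+x. ennreal (Ent M2 (\<lambda>y. f (x, y))) \<partial>M1)"
proof -
  interpret M1: prob_space M1 by fact
  interpret M2: prob_space M2 by fact
  interpret P: pair_prob_space M1 M2 ..
  let ?P = "M1 \<Otimes>\<^sub>M M2"
  let ?c = "hi * max \<bar>ln lo\<bar> \<bar>ln hi\<bar>"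
  define F where "F y = (\<integral>x. f (x, y) \<partial>M1)" for y
  define m where "m x = (\<integral>y. f (x, y) \<partial>M2)" for x
  define t where "t = (\<integral>p. f p \<partial>?P)"
  have [measurable]: "(\<lambda>y. \<integral>x. f (x, y) \<partial>M1) \<in> borel_measurable M2"
    "(\<lambda>x. \<integral>y. f (x, y) \<partial>M2) \<in> borel_measurable M1"
    by measurable
  have [measurable]: "F \<in> borel_measurable M2" "m \<in> borel_measurable M1"
    unfolding F_def m_def by measurable
  have fx: "(\<lambda>x. f (x, y)) \<in> borel_measurable M1" if "y \<in> space M2" for y
    using that by measurable
  have fy: "(\<lambda>y. f (x, y)) \<in> borel_measurable M2" if "x \<in> space M1" for x
    using that by measurable
  \<comment> \<open>Outside the space of the measure the partial integrals are uncontrolled; the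
    default value \<open>lo\<close> makes the bounds hold everywhere.\<close>
  define F' where "F' y = (if y \<in> space M2 then F y else lo)" for y
  define m' where "m' x = (if x \<in> space M1 then m x else lo)" for x
  have lohi: "lo \<le> hi" using f(2,3) order_trans by blast
  have F': "lo \<le> F' y" "F' y \<le> hi" for y
    using M1.expectation_between[OF fx f(2,3)] lohi by (auto simp: F'_def F_def)
  have m': "lo \<le> m' x" "m' x \<le> hi" for x
    using M2.expectation_between[OF fy f(2,3)] lohi by (auto simp: m'_def m_def)
  have [measurable]: "F' \<in> borel_measurable M2" "m' \<in> borel_measurable M1"
    unfolding F'_def m'_def by measurable
  have t: "lo \<le> t" unfolding t_def by (rule P.expectation_between[OF meas f(2,3)])
  have fl: "integrable ?P (\<lambda>p. f p * ln (f p))"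
    by (rule P.integrable_between[OF _ mult_ln_bounds[OF f]]) simp
  have ff: "integrable ?P f"
    by (rule P.integrable_between[OF meas f(2,3)])
  have lnb: "\<bar>ln x\<bar> \<le> max \<bar>ln lo\<bar> \<bar>ln hi\<bar>" if "lo \<le> x" "x \<le> hi" for x
  proof -
    have "ln lo \<le> ln x" "ln x \<le> ln hi"
      using that f(1) by (subst ln_le_cancel_iff; linarith)+
    then show ?thesis by linarith
  qed
  have bnd: "\<bar>f p * l\<bar> \<le> ?c" if "\<bar>l\<bar> \<le> max \<bar>ln lo\<bar> \<bar>ln hi\<bar>" for p l
    using that f(1) f(2)[of p] f(3)[of p] by (auto simp: abs_mult intro!: mult_mono)
  have fF: "integrable ?P (\<lambda>p. f p * ln (F' (snd p)))"
    by (rule P.integrable_const_bound[where B="?c"]) (auto intro!: AE_I2 bnd lnb F')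
  have fm: "integrable ?P (\<lambda>p. f p * ln (m' (fst p)))"
    by (rule P.integrable_const_bound[where B="?c"]) (auto intro!: AE_I2 bnd lnb m')
  have Fm: "integrable ?P (\<lambda>p. F' (snd p) * m' (fst p))"
  proof (rule P.integrable_between[where lo="lo * lo" and hi="hi * hi"])
    show "(\<lambda>p. F' (snd p) * m' (fst p)) \<in> borel_measurable ?P" by measurable
    show "lo * lo \<le> F' (snd p) * m' (fst p)" "F' (snd p) * m' (fst p) \<le> hi * hi" for p
      using F'[of "snd p"] m'[of "fst p"] f(1) by (intro mult_mono; linarith)+
  qed
  have e1: "(\<integral>y. (\<integral>x. f (x, y) * ln (f (x, y)) \<partial>M1) \<partial>M2) = (\<integral>p. f p * ln (f p) \<partial>?P)"
    using P.integral_snd[of "\<lambda>x y. f (x, y) * ln (f (x, y))"] fl by (simp add: case_prod_beta')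
  have e2: "(\<integral>x. (\<integral>y. f (x, y) * ln (f (x, y)) \<partial>M2) \<partial>M1) = (\<integral>p. f p * ln (f p) \<partial>?P)"
    using P.integral_fst'[of "\<lambda>p. f p * ln (f p)"] fl by simp
  have e3: "(\<integral>y. F y * ln (F y) \<partial>M2) = (\<integral>p. f p * ln (F' (snd p)) \<partial>?P)"
  proof -
    have "(\<integral>p. f p * ln (F' (snd p)) \<partial>?P) = (\<integral>y. (\<integral>x. f (x, y) * ln (F' y) \<partial>M1) \<partial>M2)"
      using P.integral_snd[of "\<lambda>x y. f (x, y) * ln (F' y)"] fF by (simp add: case_prod_beta')
    also have "\<dots> = (\<integral>y. F y * ln (F y) \<partial>M2)"
      by (intro Bochner_Integration.integral_cong) (auto simp: F_def F'_def)
    finally show ?thesis by simp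
  qed
  have e4: "(\<integral>x. m x * ln (m x) \<partial>M1) = (\<integral>p. f p * ln (m' (fst p)) \<partial>?P)"
  proof -
    have "(\<integral>p. f p * ln (m' (fst p)) \<partial>?P) = (\<integral>x. (\<integral>y. f (x, y) * ln (m' x) \<partial>M2) \<partial>M1)"
      using P.integral_fst'[of "\<lambda>p. f p * ln (m' (fst p))"] fm by simp
    also have "\<dots> = (\<integral>x. m x * ln (m x) \<partial>M1)"
      by (intro Bochner_Integration.integral_cong) (auto simp: m_def m'_def)
    finally show ?thesis by simp
  qed
  have e5: "(\<integral>p. F' (snd p) * m' (fst p) \<partial>?P) = t * t"
  proof -
    have "(\<integral>p. F' (snd p) * m' (fst p) \<partial>?P) = (\<integral>x. (\<integral>y. F' y * m' x \<partial>M2) \<partial>M1)"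
      using P.integral_fst'[of "\<lambda>p. F' (snd p) * m' (fst p)"] Fm by simp
    also have "\<dots> = (\<integral>y. F' y \<partial>M2) * (\<integral>x. m' x \<partial>M1)" by simp
    also have "(\<integral>y. F' y \<partial>M2) = (\<integral>y. F y \<partial>M2)"
      by (intro Bochner_Integration.integral_cong) (auto simp: F'_def)
    also have "\<dots> = t"
      using P.integral_snd[of "\<lambda>x y. f (x, y)"] ff by (simp add: F_def t_def case_prod_beta')
    also have "(\<integral>x. m' x \<partial>M1) = (\<integral>x. m x \<partial>M1)"
      by (intro Bochner_Integration.integral_cong) (auto simp: m'_def)
    also have "\<dots> = t"
      using P.integral_fst'[of f] ff by (simp add: m_def t_def)
    finally show ?thesis .
  qed
  have "0 = (\<integral>p. f p - F' (snd p) * m' (fst p) / t \<partial>?P)"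
    using ff Fm e5 t f(1) by (simp add: t_def[symmetric])
  also have "\<dots> \<le> (\<integral>p. f p * ln (f p) - f p * ln (F' (snd p)) - f p * ln (m' (fst p)) + f p * ln t \<partial>?P)"
  proof (rule integral_mono)
    fix p
    have pos: "0 < f p" "0 < F' (snd p)" "0 < m' (fst p)" "0 < t"
      using f(1) f(2)[of p] F'(1)[of "snd p"] m'(1)[of "fst p"] t by linarith+
    then have ln: "ln (F' (snd p) * m' (fst p) / t) = ln (F' (snd p)) + ln (m' (fst p)) - ln t"
      by (simp add: ln_div ln_mult)
    have "f p - F' (snd p) * m' (fst p) / t \<le> f p * ln (f p) - f p * ln (F' (snd p) * m' (fst p) / t)"
      using pos by (intro mult_ln_le) auto
    then show "f p - F' (snd p) * m' (fst p) / t \<le>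
        f p * ln (f p) - f p * ln (F' (snd p)) - f p * ln (m' (fst p)) + f p * ln t"
      unfolding ln by (simp only: right_diff_distrib distrib_left)
  qed (use fl fF fm ff Fm in auto)
  also have "\<dots> = (\<integral>p. f p * ln (f p) \<partial>?P) - (\<integral>y. F y * ln (F y) \<partial>M2) - (\<integral>x. m x * ln (m x) \<partial>M1) + t * ln t"
    using fl fF fm ff by (simp add: e3 e4 t_def)
  finally have key: "0 \<le> (\<integral>p. f p * ln (f p) \<partial>?P) - (\<integral>y. F y * ln (F y) \<partial>M2) - (\<integral>x. m x * ln (m x) \<partial>M1) + t * ln t" .
  have i1: "integrable M2 (\<lambda>y. \<integral>x. f (x, y) * ln (f (x, y)) \<partial>M1)"
    using P.integrable_snd[of "\<lambda>x y. f (x, y) * ln (f (x, y))"] fl by (simp add: case_prod_beta')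
  have i2: "integrable M1 (\<lambda>x. \<integral>y. f (x, y) * ln (f (x, y)) \<partial>M2)"
    using P.integrable_fst'[of "\<lambda>p. f p * ln (f p)"] fl by simp
  have i3: "integrable M2 (\<lambda>y. F y * ln (F y))"
  proof -
    have "integrable M2 (\<lambda>y. F' y * ln (F' y))"
      by (rule M2.integrable_between[OF _ mult_ln_bounds[OF f(1) F']]) simp
    then show ?thesis
      by (rule Bochner_Integration.integrable_cong[THEN iffD1, rotated -1]) (auto simp: F'_def)
  qed
  have i4: "integrable M1 (\<lambda>x. m x * ln (m x))"
  proof -
    have "integrable M1 (\<lambda>x. m' x * ln (m' x))"
      by (rule M1.integrable_between[OF _ mult_ln_bounds[OF f(1) m']]) simp
    then show ?thesis
      by (rule Bochner_Integration.integrable_cong[THEN iffD1, rotated -1]) (auto simp: m'_def)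
  qed
  have E1: "integrable M2 (\<lambda>y. Ent M1 (\<lambda>x. f (x, y)))"
    unfolding Ent_def using i1 i3 by (auto simp: F_def[symmetric])
  have E2: "integrable M1 (\<lambda>x. Ent M2 (\<lambda>y. f (x, y)))"
    unfolding Ent_def using i2 i4 by (auto simp: m_def[symmetric])
  have n1: "AE y in M2. 0 \<le> Ent M1 (\<lambda>x. f (x, y))"
    by (intro AE_I2 M1.Ent_nonneg[OF fx f(1-3)])
  have n2: "AE x in M1. 0 \<le> Ent M2 (\<lambda>y. f (x, y))"
    by (intro AE_I2 M2.Ent_nonneg[OF fy f(1-3)])
  have "Ent ?P f \<le> (\<integral>y. Ent M1 (\<lambda>x. f (x, y)) \<partial>M2) + (\<integral>x. Ent M2 (\<lambda>y. f (x, y)) \<partial>M1)"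
    unfolding Ent_def using key i1 i2 i3 i4
    by (simp add: F_def[symmetric] m_def[symmetric] t_def[symmetric] e1 e2)
  also have "ennreal \<dots> = ennreal (\<integral>y. Ent M1 (\<lambda>x. f (x, y)) \<partial>M2) + ennreal (\<integral>x. Ent M2 (\<lambda>y. f (x, y)) \<partial>M1)"
    by (intro ennreal_plus integral_nonneg_AE n1 n2)
  also have "\<dots> = (\<integral>\<^sup>+y. ennreal (Ent M1 (\<lambda>x. f (x, y))) \<partial>M2) + (\<integral>\<^sup>+x. ennreal (Ent M2 (\<lambda>y. f (x, y))) \<partial>M1)"
    by (simp only: nn_integral_eq_integral[OF E1 n1] nn_integral_eq_integral[OF E2 n2])
  finally show ?thesis by (simp add: ennreal_leI)
qed

text \<open>Induction over the coordinates. The hypotheses concern updates \<open>w(j := x)\<close>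
  of arbitrary functions \<open>w\<close>, not only of elements of the product space, so freezing
  the coordinate \<open>i\<close> yields a function to which the induction hypothesis
  applies.\<close>

lemma log_sobolev_PiM:
  fixes \<mu> :: "'a::euclidean_space measure" and \<Phi> :: "('i \<Rightarrow> 'a) \<Rightarrow> real"
  assumes prob: "prob_space \<mu>" and sets: "sets \<mu> = sets borel" and lsi: "log_sobolev_const \<mu> C" and "0 < C"
    and "finite J" and "\<Phi> \<in> borel_measurable (Pi\<^sub>M J (\<lambda>_. borel))"
    and "\<And>j. j \<in> J \<Longrightarrow> G j \<in> borel_measurable (Pi\<^sub>M J (\<lambda>_. borel))"
    and "\<And>w j. j \<in> J \<Longrightarrow> gderiv (\<lambda>x. \<Phi> (w(j := x))) (w j) (G j w)"
    and "\<And>w j. j \<in> J \<Longrightarrow> continuous_on UNIV (\<lambda>x. G j (w(j := x)))"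
    and "\<And>w. \<bar>\<Phi> w\<bar> \<le> B"
  shows "ennreal (Ent (Pi\<^sub>M J (\<lambda>_. \<mu>)) (\<lambda>w. exp (\<Phi> w))) \<le>
    ennreal (C / 2) * (\<integral>\<^sup>+w. ennreal ((\<Sum>j\<in>J. (norm (G j w))\<^sup>2) * exp (\<Phi> w)) \<partial>Pi\<^sub>M J (\<lambda>_. \<mu>))"
  using assms(5-)
proof (induction J arbitrary: \<Phi> G rule: finite_induct)
  case empty
  have "Ent (count_space {f}) (\<lambda>w. exp (\<Phi> w)) = 0" for f :: "'i \<Rightarrow> 'a"
    by (simp add: Ent_def lebesgue_integral_count_space_finite)
  then show ?case by (simp add: PiM_empty)
next
  case (insert i J)
  interpret \<mu>: prob_space \<mu> by fact
  interpret product_sigma_finite "\<lambda>_. \<mu>" ..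
  define P where "P = Pi\<^sub>M J (\<lambda>_. \<mu>)"
  interpret P: prob_space P unfolding P_def by (rule prob_space_PiM) (rule prob)
  let ?Q = "Pi\<^sub>M (insert i J) (\<lambda>_. \<mu>)"
  have sP: "sets (Pi\<^sub>M I (\<lambda>_. \<mu>)) = sets (Pi\<^sub>M I (\<lambda>_. borel))" for I :: "'i set"
    by (intro sets_PiM_cong) (auto simp: sets)
  note [measurable_cong] = sets
  have mQ: "f \<in> borel_measurable ?Q" if "f \<in> borel_measurable (Pi\<^sub>M (insert i J) (\<lambda>_. borel))"
    for f :: "('i \<Rightarrow> 'a) \<Rightarrow> 'c::topological_space"
    using that by (simp add: measurable_cong_sets[OF sP refl])
  note \<Phi>m [measurable] = mQ[OF insert.prems(1)]
  have Gm [measurable]: "G j \<in> borel_measurable ?Q" if "j \<in> insert i J" for j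
    using mQ[OF insert.prems(2)[OF that]] .
  have T [measurable]: "(\<lambda>(x, w). w(i := x)) \<in> \<mu> \<Otimes>\<^sub>M P \<rightarrow>\<^sub>M ?Q"
    unfolding P_def by (auto simp: split_beta' intro!: measurable_fun_upd[where J=J])
  have Q_distr: "?Q = distr (\<mu> \<Otimes>\<^sub>M P) ?Q (\<lambda>(x, w). w(i := x))"
    unfolding P_def using distr_pair_PiM_eq_PiM[of J "\<lambda>_. \<mu>" i] prob by simp
  define f where "f p = exp (\<Phi> ((snd p)(i := fst p)))" for p
  have fm [measurable]: "f \<in> borel_measurable (\<mu> \<Otimes>\<^sub>M P)"
    using measurable_compose[OF T \<Phi>m] unfolding f_def by (auto simp: split_beta')
  have int_Q: "(\<integral>w. h w \<partial>?Q) = (\<integral>p. h ((snd p)(i := fst p)) \<partial>(\<mu> \<Otimes>\<^sub>M P))" if "h \<in> borel_measurable ?Q" for h :: "_ \<Rightarrow> real"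
    using integral_distr[OF T that] Q_distr by (simp add: split_beta')
  have "Ent ?Q (\<lambda>w. exp (\<Phi> w)) = Ent (\<mu> \<Otimes>\<^sub>M P) f"
    unfolding Ent_def by (simp add: int_Q f_def[abs_def])
  also have "ennreal \<dots> \<le>
      (\<integral>\<^sup>+w. ennreal (Ent \<mu> (\<lambda>x. f (x, w))) \<partial>P) + (\<integral>\<^sup>+x. ennreal (Ent P (\<lambda>w. f (x, w))) \<partial>\<mu>)"
  proof (rule Ent_pair_measure_le[OF prob P.prob_space_axioms fm])
    show "0 < exp (- B)" by simp
    show "exp (- B) \<le> f p" "f p \<le> exp B" for p
      unfolding f_def exp_le_cancel_iff using insert.prems(5)[of "(snd p)(i := fst p)"] by linarith+
  qed
  \<comment> \<open>The entropy in coordinate \<open>i\<close> falls under the inequality on one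
    factor, the entropy in the other coordinates under the induction hypothesis with coordinate
    \<open>i\<close> frozen at \<open>x\<close>.\<close>
  also have "\<dots> \<le> (\<integral>\<^sup>+w. ennreal (C / 2) * (\<integral>\<^sup>+x. ennreal ((norm (G i (w(i := x))))\<^sup>2 * exp (\<Phi> (w(i := x)))) \<partial>\<mu>) \<partial>P) +
      (\<integral>\<^sup>+x. ennreal (C / 2) * (\<integral>\<^sup>+w. ennreal ((\<Sum>j\<in>J. (norm (G j (w(i := x))))\<^sup>2) * exp (\<Phi> (w(i := x)))) \<partial>P) \<partial>\<mu>)"
  proof (intro add_mono nn_integral_mono)
    fix w :: "'i \<Rightarrow> 'a"
    show "ennreal (Ent \<mu> (\<lambda>x. f (x, w))) \<le>
        ennreal (C / 2) * (\<integral>\<^sup>+x. ennreal ((norm (G i (w(i := x))))\<^sup>2 * exp (\<Phi> (w(i := x)))) \<partial>\<mu>)"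
      unfolding f_def fst_conv snd_conv
    proof (rule log_sobolev_C1[OF prob sets lsi \<open>0 < C\<close>])
      show "gderiv (\<lambda>x. \<Phi> (w(i := x))) x (G i (w(i := x)))" for x
        using insert.prems(3)[of i "w(i := x)"] by (simp only: fun_upd_same fun_upd_upd insertI1 simp_thms)
      show "continuous_on UNIV (\<lambda>x. G i (w(i := x)))"
        by (rule insert.prems(4)) (rule insertI1)
      show "\<bar>\<Phi> (w(i := x))\<bar> \<le> B" for x
        by (rule insert.prems(5))
    qed
  next
    fix x :: 'a
    have upd: "(\<lambda>w. w(i := x)) \<in> Pi\<^sub>M J (\<lambda>_. borel) \<rightarrow>\<^sub>M Pi\<^sub>M (insert i J) (\<lambda>_. borel)"
      by (intro measurable_fun_upd[where J=J]) auto
    show "ennreal (Ent P (\<lambda>w. f (x, w))) \<le>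
        ennreal (C / 2) * (\<integral>\<^sup>+w. ennreal ((\<Sum>j\<in>J. (norm (G j (w(i := x))))\<^sup>2) * exp (\<Phi> (w(i := x)))) \<partial>P)"
      unfolding f_def fst_conv snd_conv P_def
    proof (rule insert.IH)
      show "(\<lambda>w. \<Phi> (w(i := x))) \<in> borel_measurable (Pi\<^sub>M J (\<lambda>_. borel))"
        by (rule measurable_compose[OF upd insert.prems(1)])
      show "(\<lambda>w. G j (w(i := x))) \<in> borel_measurable (Pi\<^sub>M J (\<lambda>_. borel))" if "j \<in> J" for j
        by (rule measurable_compose[OF upd insert.prems(2)]) (use that in simp)
      fix w j assume j: "j \<in> J"
      then have "i \<noteq> j" using insert.hyps by auto
      then show "gderiv (\<lambda>y. \<Phi> (w(j := y, i := x))) (w j) (G j (w(i := x)))"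
        using insert.prems(3)[of j "w(i := x)"] j by (simp only: fun_upd_twist[of i j] fun_upd_other insertI2 simp_thms not_sym)
      have twist: "w(j := y, i := x) = w(i := x, j := y)" for y
        using \<open>i \<noteq> j\<close> by (intro fun_upd_twist) simp
      show "continuous_on UNIV (\<lambda>y. G j (w(j := y, i := x)))"
        unfolding twist by (rule insert.prems(4)) (rule insertI2[OF j])
    next
      show "\<bar>\<Phi> (w(i := x))\<bar> \<le> B" for w
        by (rule insert.prems(5))
    qed
  qed
  also have "\<dots> = ennreal (C / 2) * ((\<integral>\<^sup>+w. ennreal ((norm (G i w))\<^sup>2 * exp (\<Phi> w)) \<partial>?Q) +
      (\<integral>\<^sup>+w. ennreal ((\<Sum>j\<in>J. (norm (G j w))\<^sup>2) * exp (\<Phi> w)) \<partial>?Q))"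
  proof -
    have m1: "(\<lambda>w. ennreal ((norm (G i w))\<^sup>2 * exp (\<Phi> w))) \<in> borel_measurable ?Q" by measurable
    have m2: "(\<lambda>w. ennreal ((\<Sum>j\<in>J. (norm (G j w))\<^sup>2) * exp (\<Phi> w))) \<in> borel_measurable ?Q" by measurable
    have "(\<lambda>(w, x). w(i := x)) \<in> P \<Otimes>\<^sub>M \<mu> \<rightarrow>\<^sub>M ?Q"
      unfolding P_def by (auto simp: split_beta' intro!: measurable_fun_upd[where J=J])
    note T' = this
    have a1: "(\<lambda>w. \<integral>\<^sup>+x. ennreal ((norm (G i (w(i := x))))\<^sup>2 * exp (\<Phi> (w(i := x)))) \<partial>\<mu>) \<in> borel_measurable P"
      by (rule \<mu>.borel_measurable_nn_integral) (use measurable_compose[OF T' m1] in \<open>simp add: split_beta'\<close>)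
    have a2: "(\<lambda>x. \<integral>\<^sup>+w. ennreal ((\<Sum>j\<in>J. (norm (G j (w(i := x))))\<^sup>2) * exp (\<Phi> (w(i := x)))) \<partial>P) \<in> borel_measurable \<mu>"
      by (rule P.borel_measurable_nn_integral) (use measurable_compose[OF T m2] in \<open>simp add: split_beta'\<close>)
    show ?thesis
      by (simp add: nn_integral_cmult[OF a1] nn_integral_cmult[OF a2] distrib_left
          product_nn_integral_insert[OF insert.hyps m1] product_nn_integral_insert_rev[OF insert.hyps m2] P_def[symmetric])
  qed
  also have "(\<integral>\<^sup>+w. ennreal ((norm (G i w))\<^sup>2 * exp (\<Phi> w)) \<partial>?Q) + (\<integral>\<^sup>+w. ennreal ((\<Sum>j\<in>J. (norm (G j w))\<^sup>2) * exp (\<Phi> w)) \<partial>?Q)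
      = (\<integral>\<^sup>+w. ennreal ((\<Sum>j\<in>insert i J. (norm (G j w))\<^sup>2) * exp (\<Phi> w)) \<partial>?Q)"
    using insert.hyps by (subst nn_integral_add[symmetric]) (auto simp: distrib_right sum_nonneg ennreal_plus[symmetric] simp del: ennreal_plus)
  finally show ?case .
qed

section \<open>Concentration on product spaces\<close>

lemma abs_exp_minus_one_le: "\<bar>exp y - 1\<bar> \<le> \<bar>y\<bar> * exp \<bar>y::real\<bar>"
proof (cases "0 \<le> y")
  case True
  have "1 - y \<le> exp (- y)" using exp_ge_add_one_self[of "-y"] by simp
  then have "(1 - y) * exp y \<le> exp (- y) * exp y" by (intro mult_right_mono) auto
  also have "\<dots> = 1" by (simp add: exp_add[symmetric])
  finally show ?thesis using True by (simp add: algebra_simps)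
next
  case False
  have "1 - exp y \<le> - y * 1" using exp_ge_add_one_self[of y] by linarith
  also have "\<dots> \<le> - y * exp \<bar>y\<bar>" using False by (intro mult_left_mono) auto
  finally show ?thesis using False by simp
qed

text \<open>Differentiation under the integral sign; boundedness of \<open>\<Phi>\<close> supplies a
  constant dominating function along every bounded sequence of steps.\<close>

lemma (in prob_space) mgf_has_derivative:
  fixes \<Phi> :: "'a \<Rightarrow> real"
  assumes [measurable]: "\<Phi> \<in> borel_measurable M" and B: "\<And>x. \<bar>\<Phi> x\<bar> \<le> B"
  shows "((\<lambda>t. \<integral>x. exp (t * \<Phi> x) \<partial>M) has_real_derivative (\<integral>x. \<Phi> x * exp (t * \<Phi> x) \<partial>M)) (at t)"
  unfolding DERIV_def tendsto_at_iff_sequentially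
proof (intro allI impI)
  fix X :: "nat \<Rightarrow> real" assume X: "\<forall>i. X i \<in> UNIV - {0}" "X \<longlonglongrightarrow> 0"
  have "0 \<le> B" using B[of undefined] by linarith
  obtain K where K: "0 < K" "\<And>i. \<bar>X i\<bar> \<le> K"
    using X(2)[THEN convergentI, THEN convergent_imp_Bseq] by (auto simp: Bseq_def)
  have int: "integrable M (\<lambda>x. exp (s * \<Phi> x))" for s
  proof (rule integrable_const_bound[where B="exp (\<bar>s\<bar> * B)"])
    show "AE x in M. norm (exp (s * \<Phi> x)) \<le> exp (\<bar>s\<bar> * B)"
    proof (rule AE_I2)
      fix x
      have "s * \<Phi> x \<le> \<bar>s\<bar> * \<bar>\<Phi> x\<bar>" by (metis abs_ge_self abs_mult)
      also have "\<dots> \<le> \<bar>s\<bar> * B" using B by (intro mult_left_mono) auto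
      finally show "norm (exp (s * \<Phi> x)) \<le> exp (\<bar>s\<bar> * B)" by simp
    qed
  qed simp
  have "(\<lambda>i. \<integral>x. (exp ((t + X i) * \<Phi> x) - exp (t * \<Phi> x)) / X i \<partial>M) \<longlonglongrightarrow> (\<integral>x. \<Phi> x * exp (t * \<Phi> x) \<partial>M)"
  proof (rule integral_dominated_convergence[where w="\<lambda>_. exp (\<bar>t\<bar> * B) * (B * exp (K * B))"])
    show "AE x in M. (\<lambda>i. (exp ((t + X i) * \<Phi> x) - exp (t * \<Phi> x)) / X i) \<longlonglongrightarrow> \<Phi> x * exp (t * \<Phi> x)"
    proof (rule AE_I2)
      fix x
      have "((\<lambda>s. exp (s * \<Phi> x)) has_real_derivative \<Phi> x * exp (t * \<Phi> x)) (at t)"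
        by (auto intro!: derivative_eq_intros)
      then show "(\<lambda>i. (exp ((t + X i) * \<Phi> x) - exp (t * \<Phi> x)) / X i) \<longlonglongrightarrow> \<Phi> x * exp (t * \<Phi> x)"
        using X unfolding DERIV_def tendsto_at_iff_sequentially by (auto simp: o_def)
    qed
    show "AE x in M. norm ((exp ((t + X i) * \<Phi> x) - exp (t * \<Phi> x)) / X i) \<le> exp (\<bar>t\<bar> * B) * (B * exp (K * B))" for i
    proof (rule AE_I2)
      fix x
      have "X i \<noteq> 0" using X(1) by simp
      have "\<bar>exp (X i * \<Phi> x) - 1\<bar> \<le> \<bar>X i\<bar> * \<bar>\<Phi> x\<bar> * exp (\<bar>X i\<bar> * \<bar>\<Phi> x\<bar>)"
        using abs_exp_minus_one_le[of "X i * \<Phi> x"] by (simp add: abs_mult)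
      also have "\<dots> \<le> \<bar>X i\<bar> * B * exp (K * B)"
        using K B \<open>0 \<le> B\<close> by (intro mult_mono) (auto intro!: mult_mono)
      finally have 1: "\<bar>exp (X i * \<Phi> x) - 1\<bar> / \<bar>X i\<bar> \<le> B * exp (K * B)"
        using \<open>X i \<noteq> 0\<close> by (simp add: field_simps)
      have "t * \<Phi> x \<le> \<bar>t\<bar> * \<bar>\<Phi> x\<bar>" by (metis abs_ge_self abs_mult)
      also have "\<dots> \<le> \<bar>t\<bar> * B" using B by (intro mult_left_mono) auto
      finally have 2: "exp (t * \<Phi> x) \<le> exp (\<bar>t\<bar> * B)" by simp
      have "(exp ((t + X i) * \<Phi> x) - exp (t * \<Phi> x)) / X i = exp (t * \<Phi> x) * ((exp (X i * \<Phi> x) - 1) / X i)"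
        by (simp add: distrib_right exp_add right_diff_distrib)
      then have "norm ((exp ((t + X i) * \<Phi> x) - exp (t * \<Phi> x)) / X i)
          = exp (t * \<Phi> x) * (\<bar>exp (X i * \<Phi> x) - 1\<bar> / \<bar>X i\<bar>)"
        by (simp only: abs_mult abs_divide real_norm_def abs_exp_cancel)
      also have "\<dots> \<le> exp (\<bar>t\<bar> * B) * (B * exp (K * B))"
        using 1 2 by (intro mult_mono) auto
      finally show "norm ((exp ((t + X i) * \<Phi> x) - exp (t * \<Phi> x)) / X i) \<le> exp (\<bar>t\<bar> * B) * (B * exp (K * B))" .
    qed
  qed auto
  then show "((\<lambda>h. ((\<integral>x. exp ((t + h) * \<Phi> x) \<partial>M) - (\<integral>x. exp (t * \<Phi> x) \<partial>M)) / h) \<circ> X) \<longlonglongrightarrow> (\<integral>x. \<Phi> x * exp (t * \<Phi> x) \<partial>M)"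
    using int by (simp add: o_def)
qed

text \<open>Herbst's argument: \<open>u(s) = s\<^sup>-\<^sup>1 log E e\<^sup>s\<^sup>\<Phi>\<close> tends to \<open>E \<Phi>\<close> at \<open>0\<close>, and \<open>u'(s)\<close> is the entropy
  of \<open>e\<^sup>s\<^sup>\<Phi>\<close> divided by \<open>s\<^sup>2 E e\<^sup>s\<^sup>\<Phi>\<close>.\<close>

lemma (in prob_space) Herbst:
  fixes \<Phi> :: "'a \<Rightarrow> real"
  assumes meas [measurable]: "\<Phi> \<in> borel_measurable M" and B: "\<And>x. \<bar>\<Phi> x\<bar> \<le> B"
    and "0 < t" "0 \<le> \<kappa>" "0 \<le> \<beta>"
    and ent: "\<And>s. 0 < s \<Longrightarrow> s \<le> t \<Longrightarrow> Ent M (\<lambda>x. exp (s * \<Phi> x)) \<le>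
      s\<^sup>2 * (\<integral>x. exp (s * \<Phi> x) \<partial>M) * (\<kappa> + \<beta> * (ln (\<integral>x. exp (s * \<Phi> x) \<partial>M) / s))"
  shows "ln (\<integral>x. exp (t * \<Phi> x) \<partial>M) \<le> t * exp (\<beta> * t) * (expectation \<Phi> + \<kappa> * t)"
proof -
  define m where "m s = (\<integral>x. exp (s * \<Phi> x) \<partial>M)" for s
  define m' where "m' s = (\<integral>x. \<Phi> x * exp (s * \<Phi> x) \<partial>M)" for s
  define u where "u s = ln (m s) / s" for s
  \<comment> \<open>With the integrating factor \<open>exp (- \<beta> * s)\<close>, the differential
    inequality \<open>u' \<le> \<kappa> + \<beta> u\<close> implies that \<open>v\<close> is
    nonincreasing.\<close>
  define v where "v s = u s * exp (- \<beta> * s) - \<kappa> * s" for s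
  have dm: "(m has_real_derivative m' s) (at s)" for s
    unfolding m_def[abs_def] m'_def by (rule mgf_has_derivative[OF meas B])
  have sb: "\<bar>s * \<Phi> x\<bar> \<le> \<bar>s\<bar> * B" for s x
    using B[of x] by (auto simp: abs_mult intro!: mult_left_mono)
  have mpos: "0 < m s" for s
    unfolding m_def by (rule order_less_le_trans[OF _ expectation_between(1)[where lo="exp (- (\<bar>s\<bar> * B))" and hi="exp (\<bar>s\<bar> * B)"]])
      (use sb[of s] in \<open>auto simp: abs_le_iff minus_le_iff\<close>)
  have m0: "m 0 = 1" by (simp add: m_def prob_space)
  have m'0: "m' 0 = expectation \<Phi>" by (simp add: m'_def)
  have Ent_eq: "Ent M (\<lambda>x. exp (s * \<Phi> x)) = s * m' s - m s * ln (m s)" for s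
    by (simp add: Ent_def m_def m'_def mult_ac flip: Bochner_Integration.integral_mult_right_zero)
  have du: "(u has_real_derivative Ent M (\<lambda>x. exp (s * \<Phi> x)) / (s\<^sup>2 * m s)) (at s)" if "0 < s" for s
    unfolding u_def[abs_def] Ent_eq using that mpos[of s]
    by (auto intro!: derivative_eq_intros dm simp: power2_eq_square field_simps)
  have dv: "\<exists>y. (v has_real_derivative y) (at s) \<and> y \<le> 0" if "0 < s" "s \<le> t" for s
  proof (intro exI conjI)
    let ?y = "Ent M (\<lambda>x. exp (s * \<Phi> x)) / (s\<^sup>2 * m s)"
    show "(v has_real_derivative (?y - \<beta> * u s) * exp (- \<beta> * s) - \<kappa>) (at s)"
      unfolding v_def[abs_def] by (auto intro!: derivative_eq_intros du that simp: algebra_simps)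
    have "?y \<le> \<kappa> + \<beta> * u s"
      using ent[OF that] mpos[of s] that by (simp add: u_def m_def[symmetric] divide_le_eq mult_ac)
    then have "(?y - \<beta> * u s) * exp (- \<beta> * s) \<le> \<kappa> * exp (- \<beta> * s)"
      by (intro mult_right_mono) auto
    also have "\<dots> \<le> \<kappa> * 1"
      using that \<open>0 \<le> \<kappa>\<close> \<open>0 \<le> \<beta>\<close> by (intro mult_left_mono) auto
    finally show "(?y - \<beta> * u s) * exp (- \<beta> * s) - \<kappa> \<le> 0" by simp
  qed
  have "v t \<le> v s" if "0 < s" "s \<le> t" for s
    by (rule DERIV_nonpos_imp_nonincreasing[OF that(2)]) (use dv that in auto)
  then have ev: "\<forall>\<^sub>F s in at_right 0. v t \<le> v s"
    using \<open>0 < t\<close> by (auto simp: eventually_at_right_field)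
  \<comment> \<open>Since \<open>ln (m 0) = 0\<close>, the function \<open>u\<close> is the
    difference quotient of \<open>ln \<circ> m\<close> at 0, so its limit is the derivative there,
    the mean of \<open>\<Phi>\<close>.\<close>
  have "((\<lambda>s. ln (m s)) has_real_derivative m' 0 / m 0) (at 0)"
    using mpos[of 0] by (auto intro!: derivative_eq_intros dm)
  then have "(u \<longlongrightarrow> expectation \<Phi>) (at 0)"
    by (simp add: DERIV_def m0 m'0 u_def[abs_def])
  then have "(u \<longlongrightarrow> expectation \<Phi>) (at_right 0)"
    by (rule filterlim_mono) (auto simp: at_within_le_at)
  then have "(v \<longlongrightarrow> expectation \<Phi> * exp (- \<beta> * 0) - \<kappa> * 0) (at_right 0)"
    unfolding v_def[abs_def] by (intro tendsto_intros)
  then have "v t \<le> expectation \<Phi>"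
    using tendsto_lowerbound[OF _ ev] by simp
  then have "u t * exp (- \<beta> * t) \<le> expectation \<Phi> + \<kappa> * t" by (simp add: v_def)
  then have "u t * exp (- \<beta> * t) * (t * exp (\<beta> * t)) \<le> (expectation \<Phi> + \<kappa> * t) * (t * exp (\<beta> * t))"
    using \<open>0 < t\<close> by (intro mult_right_mono) auto
  moreover have "u t * exp (- \<beta> * t) * (t * exp (\<beta> * t)) = ln (m t)"
    using \<open>0 < t\<close> exp_minus_inverse[of "\<beta> * t"] by (simp add: u_def mult_ac)
  ultimately show ?thesis by (simp add: m_def mult_ac)
qed

text \<open>The variational inequality for entropy: \<open>f\<close> is compared with a multiple of
  \<open>exp (e * R)\<close>. It trades an integral of \<open>R\<close> against \<open>f\<close> for
  the entropy of \<open>f\<close> and an exponential moment of \<open>R\<close>, which makes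
  unbounded gradient bounds tractable.\<close>

lemma (in prob_space) entropy_inequality:
  assumes [measurable]: "f \<in> borel_measurable M" "R \<in> borel_measurable M"
    and f: "0 < lo" "\<And>x. lo \<le> f x" "\<And>x. f x \<le> hi"
    and R: "\<And>x. 0 \<le> R x" "0 < e" "(\<integral>\<^sup>+x. ennreal (exp (e * R x)) \<partial>M) \<le> ennreal (exp (e * \<rho>))"
  shows "integrable M (\<lambda>x. R x * f x)" "e * (\<integral>x. R x * f x \<partial>M) \<le> Ent M f + e * \<rho> * expectation f"
proof -
  let ?m = "expectation f"
  have m: "0 < ?m" using expectation_between(1)[of f lo hi] f by auto
  have i1: "integrable M f" by (rule integrable_between[OF _ f(2,3)]) simp
  have i2: "integrable M (\<lambda>x. f x * ln (f x))"
    by (rule integrable_between[OF _ mult_ln_bounds[OF f]]) simp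
  have i3: "integrable M (\<lambda>x. exp (e * R x))"
    using R(3) by (intro integrableI_bounded) (auto intro: order_le_less_trans)
  have i3b: "(\<integral>x. exp (e * R x) \<partial>M) \<le> exp (e * \<rho>)"
    using R(3) nn_integral_eq_integral[OF i3] by (simp add: ennreal_le_iff)
  have i4: "integrable M R"
  proof (rule Bochner_Integration.integrable_bound[where f="\<lambda>x. exp (e * R x) / e"])
    show "AE x in M. norm (R x) \<le> norm (exp (e * R x) / e)"
    proof (rule AE_I2)
      fix x
      have "e * R x \<le> exp (e * R x)" using exp_ge_add_one_self[of "e * R x"] by linarith
      then show "norm (R x) \<le> norm (exp (e * R x) / e)"
        using R(1,2) by (simp add: field_simps)
    qed
  qed (use i3 in auto)
  have hi: "0 \<le> hi" using f(1) f(2,3)[of undefined] by linarith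
  show i5: "integrable M (\<lambda>x. R x * f x)"
  proof (rule Bochner_Integration.integrable_bound[where f="\<lambda>x. hi * R x"])
    show "AE x in M. norm (R x * f x) \<le> norm (hi * R x)"
    proof (rule AE_I2)
      fix x
      have "0 \<le> f x" using f(1) f(2)[of x] by linarith
      then show "norm (R x * f x) \<le> norm (hi * R x)"
        using R(1)[of x] mult_left_mono[OF f(3)[of x] R(1)[of x]] hi by (simp add: abs_mult mult.commute[of hi])
    qed
  qed (use i4 in auto)
  have "(\<integral>x. e * (R x * f x) - e * \<rho> * f x \<partial>M) \<le>
      (\<integral>x. f x * ln (f x) - f x * ln ?m - f x + ?m * exp (- e * \<rho>) * exp (e * R x) \<partial>M)"
  proof (rule integral_mono)
    fix x
    have fx: "0 < f x" using f(1) f(2)[of x] by linarith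
    have "f x - ?m * exp (e * (R x - \<rho>)) \<le> f x * ln (f x) - f x * ln (?m * exp (e * (R x - \<rho>)))"
      using fx m by (intro mult_ln_le) auto
    also have "ln (?m * exp (e * (R x - \<rho>))) = ln ?m + e * (R x - \<rho>)"
      using m by (simp add: ln_mult)
    finally show "e * (R x * f x) - e * \<rho> * f x \<le> f x * ln (f x) - f x * ln ?m - f x + ?m * exp (- e * \<rho>) * exp (e * R x)"
      by (simp add: exp_add[symmetric] exp_diff exp_minus algebra_simps divide_inverse)
  qed (use i1 i2 i3 i5 in auto)
  also have "\<dots> = Ent M f - ?m + ?m * exp (- e * \<rho>) * (\<integral>x. exp (e * R x) \<partial>M)"
    using i1 i2 i3 by (simp add: Ent_def)
  also have "\<dots> \<le> Ent M f - ?m + ?m * exp (- e * \<rho>) * exp (e * \<rho>)"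
    using m i3b by (intro add_left_mono mult_left_mono) auto
  also have "\<dots> = Ent M f" by (simp add: exp_minus)
  finally show "e * (\<integral>x. R x * f x \<partial>M) \<le> Ent M f + e * \<rho> * ?m"
    using i1 i5 by simp
qed

text \<open>Partial gradients, one coordinate at a time, of functions on all of
  \<open>'i \<Rightarrow> 'a\<close>. Each \<open>G j\<close> is continuous in its own coordinate,
  which is the form of regularity that the tensorized inequality works with.\<close>

definition coord_gradient :: "'i set \<Rightarrow> (('i \<Rightarrow> 'a::euclidean_space) \<Rightarrow> real) \<Rightarrow> ('i \<Rightarrow> ('i \<Rightarrow> 'a) \<Rightarrow> 'a) \<Rightarrow> bool" where
  "coord_gradient J \<Phi> G \<longleftrightarrow> \<Phi> \<in> borel_measurable (Pi\<^sub>M J (\<lambda>_. borel)) \<and>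
    (\<forall>j\<in>J. G j \<in> borel_measurable (Pi\<^sub>M J (\<lambda>_. borel))) \<and>
    (\<forall>j\<in>J. \<forall>w. gderiv (\<lambda>x. \<Phi> (w(j := x))) (w j) (G j w)) \<and>
    (\<forall>j\<in>J. \<forall>w. continuous_on UNIV (\<lambda>x. G j (w(j := x))))"

text \<open>Continuity of \<open>T'\<close> is asked for on the range of \<open>\<Phi>\<close> only,
  because the truncation applied below to nonnegative functions has a pole at a negative
  point.\<close>

lemma coord_gradient_compose:
  assumes grad: "coord_gradient J \<Phi> G" and T: "\<And>w. (T has_real_derivative T' (\<Phi> w)) (at (\<Phi> w))"
    and T': "continuous_on (range \<Phi>) T'" and [measurable]: "T \<in> borel_measurable borel" "T' \<in> borel_measurable borel"
  shows "coord_gradient J (\<lambda>w. T (\<Phi> w)) (\<lambda>j w. T' (\<Phi> w) *\<^sub>R G j w)"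
  unfolding coord_gradient_def
proof (intro conjI ballI allI)
  have [measurable]: "\<Phi> \<in> borel_measurable (Pi\<^sub>M J (\<lambda>_. borel))" using grad by (simp add: coord_gradient_def)
  show "(\<lambda>w. T (\<Phi> w)) \<in> borel_measurable (Pi\<^sub>M J (\<lambda>_. borel))" by measurable
  fix j assume j: "j \<in> J"
  have [measurable]: "G j \<in> borel_measurable (Pi\<^sub>M J (\<lambda>_. borel))" using grad j by (simp add: coord_gradient_def)
  show "(\<lambda>w. T' (\<Phi> w) *\<^sub>R G j w) \<in> borel_measurable (Pi\<^sub>M J (\<lambda>_. borel))" by measurable
  fix w
  have g: "gderiv (\<lambda>x. \<Phi> (w(j := x))) (w j) (G j w)" for w
    using grad j by (simp add: coord_gradient_def)
  have "(T has_real_derivative T' (\<Phi> w)) (at (\<Phi> (w(j := w j))))"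
    using T[of w] by (simp only: fun_upd_triv)
  from GDERIV_DERIV_compose[OF g this]
  show "gderiv (\<lambda>x. T (\<Phi> (w(j := x)))) (w j) (T' (\<Phi> w) *\<^sub>R G j w)" .
  have "gderiv (\<lambda>x. \<Phi> (w(j := x))) x (G j (w(j := x)))" for x
    using g[of "w(j := x)"] by (simp only: fun_upd_upd fun_upd_same)
  then have "continuous_on UNIV (\<lambda>x. \<Phi> (w(j := x)))"
    unfolding gderiv_def by (intro has_derivative_continuous_on) blast
  moreover have "continuous_on UNIV (\<lambda>x. G j (w(j := x)))"
    using grad j unfolding coord_gradient_def by blast
  ultimately show "continuous_on UNIV (\<lambda>x. T' (\<Phi> (w(j := x))) *\<^sub>R G j (w(j := x)))"
    by (intro continuous_intros continuous_on_compose2[OF T']) auto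
qed

locale lsi_product =
  fixes \<mu> :: "'a::euclidean_space measure" and C :: real and J :: "'i set"
  assumes prob: "prob_space \<mu>" and sets_\<mu>: "sets \<mu> = sets borel" and lsi: "log_sobolev_const \<mu> C"
    and C_pos: "0 < C" and finite_J: "finite J"
begin

abbreviation P where "P \<equiv> Pi\<^sub>M J (\<lambda>_. \<mu>)"

sublocale P: prob_space P
  by (rule prob_space_PiM) (rule prob)

lemma sets_P: "sets P = sets (Pi\<^sub>M J (\<lambda>_. borel))"
  by (intro sets_PiM_cong) (auto simp: sets_\<mu>)

lemma measurable_P: "f \<in> borel_measurable (Pi\<^sub>M J (\<lambda>_. borel)) \<Longrightarrow> f \<in> borel_measurable P"
  by (simp add: measurable_cong_sets[OF sets_P refl])

text \<open>A majorant \<open>R\<close> of the squared gradient with finite weighted integral turns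
  the extended inequality into one between real numbers.\<close>

lemma log_sobolev_gradient:
  assumes grad: "coord_gradient J \<Phi> G" and B: "\<And>w. \<bar>\<Phi> w\<bar> \<le> B"
    and R: "R \<in> borel_measurable (Pi\<^sub>M J (\<lambda>_. borel))" "\<And>w. (\<Sum>j\<in>J. (norm (G j w))\<^sup>2) \<le> R w"
      "integrable P (\<lambda>w. R w * exp (\<Phi> w))"
  shows "Ent P (\<lambda>w. exp (\<Phi> w)) \<le> C / 2 * (\<integral>w. R w * exp (\<Phi> w) \<partial>P)"
proof -
  have R0: "0 \<le> R w" for w
    using R(2)[of w] by (meson order_trans sum_nonneg zero_le_power2)
  have "ennreal (Ent P (\<lambda>w. exp (\<Phi> w))) \<le>
      ennreal (C / 2) * (\<integral>\<^sup>+w. ennreal ((\<Sum>j\<in>J. (norm (G j w))\<^sup>2) * exp (\<Phi> w)) \<partial>P)"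
    by (rule log_sobolev_PiM[OF prob sets_\<mu> lsi C_pos finite_J _ _ _ _ B])
      (use grad in \<open>auto simp: coord_gradient_def\<close>)
  also have "\<dots> \<le> ennreal (C / 2) * (\<integral>\<^sup>+w. ennreal (R w * exp (\<Phi> w)) \<partial>P)"
    by (intro mult_left_mono nn_integral_mono ennreal_leI mult_right_mono R) auto
  also have "(\<integral>\<^sup>+w. ennreal (R w * exp (\<Phi> w)) \<partial>P) = ennreal (\<integral>w. R w * exp (\<Phi> w) \<partial>P)"
    using R(3) R0 by (intro nn_integral_eq_integral) auto
  also have "ennreal (C / 2) * \<dots> = ennreal (C / 2 * (\<integral>w. R w * exp (\<Phi> w) \<partial>P))"
    using C_pos R0 by (intro ennreal_mult[symmetric] integral_nonneg_AE) auto
  finally show ?thesis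
    using C_pos R0 by (subst (asm) ennreal_le_iff) (auto intro!: mult_nonneg_nonneg integral_nonneg_AE)
qed

text \<open>The truncation for signed functions: bounded for fixed \<open>h\<close>, with derivative
  in (0, 1], and tending to the identity as \<open>h\<close> tends to 0.\<close>

lemma (in -) has_real_derivative_arctan_scaled:
  assumes "0 < h"
  shows "((\<lambda>s. arctan (h * s) / h) has_real_derivative 1 / (1 + (h * s)\<^sup>2)) (at s)"
  using assms by (auto intro!: derivative_eq_intros simp: divide_inverse)

lemma (in -) abs_arctan_le_abs: "\<bar>arctan x\<bar> \<le> \<bar>x\<bar>"
proof -
  have "\<bar>arctan x - arctan 0\<bar> \<le> 1 * \<bar>x - 0\<bar>"
  proof (rule field_differentiable_bound[of UNIV arctan "\<lambda>x. inverse (1 + x\<^sup>2)" 1 x 0, simplified real_norm_def])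
    show "(arctan has_field_derivative inverse (1 + z\<^sup>2)) (at z within UNIV)" for z
      using DERIV_arctan[of z] by simp
    show "\<bar>inverse (1 + z\<^sup>2)\<bar> \<le> 1" for z :: real
      by (simp add: inverse_le_1_iff)
  qed auto
  then show ?thesis by simp
qed

lemma (in -) arctan_scaled_limit: "(\<lambda>n. arctan (inverse (real (Suc n)) * s) / inverse (real (Suc n))) \<longlonglongrightarrow> s"
proof -
  have "((\<lambda>h. arctan (h * s)) has_real_derivative s) (at 0)"
    by (auto intro!: derivative_eq_intros)
  then have "((\<lambda>h. arctan (h * s) / h) \<longlongrightarrow> s) (at 0)"
    by (simp add: DERIV_def)
  moreover have "filterlim (\<lambda>m. inverse (real (Suc m))) (at 0) sequentially"
    unfolding filterlim_at using LIMSEQ_inverse_real_of_nat by auto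
  ultimately show ?thesis by (rule filterlim_compose)
qed

text \<open>Herbst's argument with a random gradient bound \<open>R\<close>. The log-Sobolev
  inequality bounds the entropy by \<open>C * s\<^sup>2 / 2\<close> times a weighted integral of
  \<open>R\<close>, and the entropy inequality bounds this integral by \<open>1 / e\<close> times
  the entropy plus \<open>\<rho>\<close> times the mass. For \<open>C * s\<^sup>2 \<le> e\<close>
  the entropy on the right is at most half of that on the left. Truncation makes the exponential
  bounded; Fatou's lemma removes it.\<close>

lemma concentration_aux:
  assumes grad: "coord_gradient J S G" and Rm: "R \<in> borel_measurable (Pi\<^sub>M J (\<lambda>_. borel))"
    and R: "\<And>w. (\<Sum>j\<in>J. (norm (G j w))\<^sup>2) \<le> R w"
    and e: "0 < e" "0 \<le> \<rho>" "(\<integral>\<^sup>+w. ennreal (exp (e * R w)) \<partial>P) \<le> ennreal (exp (e * \<rho>))"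
    and S: "integrable P S" and t: "0 < t" "C * t\<^sup>2 \<le> e"
  shows "(\<integral>\<^sup>+w. ennreal (exp (t * S w)) \<partial>P) \<le> ennreal (exp (t * (\<integral>w. S w \<partial>P) + C * \<rho> * t\<^sup>2))"
proof -
  have Sm: "S \<in> borel_measurable (Pi\<^sub>M J (\<lambda>_. borel))" using grad by (simp add: coord_gradient_def)
  note [measurable] = measurable_P[OF Sm] measurable_P[OF Rm]
  have R0: "0 \<le> R w" for w
    using R[of w] by (meson order_trans sum_nonneg zero_le_power2)
  define T where "T n s = arctan (inverse (real (Suc n)) * s) / inverse (real (Suc n))" for n s
  define T' where "T' n s = 1 / (1 + (inverse (real (Suc n)) * s)\<^sup>2)" for n and s :: real
  have T'1: "\<bar>T' n s\<bar> \<le> 1" for n s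
    unfolding T'_def by (simp add: divide_le_eq add_pos_nonneg)
  have T_abs: "\<bar>T n s\<bar> \<le> \<bar>s\<bar>" for n s
    using abs_arctan_le_abs[of "inverse (real (Suc n)) * s"]
    by (simp add: T_def abs_mult divide_le_eq mult.commute)
  have T_bound: "\<bar>T n s\<bar> \<le> real (Suc n) * (pi / 2)" for n s
  proof -
    have "\<bar>arctan x\<bar> \<le> pi / 2" for x
      using arctan_bounded[of x] by linarith
    then have "real (Suc n) * \<bar>arctan (inverse (real (Suc n)) * s)\<bar> \<le> real (Suc n) * (pi / 2)"
      by (rule mult_left_mono) simp
    moreover have "\<bar>T n s\<bar> = real (Suc n) * \<bar>arctan (inverse (real (Suc n)) * s)\<bar>"
      unfolding T_def divide_inverse inverse_inverse_eq abs_mult abs_of_nat by (rule mult.commute)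
    ultimately show ?thesis by simp
  qed
  have [measurable]: "T n \<in> borel_measurable borel" "T' n \<in> borel_measurable borel" for n
    unfolding T_def[abs_def] T'_def[abs_def] by measurable
  define H where "H n = exp (t * (\<integral>w. T n (S w) \<partial>P) + C * \<rho> * t\<^sup>2)" for n
  have main: "(\<integral>w. exp (t * T n (S w)) \<partial>P) \<le> H n" for n
  proof -
    let ?\<Phi> = "\<lambda>w. T n (S w)"
    let ?B = "real (Suc n) * (pi / 2)"
    have ent: "Ent P (\<lambda>w. exp (s * ?\<Phi> w)) \<le> s\<^sup>2 * (\<integral>w. exp (s * ?\<Phi> w) \<partial>P) * (C * \<rho> + 0 * (ln (\<integral>w. exp (s * ?\<Phi> w) \<partial>P) / s))"
      if s: "0 < s" "s \<le> t" for s
    proof -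
      have cg: "coord_gradient J (\<lambda>w. s * T n (S w)) (\<lambda>j w. (s * T' n (S w)) *\<^sub>R G j w)"
      proof (rule coord_gradient_compose[OF grad, of "\<lambda>x. s * T n x" "\<lambda>x. s * T' n x"])
        show "((\<lambda>x. s * T n x) has_real_derivative s * T' n (S w)) (at (S w))" for w
          unfolding T_def T'_def
          by (intro DERIV_cmult has_real_derivative_arctan_scaled) simp
        have "1 + (inverse (real (Suc n)) * x)\<^sup>2 \<noteq> 0" for x
          by (smt (verit) zero_le_power2)
        then show "continuous_on (range S) (\<lambda>x. s * T' n x)"
          unfolding T'_def by (intro continuous_intros) blast
      qed auto
      have sb: "\<bar>s * ?\<Phi> w\<bar> \<le> s * ?B" for w
        using T_bound[of n "S w"] s by (simp add: abs_mult)
      have lo: "exp (- (s * ?B)) \<le> exp (s * ?\<Phi> w)" "exp (s * ?\<Phi> w) \<le> exp (s * ?B)" for w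
        using sb[of w] unfolding exp_le_cancel_iff by linarith+
      have ei: "integrable P (\<lambda>w. R w * exp (s * ?\<Phi> w))"
        "e * (\<integral>w. R w * exp (s * ?\<Phi> w) \<partial>P) \<le> Ent P (\<lambda>w. exp (s * ?\<Phi> w)) + e * \<rho> * (\<integral>w. exp (s * ?\<Phi> w) \<partial>P)"
        by (rule P.entropy_inequality[OF _ _ exp_gt_zero lo R0 e(1,3)]; measurable)+
      have "Ent P (\<lambda>w. exp (s * ?\<Phi> w)) \<le> C / 2 * (\<integral>w. (s\<^sup>2 * R w) * exp (s * ?\<Phi> w) \<partial>P)"
      proof (rule log_sobolev_gradient[OF cg sb])
        show "(\<lambda>w. s\<^sup>2 * R w) \<in> borel_measurable (Pi\<^sub>M J (\<lambda>_. borel))"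
          using Rm by measurable
        show "(\<Sum>j\<in>J. (norm ((s * T' n (S w)) *\<^sub>R G j w))\<^sup>2) \<le> s\<^sup>2 * R w" for w
        proof -
          have "(\<Sum>j\<in>J. (norm ((s * T' n (S w)) *\<^sub>R G j w))\<^sup>2) = s\<^sup>2 * (\<bar>T' n (S w)\<bar>\<^sup>2 * (\<Sum>j\<in>J. (norm (G j w))\<^sup>2))"
            by (simp add: power_mult_distrib sum_distrib_left mult_ac)
          also have "\<dots> \<le> s\<^sup>2 * (1\<^sup>2 * R w)"
            using T'1[of n "S w"] R[of w] by (intro mult_left_mono mult_mono power_mono sum_nonneg) auto
          finally show ?thesis by simp
        qed
        show "integrable P (\<lambda>w. s\<^sup>2 * R w * exp (s * T n (S w)))"
          using ei(1) by (simp add: mult.assoc)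
      qed
      then have 1: "Ent P (\<lambda>w. exp (s * ?\<Phi> w)) \<le> C * s\<^sup>2 / 2 * (\<integral>w. R w * exp (s * ?\<Phi> w) \<partial>P)"
        by (simp add: mult.assoc)
      have "C * s\<^sup>2 \<le> e"
        using s t C_pos by (intro order_trans[OF mult_left_mono[OF power_mono[of s t 2]] t(2)]) auto
      then have q: "C * s\<^sup>2 / 2 / e \<le> 1 / 2" using e(1) by (simp add: field_simps)
      have "C * s\<^sup>2 / 2 * (\<integral>w. R w * exp (s * ?\<Phi> w) \<partial>P) = C * s\<^sup>2 / 2 / e * (e * (\<integral>w. R w * exp (s * ?\<Phi> w) \<partial>P))"
        using e(1) by simp
      also have "\<dots> \<le> C * s\<^sup>2 / 2 / e * (Ent P (\<lambda>w. exp (s * ?\<Phi> w)) + e * \<rho> * (\<integral>w. exp (s * ?\<Phi> w) \<partial>P))"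
        using C_pos e(1) by (intro mult_left_mono ei(2)) auto
      also have "\<dots> = C * s\<^sup>2 / 2 / e * Ent P (\<lambda>w. exp (s * ?\<Phi> w)) + C * s\<^sup>2 / 2 * \<rho> * (\<integral>w. exp (s * ?\<Phi> w) \<partial>P)"
        using e(1) by (simp add: field_simps)
      also have "C * s\<^sup>2 / 2 / e * Ent P (\<lambda>w. exp (s * ?\<Phi> w)) \<le> 1 / 2 * Ent P (\<lambda>w. exp (s * ?\<Phi> w))"
        using q by (intro mult_right_mono P.Ent_nonneg[OF _ exp_gt_zero lo]) auto
      finally show ?thesis using 1 by (simp add: mult_ac)
    qed
    have "ln (\<integral>w. exp (t * ?\<Phi> w) \<partial>P) \<le> t * exp (0 * t) * ((\<integral>w. ?\<Phi> w \<partial>P) + C * \<rho> * t)"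
      using C_pos e(2) by (intro P.Herbst[OF _ T_bound t(1) _ _ ent]) auto
    then have l: "ln (\<integral>w. exp (t * ?\<Phi> w) \<partial>P) \<le> t * (\<integral>w. ?\<Phi> w \<partial>P) + C * \<rho> * t\<^sup>2"
      by (simp add: power2_eq_square algebra_simps)
    have pos: "0 < (\<integral>w. exp (t * ?\<Phi> w) \<partial>P)"
    proof -
      have b: "\<bar>t * ?\<Phi> w\<bar> \<le> t * ?B" for w
        using T_bound[of n "S w"] t by (simp add: abs_mult)
      have "- (t * ?B) \<le> t * ?\<Phi> w" "t * ?\<Phi> w \<le> t * ?B" for w
        using b[of w] by linarith+
      then have "exp (- (t * ?B)) \<le> (\<integral>w. exp (t * ?\<Phi> w) \<partial>P)"
        by (intro P.expectation_between(1)[where hi="exp (t * ?B)"]) (auto simp del: of_nat_Suc)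
      then show ?thesis by (rule order_less_le_trans[OF exp_gt_zero])
    qed
    have "(\<integral>w. exp (t * ?\<Phi> w) \<partial>P) = exp (ln (\<integral>w. exp (t * ?\<Phi> w) \<partial>P))" using pos by simp
    also have "\<dots> \<le> H n" unfolding H_def exp_le_cancel_iff by (rule l)
    finally show ?thesis .
  qed
  have "(\<lambda>n. \<integral>w. T n (S w) \<partial>P) \<longlonglongrightarrow> (\<integral>w. S w \<partial>P)"
  proof (rule integral_dominated_convergence[where w="\<lambda>w. \<bar>S w\<bar>"])
    show "AE w in P. (\<lambda>n. T n (S w)) \<longlonglongrightarrow> S w"
      unfolding T_def by (intro AE_I2 arctan_scaled_limit)
  qed (use S T_abs in auto)
  then have Hlim: "H \<longlonglongrightarrow> exp (t * (\<integral>w. S w \<partial>P) + C * \<rho> * t\<^sup>2)"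
    unfolding H_def[abs_def] by (intro tendsto_intros)
  have "(\<integral>\<^sup>+w. ennreal (exp (t * S w)) \<partial>P) = (\<integral>\<^sup>+w. liminf (\<lambda>n. ennreal (exp (t * T n (S w)))) \<partial>P)"
  proof (intro nn_integral_cong)
    fix w
    have "(\<lambda>n. ennreal (exp (t * T n (S w)))) \<longlonglongrightarrow> ennreal (exp (t * S w))"
      unfolding T_def by (intro tendsto_intros arctan_scaled_limit)
    then show "ennreal (exp (t * S w)) = liminf (\<lambda>n. ennreal (exp (t * T n (S w))))"
      by (intro lim_imp_Liminf[symmetric]) auto
  qed
  also have "\<dots> \<le> liminf (\<lambda>n. \<integral>\<^sup>+w. ennreal (exp (t * T n (S w))) \<partial>P)"
    by (rule nn_integral_liminf) simp
  also have "\<dots> \<le> liminf (\<lambda>n. ennreal (H n))"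
  proof (intro Liminf_mono always_eventually allI)
    fix n
    have "integrable P (\<lambda>w. exp (t * T n (S w)))"
    proof (rule P.integrable_between[where lo=0 and hi="exp (t * (real (Suc n) * (pi / 2)))"])
      show "exp (t * T n (S w)) \<le> exp (t * (real (Suc n) * (pi / 2)))" for w
        unfolding exp_le_cancel_iff using T_bound[of n "S w"] t(1)
        by (intro mult_left_mono) linarith+
    qed auto
    then have "(\<integral>\<^sup>+w. ennreal (exp (t * T n (S w))) \<partial>P) = ennreal (\<integral>w. exp (t * T n (S w)) \<partial>P)"
      by (intro nn_integral_eq_integral) auto
    also have "\<dots> \<le> ennreal (H n)" by (intro ennreal_leI main)
    finally show "(\<integral>\<^sup>+w. ennreal (exp (t * T n (S w))) \<partial>P) \<le> ennreal (H n)" .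
  qed
  also have "\<dots> = ennreal (exp (t * (\<integral>w. S w \<partial>P) + C * \<rho> * t\<^sup>2))"
    using Hlim by (intro lim_imp_Liminf tendsto_ennrealI) auto
  finally show ?thesis .
qed

lemma coord_gradient_minus:
  assumes "coord_gradient J S G"
  shows "coord_gradient J (\<lambda>w. - S w) (\<lambda>j w. - G j w)"
  using coord_gradient_compose[OF assms, of uminus "\<lambda>_. -1"]
  by (simp add: DERIV_minus[OF DERIV_ident])

text \<open>Negative \<open>t\<close> is covered by passing to \<open>- S\<close>, and centering
  moves the mean out of the exponent.\<close>

lemma concentration:
  assumes grad: "coord_gradient J S G" and Rm: "R \<in> borel_measurable (Pi\<^sub>M J (\<lambda>_. borel))"
    and R: "\<And>w. (\<Sum>j\<in>J. (norm (G j w))\<^sup>2) \<le> R w"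
    and e: "0 < e" "0 \<le> \<rho>" "(\<integral>\<^sup>+w. ennreal (exp (e * R w)) \<partial>P) \<le> ennreal (exp (e * \<rho>))"
    and S: "integrable P S" and t: "C * t\<^sup>2 \<le> e"
  shows "(\<integral>\<^sup>+w. ennreal (exp (t * (S w - (\<integral>w. S w \<partial>P)))) \<partial>P) \<le> ennreal (exp (C * \<rho> * t\<^sup>2))"
proof -
  have "(\<integral>\<^sup>+w. ennreal (exp (t * S w)) \<partial>P) \<le> ennreal (exp (t * (\<integral>w. S w \<partial>P) + C * \<rho> * t\<^sup>2))"
  proof -
    consider "t = 0" | "0 < t" | "0 < - t" by linarith
    then show ?thesis
    proof cases
      case 1
      then show ?thesis by (simp add: P.emeasure_space_1)
    next
      case 2
      then show ?thesis by (rule concentration_aux[OF grad Rm R e S _ t])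
    next
      case 3
      have "(\<integral>\<^sup>+w. ennreal (exp ((- t) * (- S w))) \<partial>P) \<le> ennreal (exp ((- t) * (\<integral>w. - S w \<partial>P) + C * \<rho> * (- t)\<^sup>2))"
        using R by (intro concentration_aux[OF coord_gradient_minus[OF grad] Rm _ e _ 3]) (use S t in auto)
      then show ?thesis by simp
    qed
  qed
  note * = this
  have [measurable]: "S \<in> borel_measurable P" using S by simp
  have "(\<integral>\<^sup>+w. ennreal (exp (t * (S w - (\<integral>w. S w \<partial>P)))) \<partial>P)
      = (\<integral>\<^sup>+w. ennreal (exp (- (t * (\<integral>w. S w \<partial>P)))) * ennreal (exp (t * S w)) \<partial>P)"
    by (intro nn_integral_cong) (simp add: ennreal_mult[symmetric] exp_add[symmetric] algebra_simps)
  also have "\<dots> = ennreal (exp (- (t * (\<integral>w. S w \<partial>P)))) * (\<integral>\<^sup>+w. ennreal (exp (t * S w)) \<partial>P)"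
    by (rule nn_integral_cmult) simp
  also have "\<dots> \<le> ennreal (exp (- (t * (\<integral>w. S w \<partial>P)))) * ennreal (exp (t * (\<integral>w. S w \<partial>P) + C * \<rho> * t\<^sup>2))"
    by (intro mult_left_mono *) simp
  also have "\<dots> = ennreal (exp (C * \<rho> * t\<^sup>2))"
    by (simp add: ennreal_mult[symmetric] exp_add[symmetric])
  finally show ?thesis .
qed

text \<open>Here the squared gradient is bounded by \<open>Q\<close> itself. The log-Sobolev
  inequality then gives the bound \<open>C * a * s * m * ln m\<close> for the entropy, where
  \<open>m\<close> is the Laplace transform at \<open>s\<close>. This is Herbst's hypothesis with
  \<open>\<kappa> = 0\<close> and \<open>\<beta> = C * a\<close>, so only the mean of
  \<open>Q\<close> enters.\<close>

lemma exp_quadratic_bound: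
  assumes grad: "coord_gradient J Q G" and Q0: "\<And>w. 0 \<le> Q w"
    and G: "\<And>w. (\<Sum>j\<in>J. (norm (G j w))\<^sup>2) \<le> a * Q w" and "0 \<le> a"
    and Q: "integrable P Q" "(\<integral>w. Q w \<partial>P) \<le> q" and t: "0 < t" "C * a * t \<le> 1"
  shows "(\<integral>\<^sup>+w. ennreal (exp (t * Q w)) \<partial>P) \<le> ennreal (exp (3 * t * q))"
proof -
  have Qm: "Q \<in> borel_measurable (Pi\<^sub>M J (\<lambda>_. borel))" using grad by (simp add: coord_gradient_def)
  note [measurable] = measurable_P[OF Qm]
  \<comment> \<open>This truncation preserves the self-bounding property:
    \<open>(T')\<^sup>2 s \<le> T\<close> on the nonnegative reals, so \<open>T n \<circ> Q\<close>
    again has its squared gradient bounded by \<open>a\<close> times itself.\<close>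
  define T where "T n s = s / (1 + inverse (real (Suc n)) * s)" for n s
  define T' where "T' n s = 1 / (1 + inverse (real (Suc n)) * s)\<^sup>2" for n and s :: real
  have d1: "1 \<le> 1 + inverse (real (Suc n)) * s" if "0 \<le> s" for n s using that by simp
  have T0: "0 \<le> T n s" "T n s \<le> s" "T n s \<le> real (Suc n)" if "0 \<le> s" for n s
    using d1[OF that, of n] that by (auto simp: T_def divide_le_eq field_simps)
  have T's: "(T' n s)\<^sup>2 * s \<le> T n s" if "0 \<le> s" for n s
  proof -
    let ?d = "1 + inverse (real (Suc n)) * s"
    have "?d \<le> ?d ^ 4" using d1[OF that, of n] by (intro self_le_power) auto
    moreover have "0 < ?d" using d1[OF that, of n] by linarith
    ultimately have "s / ?d ^ 4 \<le> s / ?d" using that by (intro divide_left_mono mult_pos_pos zero_less_power)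
    moreover have "(T' n s)\<^sup>2 * s = s / ?d ^ 4" by (simp add: T'_def power_divide flip: power_mult)
    ultimately show ?thesis by (simp add: T_def)
  qed
  have [measurable]: "T n \<in> borel_measurable borel" "T' n \<in> borel_measurable borel" for n
    unfolding T_def[abs_def] T'_def[abs_def] by measurable
  have b: "integrable P (\<lambda>w. exp (t * T n (Q w)))" and
    main: "(\<integral>w. exp (t * T n (Q w)) \<partial>P) \<le> exp (3 * t * q)" for n
  proof -
    let ?\<Phi> = "\<lambda>w. T n (Q w)"
    let ?B = "real (Suc n)"
    have \<Phi>: "0 \<le> ?\<Phi> w" "?\<Phi> w \<le> ?B" "?\<Phi> w \<le> Q w" for w using T0[OF Q0[of w], of n] by auto
    have lo: "exp 0 \<le> exp (s * ?\<Phi> w)" "exp (s * ?\<Phi> w) \<le> exp (s * ?B)" if "0 < s" for s w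
      unfolding exp_le_cancel_iff using that \<Phi>[of w] by (intro mult_nonneg_nonneg mult_left_mono; simp)+
    show "integrable P (\<lambda>w. exp (t * T n (Q w)))"
      by (rule P.integrable_between[OF _ lo[OF t(1)]]) simp
    have ge1: "1 \<le> (\<integral>w. exp (s * ?\<Phi> w) \<partial>P)" if "0 < s" for s
      using P.expectation_between(1)[OF _ lo[OF that]] by simp
    have ent: "Ent P (\<lambda>w. exp (s * ?\<Phi> w)) \<le> s\<^sup>2 * (\<integral>w. exp (s * ?\<Phi> w) \<partial>P) * (0 + C * a * (ln (\<integral>w. exp (s * ?\<Phi> w) \<partial>P) / s))"
      if s: "0 < s" "s \<le> t" for s
    proof -
      let ?m = "\<integral>w. exp (s * ?\<Phi> w) \<partial>P"
      have cg: "coord_gradient J (\<lambda>w. s * T n (Q w)) (\<lambda>j w. (s * T' n (Q w)) *\<^sub>R G j w)"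
      proof (rule coord_gradient_compose[OF grad, of "\<lambda>x. s * T n x" "\<lambda>x. s * T' n x"])
        show "((\<lambda>x. s * T n x) has_real_derivative s * T' n (Q w)) (at (Q w))" for w
          unfolding T_def T'_def using d1[OF Q0[of w], of n]
          by (intro DERIV_cmult) (auto intro!: derivative_eq_intros simp: power2_eq_square field_simps)
        have "(1 + inverse (real (Suc n)) * x)\<^sup>2 \<noteq> 0" if "x \<in> range Q" for x
        proof -
          obtain w where x: "x = Q w" using \<open>x \<in> range Q\<close> by blast
          have "0 < 1 + inverse (real (Suc n)) * x" unfolding x using d1[OF Q0[of w], of n] by linarith
          then show ?thesis by simp
        qed
        then show "continuous_on (range Q) (\<lambda>x. s * T' n x)"
          unfolding T'_def by (intro continuous_intros) blast
      qed auto
      have sb: "\<bar>s * ?\<Phi> w\<bar> \<le> s * ?B" for w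
        using \<Phi>[of w] s by (simp add: abs_mult)
      have i1: "integrable P (\<lambda>w. ?\<Phi> w * exp (s * ?\<Phi> w))"
        by (rule P.integrable_between[where lo=0 and hi="?B * exp (s * ?B)"])
          (use \<Phi> lo[OF s(1)] s(1) in \<open>auto intro!: mult_mono simp del: of_nat_Suc simp: less_imp_le\<close>)
      have "Ent P (\<lambda>w. exp (s * ?\<Phi> w)) \<le> C / 2 * (\<integral>w. (s\<^sup>2 * a * ?\<Phi> w) * exp (s * ?\<Phi> w) \<partial>P)"
      proof (rule log_sobolev_gradient[OF cg sb])
        show "(\<lambda>w. s\<^sup>2 * a * T n (Q w)) \<in> borel_measurable (Pi\<^sub>M J (\<lambda>_. borel))"
          using Qm by measurable
        show "(\<Sum>j\<in>J. (norm ((s * T' n (Q w)) *\<^sub>R G j w))\<^sup>2) \<le> s\<^sup>2 * a * T n (Q w)" for w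
        proof -
          have "(\<Sum>j\<in>J. (norm ((s * T' n (Q w)) *\<^sub>R G j w))\<^sup>2) = s\<^sup>2 * ((T' n (Q w))\<^sup>2 * (\<Sum>j\<in>J. (norm (G j w))\<^sup>2))"
            by (simp add: power_mult_distrib sum_distrib_left mult_ac)
          also have "\<dots> \<le> s\<^sup>2 * ((T' n (Q w))\<^sup>2 * (a * Q w))"
            using G[of w] by (intro mult_left_mono) auto
          also have "\<dots> = s\<^sup>2 * a * ((T' n (Q w))\<^sup>2 * Q w)" by simp
          also have "\<dots> \<le> s\<^sup>2 * a * T n (Q w)"
            using T's[OF Q0] \<open>0 \<le> a\<close> by (intro mult_left_mono) auto
          finally show ?thesis .
        qed
        show "integrable P (\<lambda>w. s\<^sup>2 * a * T n (Q w) * exp (s * T n (Q w)))"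
          using i1 by (simp add: mult.assoc)
      qed
      also have "\<dots> = C * a * s / 2 * (s * (\<integral>w. ?\<Phi> w * exp (s * ?\<Phi> w) \<partial>P))"
        by (simp add: mult.assoc power2_eq_square)
      \<comment> \<open>The entropy reappears on the right with the factor
        \<open>C * a * s / 2 \<le> 1 / 2\<close> and is absorbed.\<close>
      also have "s * (\<integral>w. ?\<Phi> w * exp (s * ?\<Phi> w) \<partial>P) = Ent P (\<lambda>w. exp (s * ?\<Phi> w)) + ?m * ln ?m"
        by (simp add: Ent_def mult_ac flip: Bochner_Integration.integral_mult_right_zero)
      finally have 1: "Ent P (\<lambda>w. exp (s * ?\<Phi> w)) \<le> C * a * s / 2 * Ent P (\<lambda>w. exp (s * ?\<Phi> w)) + C * a * s / 2 * (?m * ln ?m)"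
        by (simp add: distrib_left)
      have "C * a * s \<le> C * a * t" using s C_pos \<open>0 \<le> a\<close> by (intro mult_left_mono) auto
      then have "C * a * s / 2 \<le> 1 / 2" using t(2) by simp
      then have "C * a * s / 2 * Ent P (\<lambda>w. exp (s * ?\<Phi> w)) \<le> 1 / 2 * Ent P (\<lambda>w. exp (s * ?\<Phi> w))"
        by (intro mult_right_mono P.Ent_nonneg[OF _ _ lo[OF s(1)]]) auto
      then have "Ent P (\<lambda>w. exp (s * ?\<Phi> w)) \<le> C * a * s * (?m * ln ?m)" using 1 by simp
      then show ?thesis using s by (simp add: power2_eq_square mult_ac)
    qed
    have E\<Phi>: "(\<integral>w. ?\<Phi> w \<partial>P) \<le> q" "0 \<le> (\<integral>w. ?\<Phi> w \<partial>P)"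
    proof -
      have "(\<integral>w. ?\<Phi> w \<partial>P) \<le> (\<integral>w. Q w \<partial>P)"
        by (intro integral_mono Q(1) P.integrable_between[OF _ \<Phi>(1,2)] \<Phi>(3)) auto
      then show "(\<integral>w. ?\<Phi> w \<partial>P) \<le> q" using Q(2) by linarith
      show "0 \<le> (\<integral>w. ?\<Phi> w \<partial>P)" using \<Phi>(1) by (intro integral_nonneg_AE) auto
    qed
    have "ln (\<integral>w. exp (t * ?\<Phi> w) \<partial>P) \<le> t * exp (C * a * t) * ((\<integral>w. ?\<Phi> w \<partial>P) + 0 * t)"
      by (rule P.Herbst[OF _ _ t(1) _ _ ent, where B="?B"])
        (use \<Phi> C_pos \<open>0 \<le> a\<close> in \<open>auto simp: abs_le_iff intro: order_trans\<close>)
    also have "\<dots> \<le> t * 3 * q"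
    proof -
      \<comment> \<open>The constant 3 of the statement is an upper bound for
        \<open>exp 1\<close>.\<close>
      have "exp (C * a * t) \<le> exp 1" using t(2) by simp
      then have "exp (C * a * t) \<le> 3" using exp_le by linarith
      then show ?thesis using t(1) E\<Phi> by (intro mult_mono) auto
    qed
    finally have "exp (ln (\<integral>w. exp (t * ?\<Phi> w) \<partial>P)) \<le> exp (3 * t * q)" by (simp add: mult_ac)
    then show "(\<integral>w. exp (t * T n (Q w)) \<partial>P) \<le> exp (3 * t * q)"
      using ge1[OF t(1)] by simp
  qed
  have "(\<integral>\<^sup>+w. ennreal (exp (t * Q w)) \<partial>P) = (\<integral>\<^sup>+w. liminf (\<lambda>n. ennreal (exp (t * T n (Q w)))) \<partial>P)"
  proof (intro nn_integral_cong)
    fix w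
    have "(\<lambda>n. Q w / (1 + inverse (real (Suc n)) * Q w)) \<longlonglongrightarrow> Q w / (1 + 0 * Q w)"
      by (intro tendsto_intros LIMSEQ_inverse_real_of_nat) auto
    then have "(\<lambda>n. T n (Q w)) \<longlonglongrightarrow> Q w" by (simp add: T_def)
    then have "(\<lambda>n. ennreal (exp (t * T n (Q w)))) \<longlonglongrightarrow> ennreal (exp (t * Q w))"
      by (intro tendsto_intros)
    then show "ennreal (exp (t * Q w)) = liminf (\<lambda>n. ennreal (exp (t * T n (Q w))))"
      by (intro lim_imp_Liminf[symmetric]) auto
  qed
  also have "\<dots> \<le> liminf (\<lambda>n. \<integral>\<^sup>+w. ennreal (exp (t * T n (Q w))) \<partial>P)"
    by (rule nn_integral_liminf) simp
  also have "\<dots> \<le> liminf (\<lambda>n. ennreal (exp (3 * t * q)))"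
    using main by (intro Liminf_mono always_eventually allI)
      (auto simp: nn_integral_eq_integral[OF b] intro!: ennreal_leI)
  also have "\<dots> = ennreal (exp (3 * t * q))" by (simp add: Liminf_const)
  finally show ?thesis .
qed

end

section \<open>Quadratic growth and the difference of two functionals\<close>

lemma sinh_lower: "0 \<le> a \<Longrightarrow> 2 * a \<le> exp a - exp (- a::real)"
proof -
  assume a: "0 \<le> a"
  define X where "X = 1 + a + a\<^sup>2 / 2"
  have X: "1 \<le> X" "X \<le> exp a"
    using a exp_lower_Taylor_quadratic[OF a] by (auto simp: X_def)
  have "2 * a * X + 1 \<le> X * X"
  proof -
    have "X * X - 2 * a * X - 1 = (a\<^sup>2)\<^sup>2 / 4"
      by (simp add: X_def power2_eq_square field_simps)
    moreover have "0 \<le> (a\<^sup>2)\<^sup>2 / 4" by simp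
    ultimately show ?thesis by linarith
  qed
  then have "2 * a \<le> X - 1 / X" using X by (simp add: field_simps)
  also have "\<dots> \<le> exp a - 1 / exp a"
    using X by (intro diff_mono divide_left_mono) auto
  finally show ?thesis by (simp add: exp_minus divide_inverse)
qed

text \<open>Squaring the bound for the hyperbolic sine at \<open>y / 2\<close> keeps the sharp
  quadratic term; with it a bound on exponential moments yields a second moment without loss in the
  constant.\<close>

lemma cosh_lower: "y\<^sup>2 + 2 \<le> exp y + exp (- y::real)"
proof -
  have "y\<^sup>2 + 2 \<le> exp y + exp (- y)" if "0 \<le> y" for y :: real
  proof -
    have "(2 * (y / 2))\<^sup>2 \<le> (exp (y / 2) - exp (- (y / 2)))\<^sup>2"
      using that sinh_lower[of "y / 2"] by (intro power_mono) auto
    also have "\<dots> = exp y + exp (- y) - 2"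
    proof -
      have "exp (y / 2) * exp (y / 2) = exp y" "exp (- (y / 2)) * exp (- (y / 2)) = exp (- y)"
        "exp (y / 2) * exp (- (y / 2)) = 1"
        by (simp_all add: exp_add[symmetric])
      moreover have "(u - v)\<^sup>2 = u * u + v * v - 2 * (u * v)" for u v :: real
        by (simp add: power2_eq_square algebra_simps)
      ultimately show ?thesis by simp
    qed
    finally show ?thesis by simp
  qed
  from this[of y] this[of "- y"] show ?thesis by (cases "0 \<le> y") (auto simp: add.commute)
qed

text \<open>Adding the bounds at \<open>t\<close> and \<open>- t\<close> gives
  \<open>t\<^sup>2 E Z\<^sup>2 \<le> 2 (exp (\<kappa> t\<^sup>2) - 1)\<close>; dividing by
  \<open>t\<^sup>2\<close> and letting \<open>t\<close> tend to 0 leaves \<open>2 \<kappa>\<close>,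
  whatever the radius \<open>\<tau>\<close>.\<close>

lemma (in prob_space) subgaussian_second_moment:
  fixes Z :: "'a \<Rightarrow> real"
  assumes [measurable]: "Z \<in> borel_measurable M" and "0 < \<tau>" "0 \<le> \<kappa>"
    and sg: "\<And>t. \<bar>t\<bar> \<le> \<tau> \<Longrightarrow> (\<integral>\<^sup>+x. ennreal (exp (t * Z x)) \<partial>M) \<le> ennreal (exp (\<kappa> * t\<^sup>2))"
  shows "integrable M (\<lambda>x. (Z x)\<^sup>2)" "(\<integral>x. (Z x)\<^sup>2 \<partial>M) \<le> 2 * \<kappa>"
proof -
  have ie: "integrable M (\<lambda>x. exp (t * Z x))" "(\<integral>x. exp (t * Z x) \<partial>M) \<le> exp (\<kappa> * t\<^sup>2)" if "\<bar>t\<bar> \<le> \<tau>" for t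
  proof -
    show i: "integrable M (\<lambda>x. exp (t * Z x))"
      using sg[OF that] by (intro integrableI_bounded) (auto intro: order_le_less_trans)
    show "(\<integral>x. exp (t * Z x) \<partial>M) \<le> exp (\<kappa> * t\<^sup>2)"
      using sg[OF that] nn_integral_eq_integral[OF i] by (simp add: ennreal_le_iff)
  qed
  have pt: "t\<^sup>2 * (Z x)\<^sup>2 \<le> exp (t * Z x) + exp ((- t) * Z x) - 2" for t x
    using cosh_lower[of "t * Z x"] by (simp add: power_mult_distrib)
  have "integrable M (\<lambda>x. \<tau>\<^sup>2 * (Z x)\<^sup>2)"
  proof (rule Bochner_Integration.integrable_bound[where f="\<lambda>x. exp (\<tau> * Z x) + exp ((- \<tau>) * Z x)"])
    show "integrable M (\<lambda>x. exp (\<tau> * Z x) + exp ((- \<tau>) * Z x))"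
      using \<open>0 < \<tau>\<close> by (intro Bochner_Integration.integrable_add ie) auto
    show "AE x in M. norm (\<tau>\<^sup>2 * (Z x)\<^sup>2) \<le> norm (exp (\<tau> * Z x) + exp ((- \<tau>) * Z x))"
    proof (rule AE_I2)
      fix x
      have "norm (\<tau>\<^sup>2 * (Z x)\<^sup>2) = \<tau>\<^sup>2 * (Z x)\<^sup>2" by simp
      also have "\<dots> \<le> exp (\<tau> * Z x) + exp ((- \<tau>) * Z x)" using pt[of \<tau> x] by linarith
      also have "\<dots> \<le> norm (exp (\<tau> * Z x) + exp ((- \<tau>) * Z x))" by simp
      finally show "norm (\<tau>\<^sup>2 * (Z x)\<^sup>2) \<le> norm (exp (\<tau> * Z x) + exp ((- \<tau>) * Z x))" .
    qed
  qed simp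
  then show i: "integrable M (\<lambda>x. (Z x)\<^sup>2)" using \<open>0 < \<tau>\<close> by simp
  have bound: "(\<integral>x. (Z x)\<^sup>2 \<partial>M) \<le> 2 * \<kappa> * exp (\<kappa> * t\<^sup>2)" if "0 < t" "t \<le> \<tau>" for t
  proof -
    have "t\<^sup>2 * (\<integral>x. (Z x)\<^sup>2 \<partial>M) = (\<integral>x. t\<^sup>2 * (Z x)\<^sup>2 \<partial>M)" by simp
    also have "\<dots> \<le> (\<integral>x. exp (t * Z x) + exp ((- t) * Z x) - 2 \<partial>M)"
      using that i by (intro integral_mono pt Bochner_Integration.integrable_diff Bochner_Integration.integrable_add ie) auto
    also have "\<dots> = (\<integral>x. exp (t * Z x) \<partial>M) + (\<integral>x. exp ((- t) * Z x) \<partial>M) - 2"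
    proof -
      have "integrable M (\<lambda>x. exp (t * Z x))" "integrable M (\<lambda>x. exp ((- t) * Z x))"
        using ie(1)[of t] ie(1)[of "- t"] that by simp_all
      then show ?thesis by (simp add: prob_space)
    qed
    also have "\<dots> \<le> exp (\<kappa> * t\<^sup>2) + exp (\<kappa> * (- t)\<^sup>2) - 2"
      using that by (intro diff_right_mono add_mono ie) auto
    also have "\<dots> = 2 * (exp (\<kappa> * t\<^sup>2) - 1)" by simp
    also have "\<dots> \<le> 2 * (\<kappa> * t\<^sup>2 * exp (\<kappa> * t\<^sup>2))"
      using abs_exp_minus_one_le[of "\<kappa> * t\<^sup>2"] \<open>0 \<le> \<kappa>\<close> by simp
    finally have "t\<^sup>2 * (\<integral>x. (Z x)\<^sup>2 \<partial>M) \<le> t\<^sup>2 * (2 * \<kappa> * exp (\<kappa> * t\<^sup>2))" by (simp add: mult_ac)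
    then show ?thesis using that by simp
  qed
  have "((\<lambda>t. 2 * \<kappa> * exp (\<kappa> * t\<^sup>2)) \<longlongrightarrow> 2 * \<kappa> * exp (\<kappa> * 0\<^sup>2)) (at_right 0)"
    by (intro tendsto_intros)
  moreover have "\<forall>\<^sub>F t in at_right 0. (\<integral>x. (Z x)\<^sup>2 \<partial>M) \<le> 2 * \<kappa> * exp (\<kappa> * t\<^sup>2)"
    using \<open>0 < \<tau>\<close> bound by (auto simp: eventually_at_right_field intro!: exI[of _ \<tau>])
  ultimately show "(\<integral>x. (Z x)\<^sup>2 \<partial>M) \<le> 2 * \<kappa>"
    using tendsto_lowerbound by fastforce
qed

text \<open>\<open>N\<close> bounds the norm of the block operator from l2 over \<open>J\<close> to
  l2 over \<open>K\<close> whose entries are the maps \<open>L k j\<close>.\<close>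

definition op_bound :: "'k set \<Rightarrow> 'i set \<Rightarrow> ('k \<Rightarrow> 'i \<Rightarrow> 'a::euclidean_space \<Rightarrow> 'e::euclidean_space) \<Rightarrow> real \<Rightarrow> bool" where
  "op_bound K J L N \<longleftrightarrow> (\<forall>u. (\<Sum>k\<in>K. (norm (\<Sum>j\<in>J. L k j (u j)))\<^sup>2) \<le> N\<^sup>2 * (\<Sum>j\<in>J. (norm (u j))\<^sup>2))"

text \<open>An operator and its adjoint have the same norm. The bound is tested on \<open>u\<close>,
  the adjoint applied to \<open>v\<close>; Young's inequality weighted by \<open>N\<^sup>2\<close>
  leaves only half of \<open>?U\<close> on the right.\<close>

lemma op_bound_adjoint:
  assumes op: "op_bound K J L N" and lin: "\<And>k j. linear (L k j)" and "0 < N"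
  shows "(\<Sum>j\<in>J. (norm (\<Sum>k\<in>K. adjoint (L k j) (v k)))\<^sup>2) \<le> N\<^sup>2 * (\<Sum>k\<in>K. (norm (v k))\<^sup>2)"
proof -
  define u where "u j = (\<Sum>k\<in>K. adjoint (L k j) (v k))" for j
  define a where "a k = (\<Sum>j\<in>J. L k j (u j))" for k
  let ?U = "\<Sum>j\<in>J. (norm (u j))\<^sup>2" and ?V = "\<Sum>k\<in>K. (norm (v k))\<^sup>2"
  have ineq: "p * q \<le> (p\<^sup>2 + q\<^sup>2) / 2" for p q :: real
    using sum_squares_bound[of p q] by simp
  have "?U = (\<Sum>j\<in>J. \<Sum>k\<in>K. L k j (u j) \<bullet> v k)"
    by (simp add: power2_norm_eq_inner inner_sum_right adjoint_works[OF lin] u_def)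
  also have "\<dots> = (\<Sum>k\<in>K. a k \<bullet> v k)"
    by (subst sum.swap) (simp add: a_def inner_sum_left)
  also have "\<dots> \<le> (\<Sum>k\<in>K. ((norm (a k))\<^sup>2 / N\<^sup>2 + N\<^sup>2 * (norm (v k))\<^sup>2) / 2)"
  proof (rule sum_mono)
    fix k
    have "a k \<bullet> v k \<le> norm (a k) * norm (v k)" by (rule norm_cauchy_schwarz)
    also have "\<dots> = norm (a k) / N * (N * norm (v k))" using \<open>0 < N\<close> by simp
    also have "\<dots> \<le> ((norm (a k) / N)\<^sup>2 + (N * norm (v k))\<^sup>2) / 2"
      by (rule ineq)
    finally show "a k \<bullet> v k \<le> ((norm (a k))\<^sup>2 / N\<^sup>2 + N\<^sup>2 * (norm (v k))\<^sup>2) / 2"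
      by (simp add: power_divide power_mult_distrib)
  qed
  also have "\<dots> = ((\<Sum>k\<in>K. (norm (a k))\<^sup>2) / N\<^sup>2 + N\<^sup>2 * ?V) / 2"
    by (simp add: sum.distrib sum_divide_distrib[symmetric] sum_distrib_left[symmetric])
  finally have "?U \<le> ((\<Sum>k\<in>K. (norm (a k))\<^sup>2) / N\<^sup>2 + N\<^sup>2 * ?V) / 2" .
  moreover have "(\<Sum>k\<in>K. (norm (a k))\<^sup>2) / N\<^sup>2 \<le> ?U"
    using op[unfolded op_bound_def, rule_format, of u] \<open>0 < N\<close>
    by (simp add: a_def divide_le_eq mult.commute)
  moreover have "x \<le> y" if "x \<le> (z + y) / 2" "z \<le> x" for x y z :: real using that by (simp add: field_simps)
  ultimately have "?U \<le> N\<^sup>2 * ?V" by blast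
  then show ?thesis by (simp add: u_def)
qed

lemma coord_gradient_sum:
  fixes \<Phi> :: "'k \<Rightarrow> ('i \<Rightarrow> 'a::euclidean_space) \<Rightarrow> real"
  assumes "\<And>k. k \<in> K \<Longrightarrow> coord_gradient J (\<Phi> k) (G k)"
  shows "coord_gradient J (\<lambda>w. \<Sum>k\<in>K. \<Phi> k w) (\<lambda>j w. \<Sum>k\<in>K. G k j w)"
  using assms unfolding coord_gradient_def gderiv_def
  by (auto intro!: borel_measurable_sum has_derivative_sum continuous_on_sum simp: inner_sum_right)

lemma coord_gradient_diff:
  assumes "coord_gradient J \<Phi> G" "coord_gradient J \<Psi> H"
  shows "coord_gradient J (\<lambda>w. \<Phi> w - \<Psi> w) (\<lambda>j w. G j w - H j w)"
  using assms unfolding coord_gradient_def gderiv_def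
  by (auto intro!: borel_measurable_diff has_derivative_diff continuous_on_diff simp: inner_diff_right)

lemma measurable_linear_combination:
  fixes l :: "'i \<Rightarrow> 'a::euclidean_space \<Rightarrow> 'e::euclidean_space"
  assumes "\<And>j. linear (l j)"
  shows "(\<lambda>w. \<Sum>j\<in>J. l j (w j)) \<in> borel_measurable (Pi\<^sub>M J (\<lambda>_. borel))"
proof (intro borel_measurable_sum)
  fix j assume "j \<in> J"
  have "l j \<in> borel_measurable borel"
    using assms by (intro borel_measurable_continuous_onI linear_continuous_on) (simp add: linear_conv_bounded_linear)
  then show "(\<lambda>w. l j (w j)) \<in> borel_measurable (Pi\<^sub>M J (\<lambda>_. borel))"
    using \<open>j \<in> J\<close> by measurable
qed

lemma coord_gradient_linear:
  fixes l :: "'i \<Rightarrow> 'a::euclidean_space \<Rightarrow> 'e::euclidean_space"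
  assumes "finite J" and lin: "\<And>j. linear (l j)" and grad: "\<And>x. GDERIV f x :> Df x" and cont: "continuous_on UNIV Df"
  shows "coord_gradient J (\<lambda>w. f (\<Sum>j\<in>J. l j (w j))) (\<lambda>j w. adjoint (l j) (Df (\<Sum>j\<in>J. l j (w j))))"
  unfolding coord_gradient_def
proof (intro conjI ballI allI)
  note [measurable] = measurable_linear_combination[of l J, OF lin]
  have fd: "(f has_derivative (\<lambda>h. h \<bullet> Df x)) (at x)" for x using grad[of x] by (simp add: gderiv_def)
  have "continuous_on UNIV f" by (rule has_derivative_continuous_on) (rule fd)
  then have [measurable]: "f \<in> borel_measurable borel" by (rule borel_measurable_continuous_onI)
  show "(\<lambda>w. f (\<Sum>j\<in>J. l j (w j))) \<in> borel_measurable (Pi\<^sub>M J (\<lambda>_. borel))" by measurable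
  fix j assume j: "j \<in> J"
  have la: "linear (adjoint (l j))" by (rule adjoint_linear[OF lin])
  have ca: "continuous_on A (adjoint (l j))" for A
    using la by (intro linear_continuous_on) (simp add: linear_conv_bounded_linear)
  have [measurable]: "adjoint (l j) \<in> borel_measurable borel" "Df \<in> borel_measurable borel"
    by (intro borel_measurable_continuous_onI ca cont)+
  show "(\<lambda>w. adjoint (l j) (Df (\<Sum>j\<in>J. l j (w j)))) \<in> borel_measurable (Pi\<^sub>M J (\<lambda>_. borel))" by measurable
  fix w
  define r where "r = (\<Sum>i\<in>J - {j}. l i (w i))"
  have split: "(\<Sum>i\<in>J. l i ((w(j := x)) i)) = l j x + r" for x
    using j \<open>finite J\<close> by (subst sum.remove[of J j]) (auto simp: r_def intro!: sum.cong)
  have d: "((\<lambda>x. l j x + r) has_derivative l j) (at x)" for x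
    using lin[of j] by (auto intro!: derivative_eq_intros bounded_linear_imp_has_derivative simp: linear_conv_bounded_linear)
  have "((\<lambda>x. f (l j x + r)) has_derivative (\<lambda>h. l j h \<bullet> Df (l j (w j) + r))) (at (w j))"
    using has_derivative_compose[OF d fd] .
  moreover have "l j (w j) + r = (\<Sum>i\<in>J. l i (w i))" using split[of "w j"] by (simp only: fun_upd_triv)
  ultimately show "gderiv (\<lambda>x. f (\<Sum>i\<in>J. l i ((w(j := x)) i))) (w j) (adjoint (l j) (Df (\<Sum>i\<in>J. l i (w i))))"
    unfolding gderiv_def split by (simp add: adjoint_works[OF lin])
  have "continuous_on UNIV (l j)" using lin[of j] by (intro linear_continuous_on) (simp add: linear_conv_bounded_linear)
  then show "continuous_on UNIV (\<lambda>x. adjoint (l j) (Df (\<Sum>i\<in>J. l i ((w(j := x)) i))))"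
    unfolding split by (intro continuous_on_compose2[OF ca[of UNIV]] continuous_on_compose2[OF cont] continuous_intros) auto
qed

locale C11_function =
  fixes f :: "'e::euclidean_space \<Rightarrow> real" and Df :: "'e \<Rightarrow> 'e" and \<Lambda> :: real
  assumes grad: "\<And>x. GDERIV f x :> Df x" and Lip: "\<Lambda>-lipschitz_on UNIV Df" and Lip_pos: "0 < \<Lambda>"
begin

lemma Df_diff: "norm (Df x - Df y) \<le> \<Lambda> * norm (x - y)"
  using lipschitz_onD[OF Lip, of x y] by (simp add: dist_norm)

lemma Df_growth: "norm (Df x) \<le> norm (Df 0) + \<Lambda> * norm x"
  using Df_diff[of x 0] norm_triangle_ineq2[of "Df x" "Df 0"] by simp

lemma Df_growth2: "(norm (Df x))\<^sup>2 \<le> 2 * (norm (Df 0))\<^sup>2 + 2 * \<Lambda>\<^sup>2 * (norm x)\<^sup>2"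
proof -
  have "(norm (Df x))\<^sup>2 \<le> (norm (Df 0) + \<Lambda> * norm x)\<^sup>2" by (intro power_mono Df_growth) simp
  also have "\<dots> \<le> 2 * (norm (Df 0))\<^sup>2 + 2 * \<Lambda>\<^sup>2 * (norm x)\<^sup>2"
    using sum_squares_bound[of "norm (Df 0)" "\<Lambda> * norm x"] by (simp add: power2_sum power_mult_distrib)
  finally show ?thesis .
qed

lemma Df_continuous: "continuous_on A Df"
  using lipschitz_on_continuous_on[OF Lip] continuous_on_subset by blast

text \<open>The mean value inequality on the ball of radius \<open>norm x + norm y\<close>, where
  the gradient is controlled by its linear growth.\<close>

lemma f_diff: "\<bar>f x - f y\<bar> \<le> (norm (Df 0) + \<Lambda> * (norm x + norm y)) * norm (x - y)"
proof -
  let ?S = "cball 0 (norm x + norm y) :: 'e set"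
  have "norm (f x - f y) \<le> (norm (Df 0) + \<Lambda> * (norm x + norm y)) * norm (x - y)"
  proof (rule differentiable_bound[of ?S f "\<lambda>z h. h \<bullet> Df z"])
    fix z assume z: "z \<in> ?S"
    show "(f has_derivative (\<lambda>h. h \<bullet> Df z)) (at z within ?S)"
      using grad[of z] by (simp add: gderiv_def has_derivative_at_withinI)
    have "norm (Df z) \<le> norm (Df 0) + \<Lambda> * (norm x + norm y)"
      using Df_growth[of z] z Lip_pos by (intro order_trans[OF Df_growth] add_left_mono mult_left_mono) auto
    then show "onorm (\<lambda>h. h \<bullet> Df z) \<le> norm (Df 0) + \<Lambda> * (norm x + norm y)"
      using Cauchy_Schwarz_ineq2[of _ "Df z"]
      by (intro onorm_le) (metis mult.commute mult_left_mono norm_ge_zero order_trans real_norm_def)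
  qed auto
  then show ?thesis by simp
qed

lemma f_measurable [measurable]: "f \<in> borel_measurable borel"
proof -
  have "continuous_on UNIV f"
    by (rule has_derivative_continuous_on) (use grad in \<open>simp add: gderiv_def\<close>)
  then show ?thesis by (rule borel_measurable_continuous_onI)
qed

lemma f_growth: "\<bar>f x\<bar> \<le> (\<bar>f 0\<bar> + norm (Df 0)) + (norm (Df 0) + \<Lambda>) * (norm x)\<^sup>2"
proof -
  have n: "norm x \<le> 1 + (norm x)\<^sup>2"
    using sum_squares_bound[of "norm x" 1] by (smt (verit) norm_ge_zero one_power2)
  have "\<bar>f x\<bar> \<le> \<bar>f 0\<bar> + norm (Df 0) * norm x + \<Lambda> * (norm x)\<^sup>2"
    using f_diff[of x 0] by (simp add: distrib_right power2_eq_square)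
  also have "norm (Df 0) * norm x \<le> norm (Df 0) * (1 + (norm x)\<^sup>2)" using n by (intro mult_left_mono) auto
  finally show ?thesis by (simp add: algebra_simps)
qed

lemma (in prob_space) C11_integrable:
  assumes "C11_function f Df \<Lambda>" and [measurable]: "V \<in> borel_measurable M" and "integrable M (\<lambda>x. (norm (V x))\<^sup>2)"
  shows "integrable M (\<lambda>x. f (V x))"
proof -
  interpret C11_function f Df \<Lambda> by fact
  show ?thesis
  proof (rule Bochner_Integration.integrable_bound[where f="\<lambda>x. (\<bar>f 0\<bar> + norm (Df 0)) + (norm (Df 0) + \<Lambda>) * (norm (V x))\<^sup>2"])
    show "AE x in M. norm (f (V x)) \<le> norm ((\<bar>f 0\<bar> + norm (Df 0)) + (norm (Df 0) + \<Lambda>) * (norm (V x))\<^sup>2)"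
      using f_growth Lip_pos by (intro AE_I2) (smt (verit) real_norm_def)
  qed (use assms(3) in auto)
qed

end

locale lsi_product_centered = lsi_product \<mu> C J
  for \<mu> :: "'a::euclidean_space measure" and C :: real and J :: "'i set" +
  assumes mean_integrable: "integrable \<mu> (\<lambda>x. x)" and mean_zero: "(\<integral>x. x \<partial>\<mu>) = 0"
begin

abbreviation lin_comb :: "('i \<Rightarrow> 'a \<Rightarrow> 'e::euclidean_space) \<Rightarrow> ('i \<Rightarrow> 'a) \<Rightarrow> 'e" where
  "lin_comb l w \<equiv> (\<Sum>j\<in>J. l j (w j))"

lemma integral_linear_comb:
  fixes l :: "'i \<Rightarrow> 'a \<Rightarrow> 'e::euclidean_space"
  assumes lin: "\<And>j. linear (l j)"
  shows "integrable P (lin_comb l)" "(\<integral>w. lin_comb l w \<partial>P) = 0"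
proof -
  have bl: "bounded_linear (l j)" for j using lin by (simp add: linear_conv_bounded_linear)
  have "integrable P (\<lambda>w. l j (w j)) \<and> (\<integral>w. l j (w j) \<partial>P) = 0" if j: "j \<in> J" for j
  proof -
    have d: "distr P \<mu> (\<lambda>w. w j) = \<mu>" using distr_PiM_component[of J "\<lambda>_. \<mu>" j] prob j by simp
    have m: "(\<lambda>w. w j) \<in> P \<rightarrow>\<^sub>M \<mu>" using j by measurable
    have i: "integrable \<mu> (l j)" using integrable_bounded_linear[OF bl mean_integrable] .
    have "integrable P (\<lambda>w. l j (w j))"
      using i by (subst (asm) d[symmetric]) (simp add: integrable_distr_eq[OF m] borel_measurable_integrable[OF i])
    moreover have "(\<integral>w. l j (w j) \<partial>P) = (\<integral>x. l j x \<partial>\<mu>)"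
      by (subst (2) d[symmetric]) (simp add: integral_distr[OF m] borel_measurable_integrable[OF i])
    moreover have "(\<integral>x. l j x \<partial>\<mu>) = l j (\<integral>x. x \<partial>\<mu>)"
      by (rule integral_bounded_linear[OF bl mean_integrable])
    ultimately show ?thesis using mean_zero linear_0[OF lin] by simp
  qed
  then show "integrable P (lin_comb l)" "(\<integral>w. lin_comb l w \<partial>P) = 0" by auto
qed

text \<open>A coordinate of a linear form has constant gradient, of norm at most \<open>N\<close> by
  the adjoint bound; so it is subgaussian with constant \<open>C * N\<^sup>2\<close>, and its second
  moment is at most twice that. Summing over a basis gives the dimension factor.\<close>

lemma second_moment:
  fixes L :: "'k \<Rightarrow> 'i \<Rightarrow> 'a \<Rightarrow> 'e::euclidean_space"
  assumes "finite K" and lin: "\<And>k j. linear (L k j)" and op: "op_bound K J L N" and "0 < N" and k: "k \<in> K"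
  shows "integrable P (\<lambda>w. (norm (lin_comb (L k) w))\<^sup>2)"
    "(\<integral>w. (norm (lin_comb (L k) w))\<^sup>2 \<partial>P) \<le> DIM('e) * (2 * (C * N\<^sup>2))"
proof -
  have comp: "integrable P (\<lambda>w. (lin_comb (L k) w \<bullet> b)\<^sup>2) \<and> (\<integral>w. (lin_comb (L k) w \<bullet> b)\<^sup>2 \<partial>P) \<le> 2 * (C * N\<^sup>2)"
    if b: "b \<in> Basis" for b
  proof -
    let ?Z = "\<lambda>w. lin_comb (L k) w \<bullet> b"
    have gd: "GDERIV (\<lambda>x. x \<bullet> b) x :> b" for x :: 'e
      unfolding gderiv_def by (auto intro!: derivative_eq_intros)
    have cg: "coord_gradient J ?Z (\<lambda>j w. adjoint (L k j) b)"
      by (rule coord_gradient_linear[OF finite_J lin gd]) simp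
    have int: "integrable P ?Z" "(\<integral>w. ?Z w \<partial>P) = 0"
      using integral_linear_comb[of "L k", OF lin] by auto
    have "(\<Sum>j\<in>J. (norm (adjoint (L k j) b))\<^sup>2) \<le> N\<^sup>2"
    proof -
      have "(\<Sum>k'\<in>K. adjoint (L k' j) (if k' = k then b else 0)) = adjoint (L k j) b" for j
      proof -
        have "adjoint (L k' j) (if k' = k then b else 0) = (if k' = k then adjoint (L k j) b else 0)" for k'
          using linear_0[OF adjoint_linear[OF lin]] by simp
        then show ?thesis using k \<open>finite K\<close> by simp
      qed
      moreover have "(\<Sum>k'\<in>K. (norm (if k' = k then b else 0))\<^sup>2) = 1"
      proof -
        have "(norm (if k' = k then b else 0))\<^sup>2 = (if k' = k then 1 else 0)" for k' using b by simp
        then show ?thesis using k \<open>finite K\<close> by simp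
      qed
      ultimately show ?thesis
        using op_bound_adjoint[OF op lin \<open>0 < N\<close>, of "\<lambda>k'. if k' = k then b else 0"] by simp
    qed
    note R = this
    have sg: "(\<integral>\<^sup>+w. ennreal (exp (t * ?Z w)) \<partial>P) \<le> ennreal (exp (C * N\<^sup>2 * t\<^sup>2))" for t
    proof -
      \<comment> \<open>The gradient bound is deterministic, so every positive \<open>e\<close> is
        admissible; \<open>C * t\<^sup>2 + 1\<close> is large enough for the given
        \<open>t\<close>.\<close>
      have "(\<integral>\<^sup>+w. ennreal (exp (t * (?Z w - (\<integral>w. ?Z w \<partial>P)))) \<partial>P) \<le> ennreal (exp (C * N\<^sup>2 * t\<^sup>2))"
        using R C_pos
        by (intro concentration[OF cg, where R="\<lambda>_. N\<^sup>2" and e="C * t\<^sup>2 + 1"])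
          (auto simp: P.emeasure_space_1 int(1) add_nonneg_pos)
      then show ?thesis by (simp add: int(2))
    qed
    have "?Z \<in> borel_measurable P" using int(1) by simp
    from P.subgaussian_second_moment[OF this zero_less_one _ sg]
    show ?thesis using C_pos by (auto simp: mult.assoc)
  qed
  have eq: "(norm (lin_comb (L k) w))\<^sup>2 = (\<Sum>b\<in>Basis. (lin_comb (L k) w \<bullet> b)\<^sup>2)" for w
    unfolding power2_norm_eq_inner by (subst euclidean_inner) (simp add: power2_eq_square)
  show "integrable P (\<lambda>w. (norm (lin_comb (L k) w))\<^sup>2)"
    unfolding eq using comp by auto
  have "(\<integral>w. (norm (lin_comb (L k) w))\<^sup>2 \<partial>P) = (\<Sum>b\<in>Basis. \<integral>w. (lin_comb (L k) w \<bullet> b)\<^sup>2 \<partial>P)"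
    unfolding eq using comp by (subst Bochner_Integration.integral_sum) auto
  also have "\<dots> \<le> (\<Sum>b\<in>(Basis::'e set). 2 * (C * N\<^sup>2))" using comp by (intro sum_mono) auto
  finally show "(\<integral>w. (norm (lin_comb (L k) w))\<^sup>2 \<partial>P) \<le> DIM('e) * (2 * (C * N\<^sup>2))" by simp
qed

text \<open>The gradient of the sum of squares is twice the adjoint applied to the values, so its
  square is at most \<open>4 * N\<^sup>2\<close> times the sum itself: the self-bounding case with
  \<open>a = 4 * N\<^sup>2\<close>.\<close>

lemma exp_quadratic_form_bound:
  fixes L :: "'k \<Rightarrow> 'i \<Rightarrow> 'a \<Rightarrow> 'e::euclidean_space"
  assumes "finite K" and lin: "\<And>k j. linear (L k j)" and op: "op_bound K J L N" and "0 < N"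
    and t: "0 < t" "C * (4 * N\<^sup>2) * t \<le> 1"
  shows "(\<integral>\<^sup>+w. ennreal (exp (t * (\<Sum>k\<in>K. (norm (lin_comb (L k) w))\<^sup>2))) \<partial>P)
    \<le> ennreal (exp (3 * t * (card K * (DIM('e) * (2 * (C * N\<^sup>2))))))"
proof (rule exp_quadratic_bound[OF _ _ _ _ _ _ t])
  have gd: "GDERIV (\<lambda>x. (norm x)\<^sup>2) x :> 2 *\<^sub>R x" for x :: 'e
    unfolding gderiv_def power2_norm_eq_inner by (auto intro!: derivative_eq_intros simp: inner_commute)
  show "coord_gradient J (\<lambda>w. \<Sum>k\<in>K. (norm (lin_comb (L k) w))\<^sup>2)
      (\<lambda>j w. \<Sum>k\<in>K. adjoint (L k j) (2 *\<^sub>R lin_comb (L k) w))"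
    by (intro coord_gradient_sum coord_gradient_linear[OF finite_J lin gd] continuous_intros)
  show "(\<Sum>j\<in>J. (norm (\<Sum>k\<in>K. adjoint (L k j) (2 *\<^sub>R lin_comb (L k) w)))\<^sup>2)
      \<le> 4 * N\<^sup>2 * (\<Sum>k\<in>K. (norm (lin_comb (L k) w))\<^sup>2)" for w
    using op_bound_adjoint[OF op lin \<open>0 < N\<close>, of "\<lambda>k. 2 *\<^sub>R lin_comb (L k) w"]
    by (simp add: power_mult_distrib sum_distrib_left mult_ac)
  show "integrable P (\<lambda>w. \<Sum>k\<in>K. (norm (lin_comb (L k) w))\<^sup>2)"
    using second_moment(1)[OF assms(1-4)] by auto
  have "(\<integral>w. (\<Sum>k\<in>K. (norm (lin_comb (L k) w))\<^sup>2) \<partial>P) = (\<Sum>k\<in>K. \<integral>w. (norm (lin_comb (L k) w))\<^sup>2 \<partial>P)"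
    using second_moment(1)[OF assms(1-4)] by (intro Bochner_Integration.integral_sum)
  also have "\<dots> \<le> (\<Sum>k\<in>K. DIM('e) * (2 * (C * N\<^sup>2)))"
    by (intro sum_mono second_moment(2)[OF assms(1-4)])
  finally show "(\<integral>w. (\<Sum>k\<in>K. (norm (lin_comb (L k) w))\<^sup>2) \<partial>P) \<le> card K * (DIM('e) * (2 * (C * N\<^sup>2)))" by simp
qed (auto intro: sum_nonneg)

text \<open>The random gradient bound \<open>R\<close> consists of a constant and two quadratic
  forms in the noise, one with coefficient of order \<open>\<delta>\<^sup>2\<close> and operator
  norm \<open>N\<close>, the other with coefficient of order \<open>N\<^sup>2\<close> and operator
  norm \<open>\<delta>\<close>. This balance puts \<open>\<delta>\<^sup>2\<close> in front of the
  whole bound.\<close>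

lemma difference_concentration:
  fixes L L' :: "'k \<Rightarrow> 'i \<Rightarrow> 'a \<Rightarrow> 'e::euclidean_space"
  assumes C11: "C11_function f Df \<Lambda>" and "finite K"
    and lin: "\<And>k j. linear (L k j)" "\<And>k j. linear (L' k j)"
    and op: "op_bound K J L N" "op_bound K J L' N" "op_bound K J (\<lambda>k j x. L k j x - L' k j x) \<delta>"
    and pos: "0 < N" "0 < \<delta>" and t: "32 * C\<^sup>2 * N\<^sup>2 * \<delta>\<^sup>2 * (\<Lambda>\<^sup>2 + 1) * t\<^sup>2 \<le> 1"
  defines "D \<equiv> \<lambda>w. \<Sum>k\<in>K. f (lin_comb (L k) w) - f (lin_comb (L' k) w)"
  shows "(\<integral>\<^sup>+w. ennreal (exp (t * (D w - (\<integral>w. D w \<partial>P)))) \<partial>P)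
    \<le> ennreal (exp (C * (4 * (norm (Df 0))\<^sup>2 + 36 * C * DIM('e) * \<Lambda>\<^sup>2 * N\<^sup>2) * \<delta>\<^sup>2 * card K * t\<^sup>2))"
    and "integrable P D"
proof -
  interpret C11_function f Df \<Lambda> by fact
  define c0 where "c0 = norm (Df 0)"
  let ?X = "\<lambda>k w. lin_comb (L k) w" and ?X' = "\<lambda>k w. lin_comb (L' k) w"
  define \<Delta> where "\<Delta> k j x = L k j x - L' k j x" for k j x
  have lin\<Delta>: "linear (\<Delta> k j)" for k j
    unfolding \<Delta>_def by (intro linear_compose_sub lin)
  have op\<Delta>: "op_bound K J \<Delta> \<delta>" using op(3) by (simp add: \<Delta>_def[abs_def])
  have adj\<Delta>: "adjoint (\<Delta> k j) y = adjoint (L k j) y - adjoint (L' k j) y" for k j y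
  proof -
    have "x \<bullet> adjoint (\<Delta> k j) y = x \<bullet> (adjoint (L k j) y - adjoint (L' k j) y)" for x
      by (simp add: adjoint_works[OF lin\<Delta>] inner_diff_right adjoint_works[OF lin(1)] adjoint_works[OF lin(2)]
          \<Delta>_def inner_diff_left)
    then show ?thesis using vector_eq_ldot by blast
  qed
  have X\<Delta>: "lin_comb (\<Delta> k) w = ?X k w - ?X' k w" for k w
    by (simp add: \<Delta>_def sum_subtractf)
  define G where "G j w = (\<Sum>k\<in>K. adjoint (L k j) (Df (?X k w)) - adjoint (L' k j) (Df (?X' k w)))" for j w
  have cg: "coord_gradient J D G"
    unfolding D_def G_def[abs_def]
    by (intro coord_gradient_sum coord_gradient_diff coord_gradient_linear[OF finite_J] lin grad Df_continuous)
  define Q where "Q w = (\<Sum>k\<in>K. (norm (?X k w))\<^sup>2)" for w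
  define Q\<Delta> where "Q\<Delta> w = (\<Sum>k\<in>K. (norm (lin_comb (\<Delta> k) w))\<^sup>2)" for w
  \<comment> \<open>Splitting the gradient into two terms costs a factor 2, and separating the
    constant and quadratic parts of \<open>(norm (Df x))\<^sup>2\<close> costs another 2 in the
    first term: hence 4 in \<open>A\<close> and \<open>\<alpha>\<close>, and 2 in
    \<open>\<beta>\<close>.\<close>
  define A where "A = 4 * \<delta>\<^sup>2 * c0\<^sup>2 * card K"
  define \<alpha> where "\<alpha> = 4 * \<delta>\<^sup>2 * \<Lambda>\<^sup>2"
  define \<beta> where "\<beta> = 2 * N\<^sup>2 * \<Lambda>\<^sup>2"
  have \<alpha>\<beta>: "0 < \<alpha>" "0 < \<beta>" using pos Lip_pos by (auto simp: \<alpha>_def \<beta>_def)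
  define R where "R w = A + \<alpha> * Q w + \<beta> * Q\<Delta> w" for w
  have G_le: "(\<Sum>j\<in>J. (norm (G j w))\<^sup>2) \<le> R w" for w
  proof -
    let ?u = "\<lambda>j. \<Sum>k\<in>K. adjoint (\<Delta> k j) (Df (?X k w))"
    let ?v = "\<lambda>j. \<Sum>k\<in>K. adjoint (L' k j) (Df (?X k w) - Df (?X' k w))"
    have "G j w = ?u j + ?v j" for j
      by (simp add: G_def adj\<Delta> linear_diff[OF adjoint_linear[OF lin(2)]] flip: sum.distrib)
    then have "(norm (G j w))\<^sup>2 \<le> 2 * (norm (?u j))\<^sup>2 + 2 * (norm (?v j))\<^sup>2" for j
    proof -
      have "(norm (?u j + ?v j))\<^sup>2 \<le> (norm (?u j) + norm (?v j))\<^sup>2" by (intro power_mono norm_triangle_ineq) simp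
      also have "\<dots> \<le> 2 * (norm (?u j))\<^sup>2 + 2 * (norm (?v j))\<^sup>2"
        using sum_squares_bound[of "norm (?u j)" "norm (?v j)"] by (simp add: power2_sum)
      finally show ?thesis using \<open>G j w = ?u j + ?v j\<close> by simp
    qed
    then have "(\<Sum>j\<in>J. (norm (G j w))\<^sup>2) \<le> 2 * (\<Sum>j\<in>J. (norm (?u j))\<^sup>2) + 2 * (\<Sum>j\<in>J. (norm (?v j))\<^sup>2)"
      by (simp add: sum_mono sum_distrib_left flip: sum.distrib)
    also have "\<dots> \<le> 2 * (\<delta>\<^sup>2 * (\<Sum>k\<in>K. (norm (Df (?X k w)))\<^sup>2)) + 2 * (N\<^sup>2 * (\<Sum>k\<in>K. (norm (Df (?X k w) - Df (?X' k w)))\<^sup>2))"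
      by (intro add_mono mult_left_mono op_bound_adjoint[OF op\<Delta> lin\<Delta> pos(2)] op_bound_adjoint[OF op(2) lin(2) pos(1)]) auto
    also have "\<dots> \<le> 2 * (\<delta>\<^sup>2 * (\<Sum>k\<in>K. 2 * c0\<^sup>2 + 2 * \<Lambda>\<^sup>2 * (norm (?X k w))\<^sup>2)) + 2 * (N\<^sup>2 * (\<Sum>k\<in>K. \<Lambda>\<^sup>2 * (norm (lin_comb (\<Delta> k) w))\<^sup>2))"
    proof (intro add_mono mult_left_mono sum_mono)
      fix k
      show "(norm (Df (?X k w)))\<^sup>2 \<le> 2 * c0\<^sup>2 + 2 * \<Lambda>\<^sup>2 * (norm (?X k w))\<^sup>2"
        unfolding c0_def by (rule Df_growth2)
      have "(norm (Df (?X k w) - Df (?X' k w)))\<^sup>2 \<le> (\<Lambda> * norm (?X k w - ?X' k w))\<^sup>2"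
        by (intro power_mono Df_diff) simp
      then show "(norm (Df (?X k w) - Df (?X' k w)))\<^sup>2 \<le> \<Lambda>\<^sup>2 * (norm (lin_comb (\<Delta> k) w))\<^sup>2"
        by (simp only: X\<Delta> power_mult_distrib)
    qed auto
    also have "\<dots> = R w"
      by (simp add: R_def A_def \<alpha>_def \<beta>_def Q_def Q\<Delta>_def sum.distrib sum_distrib_left[symmetric] algebra_simps)
    finally show ?thesis .
  qed
  \<comment> \<open>The exponential moment of \<open>Q\<close> at exponent
    \<open>2 * e * \<alpha>\<close> demands
    \<open>C * (4 * N\<^sup>2) * (2 * e * \<alpha>) \<le> 1\<close>, which is where 32 comes from;
    the analogous condition for \<open>Q\<Delta>\<close> only has 16.\<close>
  define e where "e = 1 / (32 * C * N\<^sup>2 * \<delta>\<^sup>2 * (\<Lambda>\<^sup>2 + 1))"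
  have den: "0 < 32 * C * N\<^sup>2 * \<delta>\<^sup>2 * (\<Lambda>\<^sup>2 + 1)"
    using pos C_pos by (intro mult_pos_pos add_nonneg_pos) auto
  have e: "0 < e" using den by (simp add: e_def)
  have e\<Lambda>: "32 * C * N\<^sup>2 * \<delta>\<^sup>2 * \<Lambda>\<^sup>2 * e \<le> 1"
  proof -
    have "32 * C * N\<^sup>2 * \<delta>\<^sup>2 * \<Lambda>\<^sup>2 \<le> 32 * C * N\<^sup>2 * \<delta>\<^sup>2 * (\<Lambda>\<^sup>2 + 1)"
      using C_pos by (intro mult_left_mono) auto
    then show ?thesis
      unfolding e_def using den by (simp only: mult_1_right times_divide_eq_right divide_le_eq_1_pos)
  qed
  define d where "d = real DIM('e)"
  define q1 where "q1 = card K * (d * (2 * (C * N\<^sup>2)))"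
  define q2 where "q2 = card K * (d * (2 * (C * \<delta>\<^sup>2)))"
  \<comment> \<open>The two quadratic forms contribute 24 and 12 times \<open>C * d *
    \<Lambda>\<^sup>2 * N\<^sup>2 * \<delta>\<^sup>2 * card K\<close>, which add up to the constant
    36.\<close>
  define \<rho> where "\<rho> = (4 * c0\<^sup>2 + 36 * C * d * \<Lambda>\<^sup>2 * N\<^sup>2) * \<delta>\<^sup>2 * card K"
  have \<rho>: "0 \<le> \<rho>" using C_pos by (auto simp: \<rho>_def d_def intro!: mult_nonneg_nonneg add_nonneg_nonneg)
  have \<rho>_eq: "e * A + 3 * (2 * e * \<alpha>) * q1 / 2 + 3 * (2 * e * \<beta>) * q2 / 2 = e * \<rho>"
    by (simp add: A_def \<alpha>_def \<beta>_def q1_def q2_def \<rho>_def algebra_simps)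
  have Rm: "R \<in> borel_measurable (Pi\<^sub>M J (\<lambda>_. borel))" "Q \<in> borel_measurable (Pi\<^sub>M J (\<lambda>_. borel))"
    "Q\<Delta> \<in> borel_measurable (Pi\<^sub>M J (\<lambda>_. borel))"
    using measurable_linear_combination[of "L _" J, OF lin(1)] measurable_linear_combination[of "\<Delta> _" J, OF lin\<Delta>]
    unfolding R_def Q_def Q\<Delta>_def by measurable
  note [measurable] = measurable_P[OF Rm(1)] measurable_P[OF Rm(2)] measurable_P[OF Rm(3)]
  have b1: "(\<integral>\<^sup>+w. ennreal (exp (2 * e * \<alpha> * Q w)) \<partial>P) \<le> ennreal (exp (3 * (2 * e * \<alpha>) * q1))"
    unfolding Q_def q1_def d_def
    by (rule exp_quadratic_form_bound[OF \<open>finite K\<close> lin(1) op(1) pos(1)])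
      (use e \<alpha>\<beta> e\<Lambda> in \<open>auto simp: \<alpha>_def mult_ac\<close>)
  have b2: "(\<integral>\<^sup>+w. ennreal (exp (2 * e * \<beta> * Q\<Delta> w)) \<partial>P) \<le> ennreal (exp (3 * (2 * e * \<beta>) * q2))"
  proof -
    have "C * (4 * \<delta>\<^sup>2) * (2 * e * \<beta>) \<le> 32 * C * N\<^sup>2 * \<delta>\<^sup>2 * \<Lambda>\<^sup>2 * e"
    proof -
      have "C * (4 * \<delta>\<^sup>2) * (2 * e * \<beta>) = 16 * (C * N\<^sup>2 * \<delta>\<^sup>2 * \<Lambda>\<^sup>2 * e)"
        by (simp add: \<beta>_def)
      also have "\<dots> \<le> 32 * (C * N\<^sup>2 * \<delta>\<^sup>2 * \<Lambda>\<^sup>2 * e)"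
        using C_pos e by (intro mult_right_mono) auto
      finally show ?thesis by (simp add: mult.assoc)
    qed
    then have le1: "C * (4 * \<delta>\<^sup>2) * (2 * e * \<beta>) \<le> 1" using e\<Lambda> by linarith
    show ?thesis
      unfolding Q\<Delta>_def q2_def d_def
      by (rule exp_quadratic_form_bound[OF \<open>finite K\<close> lin\<Delta> op\<Delta> pos(2) _ le1]) (use e \<alpha>\<beta> in auto)
  qed
  have expR: "(\<integral>\<^sup>+w. ennreal (exp (e * R w)) \<partial>P) \<le> ennreal (exp (e * \<rho>))"
  proof -
    let ?p = "3 * (2 * e * \<alpha>) * q1" and ?q = "3 * (2 * e * \<beta>) * q2"
    \<comment> \<open>Young's inequality for the product of two exponentials, each normalized by its
      own bound, takes the place of Cauchy-Schwarz; this is why the exponents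
      \<open>e * \<alpha>\<close> and \<open>e * \<beta>\<close> are doubled.\<close>
    have am: "exp (e * R w) \<le> exp (e * \<rho>) / 2 * (exp (- ?p) * exp (2 * e * \<alpha> * Q w) + exp (- ?q) * exp (2 * e * \<beta> * Q\<Delta> w))" for w
    proof -
      let ?x = "2 * e * \<alpha> * Q w - ?p" and ?y = "2 * e * \<beta> * Q\<Delta> w - ?q"
      have "e * R w = e * \<rho> + (?x / 2 + ?y / 2)"
        unfolding \<rho>_eq[symmetric] R_def by (simp add: distrib_left diff_divide_distrib)
      then have "exp (e * R w) = exp (e * \<rho>) * (exp (?x / 2) * exp (?y / 2))"
        by (simp only: exp_add)
      moreover have "exp (e * \<rho>) * (exp (?x / 2) * exp (?y / 2)) \<le> exp (e * \<rho>) * (((exp (?x / 2))\<^sup>2 + (exp (?y / 2))\<^sup>2) / 2)"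
        using sum_squares_bound[of "exp (?x / 2)" "exp (?y / 2)"]
        by (intro mult_left_mono) (simp_all add: mult.assoc)
      moreover have "(exp (?x / 2))\<^sup>2 = exp (- ?p) * exp (2 * e * \<alpha> * Q w)"
        by (simp add: power2_eq_square exp_add[symmetric])
      moreover have "(exp (?y / 2))\<^sup>2 = exp (- ?q) * exp (2 * e * \<beta> * Q\<Delta> w)"
        by (simp add: power2_eq_square exp_add[symmetric])
      ultimately show ?thesis by simp
    qed
    have "(\<integral>\<^sup>+w. ennreal (exp (e * R w)) \<partial>P)
        \<le> (\<integral>\<^sup>+w. ennreal (exp (e * \<rho>) / 2) * (ennreal (exp (- ?p)) * ennreal (exp (2 * e * \<alpha> * Q w)) + ennreal (exp (- ?q)) * ennreal (exp (2 * e * \<beta> * Q\<Delta> w))) \<partial>P)"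
      using am by (intro nn_integral_mono) (simp add: ennreal_mult[symmetric] ennreal_plus[symmetric] ennreal_leI del: ennreal_plus)
    also have "\<dots> = ennreal (exp (e * \<rho>) / 2) * (ennreal (exp (- ?p)) * (\<integral>\<^sup>+w. ennreal (exp (2 * e * \<alpha> * Q w)) \<partial>P)
        + ennreal (exp (- ?q)) * (\<integral>\<^sup>+w. ennreal (exp (2 * e * \<beta> * Q\<Delta> w)) \<partial>P))"
      by (simp add: nn_integral_cmult nn_integral_add)
    also have "\<dots> \<le> ennreal (exp (e * \<rho>) / 2) * (ennreal (exp (- ?p)) * ennreal (exp ?p) + ennreal (exp (- ?q)) * ennreal (exp ?q))"
      by (intro mult_left_mono add_mono b1 b2) auto
    also have "\<dots> = ennreal (exp (e * \<rho>) / 2) * ennreal 2"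
      by (simp add: ennreal_mult[symmetric] exp_add[symmetric])
    also have "\<dots> = ennreal (exp (e * \<rho>))"
      by (subst ennreal_mult[symmetric]) auto
    finally show ?thesis .
  qed
  show int: "integrable P D"
    unfolding D_def
  proof (intro Bochner_Integration.integrable_sum Bochner_Integration.integrable_diff P.C11_integrable[OF C11])
    fix k assume k: "k \<in> K"
    show "?X k \<in> borel_measurable P" "?X' k \<in> borel_measurable P"
      by (intro measurable_P measurable_linear_combination lin)+
    show "integrable P (\<lambda>w. (norm (?X k w))\<^sup>2)" "integrable P (\<lambda>w. (norm (?X' k w))\<^sup>2)"
      by (intro second_moment(1)[OF \<open>finite K\<close> lin(1) op(1) pos(1) k] second_moment(1)[OF \<open>finite K\<close> lin(2) op(2) pos(1) k])+
  qed
  have "C * t\<^sup>2 \<le> e"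
  proof -
    have "C * t\<^sup>2 * (32 * C * N\<^sup>2 * \<delta>\<^sup>2 * (\<Lambda>\<^sup>2 + 1)) \<le> 1"
      using t by (simp add: power2_eq_square mult_ac)
    then show ?thesis using den by (simp add: e_def pos_le_divide_eq)
  qed
  from concentration[OF cg Rm(1) G_le e \<rho> expR int this]
  show "(\<integral>\<^sup>+w. ennreal (exp (t * (D w - (\<integral>w. D w \<partial>P)))) \<partial>P)
    \<le> ennreal (exp (C * (4 * (norm (Df 0))\<^sup>2 + 36 * C * DIM('e) * \<Lambda>\<^sup>2 * N\<^sup>2) * \<delta>\<^sup>2 * card K * t\<^sup>2))"
    by (simp add: \<rho>_def c0_def d_def mult.assoc)
qed

end

section \<open>Moving averages\<close>

locale iid_lsi = prob_space M
  for M :: "'w measure" and \<mu> :: "'a::euclidean_space measure" and \<xi> :: "'i \<Rightarrow> 'w \<Rightarrow> 'a" and C :: real +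
  assumes indep: "indep_vars (\<lambda>_. borel) \<xi> UNIV" and law: "\<And>i. distr M borel (\<xi> i) = \<mu>"
    and LSI: "log_sobolev_const \<mu> C" and C_positive: "0 < C"
    and \<xi>_integrable: "\<And>i. integrable M (\<xi> i)" and \<xi>_mean: "\<And>i. (\<integral>\<omega>. \<xi> i \<omega> \<partial>M) = 0"
begin

lemma \<xi>_measurable [measurable]: "\<xi> i \<in> borel_measurable M"
  using \<xi>_integrable[of i] by simp

lemma lsi_product_centered:
  assumes "finite J"
  shows "lsi_product_centered \<mu> C J"
proof (intro lsi_product_centered.intro lsi_product.intro lsi_product_centered_axioms.intro)
  have \<mu>: "\<mu> = distr M borel (\<xi> undefined)" using law by simp
  show "prob_space \<mu>" unfolding \<mu> by (rule prob_space_distr) simp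
  show "sets \<mu> = sets borel" unfolding \<mu> by simp
  show "integrable \<mu> (\<lambda>x. x)"
    unfolding \<mu> by (subst integrable_distr_eq) (simp_all add: \<xi>_integrable)
  show "(\<integral>x. x \<partial>\<mu>) = 0"
    unfolding \<mu> by (subst integral_distr) (simp_all add: \<xi>_mean)
qed (use LSI C_positive assms in auto)

lemma distr_PiM_finite:
  assumes "J \<noteq> {}"
  shows "distr M (Pi\<^sub>M J (\<lambda>_. borel)) (\<lambda>\<omega>. \<lambda>i\<in>J. \<xi> i \<omega>) = Pi\<^sub>M J (\<lambda>_. \<mu>)"
proof -
  have "indep_vars (\<lambda>_. borel) \<xi> J" using indep by (rule indep_vars_subset) simp
  then show ?thesis
    using assms by (subst (asm) indep_vars_iff_distr_eq_PiM) (simp_all add: law)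
qed

lemma restrict_measurable: "(\<lambda>\<omega>. \<lambda>i\<in>J. \<xi> i \<omega>) \<in> M \<rightarrow>\<^sub>M Pi\<^sub>M J (\<lambda>_. borel)"
  by (rule measurable_restrict) simp

lemma nn_integral_finite:
  assumes "J \<noteq> {}" "h \<in> borel_measurable (Pi\<^sub>M J (\<lambda>_. borel))"
  shows "(\<integral>\<^sup>+w. h w \<partial>Pi\<^sub>M J (\<lambda>_. \<mu>)) = (\<integral>\<^sup>+\<omega>. h (\<lambda>i\<in>J. \<xi> i \<omega>) \<partial>M)"
  unfolding distr_PiM_finite[OF assms(1), symmetric]
  using assms(2) restrict_measurable by (simp add: nn_integral_distr)

lemma integral_finite:
  fixes h :: "_ \<Rightarrow> real"
  assumes "J \<noteq> {}" "h \<in> borel_measurable (Pi\<^sub>M J (\<lambda>_. borel))"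
  shows "(\<integral>w. h w \<partial>Pi\<^sub>M J (\<lambda>_. \<mu>)) = (\<integral>\<omega>. h (\<lambda>i\<in>J. \<xi> i \<omega>) \<partial>M)"
    "integrable (Pi\<^sub>M J (\<lambda>_. \<mu>)) h \<longleftrightarrow> integrable M (\<lambda>\<omega>. h (\<lambda>i\<in>J. \<xi> i \<omega>))"
  unfolding distr_PiM_finite[OF assms(1), symmetric]
  using assms(2) restrict_measurable by (simp_all add: integral_distr integrable_distr_eq)

lemma partial_sum_square_integrable:
  fixes L :: "'k \<Rightarrow> 'i \<Rightarrow> 'a \<Rightarrow> 'e::euclidean_space"
  assumes "finite K" "\<And>k j. linear (L k j)" "finite J" "J \<noteq> {}" "op_bound K J L N" "0 < N" "k \<in> K"
  shows "integrable M (\<lambda>\<omega>. (norm (\<Sum>j\<in>J. L k j (\<xi> j \<omega>)))\<^sup>2)"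
proof -
  interpret lsi_product_centered \<mu> C J using \<open>finite J\<close> by (rule lsi_product_centered)
  have "integrable (Pi\<^sub>M J (\<lambda>_. \<mu>)) (\<lambda>w. (norm (\<Sum>j\<in>J. L k j (w j)))\<^sup>2)"
    by (rule second_moment(1)[OF assms(1,2,5,6,7)])
  moreover have "(\<lambda>w. (norm (\<Sum>j\<in>J. L k j (w j)))\<^sup>2) \<in> borel_measurable (Pi\<^sub>M J (\<lambda>_. borel))"
    using measurable_linear_combination[of "L k" J, OF assms(2)] by measurable
  ultimately have "integrable M (\<lambda>\<omega>. (norm (\<Sum>j\<in>J. L k j ((\<lambda>i\<in>J. \<xi> i \<omega>) j)))\<^sup>2)"
    using integral_finite(2)[OF \<open>J \<noteq> {}\<close>] by blast
  then show ?thesis by simp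
qed

text \<open>Convergence along finite sets of indices makes one such set serve all
  \<open>k \<in> K\<close> at once. Square integrability of the limit comes from that of a partial
  sum close to it.\<close>

lemma L2_sum_close:
  fixes L :: "'k \<Rightarrow> 'i \<Rightarrow> 'a \<Rightarrow> 'e::euclidean_space"
  assumes "finite K" "\<And>k j. linear (L k j)" "\<And>J. finite J \<Longrightarrow> op_bound K J L N" "0 < N"
    and V: "\<And>k. k \<in> K \<Longrightarrow> L2_sum M (\<lambda>j \<omega>. L k j (\<xi> j \<omega>)) (V k)" and "0 < h"
  shows "\<forall>\<^sub>F J in finite_subsets_at_top UNIV. finite J \<and> J \<noteq> {} \<and>
    (\<forall>k\<in>K. integrable M (\<lambda>\<omega>. (norm (V k \<omega> - (\<Sum>j\<in>J. L k j (\<xi> j \<omega>))))\<^sup>2) \<and>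
       integrable M (\<lambda>\<omega>. (norm (V k \<omega>))\<^sup>2) \<and>
       (\<integral>\<omega>. (norm (V k \<omega> - (\<Sum>j\<in>J. L k j (\<xi> j \<omega>))))\<^sup>2 \<partial>M) \<le> h)"
proof -
  have "\<forall>\<^sub>F J in finite_subsets_at_top UNIV. \<forall>k\<in>K.
      (\<integral>\<^sup>+\<omega>. ennreal ((norm (V k \<omega> - (\<Sum>j\<in>J. L k j (\<xi> j \<omega>))))\<^sup>2) \<partial>M) < ennreal h"
    using V \<open>0 < h\<close> \<open>finite K\<close> unfolding L2_sum_def
    by (intro eventually_ball_finite ballI) (auto intro!: order_tendstoD(2))
  moreover have "\<forall>\<^sub>F J in finite_subsets_at_top (UNIV::'i set). finite J \<and> J \<noteq> {}"
    by (auto simp: eventually_finite_subsets_at_top intro!: exI[of _ "{undefined}"])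
  ultimately show ?thesis
  proof eventually_elim
    case (elim J)
    have "integrable M (\<lambda>\<omega>. (norm (V k \<omega> - (\<Sum>j\<in>J. L k j (\<xi> j \<omega>))))\<^sup>2) \<and>
       integrable M (\<lambda>\<omega>. (norm (V k \<omega>))\<^sup>2) \<and>
       (\<integral>\<omega>. (norm (V k \<omega> - (\<Sum>j\<in>J. L k j (\<xi> j \<omega>))))\<^sup>2 \<partial>M) \<le> h" if k: "k \<in> K" for k
    proof -
      have [measurable]: "V k \<in> borel_measurable M" "\<And>j. (\<lambda>\<omega>. L k j (\<xi> j \<omega>)) \<in> borel_measurable M"
        using V[OF k] by (auto simp: L2_sum_def)
      let ?S = "\<lambda>\<omega>. \<Sum>j\<in>J. L k j (\<xi> j \<omega>)"
      have lt: "(\<integral>\<^sup>+\<omega>. ennreal ((norm (V k \<omega> - ?S \<omega>))\<^sup>2) \<partial>M) < ennreal h"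
        using elim k by blast
      have i: "integrable M (\<lambda>\<omega>. (norm (V k \<omega> - ?S \<omega>))\<^sup>2)"
        using lt by (intro integrableI_bounded) (auto intro: order_less_trans)
      have iS: "integrable M (\<lambda>\<omega>. (norm (?S \<omega>))\<^sup>2)"
        using elim k assms by (intro partial_sum_square_integrable) auto
      have "integrable M (\<lambda>\<omega>. (norm (V k \<omega>))\<^sup>2)"
      proof (rule Bochner_Integration.integrable_bound[where f="\<lambda>\<omega>. 2 * (norm (V k \<omega> - ?S \<omega>))\<^sup>2 + 2 * (norm (?S \<omega>))\<^sup>2"])
        show "AE \<omega> in M. norm ((norm (V k \<omega>))\<^sup>2) \<le> norm (2 * (norm (V k \<omega> - ?S \<omega>))\<^sup>2 + 2 * (norm (?S \<omega>))\<^sup>2)"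
        proof (rule AE_I2)
          fix \<omega>
          have "(norm (V k \<omega>))\<^sup>2 \<le> (norm (V k \<omega> - ?S \<omega>) + norm (?S \<omega>))\<^sup>2"
            using norm_triangle_ineq[of "V k \<omega> - ?S \<omega>" "?S \<omega>"] by (intro power_mono) auto
          also have "\<dots> \<le> 2 * (norm (V k \<omega> - ?S \<omega>))\<^sup>2 + 2 * (norm (?S \<omega>))\<^sup>2"
            using sum_squares_bound[of "norm (V k \<omega> - ?S \<omega>)" "norm (?S \<omega>)"] by (simp add: power2_sum)
          finally show "norm ((norm (V k \<omega>))\<^sup>2) \<le> norm (2 * (norm (V k \<omega> - ?S \<omega>))\<^sup>2 + 2 * (norm (?S \<omega>))\<^sup>2)" by simp
        qed
      qed (use i iS in auto)
      moreover have "(\<integral>\<omega>. (norm (V k \<omega> - ?S \<omega>))\<^sup>2 \<partial>M) \<le> h"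
        using lt \<open>0 < h\<close> nn_integral_eq_integral[OF i] by (simp add: ennreal_less_iff integral_nonneg_AE)
      ultimately show ?thesis using i by blast
    qed
    then show ?case using elim by blast
  qed
qed

text \<open>A weighted Young inequality: if \<open>x - y\<close> has L2 size \<open>h\<close> and
  \<open>x\<close> is bounded in L2, the difference of the values has L1 size of order
  \<open>h\<close>, in spite of the quadratic growth of \<open>f\<close>.\<close>

lemma (in C11_function) f_diff_split:
  assumes "0 < h"
  shows "\<bar>f x - f y\<bar> \<le> h / 2 * (norm (Df 0) + 2 * \<Lambda> * norm x)\<^sup>2 + (1 / (2 * h) + \<Lambda>) * (norm (x - y))\<^sup>2"
proof -
  let ?z = "norm (x - y)" and ?c = "norm (Df 0) + 2 * \<Lambda> * norm x"
  have "norm y \<le> norm x + ?z" by (metis norm_minus_commute norm_triangle_sub)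
  then have "\<Lambda> * norm y \<le> \<Lambda> * (norm x + ?z)" using Lip_pos by (intro mult_left_mono) auto
  then have "(norm (Df 0) + \<Lambda> * (norm x + norm y)) * ?z \<le> (?c + \<Lambda> * ?z) * ?z"
    by (intro mult_right_mono) (auto simp: algebra_simps)
  with f_diff[of x y] have "\<bar>f x - f y\<bar> \<le> ?c * ?z + \<Lambda> * ?z\<^sup>2"
    by (simp add: power2_eq_square algebra_simps)
  moreover have "?c * ?z \<le> h / 2 * ?c\<^sup>2 + 1 / (2 * h) * ?z\<^sup>2"
  proof -
    have "0 \<le> (h * ?c - ?z)\<^sup>2 / (2 * h)" using assms by simp
    also have "\<dots> = h / 2 * ?c\<^sup>2 + 1 / (2 * h) * ?z\<^sup>2 - ?c * ?z"
      using assms by (simp add: power2_eq_square field_simps)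
    finally show ?thesis by simp
  qed
  ultimately show ?thesis by (simp add: distrib_right)
qed

text \<open>The finite-dimensional bound depends on the index set \<open>J\<close> of the noise only
  through operator norms, which are bounded uniformly in \<open>J\<close>. The truncated functionals
  converge in L1, hence almost surely along a subsequence, and Fatou's lemma carries the bound over
  to the infinite sums.\<close>

lemma difference_concentration_L2:
  fixes L L' :: "'k \<Rightarrow> 'i \<Rightarrow> 'a \<Rightarrow> 'e::euclidean_space"
  assumes C11: "C11_function f Df \<Lambda>" and "finite K"
    and lin: "\<And>k j. linear (L k j)" "\<And>k j. linear (L' k j)"
    and op: "\<And>J. finite J \<Longrightarrow> op_bound K J L N" "\<And>J. finite J \<Longrightarrow> op_bound K J L' N"
      "\<And>J. finite J \<Longrightarrow> op_bound K J (\<lambda>k j x. L k j x - L' k j x) \<delta>"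
    and pos: "0 < N" "0 < \<delta>" and t: "32 * C\<^sup>2 * N\<^sup>2 * \<delta>\<^sup>2 * (\<Lambda>\<^sup>2 + 1) * t\<^sup>2 \<le> 1"
    and V: "\<And>k. k \<in> K \<Longrightarrow> L2_sum M (\<lambda>j \<omega>. L k j (\<xi> j \<omega>)) (V k)"
      "\<And>k. k \<in> K \<Longrightarrow> L2_sum M (\<lambda>j \<omega>. L' k j (\<xi> j \<omega>)) (V' k)"
  defines "D \<equiv> \<lambda>\<omega>. \<Sum>k\<in>K. f (V k \<omega>) - f (V' k \<omega>)"
  shows "integrable M D"
    and "(\<integral>\<^sup>+\<omega>. ennreal (exp (t * (D \<omega> - (\<integral>\<omega>. D \<omega> \<partial>M)))) \<partial>M)
    \<le> ennreal (exp (C * (4 * (norm (Df 0))\<^sup>2 + 36 * C * DIM('e) * \<Lambda>\<^sup>2 * N\<^sup>2) * \<delta>\<^sup>2 * card K * t\<^sup>2))"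
      (is "_ \<le> ennreal ?b")
proof -
  interpret f: C11_function f Df \<Lambda> by fact
  have [measurable]: "V k \<in> borel_measurable M" "V' k \<in> borel_measurable M" if "k \<in> K" for k
    using V[OF that] by (auto simp: L2_sum_def)
  have lm [measurable]: "(\<lambda>\<omega>. L k j (\<xi> j \<omega>)) \<in> borel_measurable M" "(\<lambda>\<omega>. L' k j (\<xi> j \<omega>)) \<in> borel_measurable M" if "k \<in> K" for k j
    using V[OF that] by (auto simp: L2_sum_def)
  define S where "S J k \<omega> = (\<Sum>j\<in>J. L k j (\<xi> j \<omega>))" for J k \<omega>
  define S' where "S' J k \<omega> = (\<Sum>j\<in>J. L' k j (\<xi> j \<omega>))" for J k \<omega>
  have Sm [measurable]: "S J k \<in> borel_measurable M" "S' J k \<in> borel_measurable M" if "k \<in> K" for J k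
    using lm[OF that] unfolding S_def S'_def by measurable
  define h where "h n = inverse (real (Suc n))" for n
  have h: "0 < h n" for n by (simp add: h_def)
  define close where "close n J \<longleftrightarrow> finite J \<and> J \<noteq> {} \<and> (\<forall>k\<in>K. integrable M (\<lambda>\<omega>. (norm (V k \<omega> - S J k \<omega>))\<^sup>2) \<and>
       integrable M (\<lambda>\<omega>. (norm (V k \<omega>))\<^sup>2) \<and> (\<integral>\<omega>. (norm (V k \<omega> - S J k \<omega>))\<^sup>2 \<partial>M) \<le> (h n)\<^sup>2) \<and>
     (\<forall>k\<in>K. integrable M (\<lambda>\<omega>. (norm (V' k \<omega> - S' J k \<omega>))\<^sup>2) \<and>
       integrable M (\<lambda>\<omega>. (norm (V' k \<omega>))\<^sup>2) \<and> (\<integral>\<omega>. (norm (V' k \<omega> - S' J k \<omega>))\<^sup>2 \<partial>M) \<le> (h n)\<^sup>2)" for n J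
  have ex: "\<exists>J. close n J" for n
  proof -
    have h2: "0 < (h n)\<^sup>2" using h[of n] by simp
    have "\<forall>\<^sub>F J in finite_subsets_at_top UNIV. finite J \<and> J \<noteq> {} \<and> (\<forall>k\<in>K. integrable M (\<lambda>\<omega>. (norm (V k \<omega> - S J k \<omega>))\<^sup>2) \<and>
       integrable M (\<lambda>\<omega>. (norm (V k \<omega>))\<^sup>2) \<and> (\<integral>\<omega>. (norm (V k \<omega> - S J k \<omega>))\<^sup>2 \<partial>M) \<le> (h n)\<^sup>2) \<and>
     (\<forall>k\<in>K. integrable M (\<lambda>\<omega>. (norm (V' k \<omega> - S' J k \<omega>))\<^sup>2) \<and>
       integrable M (\<lambda>\<omega>. (norm (V' k \<omega>))\<^sup>2) \<and> (\<integral>\<omega>. (norm (V' k \<omega> - S' J k \<omega>))\<^sup>2 \<partial>M) \<le> (h n)\<^sup>2)"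
    proof -
      note a = L2_sum_close[of K L N V, OF \<open>finite K\<close> lin(1) op(1) pos(1) V(1) h2]
      note b = L2_sum_close[of K L' N V', OF \<open>finite K\<close> lin(2) op(2) pos(1) V(2) h2]
      have "\<forall>\<^sub>F J in finite_subsets_at_top UNIV. finite J \<and> J \<noteq> {} \<and> (\<forall>k\<in>K. integrable M (\<lambda>\<omega>. (norm (V k \<omega> - S J k \<omega>))\<^sup>2) \<and>
         integrable M (\<lambda>\<omega>. (norm (V k \<omega>))\<^sup>2) \<and> (\<integral>\<omega>. (norm (V k \<omega> - S J k \<omega>))\<^sup>2 \<partial>M) \<le> (h n)\<^sup>2)"
        unfolding S_def by (rule a) auto
      moreover have "\<forall>\<^sub>F J in finite_subsets_at_top UNIV. finite J \<and> J \<noteq> {} \<and> (\<forall>k\<in>K. integrable M (\<lambda>\<omega>. (norm (V' k \<omega> - S' J k \<omega>))\<^sup>2) \<and>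
         integrable M (\<lambda>\<omega>. (norm (V' k \<omega>))\<^sup>2) \<and> (\<integral>\<omega>. (norm (V' k \<omega> - S' J k \<omega>))\<^sup>2 \<partial>M) \<le> (h n)\<^sup>2)"
        unfolding S'_def by (rule b) auto
      ultimately show ?thesis by eventually_elim blast
    qed
    then show ?thesis unfolding close_def by (rule eventually_happens'[OF finite_subsets_at_top_neq_bot])
  qed
  \<comment> \<open>One finite set serves both systems \<open>L\<close> and \<open>L'\<close>, with
    L2 error at most \<open>h n\<close> for every \<open>k\<close>.\<close>
  define J where "J n = (SOME J. close n J)" for n
  have "close n (J n)" for n unfolding J_def by (rule someI_ex[OF ex])
  then have J: "\<And>n. finite (J n)" "\<And>n. J n \<noteq> {}"
    and c1: "\<And>n k. k \<in> K \<Longrightarrow> integrable M (\<lambda>\<omega>. (norm (V k \<omega> - S (J n) k \<omega>))\<^sup>2)"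
      "\<And>k. k \<in> K \<Longrightarrow> integrable M (\<lambda>\<omega>. (norm (V k \<omega>))\<^sup>2)"
      "\<And>n k. k \<in> K \<Longrightarrow> (\<integral>\<omega>. (norm (V k \<omega> - S (J n) k \<omega>))\<^sup>2 \<partial>M) \<le> (h n)\<^sup>2"
    and c2: "\<And>n k. k \<in> K \<Longrightarrow> integrable M (\<lambda>\<omega>. (norm (V' k \<omega> - S' (J n) k \<omega>))\<^sup>2)"
      "\<And>k. k \<in> K \<Longrightarrow> integrable M (\<lambda>\<omega>. (norm (V' k \<omega>))\<^sup>2)"
      "\<And>n k. k \<in> K \<Longrightarrow> (\<integral>\<omega>. (norm (V' k \<omega> - S' (J n) k \<omega>))\<^sup>2 \<partial>M) \<le> (h n)\<^sup>2"
    unfolding close_def by blast+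
  show D: "integrable M D"
    unfolding D_def using c1(2) c2(2)
    by (intro Bochner_Integration.integrable_sum Bochner_Integration.integrable_diff C11_integrable[OF C11]) auto
  define Dn where "Dn n \<omega> = (\<Sum>k\<in>K. f (S (J n) k \<omega>) - f (S' (J n) k \<omega>))" for n \<omega>
  have sq: "integrable M (\<lambda>\<omega>. (norm (S (J n) k \<omega>))\<^sup>2)" "integrable M (\<lambda>\<omega>. (norm (S' (J n) k \<omega>))\<^sup>2)" if "k \<in> K" for n k
    unfolding S_def S'_def
    by (rule partial_sum_square_integrable[OF \<open>finite K\<close> lin(1) J op(1)[OF J(1)] pos(1) that],
        rule partial_sum_square_integrable[OF \<open>finite K\<close> lin(2) J op(2)[OF J(1)] pos(1) that])
  have Dn: "integrable M (Dn n)" for n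
    unfolding Dn_def using sq
    by (intro Bochner_Integration.integrable_sum Bochner_Integration.integrable_diff C11_integrable[OF C11]) auto
  have Dn_bound: "(\<integral>\<^sup>+\<omega>. ennreal (exp (t * (Dn n \<omega> - (\<integral>\<omega>. Dn n \<omega> \<partial>M)))) \<partial>M) \<le> ennreal ?b" for n
  proof -
    interpret l: lsi_product_centered \<mu> C "J n" using J(1) by (rule lsi_product_centered)
    let ?D = "\<lambda>w. \<Sum>k\<in>K. f (\<Sum>j\<in>J n. L k j (w j)) - f (\<Sum>j\<in>J n. L' k j (w j))"
    have m [measurable]: "?D \<in> borel_measurable (Pi\<^sub>M (J n) (\<lambda>_. borel))"
      using measurable_linear_combination[of "L _" "J n", OF lin(1)] measurable_linear_combination[of "L' _" "J n", OF lin(2)]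
      by measurable
    have ev: "?D (\<lambda>i\<in>J n. \<xi> i \<omega>) = Dn n \<omega>" for \<omega>
      by (simp add: Dn_def S_def S'_def)
    have "(\<integral>\<^sup>+w. ennreal (exp (t * (?D w - (\<integral>w. ?D w \<partial>Pi\<^sub>M (J n) (\<lambda>_. \<mu>))))) \<partial>Pi\<^sub>M (J n) (\<lambda>_. \<mu>)) \<le> ennreal ?b"
      by (rule l.difference_concentration(1)[OF C11 \<open>finite K\<close> lin op[OF J(1)] pos t])
    then show ?thesis
      unfolding integral_finite(1)[OF J(2) m] ev by (subst (asm) nn_integral_finite[OF J(2)]) (measurable, simp only: ev)
  qed
  have close_f: "(\<integral>\<omega>. \<bar>f (U \<omega>) - f (W \<omega>)\<bar> \<partial>M) \<le> h n / 2 * (\<integral>\<omega>. (norm (Df 0) + 2 * \<Lambda> * norm (U \<omega>))\<^sup>2 \<partial>M) + (1 / (2 * h n) + \<Lambda>) * (h n)\<^sup>2"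
    if [measurable]: "U \<in> borel_measurable M" "W \<in> borel_measurable M" and U: "integrable M (\<lambda>\<omega>. (norm (U \<omega>))\<^sup>2)"
      and W: "integrable M (\<lambda>\<omega>. (norm (W \<omega>))\<^sup>2)" and Z: "integrable M (\<lambda>\<omega>. (norm (U \<omega> - W \<omega>))\<^sup>2)" "(\<integral>\<omega>. (norm (U \<omega> - W \<omega>))\<^sup>2 \<partial>M) \<le> (h n)\<^sup>2" for U W n
  proof -
    have iU: "integrable M (\<lambda>\<omega>. (norm (Df 0) + 2 * \<Lambda> * norm (U \<omega>))\<^sup>2)"
    proof (rule Bochner_Integration.integrable_bound[where f="\<lambda>\<omega>. 2 * (norm (Df 0))\<^sup>2 + 2 * (2 * \<Lambda>)\<^sup>2 * (norm (U \<omega>))\<^sup>2"])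
      have "(x + y)\<^sup>2 \<le> 2 * x\<^sup>2 + 2 * y\<^sup>2" for x y :: real
        using sum_squares_bound[of x y] by (simp add: power2_sum)
      from this[of "norm (Df 0)" "2 * \<Lambda> * norm (U _)"]
      show "AE \<omega> in M. norm ((norm (Df 0) + 2 * \<Lambda> * norm (U \<omega>))\<^sup>2) \<le> norm (2 * (norm (Df 0))\<^sup>2 + 2 * (2 * \<Lambda>)\<^sup>2 * (norm (U \<omega>))\<^sup>2)"
        by (intro AE_I2) (simp add: power_mult_distrib mult.assoc)
    qed (use U in auto)
    have "(\<integral>\<omega>. \<bar>f (U \<omega>) - f (W \<omega>)\<bar> \<partial>M) \<le>
        (\<integral>\<omega>. h n / 2 * (norm (Df 0) + 2 * \<Lambda> * norm (U \<omega>))\<^sup>2 + (1 / (2 * h n) + \<Lambda>) * (norm (U \<omega> - W \<omega>))\<^sup>2 \<partial>M)"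
    proof (rule integral_mono)
      show "integrable M (\<lambda>\<omega>. \<bar>f (U \<omega>) - f (W \<omega>)\<bar>)"
        using U W by (intro integrable_abs Bochner_Integration.integrable_diff C11_integrable[OF C11]) auto
    qed (use iU Z f.f_diff_split[OF h] in auto)
    also have "\<dots> = h n / 2 * (\<integral>\<omega>. (norm (Df 0) + 2 * \<Lambda> * norm (U \<omega>))\<^sup>2 \<partial>M) + (1 / (2 * h n) + \<Lambda>) * (\<integral>\<omega>. (norm (U \<omega> - W \<omega>))\<^sup>2 \<partial>M)"
      using iU Z by simp
    also have "\<dots> \<le> h n / 2 * (\<integral>\<omega>. (norm (Df 0) + 2 * \<Lambda> * norm (U \<omega>))\<^sup>2 \<partial>M) + (1 / (2 * h n) + \<Lambda>) * (h n)\<^sup>2"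
      using Z h[of n] f.Lip_pos by (intro add_left_mono mult_left_mono) auto
    finally show ?thesis .
  qed
  define A where "A U = (\<integral>\<omega>. (norm (Df 0) + 2 * \<Lambda> * norm (U \<omega>))\<^sup>2 \<partial>M)" for U :: "'w \<Rightarrow> 'e"
  define c where "c n = (\<Sum>k\<in>K. (h n / 2 * A (V k) + (h n / 2 + \<Lambda> * (h n)\<^sup>2)) + (h n / 2 * A (V' k) + (h n / 2 + \<Lambda> * (h n)\<^sup>2)))" for n
  have hh: "(1 / (2 * h n) + \<Lambda>) * (h n)\<^sup>2 = h n / 2 + \<Lambda> * (h n)\<^sup>2" for n
    using h[of n] by (simp add: power2_eq_square field_simps)
  have L1: "(\<integral>\<omega>. norm (Dn n \<omega> - D \<omega>) \<partial>M) \<le> c n" for n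
  proof -
    let ?g = "\<lambda>k \<omega>. \<bar>f (V k \<omega>) - f (S (J n) k \<omega>)\<bar>" and ?g' = "\<lambda>k \<omega>. \<bar>f (V' k \<omega>) - f (S' (J n) k \<omega>)\<bar>"
    have gi: "integrable M (?g k)" "integrable M (?g' k)" if "k \<in> K" for k
      using that c1(2) c2(2) sq
      by (auto intro!: integrable_abs Bochner_Integration.integrable_diff C11_integrable[OF C11])
    have "(\<integral>\<omega>. norm (Dn n \<omega> - D \<omega>) \<partial>M) \<le> (\<integral>\<omega>. (\<Sum>k\<in>K. ?g k \<omega> + ?g' k \<omega>) \<partial>M)"
    proof (rule integral_mono)
      fix \<omega>
      have "norm (Dn n \<omega> - D \<omega>) \<le> (\<Sum>k\<in>K. norm ((f (S (J n) k \<omega>) - f (S' (J n) k \<omega>)) - (f (V k \<omega>) - f (V' k \<omega>))))"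
        unfolding Dn_def D_def sum_subtractf[symmetric] by (rule norm_sum)
      also have "\<dots> \<le> (\<Sum>k\<in>K. ?g k \<omega> + ?g' k \<omega>)"
        by (intro sum_mono) (simp only: real_norm_def; linarith)
      finally show "norm (Dn n \<omega> - D \<omega>) \<le> (\<Sum>k\<in>K. ?g k \<omega> + ?g' k \<omega>)" .
    qed (use Dn D gi in auto)
    also have "\<dots> = (\<Sum>k\<in>K. (\<integral>\<omega>. ?g k \<omega> \<partial>M) + (\<integral>\<omega>. ?g' k \<omega> \<partial>M))"
      using gi by (subst Bochner_Integration.integral_sum) auto
    also have "\<dots> \<le> c n"
      unfolding c_def A_def hh[symmetric]
      by (intro sum_mono add_mono close_f c1 c2 sq) auto
    finally show ?thesis .
  qed
  have "h \<longlonglongrightarrow> 0" unfolding h_def by (rule LIMSEQ_inverse_real_of_nat)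
  then have "c \<longlonglongrightarrow> (\<Sum>k\<in>K. (0 / 2 * A (V k) + (0 / 2 + \<Lambda> * 0\<^sup>2)) + (0 / 2 * A (V' k) + (0 / 2 + \<Lambda> * 0\<^sup>2)))"
    unfolding c_def[abs_def] by (intro tendsto_intros) auto
  then have c_lim: "c \<longlonglongrightarrow> 0" by simp
  have L1lim: "(\<lambda>n. \<integral>\<omega>. norm (Dn n \<omega> - D \<omega>) \<partial>M) \<longlonglongrightarrow> 0"
  proof (rule Lim_null_comparison[OF _ c_lim], intro always_eventually allI)
    fix n
    have "0 \<le> (\<integral>\<omega>. norm (Dn n \<omega> - D \<omega>) \<partial>M)" by (intro integral_nonneg_AE) auto
    then show "norm (\<integral>\<omega>. norm (Dn n \<omega> - D \<omega>) \<partial>M) \<le> c n" using L1[of n] by simp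
  qed
  obtain r where r: "strict_mono r" and ae: "AE \<omega> in M. (\<lambda>n. Dn (r n) \<omega> - D \<omega>) \<longlonglongrightarrow> 0"
    using tendsto_L1_AE_subseq[OF _ L1lim] Dn D by auto
  have Elim: "(\<lambda>n. \<integral>\<omega>. Dn n \<omega> \<partial>M) \<longlonglongrightarrow> (\<integral>\<omega>. D \<omega> \<partial>M)"
  proof (rule Lim_transform)
    show "(\<lambda>n. (\<integral>\<omega>. D \<omega> \<partial>M)) \<longlonglongrightarrow> (\<integral>\<omega>. D \<omega> \<partial>M)" by simp
    have "norm ((\<integral>\<omega>. Dn n \<omega> \<partial>M) - (\<integral>\<omega>. D \<omega> \<partial>M)) \<le> (\<integral>\<omega>. norm (Dn n \<omega> - D \<omega>) \<partial>M)" for n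
    proof -
      have "(\<integral>\<omega>. Dn n \<omega> \<partial>M) - (\<integral>\<omega>. D \<omega> \<partial>M) = (\<integral>\<omega>. Dn n \<omega> - D \<omega> \<partial>M)" using Dn D by simp
      then show ?thesis using integral_norm_bound[of M "\<lambda>\<omega>. Dn n \<omega> - D \<omega>"] by simp
    qed
    then show "(\<lambda>n. (\<integral>\<omega>. Dn n \<omega> \<partial>M) - (\<integral>\<omega>. D \<omega> \<partial>M)) \<longlonglongrightarrow> 0"
      by (intro Lim_null_comparison[OF _ L1lim] always_eventually) auto
  qed
  have [measurable]: "Dn n \<in> borel_measurable M" for n using Dn[of n] by simp
  have "(\<integral>\<^sup>+\<omega>. ennreal (exp (t * (D \<omega> - (\<integral>\<omega>. D \<omega> \<partial>M)))) \<partial>M)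
      = (\<integral>\<^sup>+\<omega>. liminf (\<lambda>n. ennreal (exp (t * (Dn (r n) \<omega> - (\<integral>\<omega>. Dn (r n) \<omega> \<partial>M))))) \<partial>M)"
  proof (rule nn_integral_cong_AE)
    show "AE \<omega> in M. ennreal (exp (t * (D \<omega> - (\<integral>\<omega>. D \<omega> \<partial>M)))) = liminf (\<lambda>n. ennreal (exp (t * (Dn (r n) \<omega> - (\<integral>\<omega>. Dn (r n) \<omega> \<partial>M)))))"
      using ae
    proof eventually_elim
      case (elim \<omega>)
      have "(\<lambda>n. (Dn (r n) \<omega> - D \<omega>) + D \<omega>) \<longlonglongrightarrow> 0 + D \<omega>" by (intro tendsto_intros elim)
      then have "(\<lambda>n. Dn (r n) \<omega>) \<longlonglongrightarrow> D \<omega>" by simp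
      moreover have "(\<lambda>n. \<integral>\<omega>. Dn (r n) \<omega> \<partial>M) \<longlonglongrightarrow> (\<integral>\<omega>. D \<omega> \<partial>M)"
        using LIMSEQ_subseq_LIMSEQ[OF Elim r] by (simp add: o_def)
      ultimately have "(\<lambda>n. ennreal (exp (t * (Dn (r n) \<omega> - (\<integral>\<omega>. Dn (r n) \<omega> \<partial>M))))) \<longlonglongrightarrow> ennreal (exp (t * (D \<omega> - (\<integral>\<omega>. D \<omega> \<partial>M))))"
        by (intro tendsto_intros)
      then show ?case by (intro lim_imp_Liminf[symmetric]) auto
    qed
  qed
  also have "\<dots> \<le> liminf (\<lambda>n. \<integral>\<^sup>+\<omega>. ennreal (exp (t * (Dn (r n) \<omega> - (\<integral>\<omega>. Dn (r n) \<omega> \<partial>M)))) \<partial>M)"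
    by (rule nn_integral_liminf) simp
  also have "\<dots> \<le> liminf (\<lambda>n. ennreal ?b)"
    using Dn_bound by (intro Liminf_mono always_eventually allI)
  also have "\<dots> = ennreal ?b" by (simp add: Liminf_const)
  finally show "(\<integral>\<^sup>+\<omega>. ennreal (exp (t * (D \<omega> - (\<integral>\<omega>. D \<omega> \<partial>M)))) \<partial>M) \<le> ennreal ?b" .
qed

end

section \<open>Cumulants of subgaussian sequences\<close>

definition centered :: "'w measure \<Rightarrow> ('w \<Rightarrow> real) \<Rightarrow> 'w \<Rightarrow> real" where
  "centered M Z \<omega> = Z \<omega> - (\<integral>\<omega>. Z \<omega> \<partial>M)"

definition cumulant :: "'w measure \<Rightarrow> ('w \<Rightarrow> real) \<Rightarrow> real \<Rightarrow> real" where
  "cumulant M Z t = ln (\<integral>\<omega>. exp (t * centered M Z \<omega>) \<partial>M)"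

text \<open>A local notion: the bound is asked for in the range
  \<open>\<bar>t\<bar> \<le> \<tau>\<close> only, since functionals of quadratic growth need not
  have exponential moments of all orders. Stated with the nonnegative integral, it contains the
  integrability of these exponentials.\<close>

definition subgaussian :: "'w measure \<Rightarrow> ('w \<Rightarrow> real) \<Rightarrow> real \<Rightarrow> real \<Rightarrow> bool" where
  "subgaussian M Z \<kappa> \<tau> \<longleftrightarrow> integrable M Z \<and>
     (\<forall>t. \<bar>t\<bar> \<le> \<tau> \<longrightarrow> (\<integral>\<^sup>+\<omega>. ennreal (exp (t * centered M Z \<omega>)) \<partial>M) \<le> ennreal (exp (\<kappa> * t\<^sup>2)))"

context prob_space
begin

lemma subgaussian_integrable_exp:
  assumes "subgaussian M Z \<kappa> \<tau>" "\<bar>t\<bar> \<le> \<tau>"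
  shows "integrable M (\<lambda>\<omega>. exp (t * centered M Z \<omega>))" "cumulant M Z t \<le> \<kappa> * t\<^sup>2"
proof -
  have [measurable]: "Z \<in> borel_measurable M" using assms(1) unfolding subgaussian_def by (auto intro: borel_measurable_integrable)
  have le: "(\<integral>\<^sup>+\<omega>. ennreal (exp (t * centered M Z \<omega>)) \<partial>M) \<le> ennreal (exp (\<kappa> * t\<^sup>2))"
    using assms by (simp add: subgaussian_def)
  show i: "integrable M (\<lambda>\<omega>. exp (t * centered M Z \<omega>))"
    using le unfolding centered_def by (intro integrableI_bounded) (auto intro: order_le_less_trans)
  have "(\<integral>\<omega>. exp (t * centered M Z \<omega>) \<partial>M) \<le> exp (\<kappa> * t\<^sup>2)"
    using le nn_integral_eq_integral[OF i] by (simp add: ennreal_le_iff)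
  moreover have "0 < (\<integral>\<omega>. exp (t * centered M Z \<omega>) \<partial>M)" by (rule expectation_pos[OF i]) simp
  ultimately show "cumulant M Z t \<le> \<kappa> * t\<^sup>2"
    unfolding cumulant_def by (metis ln_exp ln_le_cancel_iff exp_gt_zero)
qed

lemma subgaussian_variance:
  assumes sg: "subgaussian M Z \<kappa> \<tau>" and "0 < \<tau>" "0 \<le> \<kappa>"
  shows "integrable M (\<lambda>\<omega>. (centered M Z \<omega>)\<^sup>2)" "(\<integral>\<omega>. (centered M Z \<omega>)\<^sup>2 \<partial>M) \<le> 2 * \<kappa>"
proof -
  have "centered M Z \<in> borel_measurable M"
    using sg unfolding subgaussian_def centered_def[abs_def] by auto
  from subgaussian_second_moment[OF this assms(2,3)] sg
  show "integrable M (\<lambda>\<omega>. (centered M Z \<omega>)\<^sup>2)" "(\<integral>\<omega>. (centered M Z \<omega>)\<^sup>2 \<partial>M) \<le> 2 * \<kappa>"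
    by (auto simp: subgaussian_def)
qed

lemma centered_add: "integrable M X \<Longrightarrow> integrable M Y \<Longrightarrow>
    centered M (\<lambda>\<omega>. X \<omega> + Y \<omega>) \<omega> = centered M X \<omega> + centered M Y \<omega>"
  by (simp add: centered_def)

lemma centered_diff: "integrable M X \<Longrightarrow> integrable M Y \<Longrightarrow>
    centered M (\<lambda>\<omega>. X \<omega> - Y \<omega>) \<omega> = centered M X \<omega> - centered M Y \<omega>"
  by (simp add: centered_def)

lemma centered_add_const: "integrable M X \<Longrightarrow> centered M (\<lambda>\<omega>. X \<omega> + c) = centered M X"
  by (simp add: centered_def[abs_def] prob_space)

lemma centered_measurable: "integrable M X \<Longrightarrow> centered M X \<in> borel_measurable M"
  unfolding centered_def[abs_def] by auto

text \<open>Convexity of \<open>exp\<close>, applied to the two exponents after normalization by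
  their log-moments; integrating the pointwise inequality then gives total mass at most 1.\<close>

lemma Holder_exp:
  fixes A B :: "'a \<Rightarrow> real"
  assumes [measurable]: "A \<in> borel_measurable M" "B \<in> borel_measurable M" and \<theta>: "0 < \<theta>" "\<theta> < 1"
    and iA: "integrable M (\<lambda>x. exp (A x / \<theta>))" and iB: "integrable M (\<lambda>x. exp (B x / (1 - \<theta>)))"
  shows "integrable M (\<lambda>x. exp (A x + B x))"
    "ln (\<integral>x. exp (A x + B x) \<partial>M) \<le> \<theta> * ln (\<integral>x. exp (A x / \<theta>) \<partial>M) + (1 - \<theta>) * ln (\<integral>x. exp (B x / (1 - \<theta>)) \<partial>M)"
proof -
  define a where "a = ln (\<integral>x. exp (A x / \<theta>) \<partial>M)"
  define b where "b = ln (\<integral>x. exp (B x / (1 - \<theta>)) \<partial>M)"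
  have ea: "(\<integral>x. exp (A x / \<theta>) \<partial>M) = exp a" and eb: "(\<integral>x. exp (B x / (1 - \<theta>)) \<partial>M) = exp b"
    unfolding a_def b_def using expectation_pos[OF iA] expectation_pos[OF iB] by simp_all
  let ?g = "\<lambda>x. exp (\<theta> * a + (1 - \<theta>) * b) * (\<theta> * exp (- a) * exp (A x / \<theta>) + (1 - \<theta>) * exp (- b) * exp (B x / (1 - \<theta>)))"
  have pt: "exp (A x + B x) \<le> ?g x" for x
  proof -
    let ?u = "A x / \<theta> - a" and ?v = "B x / (1 - \<theta>) - b"
    have "exp (\<theta> * ?u + (1 - \<theta>) * ?v) \<le> \<theta> * exp ?u + (1 - \<theta>) * exp ?v"
      using convex_onD[OF exp_convex, of "1 - \<theta>" ?u ?v] \<theta> by simp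
    moreover have "A x + B x = (\<theta> * a + (1 - \<theta>) * b) + (\<theta> * ?u + (1 - \<theta>) * ?v)"
      using \<theta> by (simp add: right_diff_distrib)
    then have "exp (A x + B x) = exp (\<theta> * a + (1 - \<theta>) * b) * exp (\<theta> * ?u + (1 - \<theta>) * ?v)"
      by (simp only: exp_add)
    ultimately have "exp (A x + B x) \<le> exp (\<theta> * a + (1 - \<theta>) * b) * (\<theta> * exp ?u + (1 - \<theta>) * exp ?v)"
      by simp
    then show ?thesis by (simp only: exp_diff exp_minus divide_inverse mult_ac)
  qed
  have gi: "integrable M ?g" using iA iB by auto
  show i: "integrable M (\<lambda>x. exp (A x + B x))"
  proof (rule Bochner_Integration.integrable_bound[OF gi])
    show "AE x in M. norm (exp (A x + B x)) \<le> norm (?g x)"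
      by (intro AE_I2) (simp only: real_norm_def abs_exp_cancel order_trans[OF pt abs_ge_self])
  qed simp
  have "(\<integral>x. exp (A x + B x) \<partial>M) \<le> (\<integral>x. ?g x \<partial>M)" by (intro integral_mono i gi pt)
  also have "\<dots> = exp (\<theta> * a + (1 - \<theta>) * b) * (\<theta> * exp (- a) * exp a + (1 - \<theta>) * exp (- b) * exp b)"
    using iA iB by (simp add: ea eb)
  also have "\<dots> = exp (\<theta> * a + (1 - \<theta>) * b)"
    by (simp add: mult.assoc exp_add[symmetric])
  finally have "(\<integral>x. exp (A x + B x) \<partial>M) \<le> exp (\<theta> * a + (1 - \<theta>) * b)" .
  then have "ln (\<integral>x. exp (A x + B x) \<partial>M) \<le> ln (exp (\<theta> * a + (1 - \<theta>) * b))"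
    using expectation_pos[OF i] by (subst ln_le_cancel_iff) auto
  then show "ln (\<integral>x. exp (A x + B x) \<partial>M) \<le> \<theta> * ln (\<integral>x. exp (A x / \<theta>) \<partial>M) + (1 - \<theta>) * ln (\<integral>x. exp (B x / (1 - \<theta>)) \<partial>M)"
    by (simp add: a_def b_def)
qed

text \<open>The separate scalars \<open>u\<close>, \<open>t\<close>, \<open>s\<close> allow both
  uses below: a sum as approximation plus error, and the approximation as sum minus error.\<close>

lemma cumulant_Holder:
  assumes XY: "integrable M X" "integrable M Y" and \<theta>: "0 < \<theta>" "\<theta> < 1"
    and i: "integrable M (\<lambda>\<omega>. exp (t / \<theta> * centered M X \<omega>))"
      "integrable M (\<lambda>\<omega>. exp (s / (1 - \<theta>) * centered M Y \<omega>))"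
    and Z: "\<And>\<omega>. u * centered M Z \<omega> = t * centered M X \<omega> + s * centered M Y \<omega>"
  shows "integrable M (\<lambda>\<omega>. exp (u * centered M Z \<omega>))"
    "cumulant M Z u \<le> \<theta> * cumulant M X (t / \<theta>) + (1 - \<theta>) * cumulant M Y (s / (1 - \<theta>))"
proof -
  have m: "(\<lambda>\<omega>. t * centered M X \<omega>) \<in> borel_measurable M" "(\<lambda>\<omega>. s * centered M Y \<omega>) \<in> borel_measurable M"
    using centered_measurable[OF XY(1)] centered_measurable[OF XY(2)] by measurable
  have i': "integrable M (\<lambda>\<omega>. exp (t * centered M X \<omega> / \<theta>))" "integrable M (\<lambda>\<omega>. exp (s * centered M Y \<omega> / (1 - \<theta>)))"
    using i by (simp_all add: field_simps)
  note H = Holder_exp[OF m \<theta> i']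
  show "integrable M (\<lambda>\<omega>. exp (u * centered M Z \<omega>))" unfolding Z by (rule H(1))
  show "cumulant M Z u \<le> \<theta> * cumulant M X (t / \<theta>) + (1 - \<theta>) * cumulant M Y (s / (1 - \<theta>))"
    unfolding cumulant_def Z using H(2) by simp
qed

text \<open>Hoelder's inequality with \<open>\<theta> = 1/2\<close> evaluates both transforms at
  \<open>2 * t\<close>: this halves the radius and doubles the constants.\<close>

lemma subgaussian_add:
  assumes X: "subgaussian M X \<kappa> \<tau>" and Y: "subgaussian M Y \<eta> \<tau>"
  shows "subgaussian M (\<lambda>\<omega>. X \<omega> + Y \<omega>) (2 * (\<kappa> + \<eta>)) (\<tau> / 2)"
  unfolding subgaussian_def
proof (intro conjI allI impI)
  have XY: "integrable M X" "integrable M Y" using X Y by (auto simp: subgaussian_def)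
  then show "integrable M (\<lambda>\<omega>. X \<omega> + Y \<omega>)" by simp
  fix t assume t: "\<bar>t\<bar> \<le> \<tau> / 2"
  then have t2: "\<bar>t / (1/2)\<bar> \<le> \<tau>" "\<bar>t / (1 - 1/2)\<bar> \<le> \<tau>" by auto
  let ?Z = "\<lambda>\<omega>. X \<omega> + Y \<omega>"
  have z: "t * centered M ?Z \<omega> = t * centered M X \<omega> + t * centered M Y \<omega>" for \<omega>
    by (simp add: centered_add[OF XY] distrib_left)
  note H = cumulant_Holder[OF XY _ _ subgaussian_integrable_exp(1)[OF X t2(1)] subgaussian_integrable_exp(1)[OF Y t2(2)] z]
  have i: "integrable M (\<lambda>\<omega>. exp (t * centered M ?Z \<omega>))" by (rule H(1)) auto
  have "cumulant M ?Z t \<le> (1/2) * cumulant M X (t / (1/2)) + (1 - 1/2) * cumulant M Y (t / (1 - 1/2))"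
    by (rule H(2)) auto
  also have "\<dots> \<le> (1/2) * (\<kappa> * (t / (1/2))\<^sup>2) + (1 - 1/2) * (\<eta> * (t / (1 - 1/2))\<^sup>2)"
    by (intro add_mono mult_left_mono subgaussian_integrable_exp(2)[OF X t2(1)] subgaussian_integrable_exp(2)[OF Y t2(2)]) auto
  also have "\<dots> = 2 * (\<kappa> + \<eta>) * t\<^sup>2" by (simp add: power2_eq_square algebra_simps)
  finally have "exp (cumulant M ?Z t) \<le> exp (2 * (\<kappa> + \<eta>) * t\<^sup>2)" by simp
  then have "(\<integral>\<omega>. exp (t * centered M ?Z \<omega>) \<partial>M) \<le> exp (2 * (\<kappa> + \<eta>) * t\<^sup>2)"
    unfolding cumulant_def using expectation_pos[OF i] by simp
  then show "(\<integral>\<^sup>+\<omega>. ennreal (exp (t * centered M ?Z \<omega>)) \<partial>M) \<le> ennreal (exp (2 * (\<kappa> + \<eta>) * t\<^sup>2))"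
    using nn_integral_eq_integral[OF i] by (simp add: ennreal_leI)
qed

lemma exp_minus_one_minus_le: "\<bar>exp y - 1 - y\<bar> \<le> y\<^sup>2 * exp \<bar>y::real\<bar>"
proof -
  have "0 \<le> exp y - 1 - y" using exp_ge_add_one_self[of y] by linarith
  have "exp y - 1 \<le> y * exp y"
  proof -
    have "1 - y \<le> exp (- y)" using exp_ge_add_one_self[of "- y"] by simp
    then have "(1 - y) * exp y \<le> exp (- y) * exp y" by (intro mult_right_mono) auto
    then show ?thesis by (simp add: exp_minus algebra_simps)
  qed
  then have "exp y - 1 - y \<le> y * (exp y - 1)" by (simp add: right_diff_distrib)
  also have "\<dots> \<le> \<bar>y\<bar> * \<bar>exp y - 1\<bar>" by (metis abs_ge_self abs_mult)
  also have "\<dots> \<le> \<bar>y\<bar> * (\<bar>y\<bar> * exp \<bar>y\<bar>)" by (intro mult_left_mono abs_exp_minus_one_le) auto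
  also have "\<dots> = y\<^sup>2 * exp \<bar>y\<bar>" by (simp add: power2_eq_square flip: mult.assoc)
  finally show ?thesis using \<open>0 \<le> exp y - 1 - y\<close> by simp
qed

text \<open>The linear term of the exponential integrates to 0, so after division by
  \<open>t\<^sup>2\<close> dominated convergence leaves half the variance; then
  \<open>ln (1 + x)\<close> is replaced by \<open>x\<close> up to a quadratic error.\<close>

lemma cumulant_second_order:
  assumes sg: "subgaussian M Z \<kappa> \<tau>" and "0 < \<tau>" "0 \<le> \<kappa>" and t: "t \<longlonglongrightarrow> 0" "\<And>n. t n \<noteq> 0"
  shows "(\<lambda>n. cumulant M Z (t n) / (t n)\<^sup>2) \<longlonglongrightarrow> (\<integral>\<omega>. (centered M Z \<omega>)\<^sup>2 \<partial>M) / 2"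
proof -
  let ?Z = "centered M Z"
  let ?v = "\<integral>\<omega>. (?Z \<omega>)\<^sup>2 \<partial>M"
  have iZ: "integrable M Z" using sg by (simp add: subgaussian_def)
  have [measurable]: "?Z \<in> borel_measurable M" by (rule centered_measurable[OF iZ])
  have iZc: "integrable M ?Z" "(\<integral>\<omega>. ?Z \<omega> \<partial>M) = 0"
    using iZ unfolding centered_def[abs_def] by (auto simp: prob_space)
  obtain n0 where n0: "\<And>n. n \<ge> n0 \<Longrightarrow> \<bar>t n\<bar> < \<tau> / 2"
    using LIMSEQ_D[OF t(1), of "\<tau> / 2"] \<open>0 < \<tau>\<close> by auto
  \<comment> \<open>Dominated convergence works with integrable terms for every \<open>n\<close>;
    after the shift all arguments are below \<open>\<tau> / 2\<close>, and the shift is undone at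
    the end.\<close>
  define s where "s n = t (n + n0)" for n
  have s: "s \<longlonglongrightarrow> 0" "\<And>n. s n \<noteq> 0" "\<And>n. \<bar>s n\<bar> < \<tau> / 2"
    using LIMSEQ_ignore_initial_segment[OF t(1), of n0] t(2) n0 by (auto simp: s_def[abs_def])
  have ie: "integrable M (\<lambda>\<omega>. exp (\<tau> * ?Z \<omega>) + exp ((- \<tau>) * ?Z \<omega>))"
    using \<open>0 < \<tau>\<close> by (intro Bochner_Integration.integrable_add subgaussian_integrable_exp(1)[OF sg]) auto
  have i_s: "integrable M (\<lambda>\<omega>. exp (s n * ?Z \<omega>))" for n
    using s(3)[of n] \<open>0 < \<tau>\<close> by (intro subgaussian_integrable_exp(1)[OF sg]) linarith
  \<comment> \<open>As \<open>\<bar>s n\<bar> < \<tau> / 2\<close>, the remainder is at most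
    \<open>Z\<^sup>2 exp (\<tau> \<bar>Z\<bar> / 2)\<close>, and \<open>Z\<^sup>2 \<le> 8 /
    \<tau>\<^sup>2 * exp (\<tau> \<bar>Z\<bar> / 2)\<close>; together they stay within the radius
    \<open>\<tau>\<close>.\<close>
  define w where "w \<omega> = 8 / \<tau>\<^sup>2 * (exp (\<tau> * ?Z \<omega>) + exp ((- \<tau>) * ?Z \<omega>))" for \<omega>
  have "(\<lambda>n. \<integral>\<omega>. (exp (s n * ?Z \<omega>) - 1 - s n * ?Z \<omega>) / (s n)\<^sup>2 \<partial>M) \<longlonglongrightarrow> (\<integral>\<omega>. (?Z \<omega>)\<^sup>2 / 2 \<partial>M)"
  proof (rule integral_dominated_convergence[where w=w])
    show "integrable M w" unfolding w_def using ie by (rule integrable_mult_right)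
    show "AE \<omega> in M. (\<lambda>n. (exp (s n * ?Z \<omega>) - 1 - s n * ?Z \<omega>) / (s n)\<^sup>2) \<longlonglongrightarrow> (?Z \<omega>)\<^sup>2 / 2"
    proof (rule AE_I2)
      fix \<omega>
      have "((\<lambda>h. (exp (h * ?Z \<omega>) - 1 - h * ?Z \<omega>) / h\<^sup>2) \<longlongrightarrow> (?Z \<omega>)\<^sup>2 / 2) (at 0)"
      proof (rule lhopital)
        show "((\<lambda>h. exp (h * ?Z \<omega>) - 1 - h * ?Z \<omega>) \<longlongrightarrow> 0) (at 0)"
          by (auto intro!: tendsto_eq_intros)
        show "((\<lambda>h::real. h\<^sup>2) \<longlongrightarrow> 0) (at 0)"
          by (auto intro!: tendsto_eq_intros)
        show "\<forall>\<^sub>F h in at (0::real). h\<^sup>2 \<noteq> 0" "\<forall>\<^sub>F h in at (0::real). 2 * h \<noteq> 0"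
          by (auto simp: eventually_at intro!: exI[of _ 1])
        show "\<forall>\<^sub>F h in at 0. ((\<lambda>h. exp (h * ?Z \<omega>) - 1 - h * ?Z \<omega>) has_real_derivative (exp (h * ?Z \<omega>) * ?Z \<omega> - ?Z \<omega>)) (at h)"
          by (intro always_eventually allI) (auto intro!: derivative_eq_intros)
        show "\<forall>\<^sub>F h in at 0. ((\<lambda>h::real. h\<^sup>2) has_real_derivative 2 * h) (at h)"
          by (intro always_eventually allI) (auto intro!: derivative_eq_intros)
        have "((\<lambda>h. exp (h * ?Z \<omega>) * ?Z \<omega>) has_real_derivative (?Z \<omega>)\<^sup>2) (at 0)"
          by (auto intro!: derivative_eq_intros simp: power2_eq_square)
        then have "((\<lambda>h. (exp (h * ?Z \<omega>) * ?Z \<omega> - ?Z \<omega>) / h / 2) \<longlongrightarrow> (?Z \<omega>)\<^sup>2 / 2) (at 0)"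
          unfolding DERIV_def by (intro tendsto_divide tendsto_const) auto
        then show "((\<lambda>h. (exp (h * ?Z \<omega>) * ?Z \<omega> - ?Z \<omega>) / (2 * h)) \<longlongrightarrow> (?Z \<omega>)\<^sup>2 / 2) (at 0)"
          by (simp add: mult.commute)
      qed
      moreover have "filterlim s (at 0) sequentially"
        unfolding filterlim_at using s by auto
      ultimately show "(\<lambda>n. (exp (s n * ?Z \<omega>) - 1 - s n * ?Z \<omega>) / (s n)\<^sup>2) \<longlonglongrightarrow> (?Z \<omega>)\<^sup>2 / 2"
        by (rule filterlim_compose)
    qed
    show "AE \<omega> in M. norm ((exp (s n * ?Z \<omega>) - 1 - s n * ?Z \<omega>) / (s n)\<^sup>2) \<le> w \<omega>" for n
    proof (rule AE_I2)
      fix \<omega>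
      let ?x = "\<bar>?Z \<omega>\<bar>"
      have "norm ((exp (s n * ?Z \<omega>) - 1 - s n * ?Z \<omega>) / (s n)\<^sup>2) \<le> (s n * ?Z \<omega>)\<^sup>2 * exp \<bar>s n * ?Z \<omega>\<bar> / (s n)\<^sup>2"
        using exp_minus_one_minus_le[of "s n * ?Z \<omega>"] by (simp add: divide_right_mono)
      also have "\<dots> = (?Z \<omega>)\<^sup>2 * exp \<bar>s n * ?Z \<omega>\<bar>" using s(2)[of n] by (simp add: power_mult_distrib)
      also have "\<dots> \<le> (8 / \<tau>\<^sup>2 * exp (\<tau> / 2 * ?x)) * exp (\<tau> / 2 * ?x)"
      proof (intro mult_mono)
        have "1 + \<tau> / 2 * ?x + (\<tau> / 2 * ?x)\<^sup>2 / 2 \<le> exp (\<tau> / 2 * ?x)"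
          using \<open>0 < \<tau>\<close> by (intro exp_lower_Taylor_quadratic) auto
        moreover have "0 \<le> \<tau> / 2 * ?x" using \<open>0 < \<tau>\<close> by simp
        ultimately have "(\<tau> / 2 * ?x)\<^sup>2 / 2 \<le> exp (\<tau> / 2 * ?x)" by linarith
        then have "\<tau>\<^sup>2 / 8 * (?Z \<omega>)\<^sup>2 \<le> exp (\<tau> / 2 * ?x)"
          by (simp add: power_mult_distrib power_divide)
        then have "8 / \<tau>\<^sup>2 * (\<tau>\<^sup>2 / 8 * (?Z \<omega>)\<^sup>2) \<le> 8 / \<tau>\<^sup>2 * exp (\<tau> / 2 * ?x)"
          by (rule mult_left_mono) simp
        then show "(?Z \<omega>)\<^sup>2 \<le> 8 / \<tau>\<^sup>2 * exp (\<tau> / 2 * ?x)" using \<open>0 < \<tau>\<close> by simp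
        show "exp \<bar>s n * ?Z \<omega>\<bar> \<le> exp (\<tau> / 2 * ?x)"
          unfolding exp_le_cancel_iff abs_mult using s(3)[of n] by (intro mult_right_mono) auto
      qed auto
      also have "\<dots> = 8 / \<tau>\<^sup>2 * exp (\<tau> * ?x)" by (simp add: exp_add[symmetric])
      also have "\<dots> \<le> w \<omega>"
        unfolding w_def by (intro mult_left_mono) (cases "0 \<le> ?Z \<omega>", auto)
      finally show "norm ((exp (s n * ?Z \<omega>) - 1 - s n * ?Z \<omega>) / (s n)\<^sup>2) \<le> w \<omega>" .
    qed
  qed auto
  moreover have "(\<integral>\<omega>. (exp (s n * ?Z \<omega>) - 1 - s n * ?Z \<omega>) / (s n)\<^sup>2 \<partial>M) = ((\<integral>\<omega>. exp (s n * ?Z \<omega>) \<partial>M) - 1) / (s n)\<^sup>2" for n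
    using i_s[of n] iZc by (simp add: prob_space)
  ultimately have g: "(\<lambda>n. ((\<integral>\<omega>. exp (s n * ?Z \<omega>) \<partial>M) - 1) / (s n)\<^sup>2) \<longlonglongrightarrow> ?v / 2"
    by (simp add: s(2))
  define g where "g n = ((\<integral>\<omega>. exp (s n * ?Z \<omega>) \<partial>M) - 1) / (s n)\<^sup>2" for n
  have g_lim: "g \<longlonglongrightarrow> ?v / 2" using g by (simp add: g_def[abs_def])
  have "(\<lambda>n. (s n)\<^sup>2 * g n) \<longlonglongrightarrow> 0\<^sup>2 * (?v / 2)" by (intro tendsto_intros s g_lim)
  then have "\<forall>\<^sub>F n in sequentially. \<bar>(s n)\<^sup>2 * g n\<bar> < 1/2"
    by (intro order_tendstoD(2)[where y=0] tendsto_rabs_zero) auto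
  then have ev: "\<forall>\<^sub>F n in sequentially. norm (cumulant M Z (s n) / (s n)\<^sup>2 - g n) \<le> 2 * ((s n)\<^sup>2 * g n * g n)"
  proof eventually_elim
    case (elim n)
    have e: "(\<integral>\<omega>. exp (s n * ?Z \<omega>) \<partial>M) = 1 + (s n)\<^sup>2 * g n" using s(2)[of n] by (simp add: g_def)
    have "\<bar>ln (1 + (s n)\<^sup>2 * g n) - (s n)\<^sup>2 * g n\<bar> \<le> 2 * ((s n)\<^sup>2 * g n)\<^sup>2"
      using elim by (intro abs_ln_one_plus_x_minus_x_bound) auto
    then have "\<bar>ln (1 + (s n)\<^sup>2 * g n) - (s n)\<^sup>2 * g n\<bar> / (s n)\<^sup>2 \<le> 2 * ((s n)\<^sup>2 * g n)\<^sup>2 / (s n)\<^sup>2"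
      by (rule divide_right_mono) simp
    also have "\<dots> = 2 * ((s n)\<^sup>2 * g n * g n)"
      using s(2)[of n] by (simp add: power2_eq_square)
    also have "\<bar>ln (1 + (s n)\<^sup>2 * g n) - (s n)\<^sup>2 * g n\<bar> / (s n)\<^sup>2 = \<bar>(ln (1 + (s n)\<^sup>2 * g n) - (s n)\<^sup>2 * g n) / (s n)\<^sup>2\<bar>"
      by (simp add: abs_divide)
    also have "(ln (1 + (s n)\<^sup>2 * g n) - (s n)\<^sup>2 * g n) / (s n)\<^sup>2 = cumulant M Z (s n) / (s n)\<^sup>2 - g n"
      using s(2)[of n] by (simp add: cumulant_def e diff_divide_distrib)
    finally show ?case by simp
  qed
  have "(\<lambda>n. 2 * ((s n)\<^sup>2 * g n * g n)) \<longlonglongrightarrow> 2 * (0\<^sup>2 * (?v / 2) * (?v / 2))"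
    by (intro tendsto_intros s g_lim)
  then have "(\<lambda>n. cumulant M Z (s n) / (s n)\<^sup>2 - g n) \<longlonglongrightarrow> 0"
    by (intro Lim_null_comparison[OF ev]) simp
  from tendsto_add[OF this g_lim] have "(\<lambda>n. cumulant M Z (s n) / (s n)\<^sup>2) \<longlonglongrightarrow> ?v / 2" by simp
  then show ?thesis unfolding s_def by (rule LIMSEQ_offset)
qed

text \<open>Young's inequality with weight \<open>e\<close>. The hypothesis on absolute values lets
  it serve both for \<open>Z = X + D\<close> and for \<open>Z = X - D\<close>.\<close>

lemma variance_perturbation:
  assumes X: "integrable M X" "integrable M (\<lambda>\<omega>. (centered M X \<omega>)\<^sup>2)"
    and D: "integrable M D" "integrable M (\<lambda>\<omega>. (centered M D \<omega>)\<^sup>2)" and "0 < e"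
    and Z: "integrable M Z" "integrable M (\<lambda>\<omega>. (centered M Z \<omega>)\<^sup>2)"
    and eq: "\<And>\<omega>. \<bar>centered M Z \<omega>\<bar> \<le> \<bar>centered M X \<omega>\<bar> + \<bar>centered M D \<omega>\<bar>"
  shows "(\<integral>\<omega>. (centered M Z \<omega>)\<^sup>2 \<partial>M) \<le>
    (1 + e) * (\<integral>\<omega>. (centered M X \<omega>)\<^sup>2 \<partial>M) + (1 + 1 / e) * (\<integral>\<omega>. (centered M D \<omega>)\<^sup>2 \<partial>M)"
proof -
  have "(\<integral>\<omega>. (centered M Z \<omega>)\<^sup>2 \<partial>M) \<le> (\<integral>\<omega>. (1 + e) * (centered M X \<omega>)\<^sup>2 + (1 + 1 / e) * (centered M D \<omega>)\<^sup>2 \<partial>M)"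
  proof (rule integral_mono)
    fix \<omega>
    let ?x = "\<bar>centered M X \<omega>\<bar>" and ?d = "\<bar>centered M D \<omega>\<bar>"
    have "(centered M Z \<omega>)\<^sup>2 = \<bar>centered M Z \<omega>\<bar>\<^sup>2" by simp
    also have "\<dots> \<le> (?x + ?d)\<^sup>2" using eq[of \<omega>] by (intro power_mono) auto
    also have "\<dots> \<le> (1 + e) * ?x\<^sup>2 + (1 + 1 / e) * ?d\<^sup>2"
    proof -
      have "0 \<le> (e * ?x - ?d)\<^sup>2 / e" using \<open>0 < e\<close> by simp
      also have "\<dots> = (1 + e) * ?x\<^sup>2 + (1 + 1 / e) * ?d\<^sup>2 - (?x + ?d)\<^sup>2"
        using \<open>0 < e\<close> by (simp add: power2_eq_square field_simps)
      finally show ?thesis by simp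
    qed
    finally show "(centered M Z \<omega>)\<^sup>2 \<le> (1 + e) * (centered M X \<omega>)\<^sup>2 + (1 + 1 / e) * (centered M D \<omega>)\<^sup>2" by simp
  qed (use X D Z in auto)
  then show ?thesis using X D by simp
qed

text \<open>If \<open>S n\<close> can be approximated by sequences \<open>Y n\<close> with quadratic cumulant asymptotics, up to errors of
  arbitrarily small subgaussian constant per step, then it has quadratic asymptotics itself:
  Hoelder's inequality with exponents close to \<open>1\<close> loses only \<open>O(\<surd>\<epsilon>)\<close>.\<close>

lemma cumulant_approximation:
  fixes S :: "nat \<Rightarrow> 'a \<Rightarrow> real"
  assumes S: "\<And>n. integrable M (S n)" "\<And>n. integrable M (\<lambda>\<omega>. (centered M (S n) \<omega>)\<^sup>2)"
    and approx: "\<And>\<epsilon>::real. 0 < \<epsilon> \<Longrightarrow> \<exists>Y s \<tau>. 0 < \<tau> \<and> (\<forall>n. integrable M (Y n) \<and> integrable M (\<lambda>\<omega>. (centered M (Y n) \<omega>)\<^sup>2)) \<and>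
      (\<forall>\<^sub>F n in sequentially. subgaussian M (\<lambda>\<omega>. S n \<omega> - Y n \<omega>) (\<epsilon> * n) \<tau>) \<and>
      (\<lambda>n. (\<integral>\<omega>. (centered M (Y n) \<omega>)\<^sup>2 \<partial>M) / n) \<longlonglongrightarrow> s \<and>
      (\<forall>t::nat \<Rightarrow> real. t \<longlonglongrightarrow> 0 \<longrightarrow> (\<forall>n. 0 < t n) \<longrightarrow>
        (\<forall>\<^sub>F n in sequentially. integrable M (\<lambda>\<omega>. exp (t n * centered M (Y n) \<omega>))) \<and>
        (\<lambda>n. cumulant M (Y n) (t n) / (n * (t n)\<^sup>2)) \<longlonglongrightarrow> s / 2)"
  shows "\<exists>v. (\<lambda>n. (\<integral>\<omega>. (centered M (S n) \<omega>)\<^sup>2 \<partial>M) / n) \<longlonglongrightarrow> v \<and>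
    (\<forall>t::nat \<Rightarrow> real. t \<longlonglongrightarrow> 0 \<longrightarrow> (\<forall>n. 0 < t n) \<longrightarrow>
        (\<forall>\<^sub>F n in sequentially. integrable M (\<lambda>\<omega>. exp (t n * centered M (S n) \<omega>))) \<and>
        (\<lambda>n. cumulant M (S n) (t n) / (n * (t n)\<^sup>2)) \<longlonglongrightarrow> v / 2)"
proof -
  define V where "V n = (\<integral>\<omega>. (centered M (S n) \<omega>)\<^sup>2 \<partial>M) / n" for n :: nat
  have main: "\<exists>s\<ge>0. (\<forall>\<^sub>F n in sequentially. V n \<le> (1 + e) * (s + e) + 2 * e\<^sup>2 + 2 * e \<and> s - e \<le> (1 + e) * V n + 2 * e\<^sup>2 + 2 * e) \<and>
    (\<forall>t::nat \<Rightarrow> real. t \<longlonglongrightarrow> 0 \<longrightarrow> (\<forall>n. 0 < t n) \<longrightarrow>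
        (\<forall>\<^sub>F n in sequentially. integrable M (\<lambda>\<omega>. exp (t n * centered M (S n) \<omega>)) \<and>
          cumulant M (S n) (t n) / (n * (t n)\<^sup>2) \<le> (s / 2 + e) / (1 - e) + e \<and>
          (1 - e) * (s / 2 - e) - e \<le> cumulant M (S n) (t n) / (n * (t n)\<^sup>2)))"
    if e: "0 < e" "e < 1" for e :: real
  proof -
    \<comment> \<open>Hoelder's inequality with weight \<open>e\<close> for the error evaluates its
      cumulant at \<open>t / e\<close>. A subgaussian constant \<open>e\<^sup>2 * n\<close> then
      contributes \<open>e * (e\<^sup>2 * n * (t / e)\<^sup>2) = e * n * t\<^sup>2\<close>, which is
      of order \<open>e\<close> after normalization.\<close>
    obtain Y s \<tau> where \<tau>: "0 < \<tau>" and Y: "\<And>n. integrable M (Y n)" "\<And>n. integrable M (\<lambda>\<omega>. (centered M (Y n) \<omega>)\<^sup>2)"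
      and sg: "\<forall>\<^sub>F n in sequentially. subgaussian M (\<lambda>\<omega>. S n \<omega> - Y n \<omega>) (e\<^sup>2 * n) \<tau>"
      and VY: "(\<lambda>n. (\<integral>\<omega>. (centered M (Y n) \<omega>)\<^sup>2 \<partial>M) / n) \<longlonglongrightarrow> s"
      and cY: "\<And>t::nat \<Rightarrow> real. t \<longlonglongrightarrow> 0 \<Longrightarrow> (\<And>n. 0 < t n) \<Longrightarrow>
        (\<forall>\<^sub>F n in sequentially. integrable M (\<lambda>\<omega>. exp (t n * centered M (Y n) \<omega>))) \<and>
        (\<lambda>n. cumulant M (Y n) (t n) / (n * (t n)\<^sup>2)) \<longlonglongrightarrow> s / 2"
      using approx[of "e\<^sup>2"] e(1) by auto
    define D where "D n \<omega> = S n \<omega> - Y n \<omega>" for n \<omega>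
    have sgD: "\<forall>\<^sub>F n in sequentially. subgaussian M (D n) (e\<^sup>2 * n) \<tau>" using sg by (simp add: D_def[abs_def])
    have Di: "integrable M (D n)" for n using S(1)[of n] Y(1)[of n] by (simp add: D_def[abs_def])
    have cD: "centered M (D n) \<omega> = centered M (S n) \<omega> - centered M (Y n) \<omega>" for n \<omega>
      unfolding D_def[abs_def] by (rule centered_diff[OF S(1) Y(1)])
    have s0: "0 \<le> s"
      by (rule LIMSEQ_le_const[OF VY]) (auto intro!: divide_nonneg_nonneg integral_nonneg_AE)
    have var: "\<forall>\<^sub>F n in sequentially. V n \<le> (1 + e) * (s + e) + 2 * e\<^sup>2 + 2 * e \<and> s - e \<le> (1 + e) * V n + 2 * e\<^sup>2 + 2 * e"
    proof -
      have "\<forall>\<^sub>F n in sequentially. dist ((\<integral>\<omega>. (centered M (Y n) \<omega>)\<^sup>2 \<partial>M) / n) s < e"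
        by (rule tendstoD[OF VY e(1)])
      with sgD eventually_gt_at_top[of 0] show ?thesis
      proof eventually_elim
        case (elim n)
        let ?VY = "\<integral>\<omega>. (centered M (Y n) \<omega>)\<^sup>2 \<partial>M" and ?VS = "\<integral>\<omega>. (centered M (S n) \<omega>)\<^sup>2 \<partial>M" and ?VD = "\<integral>\<omega>. (centered M (D n) \<omega>)\<^sup>2 \<partial>M"
        have n: "0 < real n" using elim by simp
        have vD: "integrable M (\<lambda>\<omega>. (centered M (D n) \<omega>)\<^sup>2)" "?VD \<le> 2 * (e\<^sup>2 * n)"
          using subgaussian_variance[OF elim(1) \<tau>] by auto
        have "(1 + 1 / e) * ?VD \<le> (1 + 1 / e) * (2 * (e\<^sup>2 * n))"
          using vD(2) e by (intro mult_left_mono) auto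
        also have "\<dots> = (2 * e\<^sup>2 + 2 * e) * n" using e by (simp add: power2_eq_square field_simps)
        finally have dd: "(1 + 1 / e) * ?VD \<le> (2 * e\<^sup>2 + 2 * e) * n" .
        have "?VS \<le> (1 + e) * ?VY + (1 + 1 / e) * ?VD"
          by (rule variance_perturbation[OF Y Di vD(1) e(1) S]) (simp add: cD)
        with dd have 1: "?VS \<le> (1 + e) * ?VY + (2 * e\<^sup>2 + 2 * e) * n" by linarith
        have "?VY \<le> (1 + e) * ?VS + (1 + 1 / e) * ?VD"
          by (rule variance_perturbation[OF S Di vD(1) e(1) Y]) (simp add: cD)
        with dd have 2: "?VY \<le> (1 + e) * ?VS + (2 * e\<^sup>2 + 2 * e) * n" by linarith
        have "?VS / n \<le> ((1 + e) * ?VY + (2 * e\<^sup>2 + 2 * e) * n) / n" using 1 by (rule divide_right_mono) simp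
        also have "\<dots> = (1 + e) * (?VY / n) + (2 * e\<^sup>2 + 2 * e)" using n by (simp add: add_divide_distrib)
        also have "(1 + e) * (?VY / n) \<le> (1 + e) * (s + e)"
          using elim(3) e by (intro mult_left_mono) (auto simp: dist_real_def abs_less_iff)
        finally have a: "V n \<le> (1 + e) * (s + e) + 2 * e\<^sup>2 + 2 * e" by (simp add: V_def)
        have "s - e \<le> ?VY / n" using elim(3) by (auto simp: dist_real_def abs_less_iff)
        also have "\<dots> \<le> ((1 + e) * ?VS + (2 * e\<^sup>2 + 2 * e) * n) / n" using 2 by (rule divide_right_mono) simp
        also have "\<dots> = (1 + e) * V n + (2 * e\<^sup>2 + 2 * e)" using n by (simp add: add_divide_distrib V_def)
        finally show ?case using a by simp
      qed
    qed
    have cum: "\<forall>\<^sub>F n in sequentially. integrable M (\<lambda>\<omega>. exp (t n * centered M (S n) \<omega>)) \<and>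
          cumulant M (S n) (t n) / (n * (t n)\<^sup>2) \<le> (s / 2 + e) / (1 - e) + e \<and>
          (1 - e) * (s / 2 - e) - e \<le> cumulant M (S n) (t n) / (n * (t n)\<^sup>2)"
      if t: "t \<longlonglongrightarrow> 0" "\<And>n. 0 < t n" for t :: "nat \<Rightarrow> real"
    proof -
      define \<theta> where "\<theta> = 1 - e"
      have \<theta>: "0 < \<theta>" "\<theta> < 1" "1 - \<theta> = e" using e by (auto simp: \<theta>_def)
      have "(\<lambda>n. t n / \<theta>) \<longlonglongrightarrow> 0" "(\<lambda>n. \<theta> * t n) \<longlonglongrightarrow> 0"
        using tendsto_divide[OF t(1) tendsto_const[of \<theta>]] tendsto_mult[OF tendsto_const[of \<theta>] t(1)] \<theta> by auto
      then have c1: "\<forall>\<^sub>F n in sequentially. integrable M (\<lambda>\<omega>. exp (t n / \<theta> * centered M (Y n) \<omega>))"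
          "(\<lambda>n. cumulant M (Y n) (t n / \<theta>) / (n * (t n / \<theta>)\<^sup>2)) \<longlonglongrightarrow> s / 2"
          "\<forall>\<^sub>F n in sequentially. integrable M (\<lambda>\<omega>. exp (\<theta> * t n * centered M (Y n) \<omega>))"
          "(\<lambda>n. cumulant M (Y n) (\<theta> * t n) / (n * (\<theta> * t n)\<^sup>2)) \<longlonglongrightarrow> s / 2"
        using cY[of "\<lambda>n. t n / \<theta>"] cY[of "\<lambda>n. \<theta> * t n"] t(2) \<theta> by auto
      have "\<forall>\<^sub>F n in sequentially. dist (cumulant M (Y n) (t n / \<theta>) / (n * (t n / \<theta>)\<^sup>2)) (s / 2) < e"
        "\<forall>\<^sub>F n in sequentially. dist (cumulant M (Y n) (\<theta> * t n) / (n * (\<theta> * t n)\<^sup>2)) (s / 2) < e"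
        by (rule tendstoD[OF c1(2) e(1)], rule tendstoD[OF c1(4) e(1)])
      moreover have "\<forall>\<^sub>F n in sequentially. t n < \<tau> * e"
        using \<tau> e by (intro order_tendstoD(2)[OF t(1)]) auto
      ultimately show ?thesis using c1(1,3) sgD eventually_gt_at_top[of 0]
      proof eventually_elim
        case (elim n)
        have n: "0 < real n" using elim by simp
        have tn: "0 < t n" "0 < (t n)\<^sup>2" using t(2)[of n] by auto
        have b1: "\<bar>t n / e\<bar> \<le> \<tau>" using elim(3) tn e by (simp add: divide_le_eq)
        have "\<theta> * t n \<le> 1 * t n" using \<theta> tn by (intro mult_right_mono) auto
        then have "\<theta> * t n / e \<le> \<tau>" using elim(3) e by (simp add: divide_le_eq)
        then have b2: "\<bar>- (\<theta> * t n) / e\<bar> \<le> \<tau>" using tn e \<theta> by (simp add: abs_mult)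
        note iD1 = subgaussian_integrable_exp[OF elim(6) b1] and iD2 = subgaussian_integrable_exp[OF elim(6) b2]
        have z1: "t n * centered M (S n) \<omega> = t n * centered M (Y n) \<omega> + t n * centered M (D n) \<omega>" for \<omega>
          by (simp add: cD right_diff_distrib)
        have iS: "integrable M (\<lambda>\<omega>. exp (t n * centered M (S n) \<omega>))"
          and uS: "cumulant M (S n) (t n) \<le> \<theta> * cumulant M (Y n) (t n / \<theta>) + (1 - \<theta>) * cumulant M (D n) (t n / (1 - \<theta>))"
          by (rule cumulant_Holder[OF Y(1) Di \<theta>(1,2) elim(4) _ z1]; use iD1 \<theta>(3) in simp)+
        have iS': "integrable M (\<lambda>\<omega>. exp (\<theta> * t n / \<theta> * centered M (S n) \<omega>))" using iS \<theta> by simp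
        \<comment> \<open>For the lower bound the roles are exchanged: the approximation is the sum
          minus the error, evaluated at \<open>\<theta> * t n\<close> so that Hoelder's inequality
          returns the cumulant of the sum at \<open>t n\<close>.\<close>
        have z2: "\<theta> * t n * centered M (Y n) \<omega> = \<theta> * t n * centered M (S n) \<omega> + (- (\<theta> * t n)) * centered M (D n) \<omega>" for \<omega>
          by (simp add: cD right_diff_distrib)
        have lS: "cumulant M (Y n) (\<theta> * t n) \<le> \<theta> * cumulant M (S n) (\<theta> * t n / \<theta>) + (1 - \<theta>) * cumulant M (D n) (- (\<theta> * t n) / (1 - \<theta>))"
          by (rule cumulant_Holder(2)[OF S(1) Di \<theta>(1,2) iS' _ z2]) (use iD2(1) \<theta>(3) in simp)
        have "e * cumulant M (D n) (t n / e) \<le> e * (e\<^sup>2 * n * (t n / e)\<^sup>2)"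
          using iD1(2) e by (intro mult_left_mono) auto
        also have "\<dots> = e * n * (t n)\<^sup>2" using e by (simp add: power_divide)
        finally have d1: "e * cumulant M (D n) (t n / e) \<le> e * n * (t n)\<^sup>2" .
        have "e * cumulant M (D n) (- (\<theta> * t n) / e) \<le> e * (e\<^sup>2 * n * (- (\<theta> * t n) / e)\<^sup>2)"
          using iD2(2) e by (intro mult_left_mono) auto
        also have "\<dots> = \<theta> * (\<theta> * (e * n * (t n)\<^sup>2))" using e by (simp add: power_divide power_mult_distrib power2_eq_square)
        also have "\<dots> \<le> \<theta> * (1 * (e * n * (t n)\<^sup>2))"
          using e \<theta> by (intro mult_left_mono mult_right_mono) auto
        finally have d2: "e * cumulant M (D n) (- (\<theta> * t n) / e) \<le> \<theta> * (e * n * (t n)\<^sup>2)" by simp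
        let ?N = "n * (t n)\<^sup>2"
        have N: "0 < ?N" using n tn by simp
        have "cumulant M (Y n) (t n / \<theta>) / (n * (t n / \<theta>)\<^sup>2) \<le> s / 2 + e"
          using elim(1) by (auto simp: dist_real_def abs_less_iff)
        then have "cumulant M (Y n) (t n / \<theta>) \<le> (s / 2 + e) * (n * (t n / \<theta>)\<^sup>2)"
          using n tn \<theta> by (simp add: pos_divide_le_eq)
        then have "\<theta> * cumulant M (Y n) (t n / \<theta>) \<le> \<theta> * ((s / 2 + e) * (n * (t n / \<theta>)\<^sup>2))"
          using \<theta> by (intro mult_left_mono) auto
        also have "\<dots> = (s / 2 + e) / \<theta> * ?N" using \<theta> by (simp add: power_divide power2_eq_square)
        finally have "cumulant M (S n) (t n) \<le> ((s / 2 + e) / \<theta> + e) * ?N"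
          using uS d1 \<theta>(3) by (simp add: distrib_right mult.assoc)
        then have up: "cumulant M (S n) (t n) / ?N \<le> (s / 2 + e) / (1 - e) + e"
          using N by (simp add: pos_divide_le_eq \<theta>_def)
        have "s / 2 - e \<le> cumulant M (Y n) (\<theta> * t n) / (n * (\<theta> * t n)\<^sup>2)"
          using elim(2) by (auto simp: dist_real_def abs_less_iff)
        then have "(s / 2 - e) * (n * (\<theta> * t n)\<^sup>2) \<le> cumulant M (Y n) (\<theta> * t n)"
          using n tn \<theta> by (simp add: pos_le_divide_eq)
        also have "\<dots> \<le> \<theta> * cumulant M (S n) (t n) + \<theta> * (e * n * (t n)\<^sup>2)"
        proof -
          have "\<theta> * t n / \<theta> = t n" using \<theta> by simp
          then have "cumulant M (Y n) (\<theta> * t n) \<le> \<theta> * cumulant M (S n) (t n) + e * cumulant M (D n) (- (\<theta> * t n) / e)"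
            using lS by (simp only: \<theta>(3))
          with d2 show ?thesis by linarith
        qed
        finally have "\<theta> * (\<theta> * (s / 2 - e) * ?N) \<le> \<theta> * (cumulant M (S n) (t n) + e * ?N)"
          by (simp add: power_mult_distrib power2_eq_square algebra_simps)
        then have "\<theta> * (s / 2 - e) * ?N \<le> cumulant M (S n) (t n) + e * ?N"
          using \<theta>(1) by (simp only: mult_le_cancel_left_pos)
        then have "((1 - e) * (s / 2 - e) - e) * ?N \<le> cumulant M (S n) (t n)"
          by (simp add: \<theta>_def left_diff_distrib)
        then have "(1 - e) * (s / 2 - e) - e \<le> cumulant M (S n) (t n) / ?N"
          using N by (simp add: pos_le_divide_eq)
        with iS up show ?case by simp
      qed
    qed
    show ?thesis using s0 var cum by blast
  qed
  \<comment> \<open>The choice \<open>e = 1/2\<close> gives an a priori bound \<open>K\<close> on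
    the normalized variances. It makes the errors \<open>e * s\<close> uniformly small although
    \<open>s\<close> depends on \<open>e\<close>.\<close>
  have half: "0 < (1/2::real)" "(1/2::real) < 1" by simp_all
  obtain s1 where "\<forall>\<^sub>F n in sequentially. V n \<le> (1 + 1/2) * (s1 + 1/2) + 2 * (1/2)\<^sup>2 + 2 * (1/2) \<and>
      s1 - 1/2 \<le> (1 + 1/2) * V n + 2 * (1/2)\<^sup>2 + 2 * (1/2)"
    using main[OF half] by blast
  then have s1: "\<forall>\<^sub>F n in sequentially. V n \<le> (1 + 1/2) * (s1 + 1/2) + 2 * (1/2)\<^sup>2 + 2 * (1/2)"
    by (rule eventually_mono) blast
  define K where "K = \<bar>(1 + 1/2) * (s1 + 1/2) + 2 * (1/2)\<^sup>2 + 2 * (1/2)\<bar>"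
  have K: "0 \<le> K" "\<forall>\<^sub>F n in sequentially. V n \<le> K"
    using s1 by (auto simp: K_def elim!: eventually_mono)
  have V0: "0 \<le> V n" for n unfolding V_def by (auto intro!: divide_nonneg_nonneg integral_nonneg_AE)
  define c where "c = 8 * K + 40"
  have main2: "\<exists>s. (\<forall>\<^sub>F n in sequentially. \<bar>V n - s\<bar> \<le> c * e) \<and>
    (\<forall>t::nat \<Rightarrow> real. t \<longlonglongrightarrow> 0 \<longrightarrow> (\<forall>n. 0 < t n) \<longrightarrow>
        (\<forall>\<^sub>F n in sequentially. integrable M (\<lambda>\<omega>. exp (t n * centered M (S n) \<omega>)) \<and>
          \<bar>cumulant M (S n) (t n) / (n * (t n)\<^sup>2) - s / 2\<bar> \<le> c * e))"
    if e: "0 < e" "e \<le> 1/2" for e :: real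
  proof -
    obtain s where s: "0 \<le> s" and v: "\<forall>\<^sub>F n in sequentially. V n \<le> (1 + e) * (s + e) + 2 * e\<^sup>2 + 2 * e \<and> s - e \<le> (1 + e) * V n + 2 * e\<^sup>2 + 2 * e"
      and cu: "\<And>t::nat \<Rightarrow> real. t \<longlonglongrightarrow> 0 \<Longrightarrow> (\<And>n. 0 < t n) \<Longrightarrow> (\<forall>\<^sub>F n in sequentially. integrable M (\<lambda>\<omega>. exp (t n * centered M (S n) \<omega>)) \<and>
          cumulant M (S n) (t n) / (n * (t n)\<^sup>2) \<le> (s / 2 + e) / (1 - e) + e \<and>
          (1 - e) * (s / 2 - e) - e \<le> cumulant M (S n) (t n) / (n * (t n)\<^sup>2))"
      using main[of e] e by auto
    have ee: "e\<^sup>2 \<le> e" using e by (simp add: power2_eq_square mult_left_le)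
    have "\<forall>\<^sub>F n in sequentially. s \<le> 2 * K + 4"
      using v K(2)
    proof eventually_elim
      case (elim n)
      have "(1 + e) * V n \<le> (3/2) * K" using elim K V0[of n] e by (intro mult_mono) auto
      then show ?case using elim e ee K(1) by linarith
    qed
    then have sK: "s \<le> 2 * K + 4" by (simp add: eventually_const_iff)
    have se: "e * s \<le> e * (2 * K + 4)" using sK e by (intro mult_left_mono) auto
    have "\<forall>\<^sub>F n in sequentially. \<bar>V n - s\<bar> \<le> c * e"
      using v K(2)
    proof eventually_elim
      case (elim n)
      have "e * V n \<le> e * K" using elim e by (intro mult_left_mono) auto
      then have 1: "s - V n \<le> e * K + 5 * e" using elim ee by (simp add: distrib_right)
      have "(1 + e) * (s + e) = s + e + e * s + e\<^sup>2" by (simp add: power2_eq_square algebra_simps)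
      then have "V n - s \<le> e * s + 6 * e" using elim ee by linarith
      then have 2: "V n - s \<le> e * (2 * K + 4) + 6 * e" using se by linarith
      have "0 \<le> e * K" using e K by simp
      then show ?case using 1 2 e by (simp add: c_def abs_le_iff algebra_simps)
    qed
    moreover have "\<forall>\<^sub>F n in sequentially. integrable M (\<lambda>\<omega>. exp (t n * centered M (S n) \<omega>)) \<and>
          \<bar>cumulant M (S n) (t n) / (n * (t n)\<^sup>2) - s / 2\<bar> \<le> c * e"
      if t: "t \<longlonglongrightarrow> 0" "\<And>n. 0 < t n" for t :: "nat \<Rightarrow> real"
      using cu[OF t]
    proof eventually_elim
      case (elim n)
      let ?h = "cumulant M (S n) (t n) / (n * (t n)\<^sup>2)"
      have eK: "0 \<le> e * K" using e K by simp
      have "(s / 2 + e) / (1 - e) \<le> s / 2 + e + 2 * e * (s / 2 + e)"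
      proof -
        have "1 / (1 - e) \<le> 1 + 2 * e"
        proof -
          have "0 \<le> e * (1 - 2 * e)" using e by simp
          then have "1 \<le> (1 + 2 * e) * (1 - e)" by (simp add: algebra_simps)
          then show ?thesis using e by (simp add: pos_divide_le_eq)
        qed
        then have "(s / 2 + e) * (1 / (1 - e)) \<le> (s / 2 + e) * (1 + 2 * e)"
          using s e by (intro mult_left_mono) auto
        moreover have "(s / 2 + e) * (1 / (1 - e)) = (s / 2 + e) / (1 - e)" by simp
        moreover have "(s / 2 + e) * (1 + 2 * e) = s / 2 + e + 2 * e * (s / 2 + e)" by (simp add: algebra_simps)
        ultimately show ?thesis by (simp only:)
      qed
      also have "\<dots> = s / 2 + e + e * s + 2 * e\<^sup>2" by (simp add: power2_eq_square algebra_simps)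
      finally have 1: "?h - s / 2 \<le> e * (2 * K + 4) + 4 * e" using elim se ee by linarith
      have "(1 - e) * (s / 2 - e) = s / 2 - e - e * s / 2 + e\<^sup>2" by (simp add: power2_eq_square field_simps)
      moreover have "(1 - e) * (s / 2 - e) - e \<le> ?h" using elim by blast
      moreover have "0 \<le> e\<^sup>2" "0 \<le> e * s" using e s by auto
      ultimately have 2: "s / 2 - ?h \<le> e * (2 * K + 4) + 4 * e" using se e by linarith
      show ?case using 1 2 elim e eK by (simp add: c_def abs_le_iff algebra_simps)
    qed
    ultimately show ?thesis by blast
  qed
  have c: "0 < c" using K by (simp add: c_def)
  have eps: "0 < min (1/2) (r / c)" "min (1/2) (r / c) \<le> 1/2" "c * min (1/2) (r / c) \<le> r" if "0 < r" for r
  proof -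
    have "c * min (1/2) (r / c) \<le> c * (r / c)" using c by (intro mult_left_mono) auto
    then show "c * min (1/2) (r / c) \<le> r" using c by simp
    show "min (1/2) (r / c) \<le> 1/2" by (rule min.cobounded1)
  qed (use c that in auto)
  \<comment> \<open>The numbers \<open>s\<close> depend on \<open>e\<close> and are not known to
    converge. For large \<open>n\<close> they are within \<open>c * e\<close> of \<open>V n\<close>,
    so \<open>V\<close> is Cauchy; the cumulants are within \<open>c * e\<close> of
    \<open>s / 2\<close>, so the limit of \<open>V\<close> governs them as well.\<close>
  have "Cauchy V"
  proof (rule metric_CauchyI)
    fix r :: real assume "0 < r"
    then have r: "0 < r / 3" by simp
    obtain s where "\<forall>\<^sub>F n in sequentially. \<bar>V n - s\<bar> \<le> c * min (1/2) (r / 3 / c)"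
      using main2[OF eps(1,2)[OF r]] by blast
    then obtain N where N: "\<And>n. N \<le> n \<Longrightarrow> \<bar>V n - s\<bar> \<le> r / 3"
      using eps(3)[OF r] unfolding eventually_sequentially by (meson order_trans)
    have "dist (V m) (V n) < r" if "N \<le> m" "N \<le> n" for m n
      using N[OF that(1)] N[OF that(2)] \<open>0 < r\<close> unfolding dist_real_def by linarith
    then show "\<exists>N. \<forall>m\<ge>N. \<forall>n\<ge>N. dist (V m) (V n) < r" by blast
  qed
  then obtain v where v: "V \<longlonglongrightarrow> v" using Cauchy_convergent convergent_def by blast
  have "(\<forall>\<^sub>F n in sequentially. integrable M (\<lambda>\<omega>. exp (t n * centered M (S n) \<omega>))) \<and>
        (\<lambda>n. cumulant M (S n) (t n) / (n * (t n)\<^sup>2)) \<longlonglongrightarrow> v / 2"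
    if t: "t \<longlonglongrightarrow> 0" "\<forall>n. 0 < t n" for t :: "nat \<Rightarrow> real"
  proof
    show "\<forall>\<^sub>F n in sequentially. integrable M (\<lambda>\<omega>. exp (t n * centered M (S n) \<omega>))"
      using main2[of "1/2"] t by (auto elim: eventually_mono)
    show "(\<lambda>n. cumulant M (S n) (t n) / (n * (t n)\<^sup>2)) \<longlonglongrightarrow> v / 2"
    proof (rule tendstoI)
      fix r :: real assume "0 < r"
      then have r: "0 < r / 4" by simp
      obtain s where s: "\<forall>\<^sub>F n in sequentially. \<bar>V n - s\<bar> \<le> c * min (1/2) (r / 4 / c)"
        "\<forall>\<^sub>F n in sequentially. integrable M (\<lambda>\<omega>. exp (t n * centered M (S n) \<omega>)) \<and>
          \<bar>cumulant M (S n) (t n) / (n * (t n)\<^sup>2) - s / 2\<bar> \<le> c * min (1/2) (r / 4 / c)"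
        using main2[OF eps(1,2)[OF r]] t by blast
      have "\<forall>\<^sub>F n in sequentially. dist (V n) v < r / 4" by (rule tendstoD[OF v r])
      with s show "\<forall>\<^sub>F n in sequentially. dist (cumulant M (S n) (t n) / (n * (t n)\<^sup>2)) (v / 2) < r"
      proof eventually_elim
        case (elim n)
        have "\<bar>V n - s\<bar> \<le> r / 4" "\<bar>cumulant M (S n) (t n) / (n * (t n)\<^sup>2) - s / 2\<bar> \<le> r / 4"
          using conjunct2[OF elim(2)] elim(1) eps(3)[OF r] by linarith+
        then show ?case using elim(3) \<open>0 < r\<close> unfolding dist_real_def by linarith
      qed
    qed
  qed
  then show ?thesis using v unfolding V_def[abs_def] by blast
qed

end

section \<open>Block decomposition\<close>

text \<open>The product formula is proved for nonnegative integrals; from there it yields the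
  subgaussian bound for the sum, hence integrability, and then the additivity of cumulants.\<close>

lemma (in prob_space) iid_sum_cumulant:
  fixes B :: "nat \<Rightarrow> 'a \<Rightarrow> real" and q :: nat and \<kappa> \<tau> t :: real
  assumes indep: "indep_vars (\<lambda>_. borel) B UNIV" and law: "\<And>i. distr M borel (B i) = distr M borel (B 0)"
    and sg: "subgaussian M (B 0) \<kappa> \<tau>" and "0 \<le> \<kappa>"
  defines "Y \<equiv> \<lambda>(q::nat) \<omega>. \<Sum>i<q. B i \<omega>"
  shows "integrable M (Y q)" "subgaussian M (Y q) (q * \<kappa>) \<tau>"
    "\<bar>t\<bar> \<le> \<tau> \<Longrightarrow> cumulant M (Y q) t = q * cumulant M (B 0) t"
proof -
  have [measurable]: "B i \<in> borel_measurable M" for i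
    using indep by (simp add: indep_vars_def)
  have iB0: "integrable M (B 0)" using sg by (simp add: subgaussian_def)
  have iB: "integrable M (B i)" for i
  proof -
    have "integrable (distr M borel (B 0)) (\<lambda>x. x)"
      by (rule integrable_distr_eq[THEN iffD2]) (simp_all add: iB0)
    then have "integrable (distr M borel (B i)) (\<lambda>x. x)" by (simp only: law[of i])
    then show ?thesis
      by (rule integrable_distr_eq[of "B i" M borel "\<lambda>x. x", THEN iffD1, rotated -1]) simp_all
  qed
  have Bm: "B i \<in> borel_measurable M" for i by simp
  have idm: "(\<lambda>x::real. x) \<in> borel_measurable borel" by simp
  have "expectation (B i) = (\<integral>x. x \<partial>distr M borel (B i))" for i
    by (rule integral_distr[OF Bm idm, symmetric])
  then have EB: "expectation (B i) = expectation (B 0)" for i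
    by (simp only: law[of i])
  show iY: "integrable M (Y q)" unfolding Y_def using iB by simp
  define c where "c = expectation (B 0)"
  have cY: "centered M (Y q) \<omega> = (\<Sum>i<q. B i \<omega> - c)" for \<omega>
  proof -
    have "(\<integral>\<omega>. (\<Sum>i<q. B i \<omega>) \<partial>M) = (\<Sum>i<q. expectation (B i))" by (rule Bochner_Integration.integral_sum) (rule iB)
    also have "\<dots> = (\<Sum>i<q. c)" unfolding c_def by (rule sum.cong[OF refl]) (rule EB)
    finally show ?thesis unfolding centered_def Y_def by (simp only: sum_subtractf)
  qed
  have prod: "(\<integral>\<^sup>+\<omega>. ennreal (exp (t * centered M (Y q) \<omega>)) \<partial>M) = (\<integral>\<^sup>+\<omega>. ennreal (exp (t * centered M (B 0) \<omega>)) \<partial>M) ^ q" for t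
  proof -
    define g where "g x = ennreal (exp (t * (x - c)))" for x
    have [measurable]: "g \<in> borel_measurable borel" unfolding g_def by measurable
    have "indep_vars (\<lambda>_. borel) (\<lambda>i \<omega>. g (B i \<omega>)) UNIV"
      by (rule indep_vars_compose2[OF indep]) simp
    then have ind: "indep_vars (\<lambda>_. borel) (\<lambda>i \<omega>. g (B i \<omega>)) {..<q}"
      by (rule indep_vars_subset) simp
    have "(\<integral>\<^sup>+\<omega>. ennreal (exp (t * centered M (Y q) \<omega>)) \<partial>M) = (\<integral>\<^sup>+\<omega>. (\<Prod>i<q. g (B i \<omega>)) \<partial>M)"
      by (intro nn_integral_cong) (simp add: cY g_def sum_distrib_left exp_sum prod_ennreal)
    also have "\<dots> = (\<Prod>i<q. \<integral>\<^sup>+\<omega>. g (B i \<omega>) \<partial>M)"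
      by (rule indep_vars_nn_integral[OF _ ind]) auto
    also have "\<dots> = (\<Prod>i<q. \<integral>\<^sup>+\<omega>. g (B 0 \<omega>) \<partial>M)"
    proof (rule prod.cong[OF refl])
      fix i
      have "(\<integral>\<^sup>+x. g x \<partial>distr M borel (B i)) = (\<integral>\<^sup>+x. g x \<partial>distr M borel (B 0))" by (simp only: law[of i])
      then show "(\<integral>\<^sup>+\<omega>. g (B i \<omega>) \<partial>M) = (\<integral>\<^sup>+\<omega>. g (B 0 \<omega>) \<partial>M)" by (simp add: nn_integral_distr)
    qed
    finally show ?thesis by (simp add: g_def centered_def c_def)
  qed
  show sgY: "subgaussian M (Y q) (q * \<kappa>) \<tau>"
    unfolding subgaussian_def
  proof (intro conjI iY allI impI)
    fix t assume t: "\<bar>t\<bar> \<le> \<tau>"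
    have "(\<integral>\<^sup>+\<omega>. ennreal (exp (t * centered M (Y q) \<omega>)) \<partial>M) \<le> ennreal (exp (\<kappa> * t\<^sup>2)) ^ q"
      unfolding prod using sg t by (intro power_mono) (auto simp: subgaussian_def)
    also have "\<dots> = ennreal (exp (q * \<kappa> * t\<^sup>2))"
      by (simp add: ennreal_power exp_of_nat_mult[symmetric] mult.assoc)
    finally show "(\<integral>\<^sup>+\<omega>. ennreal (exp (t * centered M (Y q) \<omega>)) \<partial>M) \<le> ennreal (exp (q * \<kappa> * t\<^sup>2))" .
  qed
  assume t: "\<bar>t\<bar> \<le> \<tau>"
  note i1 = subgaussian_integrable_exp(1)[OF sg t] and i2 = subgaussian_integrable_exp(1)[OF sgY t]
  have "ennreal (\<integral>\<omega>. exp (t * centered M (Y q) \<omega>) \<partial>M) = ennreal ((\<integral>\<omega>. exp (t * centered M (B 0) \<omega>) \<partial>M) ^ q)"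
    using prod[of t] nn_integral_eq_integral[OF i1] nn_integral_eq_integral[OF i2]
    by (simp add: ennreal_power)
  then have "(\<integral>\<omega>. exp (t * centered M (Y q) \<omega>) \<partial>M) = (\<integral>\<omega>. exp (t * centered M (B 0) \<omega>) \<partial>M) ^ q"
    by (subst (asm) ennreal_inj) (auto intro!: integral_nonneg_AE zero_le_power)
  then show "cumulant M (Y q) t = q * cumulant M (B 0) t"
    unfolding cumulant_def using expectation_pos[OF i1] by (simp add: ln_realpow)
qed

text \<open>The variance of the sum is read off from the second-order behaviour of its cumulant.\<close>

lemma (in prob_space) iid_sum_variance:
  fixes B :: "nat \<Rightarrow> 'a \<Rightarrow> real" and q :: nat and \<kappa> \<tau> t :: real
  assumes indep: "indep_vars (\<lambda>_. borel) B UNIV" and law: "\<And>i. distr M borel (B i) = distr M borel (B 0)"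
    and sg: "subgaussian M (B 0) \<kappa> \<tau>" and "0 \<le> \<kappa>" "0 < \<tau>"
  shows "(\<integral>\<omega>. (centered M (\<lambda>\<omega>. \<Sum>i<q. B i \<omega>) \<omega>)\<^sup>2 \<partial>M) = q * (\<integral>\<omega>. (centered M (B 0) \<omega>)\<^sup>2 \<partial>M)"
proof -
  let ?Y = "\<lambda>\<omega>. \<Sum>i<q. B i \<omega>"
  note Y = iid_sum_cumulant[OF indep law sg \<open>0 \<le> \<kappa>\<close>, where q=q]
  define t where "t n = \<tau> * inverse (real (Suc n))" for n
  have t: "t \<longlonglongrightarrow> 0" "t n \<noteq> 0" "\<bar>t n\<bar> \<le> \<tau>" for n
  proof -
    show "t \<longlonglongrightarrow> 0"
      using tendsto_mult[OF tendsto_const LIMSEQ_inverse_real_of_nat, of \<tau>] by (simp add: t_def[abs_def])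
    show "t n \<noteq> 0" using \<open>0 < \<tau>\<close> by (simp add: t_def)
    have "\<tau> * inverse (real (Suc n)) \<le> \<tau> * 1" using \<open>0 < \<tau>\<close> by (intro mult_left_mono) (auto simp: inverse_le_1_iff)
    then show "\<bar>t n\<bar> \<le> \<tau>" using \<open>0 < \<tau>\<close> by (simp add: t_def)
  qed
  have "(\<lambda>n. cumulant M ?Y (t n) / (t n)\<^sup>2) \<longlonglongrightarrow> (\<integral>\<omega>. (centered M ?Y \<omega>)\<^sup>2 \<partial>M) / 2"
    by (rule cumulant_second_order[OF Y(2) \<open>0 < \<tau>\<close> _ t(1,2)]) (use \<open>0 \<le> \<kappa>\<close> in simp)
  moreover have "(\<lambda>n. q * (cumulant M (B 0) (t n) / (t n)\<^sup>2)) \<longlonglongrightarrow> q * ((\<integral>\<omega>. (centered M (B 0) \<omega>)\<^sup>2 \<partial>M) / 2)"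
    by (intro tendsto_mult tendsto_const cumulant_second_order[OF sg \<open>0 < \<tau>\<close> \<open>0 \<le> \<kappa>\<close> t(1,2)])
  moreover have "cumulant M ?Y (t n) / (t n)\<^sup>2 = q * (cumulant M (B 0) (t n) / (t n)\<^sup>2)" for n
    using Y(3)[OF t(3)[of n]] by simp
  ultimately have "(\<integral>\<omega>. (centered M ?Y \<omega>)\<^sup>2 \<partial>M) / 2 = q * ((\<integral>\<omega>. (centered M (B 0) \<omega>)\<^sup>2 \<partial>M) / 2)"
    using LIMSEQ_unique by (simp only:) blast
  then show ?thesis by simp
qed

text \<open>The map through which the noise variable with index \<open>j\<close> enters a window: in
  \<open>X\<^sub>n\<close> it has the coefficient \<open>a (j - n)\<close>, here with
  \<open>n = 1 + k + idx c\<close>. The summand 1 is there because \<open>k\<close> counts from 0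
  and the windows from 1.\<close>

definition window_map :: "('k \<Rightarrow> nat) \<Rightarrow> (int \<Rightarrow> real^'d^'p) \<Rightarrow> nat \<Rightarrow> int \<Rightarrow> real^'d \<Rightarrow> (real^'p)^'k::finite" where
  "window_map idx a k j u = (\<chi> c. a (j - (1 + int k + int (idx c))) *v u)"

lemma linear_window_map: "linear (window_map idx a k j)"
  unfolding window_map_def
  by (rule linearI) (auto simp: vec_eq_iff matrix_vector_right_distrib matrix_vector_mult_scaleR)

lemma norm_vec_vec_power2: "(norm (x :: (real^'p)^'k))\<^sup>2 = (\<Sum>c\<in>UNIV. (norm (x $ c))\<^sup>2)"
  unfolding power2_norm_eq_inner by (simp add: inner_vec_def)

text \<open>Each of the \<open>CARD('k)\<close> components is the convolution operator with its
  output index shifted; the squared bounds add up.\<close>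

lemma op_bound_window_map:
  fixes a :: "int \<Rightarrow> real^'d^'p" and idx :: "'k::finite \<Rightarrow> nat"
  assumes "l2_bound a N" "finite K" "finite J"
  shows "op_bound K J (window_map idx a :: nat \<Rightarrow> int \<Rightarrow> real^'d \<Rightarrow> (real^'p)^'k) (sqrt CARD('k) * N)"
  unfolding op_bound_def
proof
  fix u :: "int \<Rightarrow> real^'d"
  have "(\<Sum>k\<in>K. (norm (\<Sum>j\<in>J. window_map idx a k j (u j) :: (real^'p)^'k))\<^sup>2)
      = (\<Sum>c\<in>(UNIV :: 'k set). \<Sum>k\<in>K. (norm (\<Sum>j\<in>J. a (j - (1 + int k + int (idx c))) *v u j))\<^sup>2)"
    by (subst sum.swap) (simp add: norm_vec_vec_power2 window_map_def)
  also have "\<dots> \<le> (\<Sum>c\<in>(UNIV :: 'k set). N\<^sup>2 * (\<Sum>j\<in>J. (norm (u j))\<^sup>2))"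
  proof (rule sum_mono)
    fix c :: 'k
    let ?h = "\<lambda>k. 1 + int k + int (idx c)"
    have "inj_on ?h K" by (auto simp: inj_on_def)
    then have "(\<Sum>k\<in>K. (norm (\<Sum>j\<in>J. a (j - ?h k) *v u j))\<^sup>2) = (\<Sum>k\<in>?h ` K. (norm (\<Sum>j\<in>J. a (j - k) *v u j))\<^sup>2)"
      by (simp add: sum.reindex o_def)
    also have "\<dots> \<le> N\<^sup>2 * (\<Sum>j\<in>J. (norm (u j))\<^sup>2)"
      by (rule assms(1)[unfolded l2_bound_def, rule_format]) (use assms in auto)
    finally show "(\<Sum>k\<in>K. (norm (\<Sum>j\<in>J. a (j - ?h k) *v u j))\<^sup>2) \<le> N\<^sup>2 * (\<Sum>j\<in>J. (norm (u j))\<^sup>2)" .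
  qed
  also have "\<dots> = (sqrt CARD('k) * N)\<^sup>2 * (\<Sum>j\<in>J. (norm (u j))\<^sup>2)"
    by (simp add: power_mult_distrib)
  finally show "(\<Sum>k\<in>K. (norm (\<Sum>j\<in>J. window_map idx a k j (u j) :: (real^'p)^'k))\<^sup>2)
      \<le> (sqrt CARD('k) * N)\<^sup>2 * (\<Sum>j\<in>J. (norm (u j))\<^sup>2)" .
qed

lemma op_bound_mono: "op_bound K J L N \<Longrightarrow> 0 \<le> N \<Longrightarrow> N \<le> N' \<Longrightarrow> op_bound K J L N'"
  unfolding op_bound_def
  by (meson mult_right_mono order_trans power_mono sum_nonneg zero_le_power2)

lemma op_bound_zero: "op_bound K J (\<lambda>k j x. 0) N"
  by (simp add: op_bound_def sum_nonneg)

text \<open>The approximating coefficients must have an operator bound of their own; it comes from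
  \<open>a' = a - (a - a')\<close>, with a generous constant.\<close>

lemma l2_bound_perturbation:
  fixes a a' :: "int \<Rightarrow> real^'d^'p"
  assumes a: "l2_bound a N" and d: "l2_bound (\<lambda>n. a n - a' n) \<delta>" and "0 \<le> N" "0 \<le> \<delta>"
  shows "l2_bound a' (2 * (N + \<delta>))"
  unfolding l2_bound_def
proof (intro allI impI)
  fix K J :: "int set" and u :: "int \<Rightarrow> real^'d"
  assume fin: "finite K" "finite J"
  let ?x = "\<lambda>k. \<Sum>j\<in>J. a (j - k) *v u j" and ?z = "\<lambda>k. \<Sum>j\<in>J. (a (j - k) - a' (j - k)) *v u j"
  let ?U = "\<Sum>j\<in>J. (norm (u j))\<^sup>2"
  have "(\<Sum>k\<in>K. (norm (\<Sum>j\<in>J. a' (j - k) *v u j))\<^sup>2) \<le> (\<Sum>k\<in>K. 2 * (norm (?x k))\<^sup>2 + 2 * (norm (?z k))\<^sup>2)"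
  proof (rule sum_mono)
    fix k
    have "(\<Sum>j\<in>J. a' (j - k) *v u j) = ?x k - ?z k"
      by (simp add: matrix_vector_mult_diff_rdistrib sum_subtractf)
    then have "(norm (\<Sum>j\<in>J. a' (j - k) *v u j))\<^sup>2 \<le> (norm (?x k) + norm (?z k))\<^sup>2"
      using norm_triangle_ineq4[of "?x k" "?z k"] by (intro power_mono) auto
    also have "\<dots> \<le> 2 * (norm (?x k))\<^sup>2 + 2 * (norm (?z k))\<^sup>2"
      using sum_squares_bound[of "norm (?x k)" "norm (?z k)"] by (simp add: power2_sum)
    finally show "(norm (\<Sum>j\<in>J. a' (j - k) *v u j))\<^sup>2 \<le> 2 * (norm (?x k))\<^sup>2 + 2 * (norm (?z k))\<^sup>2" .
  qed
  also have "\<dots> = 2 * (\<Sum>k\<in>K. (norm (?x k))\<^sup>2) + 2 * (\<Sum>k\<in>K. (norm (?z k))\<^sup>2)"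
    by (simp add: sum.distrib sum_distrib_left)
  also have "\<dots> \<le> 2 * (N\<^sup>2 * ?U) + 2 * (\<delta>\<^sup>2 * ?U)"
    using a d fin unfolding l2_bound_def by (intro add_mono mult_left_mono) auto
  also have "\<dots> = (2 * N\<^sup>2 + 2 * \<delta>\<^sup>2) * ?U" by (simp add: algebra_simps)
  also have "\<dots> \<le> (2 * (N + \<delta>))\<^sup>2 * ?U"
  proof (rule mult_right_mono)
    have "0 \<le> N * \<delta>" using assms by simp
    then show "2 * N\<^sup>2 + 2 * \<delta>\<^sup>2 \<le> (2 * (N + \<delta>))\<^sup>2" by (simp add: power2_eq_square algebra_simps)
  qed (auto intro: sum_nonneg)
  finally show "(\<Sum>k\<in>K. (norm (\<Sum>j\<in>J. a' (j - k) *v u j))\<^sup>2) \<le> (2 * (N + \<delta>))\<^sup>2 * ?U" .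
qed

context iid_lsi
begin

text \<open>For given operator bounds neither the radius nor the constant per step depends on
  \<open>K\<close>; the limit in the number of steps rests on this uniformity.\<close>

lemma difference_subgaussian:
  fixes L L' :: "'k \<Rightarrow> 'i \<Rightarrow> 'a \<Rightarrow> 'e::euclidean_space"
  assumes C11: "C11_function f Df \<Lambda>" and "finite K"
    and lin: "\<And>k j. linear (L k j)" "\<And>k j. linear (L' k j)"
    and op: "\<And>J. finite J \<Longrightarrow> op_bound K J L N" "\<And>J. finite J \<Longrightarrow> op_bound K J L' N"
      "\<And>J. finite J \<Longrightarrow> op_bound K J (\<lambda>k j x. L k j x - L' k j x) \<delta>"
    and pos: "0 < N" "0 < \<delta>"
    and V: "\<And>k. k \<in> K \<Longrightarrow> L2_sum M (\<lambda>j \<omega>. L k j (\<xi> j \<omega>)) (V k)"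
      "\<And>k. k \<in> K \<Longrightarrow> L2_sum M (\<lambda>j \<omega>. L' k j (\<xi> j \<omega>)) (V' k)"
  shows "subgaussian M (\<lambda>\<omega>. \<Sum>k\<in>K. f (V k \<omega>) - f (V' k \<omega>))
    (C * (4 * (norm (Df 0))\<^sup>2 + 36 * C * DIM('e) * \<Lambda>\<^sup>2 * N\<^sup>2) * \<delta>\<^sup>2 * card K)
    (1 / (1 + 32 * C\<^sup>2 * N\<^sup>2 * \<delta>\<^sup>2 * (\<Lambda>\<^sup>2 + 1)))"
  unfolding subgaussian_def
proof (intro conjI allI impI)
  define A where "A = 32 * C\<^sup>2 * N\<^sup>2 * \<delta>\<^sup>2 * (\<Lambda>\<^sup>2 + 1)"
  have A: "0 \<le> A" by (auto simp: A_def intro!: mult_nonneg_nonneg)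
  have small: "32 * C\<^sup>2 * N\<^sup>2 * \<delta>\<^sup>2 * (\<Lambda>\<^sup>2 + 1) * t\<^sup>2 \<le> 1" if "\<bar>t\<bar> \<le> 1 / (1 + A)" for t
  proof -
    \<comment> \<open>Multiplying \<open>\<bar>t\<bar> \<le> 1\<close> and
      \<open>\<bar>t\<bar> \<le> 1 / (1 + A)\<close> gives
      \<open>t\<^sup>2 \<le> 1 / (1 + A)\<close>; this avoids a square root in the radius.\<close>
    have "1 / (1 + A) \<le> 1" using A by simp
    then have "\<bar>t\<bar> \<le> 1" using that by linarith
    then have "\<bar>t\<bar> * \<bar>t\<bar> \<le> 1 / (1 + A) * 1" using that A by (intro mult_mono) auto
    then have "A * t\<^sup>2 \<le> A * (1 / (1 + A))" using A by (intro mult_left_mono) (auto simp: power2_eq_square)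
    also have "\<dots> \<le> 1" using A by simp
    finally show ?thesis by (simp add: A_def)
  qed
  show "integrable M (\<lambda>\<omega>. \<Sum>k\<in>K. f (V k \<omega>) - f (V' k \<omega>))"
    by (rule difference_concentration_L2(1)[OF C11 \<open>finite K\<close> lin op pos _ V, where t=0]) auto
  fix t assume "\<bar>t\<bar> \<le> 1 / (1 + 32 * C\<^sup>2 * N\<^sup>2 * \<delta>\<^sup>2 * (\<Lambda>\<^sup>2 + 1))"
  then have "32 * C\<^sup>2 * N\<^sup>2 * \<delta>\<^sup>2 * (\<Lambda>\<^sup>2 + 1) * t\<^sup>2 \<le> 1" by (intro small) (simp add: A_def)
  from difference_concentration_L2(2)[OF C11 \<open>finite K\<close> lin op pos this V]
  show "(\<integral>\<^sup>+\<omega>. ennreal (exp (t * centered M (\<lambda>\<omega>. \<Sum>k\<in>K. f (V k \<omega>) - f (V' k \<omega>)) \<omega>)) \<partial>M)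
    \<le> ennreal (exp (C * (4 * (norm (Df 0))\<^sup>2 + 36 * C * DIM('e) * \<Lambda>\<^sup>2 * N\<^sup>2) * \<delta>\<^sup>2 * card K * t\<^sup>2))"
    unfolding centered_def by simp
qed

lemma L2_sum_zero: "L2_sum M (\<lambda>j \<omega>. 0) (\<lambda>\<omega>. 0)"
  by (simp add: L2_sum_def)

text \<open>Comparison with the zero operator, so that \<open>\<delta> = N\<close>: subtracting
  \<open>f 0\<close> from every summand changes the sum by a constant, which centering
  removes.\<close>

lemma sum_subgaussian:
  fixes L :: "'k \<Rightarrow> 'i \<Rightarrow> 'a \<Rightarrow> 'e::euclidean_space"
  assumes C11: "C11_function f Df \<Lambda>" and "finite K" and lin: "\<And>k j. linear (L k j)"
    and op: "\<And>J. finite J \<Longrightarrow> op_bound K J L N" and pos: "0 < N"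
    and V: "\<And>k. k \<in> K \<Longrightarrow> L2_sum M (\<lambda>j \<omega>. L k j (\<xi> j \<omega>)) (V k)"
  shows "subgaussian M (\<lambda>\<omega>. \<Sum>k\<in>K. f (V k \<omega>))
    (C * (4 * (norm (Df 0))\<^sup>2 + 36 * C * DIM('e) * \<Lambda>\<^sup>2 * N\<^sup>2) * N\<^sup>2 * card K)
    (1 / (1 + 32 * C\<^sup>2 * N\<^sup>2 * N\<^sup>2 * (\<Lambda>\<^sup>2 + 1)))" (is "subgaussian M ?S ?\<kappa> ?\<tau>")
proof -
  let ?D = "\<lambda>\<omega>. \<Sum>k\<in>K. f (V k \<omega>) - f 0"
  have sg: "subgaussian M ?D ?\<kappa> ?\<tau>"
    by (rule difference_subgaussian[where L'="\<lambda>k j x. 0" and V'="\<lambda>k \<omega>. 0", OF C11 \<open>finite K\<close> lin _ op _ _ pos pos V L2_sum_zero])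
      (auto simp: op_bound_zero op module_hom_zero linear_zero)
  have eq: "?S = (\<lambda>\<omega>. ?D \<omega> + card K * f 0)" by (simp add: sum_subtractf)
  have iD: "integrable M ?D" using sg by (simp add: subgaussian_def)
  have iS: "integrable M ?S" unfolding eq using iD by (intro Bochner_Integration.integrable_add integrable_const)
  have "centered M ?S = centered M ?D"
    unfolding eq by (rule centered_add_const[OF iD])
  then show ?thesis using sg iS by (simp add: subgaussian_def)
qed

end

text \<open>The window as an explicit function of a realization \<open>w\<close> of the noise, for
  coefficients supported in \<open>{- r..r}\<close>. It reads finitely many coordinates, and this is
  what makes separated blocks independent.\<close>

definition finite_window :: "('k::finite \<Rightarrow> nat) \<Rightarrow> (int \<Rightarrow> real^'d^'p) \<Rightarrow> nat \<Rightarrow> nat \<Rightarrow> (int \<Rightarrow> real^'d) \<Rightarrow> (real^'p)^'k" where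
  "finite_window idx a r k w = (\<chi> c. \<Sum>j\<in>{- int r..int r}. a j *v w (1 + int k + int (idx c) + j))"

lemma finite_window_eq:
  assumes a: "\<And>n. int r < \<bar>n\<bar> \<Longrightarrow> a n = 0" and "finite J" and idx: "\<And>c. idx c \<le> l"
    and J: "{1 + int k - int r..1 + int k + int l + int r} \<subseteq> J"
  shows "finite_window idx a r k w = (\<Sum>j\<in>J. window_map idx a k j (w j))"
proof -
  have "(\<Sum>j\<in>{- int r..int r}. a j *v w (b + j)) = (\<Sum>j\<in>J. a (j - b) *v w j)" if b: "{b - int r..b + int r} \<subseteq> J" for b
  proof -
    have "(\<Sum>j\<in>{- int r..int r}. a j *v w (b + j)) = (\<Sum>j\<in>{b - int r..b + int r}. a (j - b) *v w j)"
      by (rule sum.reindex_bij_witness[of _ "\<lambda>j. j - b" "\<lambda>j. b + j"]) auto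
    also have "\<dots> = (\<Sum>j\<in>J. a (j - b) *v w j)"
      using b \<open>finite J\<close> by (intro sum.mono_neutral_left) (auto simp: a)
    finally show ?thesis .
  qed
  moreover have "{(1 + int k + int (idx c)) - int r..(1 + int k + int (idx c)) + int r} \<subseteq> J" for c
    using J idx[of c] by force
  ultimately show ?thesis
    by (simp add: vec_eq_iff finite_window_def window_map_def)
qed

locale block_structure = iid_lsi M \<mu> \<xi> C
  for M :: "'w measure" and \<mu> :: "(real^'d) measure" and \<xi> :: "int \<Rightarrow> 'w \<Rightarrow> real^'d" and C :: real +
  fixes idx :: "'k::finite \<Rightarrow> nat" and l :: nat and a :: "int \<Rightarrow> real^'d^'p" and r m :: nat
    and f :: "(real^'p)^'k \<Rightarrow> real"
  assumes idx: "\<And>c. idx c \<le> l" and a: "\<And>n. int r < \<bar>n\<bar> \<Longrightarrow> a n = 0"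
    and f_meas [measurable]: "f \<in> borel_measurable borel"
begin

text \<open>A period consists of \<open>m\<close> windows that are kept and \<open>l + 2 * r\<close>
  that are dropped. A window reads the noise on an interval of at most \<open>l + 2 * r + 1\<close>
  indices, so the gap separates the index sets of successive blocks.\<close>

definition R where "R = m + l + 2 * r"

definition blk :: "nat \<Rightarrow> (int \<Rightarrow> real^'d) \<Rightarrow> real" where
  "blk i w = (\<Sum>j<m. f (finite_window idx a r (i * R + j) w))"

definition B where "B i \<omega> = blk i (\<lambda>j. \<xi> j \<omega>)"

definition I :: "nat \<Rightarrow> int set" where
  "I i = {1 + int (i * R) - int r..int (i * R) + int m + int l + int r}"

lemma blk_measurable: "blk i \<in> borel_measurable (Pi\<^sub>M (I i) (\<lambda>_. borel))"
proof -
  have "finite_window idx a r (i * R + j) = (\<lambda>w. \<Sum>j'\<in>I i. window_map idx a (i * R + j) j' (w j'))" if "j < m" for j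
    using that by (intro ext finite_window_eq[OF a _ idx]) (auto simp: I_def)
  then have "finite_window idx a r (i * R + j) \<in> borel_measurable (Pi\<^sub>M (I i) (\<lambda>_. borel))" if "j < m" for j
    using measurable_linear_combination[of "window_map idx a (i * R + j)" "I i", OF linear_window_map] that by simp
  then show ?thesis
    unfolding blk_def by (intro borel_measurable_sum measurable_compose[OF _ f_meas]) auto
qed

text \<open>A block reads the noise inside \<open>I i\<close> only, so distinct blocks are functions
  of disjoint groups of independent variables.\<close>

lemma blk_local: "blk i w = blk i (\<lambda>j\<in>I i. w j)"
  unfolding blk_def finite_window_def
proof (intro sum.cong refl arg_cong[of _ _ f])
  fix j assume "j \<in> {..<m}"
  then have "1 + int (i * R + j) + int (idx c) + j' \<in> I i" if "j' \<in> {- int r..int r}" for c j'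
    using that idx[of c] by (auto simp: I_def)
  then show "(\<chi> c. \<Sum>j'\<in>{- int r..int r}. a j' *v w (1 + int (i * R + j) + int (idx c) + j'))
      = (\<chi> c. \<Sum>j'\<in>{- int r..int r}. a j' *v (\<lambda>j\<in>I i. w j) (1 + int (i * R + j) + int (idx c) + j'))"
    by (simp add: vec_eq_iff)
qed

lemma blk_shift: "blk i w = blk 0 (\<lambda>j. w (j + int (i * R)))"
  unfolding blk_def finite_window_def by (simp add: algebra_simps)

lemma I_disjoint: "disjoint_family_on I UNIV"
proof -
  have "I i \<inter> I j = {}" if "i < j" for i j
  proof -
    have "Suc i * R \<le> j * R" using that by (intro mult_le_mono1) simp
    then have "i * R + m + l + 2 * r \<le> j * R" by (simp add: R_def)
    then have "int (i * R) + int m + int l + 2 * int r \<le> int (j * R)" by linarith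
    then show ?thesis by (auto simp: I_def)
  qed
  then show ?thesis
    unfolding disjoint_family_on_def by (metis inf_commute nat_neq_iff)
qed

lemma B_indep: "indep_vars (\<lambda>_. borel) B UNIV"
proof -
  have "indep_vars (\<lambda>i. Pi\<^sub>M (I i) (\<lambda>_. borel)) (\<lambda>i \<omega>. \<lambda>j\<in>I i. \<xi> j \<omega>) UNIV"
    by (rule indep_vars_restrict[OF indep _ I_disjoint]) simp
  from indep_vars_compose2[OF this, of blk "\<lambda>_. borel"] blk_measurable
  have "indep_vars (\<lambda>_. borel) (\<lambda>i \<omega>. blk i (\<lambda>j\<in>I i. \<xi> j \<omega>)) UNIV" by simp
  then show ?thesis
    unfolding B_def[abs_def] by (subst blk_local) simp
qed

text \<open>Stationarity: block \<open>i\<close> is block 0 evaluated at shifted coordinates, and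
  the product measure is invariant under the shift of indices. Positivity of \<open>m\<close> makes
  the index sets nonempty.\<close>

lemma B_law:
  assumes "0 < m"
  shows "distr M borel (B i) = distr M borel (B 0)"
proof -
  have ne: "I i \<noteq> {}" for i using assms by (simp add: I_def)
  have prob: "prob_space \<mu>" using lsi_product_centered[of "{}"]
    by (simp add: lsi_product_centered_def lsi_product_def)
  have sets: "sets (Pi\<^sub>M J (\<lambda>_. \<mu>)) = sets (Pi\<^sub>M J (\<lambda>_. borel))" for J :: "int set"
    using law[of 0] by (intro sets_PiM_cong) (auto simp: )
  have B_distr: "distr M borel (B i) = distr (Pi\<^sub>M (I i) (\<lambda>_. \<mu>)) borel (blk i)" for i
  proof -
    have "distr M borel (B i) = distr M borel (blk i \<circ> (\<lambda>\<omega>. \<lambda>j\<in>I i. \<xi> j \<omega>))"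
      unfolding B_def[abs_def] o_def by (subst blk_local) simp
    also have "\<dots> = distr (distr M (Pi\<^sub>M (I i) (\<lambda>_. borel)) (\<lambda>\<omega>. \<lambda>j\<in>I i. \<xi> j \<omega>)) borel (blk i)"
      by (rule distr_distr[symmetric, OF blk_measurable restrict_measurable])
    finally show ?thesis by (simp only: distr_PiM_finite[OF ne])
  qed
  define sh where "sh w = (\<lambda>j\<in>I 0. w (j + int (i * R)))" for w :: "int \<Rightarrow> real^'d"
  have inj: "inj_on (\<lambda>j. j + int (i * R)) (I 0)" "(\<lambda>j. j + int (i * R)) \<in> I 0 \<rightarrow> I i"
    by (auto simp: inj_on_def I_def)
  have "distr (Pi\<^sub>M (I i) (\<lambda>_. \<mu>)) (Pi\<^sub>M (I 0) (\<lambda>_. \<mu>)) sh = Pi\<^sub>M (I 0) (\<lambda>_. \<mu>)"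
    unfolding sh_def using distr_PiM_reindex[OF _ inj, of "\<lambda>_. \<mu>"] prob by simp
  then have "distr (Pi\<^sub>M (I 0) (\<lambda>_. \<mu>)) borel (blk 0) = distr (distr (Pi\<^sub>M (I i) (\<lambda>_. \<mu>)) (Pi\<^sub>M (I 0) (\<lambda>_. \<mu>)) sh) borel (blk 0)"
    by simp
  also have "\<dots> = distr (Pi\<^sub>M (I i) (\<lambda>_. \<mu>)) borel (blk 0 \<circ> sh)"
  proof (rule distr_distr)
    show "blk 0 \<in> borel_measurable (Pi\<^sub>M (I 0) (\<lambda>_. \<mu>))"
      using blk_measurable[of 0] by (simp add: measurable_cong_sets[OF sets refl])
    show "sh \<in> Pi\<^sub>M (I i) (\<lambda>_. \<mu>) \<rightarrow>\<^sub>M Pi\<^sub>M (I 0) (\<lambda>_. \<mu>)"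
      unfolding sh_def using inj(2) by (intro measurable_restrict measurable_component_singleton) auto
  qed
  also have "blk 0 \<circ> sh = blk i"
    by (simp add: fun_eq_iff sh_def blk_shift[of i] blk_local[symmetric, of 0])
  finally show ?thesis by (simp only: B_distr)
qed

text \<open>Division with remainder by the period: the kept windows are those whose index has
  remainder below \<open>m\<close>.\<close>

lemma sum_blocks:
  fixes g :: "nat \<Rightarrow> real"
  shows "(\<Sum>i<q. \<Sum>j<m. g (i * R + j)) = (\<Sum>k\<in>{k. k < q * R \<and> k mod R < m}. g k)"
proof (cases "R = 0")
  case False
  have "(\<Sum>k\<in>{k. k < q * R \<and> k mod R < m}. g k) = (\<Sum>k<q * R. if k mod R < m then g k else 0)"
    by (subst sum.If_cases) (auto intro!: sum.cong)
  also have "\<dots> = (\<Sum>i<q. \<Sum>k=i * R..<i * R + R. if k mod R < m then g k else 0)"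
    by (rule sum.nat_group[symmetric])
  also have "\<dots> = (\<Sum>i<q. \<Sum>j<m. g (i * R + j))"
  proof (rule sum.cong[OF refl])
    fix i
    have "(\<Sum>k=i * R..<i * R + R. if k mod R < m then g k else 0) = (\<Sum>j<R. if (i * R + j) mod R < m then g (i * R + j) else 0)"
      using sum.shift_bounds_nat_ivl[of "\<lambda>k. if k mod R < m then g k else 0" 0 "i * R" R]
      by (simp only: add.commute[of _ "i * R"] add_0_right atLeast0LessThan)
    also have "\<dots> = (\<Sum>j<R. if j < m then g (i * R + j) else 0)"
      by (intro sum.cong) auto
    also have "\<dots> = (\<Sum>j<m. g (i * R + j))"
      by (subst sum.If_cases) (auto simp: R_def intro!: sum.cong)
    finally show "(\<Sum>k=i * R..<i * R + R. if k mod R < m then g k else 0) = (\<Sum>j<m. g (i * R + j))" .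
  qed
  finally show ?thesis by simp
qed (simp add: R_def)

end

text \<open>The symbol enters only through two consequences of its continuity: the operator bound
  \<open>N\<close> and the approximations in \<open>finite_range\<close>.\<close>

locale moving_window = iid_lsi M \<mu> \<xi> C
  for M :: "'w measure" and \<mu> :: "(real^'d) measure" and \<xi> :: "int \<Rightarrow> 'w \<Rightarrow> real^'d" and C :: real +
  fixes idx :: "'k::finite \<Rightarrow> nat" and l :: nat and a :: "int \<Rightarrow> real^'d^'p" and X :: "int \<Rightarrow> 'w \<Rightarrow> real^'p" and N :: real
  assumes idx: "\<And>c. idx c \<le> l" and N: "0 < N" "l2_bound a N"
    and finite_range: "\<And>\<delta>. 0 < \<delta> \<Longrightarrow> \<exists>a' r. (\<forall>n. r < \<bar>n\<bar> \<longrightarrow> a' n = 0) \<and> l2_bound (\<lambda>n. a n - a' n) \<delta>"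
    and X: "moving_average M a \<xi> X"
begin

text \<open>Each component of a window is a shifted copy of the series for \<open>X\<close>, and the
  filter of finite index sets is invariant under shifts; the squared errors of the components add
  up.\<close>

lemma window_L2_sum:
  "L2_sum M (\<lambda>j \<omega>. window_map idx a k j (\<xi> j \<omega>)) (window idx X (1 + int k))"
  unfolding L2_sum_def
proof (intro conjI allI)
  have Xn: "L2_sum M (\<lambda>j \<omega>. a j *v \<xi> (n + j) \<omega>) (X n)" for n
    using X by (simp add: moving_average_def)
  have [measurable]: "X n \<in> borel_measurable M" for n
    using Xn[of n] by (simp add: L2_sum_def)
  have wm: "continuous_on UNIV (window_map idx a k j)" for j
    using linear_window_map by (intro linear_continuous_on) (simp add: linear_conv_bounded_linear)
  show "(\<lambda>\<omega>. window_map idx a k j (\<xi> j \<omega>)) \<in> borel_measurable M" for j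
    using borel_measurable_continuous_onI[OF wm] by measurable
  show "window idx X (1 + int k) \<in> borel_measurable M"
    unfolding window_def
  proof (rule borel_measurable_euclidean_space[THEN iffD2], intro ballI)
    fix b :: "(real^'p)^'k" assume "b \<in> Basis"
    have "(\<lambda>\<omega>. (\<chi> i. X (1 + int k + int (idx i)) \<omega>) \<bullet> b) = (\<lambda>\<omega>. \<Sum>i\<in>UNIV. X (1 + int k + int (idx i)) \<omega> \<bullet> b $ i)"
      by (simp add: inner_vec_def)
    also have "\<dots> \<in> borel_measurable M" by measurable
    finally show "(\<lambda>\<omega>. (\<chi> i. X (1 + int k + int (idx i)) \<omega>) \<bullet> b) \<in> borel_measurable M" .
  qed
  define e where "e c J = (\<integral>\<^sup>+\<omega>. ennreal ((norm (X (1 + int k + int (idx c)) \<omega> - (\<Sum>j\<in>J. a (j - (1 + int k + int (idx c))) *v \<xi> j \<omega>)))\<^sup>2) \<partial>M)" for c J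
  have "(e c \<longlongrightarrow> 0) (finite_subsets_at_top UNIV)" for c
  proof -
    let ?n = "1 + int k + int (idx c)"
    let ?h = "\<lambda>j. j - ?n"
    have F: "((\<lambda>J. \<integral>\<^sup>+\<omega>. ennreal ((norm (X ?n \<omega> - (\<Sum>j\<in>J. a j *v \<xi> (?n + j) \<omega>)))\<^sup>2) \<partial>M) \<longlongrightarrow> 0) (finite_subsets_at_top UNIV)"
      using Xn[of ?n] by (simp add: L2_sum_def)
    have eq: "filtermap ((`) ?h) (finite_subsets_at_top UNIV) = finite_subsets_at_top UNIV"
    proof -
      have "inj ?h" "range ?h = UNIV" by (auto simp: inj_def intro!: surjI[of _ "\<lambda>j. j + ?n"])
      then show ?thesis using filtermap_image_finite_subsets_at_top[of ?h UNIV] by simp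
    qed
    have "((\<lambda>J. \<integral>\<^sup>+\<omega>. ennreal ((norm (X ?n \<omega> - (\<Sum>j\<in>J. a j *v \<xi> (?n + j) \<omega>)))\<^sup>2) \<partial>M) \<longlongrightarrow> 0) (filtermap ((`) ?h) (finite_subsets_at_top UNIV))"
      unfolding eq by (rule F)
    then have "((\<lambda>J. \<integral>\<^sup>+\<omega>. ennreal ((norm (X ?n \<omega> - (\<Sum>j\<in>?h ` J. a j *v \<xi> (?n + j) \<omega>)))\<^sup>2) \<partial>M) \<longlongrightarrow> 0) (finite_subsets_at_top UNIV)"
      by (simp only: filterlim_filtermap)
    moreover have "(\<Sum>j\<in>?h ` J. a j *v \<xi> (?n + j) \<omega>) = (\<Sum>j\<in>J. a (j - ?n) *v \<xi> j \<omega>)" for J \<omega>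
      by (subst sum.reindex) (auto simp: inj_on_def)
    ultimately show ?thesis by (simp add: e_def[abs_def])
  qed
  then have "((\<lambda>J. \<Sum>c\<in>UNIV. e c J) \<longlongrightarrow> (\<Sum>c\<in>(UNIV :: 'k set). 0)) (finite_subsets_at_top UNIV)"
    by (intro tendsto_sum)
  moreover have "(\<Sum>c\<in>UNIV. e c J) = (\<integral>\<^sup>+\<omega>. ennreal ((norm (window idx X (1 + int k) \<omega> - (\<Sum>j\<in>J. window_map idx a k j (\<xi> j \<omega>))))\<^sup>2) \<partial>M)" for J
  proof -
    have am: "(\<lambda>\<omega>. A *v \<xi> j \<omega>) \<in> borel_measurable M" for A :: "real^'d^'p" and j
      by (intro measurable_compose[OF \<xi>_measurable] borel_measurable_continuous_onI linear_continuous_on) (simp add: matrix_vector_mul_bounded_linear)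
    have "(\<Sum>c\<in>UNIV. e c J) = (\<integral>\<^sup>+\<omega>. (\<Sum>c\<in>UNIV. ennreal ((norm (X (1 + int k + int (idx c)) \<omega> - (\<Sum>j\<in>J. a (j - (1 + int k + int (idx c))) *v \<xi> j \<omega>)))\<^sup>2)) \<partial>M)"
      unfolding e_def using am by (intro nn_integral_sum[symmetric]) auto
    also have "\<dots> = (\<integral>\<^sup>+\<omega>. ennreal ((norm (window idx X (1 + int k) \<omega> - (\<Sum>j\<in>J. window_map idx a k j (\<xi> j \<omega>))))\<^sup>2) \<partial>M)"
      by (intro nn_integral_cong) (simp add: norm_vec_vec_power2 window_def window_map_def sum_ennreal)
    finally show ?thesis .
  qed
  ultimately show "((\<lambda>J. \<integral>\<^sup>+\<omega>. ennreal ((norm (window idx X (1 + int k) \<omega> - (\<Sum>j\<in>J. window_map idx a k j (\<xi> j \<omega>))))\<^sup>2) \<partial>M) \<longlongrightarrow> 0) (finite_subsets_at_top UNIV)"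
    by simp
qed

lemma finite_window_L2_sum:
  assumes "\<And>n. int r < \<bar>n\<bar> \<Longrightarrow> a' n = 0"
  shows "L2_sum M (\<lambda>j \<omega>. window_map idx (a' :: int \<Rightarrow> real^'d^'p) k j (\<xi> j \<omega>)) (\<lambda>\<omega>. finite_window idx a' r k (\<lambda>j. \<xi> j \<omega>))"
proof -
  have wm: "continuous_on UNIV (window_map idx a' k j)" for j
    using linear_window_map by (intro linear_continuous_on) (simp add: linear_conv_bounded_linear)
  have m [measurable]: "(\<lambda>\<omega>. window_map idx a' k j (\<xi> j \<omega>)) \<in> borel_measurable M" for j
    using borel_measurable_continuous_onI[OF wm] by measurable
  define J0 where "J0 = {1 + int k - int r..1 + int k + int l + int r}"
  have eq: "finite_window idx a' r k (\<lambda>j. \<xi> j \<omega>) = (\<Sum>j\<in>J. window_map idx a' k j (\<xi> j \<omega>))" if "finite J" "J0 \<subseteq> J" for J \<omega>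
    using finite_window_eq[where a=a' and r=r and idx=idx and l=l and k=k and J=J and w="\<lambda>j. \<xi> j \<omega>", OF assms that(1) idx] that(2) by (simp add: J0_def)
  have "\<forall>\<^sub>F J in finite_subsets_at_top UNIV.
      (\<integral>\<^sup>+\<omega>. ennreal ((norm (finite_window idx a' r k (\<lambda>j. \<xi> j \<omega>) - (\<Sum>j\<in>J. window_map idx a' k j (\<xi> j \<omega>))))\<^sup>2) \<partial>M) = 0"
    unfolding eventually_finite_subsets_at_top
    by (intro exI[of _ J0]) (auto simp: J0_def[symmetric] eq[symmetric], simp add: J0_def)
  moreover have "(\<lambda>\<omega>. finite_window idx a' r k (\<lambda>j. \<xi> j \<omega>)) \<in> borel_measurable M"
    by (subst eq[of J0]) (auto simp: J0_def)
  ultimately show ?thesis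
    unfolding L2_sum_def using m by (auto intro: tendsto_eventually)
qed

text \<open>The error of the approximation by independent blocks has two sources: replacing
  \<open>a\<close> by \<open>a'\<close> at every step, and the windows kept by no block. Both become
  small per step by choosing \<open>\<delta>\<close> small and then \<open>m\<close> large; the
  order matters, because the range \<open>r\<close> and with it the length of the gaps depend on
  \<open>\<delta>\<close>.\<close>

theorem scalar_asymptotics:
  fixes f :: "(real^'p)^'k \<Rightarrow> real"
  assumes C11: "C11_function f Df \<Lambda>"
  defines "S \<equiv> \<lambda>n \<omega>. \<Sum>k<n. f (window idx X (1 + int k) \<omega>)"
  shows "integrable M (S n)" "integrable M (\<lambda>\<omega>. (centered M (S n) \<omega>)\<^sup>2)"
    "\<exists>v. (\<lambda>n. (\<integral>\<omega>. (centered M (S n) \<omega>)\<^sup>2 \<partial>M) / n) \<longlonglongrightarrow> v \<and>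
    (\<forall>t::nat \<Rightarrow> real. t \<longlonglongrightarrow> 0 \<longrightarrow> (\<forall>n. 0 < t n) \<longrightarrow>
        (\<forall>\<^sub>F n in sequentially. integrable M (\<lambda>\<omega>. exp (t n * centered M (S n) \<omega>))) \<and>
        (\<lambda>n. cumulant M (S n) (t n) / (n * (t n)\<^sup>2)) \<longlonglongrightarrow> v / 2)"
proof -
  interpret f: C11_function f Df \<Lambda> by fact
  define s where "s = sqrt CARD('k)"
  have s: "0 < s" by (simp add: s_def)
  \<comment> \<open>One norm bound for \<open>a\<close> and for every approximation
    \<open>a'\<close> with \<open>\<delta> \<le> 1\<close>, including the factor \<open>s\<close>
    for the number of components of a window.\<close>
  define N1 where "N1 = s * (2 * (N + 1))"
  have N1: "0 < N1" using N s by (simp add: N1_def)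
  define c where "c = C * (4 * (norm (Df 0))\<^sup>2 + 36 * C * DIM((real^'p)^'k) * \<Lambda>\<^sup>2 * N1\<^sup>2)"
  have c: "0 < c"
    unfolding c_def using C_positive f.Lip_pos N1 by (intro mult_pos_pos add_nonneg_pos) auto
  have op_a: "op_bound K J (window_map idx a :: nat \<Rightarrow> int \<Rightarrow> real^'d \<Rightarrow> (real^'p)^'k) N1" if "finite K" "finite J" for K J
    by (rule op_bound_mono[OF op_bound_window_map[OF N(2) that]])
      (use N s in \<open>auto simp: N1_def s_def intro!: mult_left_mono\<close>)
  have sgS: "subgaussian M (S n) (c * N1\<^sup>2 * n) (1 / (1 + 32 * C\<^sup>2 * N1\<^sup>2 * N1\<^sup>2 * (\<Lambda>\<^sup>2 + 1)))" for n
    unfolding S_def c_def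
    using sum_subgaussian[OF C11 finite_lessThan linear_window_map op_a N1 window_L2_sum, of n] by simp
  have \<tau>pos: "0 < 1 / (1 + 32 * C\<^sup>2 * N1\<^sup>2 * \<delta>\<^sup>2 * (\<Lambda>\<^sup>2 + 1))" for \<delta>
    by (intro divide_pos_pos add_pos_nonneg) auto
  show iS: "integrable M (S n)" for n using sgS[of n] by (simp add: subgaussian_def)
  show iS2: "integrable M (\<lambda>\<omega>. (centered M (S n) \<omega>)\<^sup>2)" for n
    by (rule subgaussian_variance(1)[OF sgS \<tau>pos]) (use c in simp)
  show "\<exists>v. (\<lambda>n. (\<integral>\<omega>. (centered M (S n) \<omega>)\<^sup>2 \<partial>M) / n) \<longlonglongrightarrow> v \<and>
    (\<forall>t::nat \<Rightarrow> real. t \<longlonglongrightarrow> 0 \<longrightarrow> (\<forall>n. 0 < t n) \<longrightarrow>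
        (\<forall>\<^sub>F n in sequentially. integrable M (\<lambda>\<omega>. exp (t n * centered M (S n) \<omega>))) \<and>
        (\<lambda>n. cumulant M (S n) (t n) / (n * (t n)\<^sup>2)) \<longlonglongrightarrow> v / 2)"
  proof (rule cumulant_approximation[OF iS iS2])
    fix \<epsilon> :: real assume \<epsilon>: "0 < \<epsilon>"
    \<comment> \<open>This makes the cost \<open>2 * c * (s * \<delta>)\<^sup>2\<close> of replacing
      \<open>a\<close> by \<open>a'\<close> at most \<open>\<epsilon> / 3\<close>; the factor 2
      comes from adding two subgaussian errors.\<close>
    define \<delta> where "\<delta> = min 1 (sqrt (\<epsilon> / (6 * c * s\<^sup>2)))"
    have \<delta>: "0 < \<delta>" "\<delta> \<le> 1" using \<epsilon> c s by (auto simp: \<delta>_def)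
    have c\<delta>: "2 * (c * (s * \<delta>)\<^sup>2) \<le> \<epsilon> / 3"
    proof -
      have "\<delta>\<^sup>2 \<le> (sqrt (\<epsilon> / (6 * c * s\<^sup>2)))\<^sup>2" using \<delta> by (intro power_mono) (auto simp: \<delta>_def)
      also have "\<dots> = \<epsilon> / (6 * c * s\<^sup>2)" using \<epsilon> c s by simp
      finally have "2 * c * s\<^sup>2 * \<delta>\<^sup>2 \<le> 2 * c * s\<^sup>2 * (\<epsilon> / (6 * c * s\<^sup>2))" using c by (intro mult_left_mono) auto
      also have "\<dots> = \<epsilon> / 3" using c s by simp
      finally show ?thesis by (simp add: power_mult_distrib mult.assoc)
    qed
    obtain a' r0 where "\<forall>n. r0 < \<bar>n\<bar> \<longrightarrow> a' n = 0" and d: "l2_bound (\<lambda>n. a n - a' n) \<delta>"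
      using finite_range[OF \<delta>(1)] by blast
    define r where "r = nat r0"
    have a': "a' n = 0" if "int r < \<bar>n\<bar>" for n
    proof -
      have "r0 \<le> int r" by (simp add: r_def)
      with that have "r0 < \<bar>n\<bar>" by linarith
      then show ?thesis using \<open>\<forall>n. r0 < \<bar>n\<bar> \<longrightarrow> a' n = 0\<close> by blast
    qed
    have la': "l2_bound a' (2 * (N + \<delta>))"
      by (rule l2_bound_perturbation[OF N(2) d]) (use N \<delta> in auto)
    have op_a': "op_bound K J (window_map idx a' :: nat \<Rightarrow> int \<Rightarrow> real^'d \<Rightarrow> (real^'p)^'k) N1" if "finite K" "finite J" for K J
      by (rule op_bound_mono[OF op_bound_window_map[OF la' that]])
        (use N \<delta> s in \<open>auto simp: N1_def s_def intro!: mult_left_mono\<close>)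
    have op_d: "op_bound K J (\<lambda>k j x. window_map idx a k j x - window_map idx a' k j x :: (real^'p)^'k) (s * \<delta>)" if "finite K" "finite J" for K J
    proof -
      have eq: "(\<lambda>k j x. window_map idx a k j x - window_map idx a' k j x :: (real^'p)^'k) = window_map idx (\<lambda>n. a n - a' n)"
        by (simp add: fun_eq_iff window_map_def vec_eq_iff matrix_vector_mult_diff_rdistrib)
      show ?thesis unfolding eq s_def by (rule op_bound_window_map[OF d that])
    qed
    define w0 where "w0 = l + 2 * r"
    \<comment> \<open>The proportion of dropped windows is at most \<open>w0 / m\<close>; this
      \<open>m\<close> makes their cost at most \<open>\<epsilon> / 3\<close> per step.\<close>
    obtain m :: nat where m: "0 < m" "6 * c * N1\<^sup>2 * real w0 / \<epsilon> < real m"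
    proof -
      obtain m0 :: nat where "6 * c * N1\<^sup>2 * real w0 / \<epsilon> < real m0" using reals_Archimedean2 by blast
      then show ?thesis by (intro that[of "Suc m0"]) auto
    qed
    interpret b: block_structure M \<mu> \<xi> C idx l a' r m f
      by unfold_locales (use idx a' in auto)
    have R: "b.R = m + w0" "0 < b.R" using m by (auto simp: b.R_def w0_def)
    define V' where "V' k \<omega> = finite_window idx a' r k (\<lambda>j. \<xi> j \<omega>)" for k \<omega>
    have V': "L2_sum M (\<lambda>j \<omega>. window_map idx a' k j (\<xi> j \<omega>)) (V' k)" for k
      unfolding V'_def by (rule finite_window_L2_sum[OF a'])
    define \<tau>0 where "\<tau>0 = 1 / (1 + 32 * C\<^sup>2 * N1\<^sup>2 * N1\<^sup>2 * (\<Lambda>\<^sup>2 + 1))"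
    define \<tau>1 where "\<tau>1 = 1 / (1 + 32 * C\<^sup>2 * N1\<^sup>2 * (s * \<delta>)\<^sup>2 * (\<Lambda>\<^sup>2 + 1))"
    have \<tau>: "0 < \<tau>0" "0 < \<tau>1" using \<tau>pos[of N1] \<tau>pos[of "s * \<delta>"] by (auto simp: \<tau>0_def \<tau>1_def)
    have sgB: "subgaussian M (b.B 0) (c * N1\<^sup>2 * m) \<tau>0"
    proof -
      have eq: "b.B 0 = (\<lambda>\<omega>. \<Sum>k<m. f (V' k \<omega>))" by (simp add: fun_eq_iff b.B_def b.blk_def V'_def)
      show ?thesis unfolding eq c_def \<tau>0_def
        using sum_subgaussian[OF C11 finite_lessThan linear_window_map op_a' N1 V', of m] by simp
    qed
    have cm: "0 \<le> c * N1\<^sup>2 * m" using c by simp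
    define Y where "Y n \<omega> = (\<Sum>i<n div b.R. b.B i \<omega>)" for n \<omega>
    note blocks = iid_sum_cumulant[OF b.B_indep b.B_law[OF m(1)] sgB cm]
    have iY: "integrable M (Y n)" for n unfolding Y_def by (rule blocks(1))
    have sgY: "subgaussian M (Y n) (real (n div b.R) * (c * N1\<^sup>2 * m)) \<tau>0" for n
      unfolding Y_def by (rule blocks(2))
    have iY2: "integrable M (\<lambda>\<omega>. (centered M (Y n) \<omega>)\<^sup>2)" for n
      by (rule subgaussian_variance(1)[OF sgY \<tau>(1)]) (use cm in simp)
    define v where "v = (\<integral>\<omega>. (centered M (b.B 0) \<omega>)\<^sup>2 \<partial>M)"
    have frac: "(\<lambda>n. real (n div b.R) / n) \<longlonglongrightarrow> 1 / b.R"
    proof -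
      have "(\<lambda>n. real (n div b.R) / n - 1 / b.R) \<longlonglongrightarrow> 0"
      proof (rule Lim_null_comparison)
        show "\<forall>\<^sub>F n in sequentially. norm (real (n div b.R) / n - 1 / b.R) \<le> 1 / real n"
          using eventually_gt_at_top[of 0]
        proof eventually_elim
          case (elim n)
          have "real n = real (n div b.R) * b.R + real (n mod b.R)"
            by (metis div_mult_mod_eq of_nat_add of_nat_mult)
          moreover have "real (n mod b.R) \<le> b.R" using mod_less_divisor[OF R(2), of n] by linarith
          ultimately have "real (n div b.R) * b.R \<le> n" "real n - b.R \<le> real (n div b.R) * b.R" by auto
          moreover have "Q / T - 1 / V \<le> 0 \<and> - (1 / T) \<le> Q / T - 1 / V"
            if "0 < T" "0 < V" "Q * V \<le> T" "T - V \<le> Q * V" for Q T V :: real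
            using that by (auto simp: field_simps)
          ultimately have "real (n div b.R) / n - 1 / b.R \<le> 0" "- (1 / real n) \<le> real (n div b.R) / n - 1 / b.R"
            using elim R(2) by simp_all
          then show ?case by simp
        qed
        show "(\<lambda>n. 1 / real n) \<longlonglongrightarrow> 0" by (rule lim_1_over_n)
      qed
      then show ?thesis by (simp add: LIM_zero_iff)
    qed
    show "\<exists>Y s \<tau>. 0 < \<tau> \<and> (\<forall>n. integrable M (Y n) \<and> integrable M (\<lambda>\<omega>. (centered M (Y n) \<omega>)\<^sup>2)) \<and>
      (\<forall>\<^sub>F n in sequentially. subgaussian M (\<lambda>\<omega>. S n \<omega> - Y n \<omega>) (\<epsilon> * n) \<tau>) \<and>
      (\<lambda>n. (\<integral>\<omega>. (centered M (Y n) \<omega>)\<^sup>2 \<partial>M) / n) \<longlonglongrightarrow> s \<and>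
      (\<forall>t::nat \<Rightarrow> real. t \<longlonglongrightarrow> 0 \<longrightarrow> (\<forall>n. 0 < t n) \<longrightarrow>
        (\<forall>\<^sub>F n in sequentially. integrable M (\<lambda>\<omega>. exp (t n * centered M (Y n) \<omega>))) \<and>
        (\<lambda>n. cumulant M (Y n) (t n) / (n * (t n)\<^sup>2)) \<longlonglongrightarrow> s / 2)"
    proof (rule exI[of _ Y], rule exI[of _ "1 / b.R * v"], rule exI[of _ "min \<tau>0 \<tau>1 / 2"], intro conjI allI impI iY iY2)
      show "0 < min \<tau>0 \<tau>1 / 2" using \<tau> by simp
      have "(\<integral>\<omega>. (centered M (Y n) \<omega>)\<^sup>2 \<partial>M) / n = real (n div b.R) / n * v" for n
        unfolding Y_def v_def using iid_sum_variance[OF b.B_indep b.B_law[OF m(1)] sgB cm \<tau>(1), of "n div b.R"] by simp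
      then show "(\<lambda>n. (\<integral>\<omega>. (centered M (Y n) \<omega>)\<^sup>2 \<partial>M) / n) \<longlonglongrightarrow> 1 / b.R * v"
        by (simp only:) (intro tendsto_intros frac)
    next
      fix t :: "nat \<Rightarrow> real" assume t: "t \<longlonglongrightarrow> 0" "\<forall>n. 0 < t n"
      have small: "\<forall>\<^sub>F n in sequentially. \<bar>t n\<bar> \<le> \<tau>0"
      proof -
        have "\<forall>\<^sub>F n in sequentially. t n < \<tau>0" by (rule order_tendstoD(2)[OF t(1) \<tau>(1)])
        then show ?thesis by eventually_elim (use t(2) in \<open>auto simp: less_imp_le\<close>)
      qed
      then show "\<forall>\<^sub>F n in sequentially. integrable M (\<lambda>\<omega>. exp (t n * centered M (Y n) \<omega>))"
        by eventually_elim (rule subgaussian_integrable_exp(1)[OF sgY])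
      have "(\<lambda>n. cumulant M (b.B 0) (t n) / (t n)\<^sup>2) \<longlonglongrightarrow> v / 2"
        unfolding v_def by (rule cumulant_second_order[OF sgB \<tau>(1) cm t(1)]) (use t(2) in \<open>simp add: less_imp_neq[symmetric]\<close>)
      then have A: "(\<lambda>n. real (n div b.R) / n * (cumulant M (b.B 0) (t n) / (t n)\<^sup>2)) \<longlonglongrightarrow> 1 / b.R * (v / 2)"
        by (intro tendsto_mult frac)
      have "\<forall>\<^sub>F n in sequentially. real (n div b.R) / n * (cumulant M (b.B 0) (t n) / (t n)\<^sup>2) = cumulant M (Y n) (t n) / (n * (t n)\<^sup>2)"
        using small
      proof eventually_elim
        case (elim n)
        have "Y n = (\<lambda>\<omega>. \<Sum>i<n div b.R. b.B i \<omega>)" by (simp add: fun_eq_iff Y_def)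
        then have "cumulant M (Y n) (t n) = real (n div b.R) * cumulant M (b.B 0) (t n)"
          using blocks(3)[OF elim, of "n div b.R"] by simp
        then show ?case by simp
      qed
      from Lim_transform_eventually[OF A this]
      show "(\<lambda>n. cumulant M (Y n) (t n) / (n * (t n)\<^sup>2)) \<longlonglongrightarrow> 1 / b.R * v / 2"
        by (simp only: times_divide_eq_right)
    next
      have "\<forall>\<^sub>F n in sequentially. 6 * c * N1\<^sup>2 * b.R / \<epsilon> < real n"
        using filterlim_real_sequentially by (simp add: filterlim_at_top_dense)
      then show "\<forall>\<^sub>F n in sequentially. subgaussian M (\<lambda>\<omega>. S n \<omega> - Y n \<omega>) (\<epsilon> * n) (min \<tau>0 \<tau>1 / 2)"
      proof eventually_elim
        case (elim n)
        let ?q = "n div b.R"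
        \<comment> \<open>The indices that the blocks leave over: the gaps and the last incomplete
          period. Their number is at most \<open>n * (w0 / m)\<close> plus one period.\<close>
        define G where "G = {..<n} - {k. k < ?q * b.R \<and> k mod b.R < m}"
        have sub: "{k. k < ?q * b.R \<and> k mod b.R < m} \<subseteq> {..<n}"
          by (auto intro: less_le_trans[OF _ div_times_less_eq_dividend[of n b.R]])
        have fin: "finite {k. k < ?q * b.R \<and> k mod b.R < m}" by (rule finite_subset[OF sub]) simp
        have Ysum: "Y n \<omega> = (\<Sum>k\<in>{k. k < ?q * b.R \<and> k mod b.R < m}. f (V' k \<omega>))" for \<omega>
          unfolding Y_def b.B_def b.blk_def V'_def by (rule b.sum_blocks)
        have cardG: "real (card G) \<le> n * (w0 / m) + b.R"
        proof -
          have "real (card {k. k < ?q * b.R \<and> k mod b.R < m}) = real ?q * m"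
            using b.sum_blocks[of "\<lambda>_. 1" ?q] by simp
          moreover have "real (card G) = real n - real (card {k. k < ?q * b.R \<and> k mod b.R < m})"
            unfolding G_def using sub fin card_mono[OF finite_lessThan sub] by (subst card_Diff_subset) (auto simp: of_nat_diff)
          moreover have "real n = real ?q * b.R + real (n mod b.R)"
            by (metis div_mult_mod_eq of_nat_add of_nat_mult)
          moreover have "real (n mod b.R) \<le> b.R" using mod_less_divisor[OF R(2), of n] by linarith
          ultimately have "real (card G) \<le> real ?q * w0 + b.R" using R(1) by (simp add: algebra_simps)
          also have "real ?q * w0 \<le> n * (w0 / m)"
          proof -
            have "?q * m \<le> ?q * b.R" using R(1) by simp
            also have "\<dots> \<le> n" by (rule div_times_less_eq_dividend)
            finally have "real (?q * m) \<le> real n" by (simp only: of_nat_le_iff)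
            then have "real ?q * m * (w0 / m) \<le> n * (w0 / m)" by (intro mult_right_mono) auto
            then show ?thesis using m by simp
          qed
          finally show ?thesis by simp
        qed
        have sg1: "subgaussian M (\<lambda>\<omega>. \<Sum>k<n. f (window idx X (1 + int k) \<omega>) - f (V' k \<omega>)) (c * (s * \<delta>)\<^sup>2 * n) \<tau>1"
          using difference_subgaussian[OF C11 finite_lessThan linear_window_map linear_window_map op_a op_a' op_d N1 _ window_L2_sum V', of n] s \<delta>
          by (simp add: c_def \<tau>1_def)
        have finG: "finite G" by (simp add: G_def)
        have sg2: "subgaussian M (\<lambda>\<omega>. \<Sum>k\<in>G. f (V' k \<omega>)) (c * N1\<^sup>2 * card G) \<tau>0"
          using sum_subgaussian[OF C11 finG linear_window_map op_a'[OF finG] N1 V'] by (simp add: c_def \<tau>0_def)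
        have eq: "S n \<omega> - Y n \<omega> = (\<Sum>k<n. f (window idx X (1 + int k) \<omega>) - f (V' k \<omega>)) + (\<Sum>k\<in>G. f (V' k \<omega>))" for \<omega>
          unfolding Ysum S_def G_def sum_subtractf using sub fin by (subst sum_diff) auto
        have mono: "subgaussian M Z \<kappa> (min \<tau>0 \<tau>1)" if "subgaussian M Z \<kappa> \<tau>" "min \<tau>0 \<tau>1 \<le> \<tau>" for Z \<kappa> \<tau>
          using that unfolding subgaussian_def by (meson order_trans)
        have sg12: "subgaussian M (\<lambda>\<omega>. S n \<omega> - Y n \<omega>) (2 * (c * (s * \<delta>)\<^sup>2 * n + c * N1\<^sup>2 * card G)) (min \<tau>0 \<tau>1 / 2)"
          unfolding eq by (rule subgaussian_add[OF mono[OF sg1] mono[OF sg2]]) auto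
        \<comment> \<open>Three shares \<open>\<epsilon> / 3 * n\<close> pay for the replacement of
          \<open>a\<close>, the gaps and the incomplete period, the last one because
          \<open>n\<close> is large.\<close>
        have le: "2 * (c * (s * \<delta>)\<^sup>2 * n + c * N1\<^sup>2 * card G) \<le> \<epsilon> * n"
        proof -
          have "2 * (c * (s * \<delta>)\<^sup>2) * n \<le> \<epsilon> / 3 * n" using c\<delta> by (intro mult_right_mono) auto
          moreover have "2 * (c * N1\<^sup>2 * card G) \<le> 2 * c * N1\<^sup>2 * (n * (w0 / m) + b.R)"
            using cardG c by (simp add: mult.assoc mult_left_mono)
          moreover have "2 * c * N1\<^sup>2 * (n * (w0 / m)) \<le> \<epsilon> / 3 * n"
          proof -
            have "6 * c * N1\<^sup>2 * real w0 \<le> \<epsilon> * real m" using m(2) \<epsilon> by (simp add: pos_divide_less_eq mult.commute)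
            then have "2 * c * N1\<^sup>2 * (w0 / m) \<le> \<epsilon> / 3" using m(1) by (simp add: field_simps)
            then have "2 * c * N1\<^sup>2 * (w0 / m) * n \<le> \<epsilon> / 3 * n" by (rule mult_right_mono) simp
            then show ?thesis by (simp add: mult_ac)
          qed
          moreover have "2 * c * N1\<^sup>2 * b.R \<le> \<epsilon> / 3 * n"
          proof -
            have "6 * c * N1\<^sup>2 * b.R \<le> \<epsilon> * n" using elim \<epsilon> by (simp add: pos_divide_less_eq mult.commute)
            then show ?thesis by simp
          qed
          ultimately show ?thesis by (simp add: distrib_left mult.assoc)
        qed
        have "ennreal (exp (2 * (c * (s * \<delta>)\<^sup>2 * n + c * N1\<^sup>2 * card G) * t\<^sup>2)) \<le> ennreal (exp (\<epsilon> * n * t\<^sup>2))" for t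
          using le by (intro ennreal_leI) (simp only: exp_le_cancel_iff, intro mult_right_mono, auto)
        then show ?case using sg12 unfolding subgaussian_def by (meson order_trans)
      qed
    qed
  qed
qed

end

section \<open>Vector-valued functionals\<close>

text \<open>A vector is the sum of its blocks, each placed in an otherwise zero vector
  \<open>e i u\<close>; the chain rule along \<open>e i\<close> identifies the derivative on such a
  vector with the partial Jacobian.\<close>

lemma frechet_derivative_block_partial:
  fixes F :: "(real^'p)^'k \<Rightarrow> real^'m"
  assumes F: "F differentiable (at x)"
  shows "frechet_derivative F (at x) h = (\<Sum>i\<in>UNIV. block_partial i F x *v (h $ i))"
proof -
  define F' where "F' = frechet_derivative F (at x)"
  have F': "(F has_derivative F') (at x)" unfolding F'_def using F by (simp add: frechet_derivative_works)
  then have lin: "linear F'" by (rule has_derivative_linear)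
  define e :: "'k \<Rightarrow> real^'p \<Rightarrow> (real^'p)^'k" where "e i u = (\<chi> j. if j = i then u else 0)" for i u
  have block: "block_partial i F x *v u = F' (e i u)" for i u
  proof -
    let ?G = "\<lambda>u. (\<chi> j. if j = i then u else x $ j) :: (real^'p)^'k"
    have e: "bounded_linear (e i)"
      unfolding linear_conv_bounded_linear[symmetric]
      by (intro linearI) (auto simp: e_def vec_eq_iff)
    have G: "?G u = (\<chi> j. if j = i then 0 else x $ j) + e i u" for u
      by (simp add: vec_eq_iff e_def)
    have "((\<lambda>u. (\<chi> j. if j = i then 0 else x $ j) + e i u) has_derivative e i) (at (x $ i))"
      using has_derivative_add[OF has_derivative_const bounded_linear.has_derivative[OF e has_derivative_ident]] by simp
    then have "(?G has_derivative e i) (at (x $ i))" by (simp only: G[symmetric])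
    moreover have "?G (x $ i) = x" by (simp add: vec_eq_iff)
    ultimately have d: "((\<lambda>u. F (?G u)) has_derivative (\<lambda>u. F' (e i u))) (at (x $ i))"
      using has_derivative_compose[of ?G "e i" "x $ i" UNIV F F'] F' by simp
    then have "(\<lambda>u. F (?G u)) differentiable (at (x $ i))" by (auto simp: differentiable_def)
    then have "((\<lambda>u. F (?G u)) has_derivative (\<lambda>u. block_partial i F x *v u)) (at (x $ i))"
      unfolding block_partial_def by (simp add: jacobian_works)
    from fun_cong[OF has_derivative_unique[OF this d]] show ?thesis .
  qed
  have "h = (\<Sum>i\<in>UNIV. e i (h $ i))"
    by (simp add: vec_eq_iff e_def if_distrib cong: if_cong)
  then have "F' h = F' (\<Sum>i\<in>UNIV. e i (h $ i))" by simp
  also have "\<dots> = (\<Sum>i\<in>UNIV. F' (e i (h $ i)))" by (rule linear_sum[OF lin])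
  finally show ?thesis by (simp add: block F'_def)
qed

text \<open>Lipschitz partial Jacobians combine into a Lipschitz gradient of every scalar
  projection. The summand 1 in \<open>\<Lambda>\<close> keeps it positive when all
  \<open>L i\<close> vanish.\<close>

lemma C11_function_inner:
  fixes F :: "(real^'p)^'k \<Rightarrow> real^'m"
  assumes F: "\<And>x. F differentiable (at x)" and Lip: "\<And>i. \<exists>L. L-lipschitz_on UNIV (block_partial i F)"
  shows "\<exists>\<Lambda>. C11_function (\<lambda>x. v \<bullet> F x) (\<lambda>x. \<chi> i. transpose (block_partial i F x) *v v) \<Lambda>"
proof -
  have grad: "GDERIV (\<lambda>x. v \<bullet> F x) x :> (\<chi> i. transpose (block_partial i F x) *v v)" for x
  proof -
    have "(F has_derivative frechet_derivative F (at x)) (at x)"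
      using F[of x] by (simp add: frechet_derivative_works)
    then have "((\<lambda>x. v \<bullet> F x) has_derivative (\<lambda>h. v \<bullet> frechet_derivative F (at x) h)) (at x)"
      by (rule has_derivative_inner_right)
    moreover have "v \<bullet> frechet_derivative F (at x) h = h \<bullet> (\<chi> i. transpose (block_partial i F x) *v v)" for h
    proof -
      have "v \<bullet> (block_partial i F x *v (h $ i)) = (h $ i) \<bullet> (transpose (block_partial i F x) *v v)" for i
        by (simp add: transpose_matrix_vector dot_lmul_matrix inner_commute[of "h $ i"])
      then show ?thesis
        by (simp add: frechet_derivative_block_partial[OF F] inner_sum_right inner_vec_def[of h])
    qed
    ultimately show ?thesis by (simp add: gderiv_def)
  qed
  have "linear (\<lambda>A :: real^'p^'m. transpose A *v v)"
    by (intro linearI) (simp_all add: vec_eq_iff matrix_vector_mult_def transpose_def sum.distrib algebra_simps sum_distrib_left)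
  then obtain K where K: "0 < K" "\<And>A :: real^'p^'m. norm (transpose A *v v) \<le> K * norm A"
    using linear_bounded_pos by blast
  obtain L where L: "\<And>i. (L i)-lipschitz_on UNIV (block_partial i F)" using Lip by metis
  define \<Lambda> where "\<Lambda> = 1 + (\<Sum>i\<in>UNIV. K * L i)"
  have L0: "0 \<le> L i" for i by (rule lipschitz_on_nonneg[OF L])
  have \<Lambda>: "0 < \<Lambda>" unfolding \<Lambda>_def using K(1) L0 by (intro add_pos_nonneg sum_nonneg) simp_all
  have "\<Lambda>-lipschitz_on UNIV (\<lambda>x. (\<chi> i. transpose (block_partial i F x) *v v) :: (real^'p)^'k)"
  proof (rule lipschitz_onI)
    fix x y
    have c: "norm (transpose (block_partial i F x) *v v - transpose (block_partial i F y) *v v) \<le> K * L i * dist x y" for i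
    proof -
      have "transpose (block_partial i F x) *v v - transpose (block_partial i F y) *v v = transpose (block_partial i F x - block_partial i F y) *v v"
        by (simp add: vec_eq_iff matrix_vector_mult_def transpose_def sum_subtractf algebra_simps)
      then have "norm (transpose (block_partial i F x) *v v - transpose (block_partial i F y) *v v) \<le> K * norm (block_partial i F x - block_partial i F y)"
        using K(2) by simp
      also have "\<dots> \<le> K * (L i * dist x y)"
        using lipschitz_onD[OF L, of x y i] K(1) by (intro mult_left_mono) (auto simp: dist_norm)
      finally show ?thesis by (simp add: mult.assoc)
    qed
    have "dist (\<chi> i. transpose (block_partial i F x) *v v) ((\<chi> i. transpose (block_partial i F y) *v v) :: (real^'p)^'k)
      \<le> (\<Sum>i\<in>UNIV. norm (transpose (block_partial i F x) *v v - transpose (block_partial i F y) *v v))"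
      unfolding dist_norm norm_vec_def by (rule order_trans[OF L2_set_le_sum]) auto
    also have "\<dots> \<le> (\<Sum>i\<in>UNIV. K * L i * dist x y)" by (intro sum_mono c)
    also have "\<dots> \<le> \<Lambda> * dist x y" by (simp add: \<Lambda>_def sum_distrib_right distrib_right)
    finally show "dist (\<chi> i. transpose (block_partial i F x) *v v) ((\<chi> i. transpose (block_partial i F y) *v v) :: (real^'p)^'k) \<le> \<Lambda> * dist x y" .
  qed (use \<Lambda> in simp)
  with grad \<Lambda> show ?thesis by (intro exI[of _ \<Lambda>] C11_function.intro) auto
qed

text \<open>Square integrability is given for the projections \<open>v \<bullet> Y\<close>; products
  of two centered coordinates are then integrable by polarization.\<close>

lemma covariance_matrix_quadratic_form:
  fixes Y :: "'w \<Rightarrow> real^'m"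
  assumes i1: "\<And>v. integrable M (\<lambda>\<omega>. v \<bullet> Y \<omega>)"
    and i2: "\<And>v. integrable M (\<lambda>\<omega>. (centered M (\<lambda>\<omega>. v \<bullet> Y \<omega>) \<omega>)\<^sup>2)"
  shows "v \<bullet> (covariance_matrix M Y *v v) = (\<integral>\<omega>. (centered M (\<lambda>\<omega>. v \<bullet> Y \<omega>) \<omega>)\<^sup>2 \<partial>M)"
proof -
  define c where "c i = centered M (\<lambda>\<omega>. Y \<omega> $ i)" for i
  have iY: "integrable M (\<lambda>\<omega>. Y \<omega> $ i)" for i
    using i1[of "axis i 1"] by (simp add: inner_axis')
  have cv: "centered M (\<lambda>\<omega>. v \<bullet> Y \<omega>) \<omega> = (\<Sum>i\<in>UNIV. v $ i * c i \<omega>)" for v \<omega>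
    unfolding centered_def c_def inner_vec_def using iY
    by (simp add: sum_subtractf right_diff_distrib)
  have c2: "integrable M (\<lambda>\<omega>. (c i \<omega>)\<^sup>2)" for i
    using i2[of "axis i 1"] unfolding c_def by (simp add: inner_axis')
  have "integrable M (\<lambda>\<omega>. (c i \<omega> + c j \<omega>)\<^sup>2)" for i j
  proof -
    have "centered M (\<lambda>\<omega>. (axis i 1 + axis j 1) \<bullet> Y \<omega>) \<omega> = c i \<omega> + c j \<omega>" for \<omega>
      unfolding c_def centered_def using iY by (simp add: inner_add_left inner_axis')
    then show ?thesis using i2[of "axis i 1 + axis j 1"] by simp
  qed
  then have "integrable M (\<lambda>\<omega>. ((c i \<omega> + c j \<omega>)\<^sup>2 - (c i \<omega>)\<^sup>2 - (c j \<omega>)\<^sup>2) / 2)" for i j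
    using c2 by (intro integrable_divide Bochner_Integration.integrable_diff) auto
  then have cc: "integrable M (\<lambda>\<omega>. c i \<omega> * c j \<omega>)" for i j
    by (simp add: power2_sum)
  have "(\<integral>\<omega>. (centered M (\<lambda>\<omega>. v \<bullet> Y \<omega>) \<omega>)\<^sup>2 \<partial>M) = (\<integral>\<omega>. (\<Sum>i\<in>UNIV. \<Sum>j\<in>UNIV. (v $ i * v $ j) * (c i \<omega> * c j \<omega>)) \<partial>M)"
    by (simp add: cv power2_eq_square sum_product mult_ac)
  also have "\<dots> = (\<Sum>i\<in>UNIV. \<Sum>j\<in>UNIV. (v $ i * v $ j) * (\<integral>\<omega>. c i \<omega> * c j \<omega> \<partial>M))"
    using cc by simp
  also have "\<dots> = v \<bullet> (covariance_matrix M Y *v v)"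
    by (simp add: inner_vec_def matrix_vector_mult_def covariance_matrix_def c_def centered_def sum_distrib_left mult_ac)
  finally show ?thesis by simp
qed

lemma covariance_matrix_symmetric: "transpose (covariance_matrix M Y) = covariance_matrix M Y"
  by (simp add: covariance_matrix_def transpose_def vec_eq_iff mult.commute)

lemma tendsto_quadratic_form:
  fixes A :: "nat \<Rightarrow> real^'m^'m"
  assumes "A \<longlonglongrightarrow> S"
  shows "(\<lambda>n. v \<bullet> (A n *v v)) \<longlonglongrightarrow> v \<bullet> (S *v v)"
  unfolding inner_vec_def matrix_vector_mult_def
  using assms by (auto intro!: tendsto_intros tendsto_vec_nth)

text \<open>Polarization: the entries of a symmetric matrix are recovered from its quadratic form at
  the unit vectors and at sums of two of them.\<close>

lemma symmetric_matrix_convergent: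
  fixes A :: "nat \<Rightarrow> real^'m^'m"
  assumes sym: "\<And>n. transpose (A n) = A n" and conv: "\<And>v. convergent (\<lambda>n. v \<bullet> (A n *v v))"
  shows "\<exists>S. A \<longlonglongrightarrow> S \<and> transpose S = S"
proof -
  define q where "q n v = v \<bullet> (A n *v v)" for n v
  let ?e = "\<lambda>i. axis i 1 :: real^'m"
  have entry: "?e i \<bullet> (A n *v ?e j) = A n $ i $ j" for n i j
    by (simp add: inner_axis' matrix_vector_mult_basis column_def)
  have sy: "A n $ i $ j = A n $ j $ i" for n i j
    using arg_cong[OF sym[of n], of "\<lambda>B. B $ j $ i"] by (simp add: transpose_def)
  have polar: "A n $ i $ j = (q n (?e i + ?e j) - q n (?e i) - q n (?e j)) / 2" for n i j
    unfolding q_def by (simp add: matrix_vector_right_distrib inner_add_left inner_add_right entry sy[of n j i])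
  have "convergent (\<lambda>n. A n $ i $ j)" for i j
    unfolding polar divide_inverse q_def by (intro convergent_mult convergent_diff conv convergent_const)
  then have "\<exists>s. \<forall>i j. (\<lambda>n. A n $ i $ j) \<longlonglongrightarrow> s i j" unfolding convergent_def by metis
  then obtain s where s: "\<And>i j. (\<lambda>n. A n $ i $ j) \<longlonglongrightarrow> s i j" by blast
  have "s i j = s j i" for i j
    using LIMSEQ_unique[OF s[of i j], of "s j i"] s[of j i] by (simp add: sy[of _ i j])
  then have "transpose (\<chi> i j. s i j) = (\<chi> i j. s i j)" by (simp add: transpose_def vec_eq_iff)
  moreover have "A \<longlonglongrightarrow> (\<chi> i j. s i j)" by (intro vec_tendstoI) (simp add: s)
  ultimately show ?thesis by blast
qed
theorem theorem3p1:
  fixes M :: "'w measure"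
    and \<mu> :: "(real^'d) measure"
    and \<xi> :: "int \<Rightarrow> 'w \<Rightarrow> real^'d"
    and a :: "int \<Rightarrow> real^'d^'p"
    and X :: "int \<Rightarrow> 'w \<Rightarrow> real^'p"
    and g :: "real \<Rightarrow> complex^'d^'p"
    and l :: nat
    and idx :: "'k::finite \<Rightarrow> nat"
    and F :: "(real^'p)^'k \<Rightarrow> real^'m"
    and b :: "nat \<Rightarrow> real"
  assumes "prob_space M"
    and "prob_space.indep_vars M (\<lambda>_. borel) \<xi> UNIV"
    and "\<forall>n. distr M borel (\<xi> n) = \<mu>"
    and "\<forall>n. integrable M (\<lambda>\<omega>. (norm (\<xi> n \<omega>))\<^sup>2)"
    and "\<forall>n. (\<integral>\<omega>. \<xi> n \<omega> \<partial>M) = 0"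
    and "(\<lambda>n. (norm (a n))\<^sup>2) summable_on UNIV"
    and "moving_average M a \<xi> X"
    and "\<forall>n. b n > 0"
    and "filterlim b at_top sequentially"
    and "(\<lambda>n. b n / sqrt (real n)) \<longlonglongrightarrow> 0"
    and "log_sobolev \<mu>"
    and "fourier_series a g" and "continuous_on UNIV g"
    and "bij_betw idx UNIV {0..l}"
    and "\<forall>x. F differentiable (at x)"
    and "\<forall>i. \<exists>L. L-lipschitz_on UNIV (block_partial i F)"
  shows "\<exists>S2 :: real^'m^'m.
    (\<lambda>n. (1 / real n) *\<^sub>R covariance_matrix M (\<lambda>\<omega>. \<Sum>k=1..n. F (window idx X (int k) \<omega>)))
      \<longlonglongrightarrow> S2 \<and>
    LDP M
      (\<lambda>n \<omega>. (1 / (sqrt (real n) * b n)) *\<^sub>R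
         (\<Sum>k=1..n. F (window idx X (int k) \<omega>) - (\<integral>\<omega>'. F (window idx X (int k) \<omega>') \<partial>M)))
      (\<lambda>n. (b n)\<^sup>2)
      (\<lambda>z. SUP v. ereal (v \<bullet> z - (v \<bullet> (S2 *v v)) / 2)) \<and>
    (\<forall>z. (SUP v. ereal (v \<bullet> z - (v \<bullet> (S2 *v v)) / 2)) =
         (if z \<in> range (\<lambda>y. S2 *v y) then ereal ((z \<bullet> (pseudo_inverse S2 *v z)) / 2) else \<infinity>))"
proof -
  interpret prob_space M by fact
  obtain C where C: "0 < C" "log_sobolev_const \<mu> C"
    using assms(11) unfolding log_sobolev_def log_sobolev_const_def by blast
  obtain N where N: "0 < N" "l2_bound a N"
    using fourier_series_l2_bound(1)[OF assms(12,13)] by blast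
  have \<xi>m: "\<xi> n \<in> borel_measurable M" for n
    using assms(2) by (simp add: indep_vars_def)
  have \<xi>i: "integrable M (\<xi> n)" for n
  proof (rule Bochner_Integration.integrable_bound)
    show "integrable M (\<lambda>\<omega>. 1 + (norm (\<xi> n \<omega>))\<^sup>2)" using assms(4) by simp
    have "x \<le> 1 + x\<^sup>2" for x :: real using sum_squares_ge_zero[of "x - 1/2" 0] by (simp add: power2_eq_square algebra_simps)
    then show "AE \<omega> in M. norm (\<xi> n \<omega>) \<le> norm (1 + (norm (\<xi> n \<omega>))\<^sup>2)" by simp
  qed (rule \<xi>m)
  interpret moving_window M \<mu> \<xi> C idx l a X N
  proof unfold_locales
    show "idx c \<le> l" for c using bij_betwE[OF assms(14)] by simp
    show "\<exists>a' r. (\<forall>n. r < \<bar>n\<bar> \<longrightarrow> a' n = 0) \<and> l2_bound (\<lambda>n. a n - a' n) \<delta>" if "0 < \<delta>" for \<delta>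
      by (rule fourier_series_l2_bound(2)[OF assms(12,13) that])
  qed (use assms C N \<xi>i in auto)
  \<comment> \<open>Windows are numbered from 1 in the statement and from 0 here, which matches the
    sums over \<open>k < n\<close> in the scalar result.\<close>
  define W where "W k = window idx X (1 + int k)" for k
  define S where "S v n \<omega> = (\<Sum>k<n. v \<bullet> F (W k \<omega>))" for v n \<omega>
  have Fd: "F differentiable (at x)" for x using assms(15) by simp
  have C11: "\<exists>\<Lambda>. C11_function (\<lambda>x. v \<bullet> F x) (\<lambda>x. \<chi> i. transpose (block_partial i F x) *v v) \<Lambda>" for v
    using C11_function_inner[OF Fd] assms(16) by blast
  have iS: "integrable M (S v n)" and iS2: "integrable M (\<lambda>\<omega>. (centered M (S v n) \<omega>)\<^sup>2)" for v n
    using C11[of v] scalar_asymptotics(1,2) unfolding S_def[abs_def] W_def by blast+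
  define asymptotic_variance where "asymptotic_variance v \<sigma> \<longleftrightarrow>
    (\<lambda>n. (\<integral>\<omega>. (centered M (S v n) \<omega>)\<^sup>2 \<partial>M) / n) \<longlonglongrightarrow> \<sigma> \<and>
    (\<forall>t::nat \<Rightarrow> real. t \<longlonglongrightarrow> 0 \<longrightarrow> (\<forall>n. 0 < t n) \<longrightarrow>
        (\<forall>\<^sub>F n in sequentially. integrable M (\<lambda>\<omega>. exp (t n * centered M (S v n) \<omega>))) \<and>
        (\<lambda>n. cumulant M (S v n) (t n) / (n * (t n)\<^sup>2)) \<longlonglongrightarrow> \<sigma> / 2)" for v \<sigma>
  have "\<exists>\<sigma>. asymptotic_variance v \<sigma>" for v
    using C11[of v] scalar_asymptotics(3) unfolding asymptotic_variance_def S_def[abs_def] W_def by blast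
  then obtain \<sigma> where var: "\<And>v. asymptotic_variance v (\<sigma> v)" by metis
  have \<sigma>: "(\<lambda>n. (\<integral>\<omega>. (centered M (S v n) \<omega>)\<^sup>2 \<partial>M) / n) \<longlonglongrightarrow> \<sigma> v" for v
    using var[of v] unfolding asymptotic_variance_def by (rule conjunct1)
  have asym: "(\<forall>\<^sub>F n in sequentially. integrable M (\<lambda>\<omega>. exp (t n * centered M (S v n) \<omega>))) \<and>
      (\<lambda>n. cumulant M (S v n) (t n) / (n * (t n)\<^sup>2)) \<longlonglongrightarrow> \<sigma> v / 2"
    if "t \<longlonglongrightarrow> 0" "\<forall>n. 0 < t n" for v and t :: "nat \<Rightarrow> real"
    using var[of v, unfolded asymptotic_variance_def, THEN conjunct2] that by (simp only: simp_thms)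
  have sum_W: "(\<Sum>k=1..n. h (window idx X (int k))) = (\<Sum>k<n. h (W k))" for h :: "('w \<Rightarrow> (real^'p)^'k) \<Rightarrow> real^'m" and n
    unfolding W_def by (rule sum.reindex_bij_witness[of _ "\<lambda>k. k + 1" "\<lambda>k. k - 1"]) (auto simp: of_nat_diff)
  define A where "A n = (1 / real n) *\<^sub>R covariance_matrix M (\<lambda>\<omega>. \<Sum>k=1..n. F (window idx X (int k) \<omega>))" for n
  have inner_sum: "v \<bullet> (\<Sum>k=1..n. F (window idx X (int k) \<omega>)) = S v n \<omega>" for v n \<omega>
    using sum_W[of "\<lambda>Y. F (Y \<omega>)" n] by (simp add: S_def inner_sum_right)
  have A: "v \<bullet> (A n *v v) = (\<integral>\<omega>. (centered M (S v n) \<omega>)\<^sup>2 \<partial>M) / n" for v n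
  proof -
    have "v \<bullet> (covariance_matrix M (\<lambda>\<omega>. \<Sum>k=1..n. F (window idx X (int k) \<omega>)) *v v) = (\<integral>\<omega>. (centered M (S v n) \<omega>)\<^sup>2 \<partial>M)"
    proof -
      have IS: "(\<lambda>\<omega>. v \<bullet> (\<Sum>k=1..n. F (window idx X (int k) \<omega>))) = S v n" for v
        by (rule ext) (rule inner_sum)
      show ?thesis
        using covariance_matrix_quadratic_form[of M "\<lambda>\<omega>. \<Sum>k=1..n. F (window idx X (int k) \<omega>)" v]
        unfolding IS using iS iS2 by simp
    qed
    then show ?thesis by (simp add: A_def scaleR_matrix_vector_assoc[symmetric])
  qed
  have "transpose (A n) = A n" for n
    by (simp add: A_def transpose_scalar covariance_matrix_symmetric)
  moreover have "convergent (\<lambda>n. v \<bullet> (A n *v v))" for v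
    unfolding A convergent_def using \<sigma> by blast
  ultimately obtain S2 where S2: "A \<longlonglongrightarrow> S2" and sym: "transpose S2 = S2"
    using symmetric_matrix_convergent[of A] by blast
  have q: "v \<bullet> (S2 *v v) = \<sigma> v" for v
    using LIMSEQ_unique[OF tendsto_quadratic_form[OF S2, of v]] \<sigma>[of v] by (simp add: A)
  have psd: "0 \<le> v \<bullet> (S2 *v v)" for v
    unfolding q by (rule LIMSEQ_le_const[OF \<sigma>]) (auto intro!: divide_nonneg_nonneg integral_nonneg)
  define Z where "Z n \<omega> = (1 / (sqrt (real n) * b n)) *\<^sub>R
         (\<Sum>k=1..n. F (window idx X (int k) \<omega>) - (\<integral>\<omega>'. F (window idx X (int k) \<omega>') \<partial>M))" for n \<omega>
  have iF: "integrable M (\<lambda>\<omega>. F (W k \<omega>))" for k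
  proof -
    have "integrable M (\<lambda>\<omega>. F (W k \<omega>) \<bullet> v)" for v
    proof -
      \<comment> \<open>A single summand is the difference of two consecutive sums, whose
        integrability is known.\<close>
      have "F (W k \<omega>) \<bullet> v = S v (Suc k) \<omega> - S v k \<omega>" for \<omega> by (simp add: S_def inner_commute)
      then show ?thesis using Bochner_Integration.integrable_diff[OF iS[of v "Suc k"] iS[of v k]] by simp
    qed
    then have "integrable M (\<lambda>\<omega>. \<Sum>e\<in>Basis. (F (W k \<omega>) \<bullet> e) *\<^sub>R e)" by simp
    then show ?thesis by (simp add: euclidean_representation)
  qed
  have ES: "expectation (S v n) = (\<Sum>k<n. v \<bullet> (\<integral>\<omega>. F (W k \<omega>) \<partial>M))" for v n
    unfolding S_def[abs_def] using iF by simp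
  have vZ: "v \<bullet> Z n \<omega> = centered M (S v n) \<omega> / (sqrt n * b n)" for v n \<omega>
    unfolding Z_def centered_def ES
    using sum_W[of "\<lambda>Y. F (Y \<omega>) - (\<integral>\<omega>'. F (Y \<omega>') \<partial>M)" n]
    by (simp add: S_def inner_sum_right inner_diff_right sum_subtractf)
  have b: "0 < b n" for n using assms(8) by simp
  \<comment> \<open>At \<open>n = 0\<close> the quotient would be 0 by the convention for division;
    the value 1 keeps \<open>t\<close> positive everywhere without affecting limits.\<close>
  define t where "t n = (if n = 0 then 1 else b n / sqrt n)" for n :: nat
  have t: "t \<longlonglongrightarrow> 0" "\<forall>n. 0 < t n"
  proof -
    show "t \<longlonglongrightarrow> 0"
      by (rule Lim_transform_eventually[OF assms(10)])
        (use eventually_gt_at_top[of 0] in eventually_elim, simp add: t_def)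
    show "\<forall>n. 0 < t n" using b by (simp add: t_def)
  qed
  \<comment> \<open>The normalizations match: speed times \<open>v \<bullet> Z n\<close> is
    \<open>t n\<close> times the centered sum, and \<open>n * (t n)\<^sup>2\<close> is the speed, so
    the limit of the normalized cumulants is the log-Laplace limit.\<close>
  have scale: "(b n)\<^sup>2 * (v \<bullet> Z n \<omega>) = t n * centered M (S v n) \<omega>" "n * (t n)\<^sup>2 = (b n)\<^sup>2" if "0 < n" for n :: nat and v \<omega>
  proof -
    show "(b n)\<^sup>2 * (v \<bullet> Z n \<omega>) = t n * centered M (S v n) \<omega>"
      using that b[of n] by (simp add: vZ t_def power2_eq_square)
    show "n * (t n)\<^sup>2 = (b n)\<^sup>2" using that by (simp add: t_def power_divide)
  qed
  have pos: "\<forall>\<^sub>F n :: nat in sequentially. 0 < n" by (rule eventually_gt_at_top)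
  interpret Z: quadratic_log_Laplace M Z "\<lambda>n. (b n)\<^sup>2" S2
  proof unfold_locales
    have "(\<lambda>\<omega>. F (window idx X (int k) \<omega>)) \<in> borel_measurable M" if "1 \<le> k" for k
      using borel_measurable_integrable[OF iF[of "k - 1"]] that by (simp add: W_def of_nat_diff)
    then show "Z n \<in> borel_measurable M" for n
      unfolding Z_def[abs_def] by (intro borel_measurable_scaleR borel_measurable_const borel_measurable_sum borel_measurable_diff) auto
    show "filterlim (\<lambda>n. (b n)\<^sup>2) at_top sequentially"
      unfolding power2_eq_square by (rule filterlim_at_top_mult_at_top[OF assms(9) assms(9)])
    fix v
    show "\<forall>\<^sub>F n in sequentially. integrable M (\<lambda>\<omega>. exp ((b n)\<^sup>2 * (v \<bullet> Z n \<omega>)))"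
      using conjunct1[OF asym[OF t, of v]] pos by eventually_elim (simp only: scale)
    have lim: "(\<lambda>n. cumulant M (S v n) (t n) / (n * (t n)\<^sup>2)) \<longlonglongrightarrow> v \<bullet> (S2 *v v) / 2"
      using asym[OF t, of v] by (simp add: q)
    show "(\<lambda>n. ln (\<integral>\<omega>. exp ((b n)\<^sup>2 * (v \<bullet> Z n \<omega>)) \<partial>M) / (b n)\<^sup>2) \<longlonglongrightarrow> v \<bullet> (S2 *v v) / 2"
      by (rule Lim_transform_eventually[OF lim])
        (use pos in eventually_elim, simp only: scale cumulant_def)
  qed (use sym psd in auto)
  show ?thesis
    using S2 Z.LDP_quadratic Legendre_quadratic_pseudo_inverse[OF sym psd]
    unfolding A_def[abs_def] Z_def[abs_def] by (intro exI[of _ S2] conjI allI) 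
qed

end
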